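(* Let $p\ge \mathrm{e}$ be a constant, let $k$ be the security parameter, let $n$ be polynomial in $k$, and let $(\mathrm{Enc},\mathrm{Dec})$ be an Enc-IND-CPA secure symmetric encryption scheme. The Melbourne shuffle $\mathrm{shuffle}(I,\pi,O)$ (with parameter $p$) is a randomized shuffle algorithm that succeeds with very high probability (for every initial permutation $\pi_0$ of $I$ and every desired permutation $\pi$, it outputs fail with probability at most $\mathrm{negl}(n)$, and otherwise $O$ contains re-encryptions of the elements of $I$ arranged according to $\pi$), and it is an oblivious shuffle: every probabilistic polynomial-time adversary wins the Shuffle-IND game against it with probability at most $\frac12+\mathrm{negl}(k)$.
   Context: Conventions. $\mathrm{negl}$ denotes a negligible function (eventually smaller than the inverse of every polynomial). $n$ is a perfect square; rounding of $p\log n$ to an integer is ignored. Elements are equal-size pairs $(x,v)$ with distinct keys $x\in[1,n]$. An array of $n$ elements is arranged according to a permutation $\pi$ of $[1,n]$ if the element with key $x$ is at position $\pi(x)$. An array of $n$ elements is split into $\sqrt n$ consecutive buckets of $\sqrt n$ positions. Storage model. A client accesses arrays on a server through requests: getRange$(S,\mathrm{loc},\ell)$ returns the $\ell$ elements of array $S$ at positions starting at loc; putRange$(S,\mathrm{loc},a)$ writes the array $a$ into $S$ starting at loc; getRangeDist and putRangeDist do the same for several ranges in one request. All elements stored on the server are encrypted with the client's secret key, and each element read is decrypted and re-encrypted with fresh randomness before being written back. Single pass $\mathrm{shuffle\_pass}(I,T,\rho,O)$. $I$ and $O$ have $n$ positions, $T$ has $n\cdot p\log n$ positions split into $\sqrt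 n$ consecutive buckets of $\sqrt n\,p\log n$ positions. Distribution phase: for each bucket $i$ of $I$ in order, the client reads the bucket, decrypts it, and for each $j$ collects the elements $(x,v)$ such that position $\rho(x)$ lies in bucket $j$ of $O$. If for some $j$ there are more than $p\log n$ such elements, the algorithm outputs fail and stops. Otherwise, each of these $\sqrt n$ batches is padded with dummy elements (of the same size as real ones) to exactly $p\log n$ elements, encrypted, and batch $j$ is written to bucket $j$ of $T$ at offset $i\cdot p\log n$ (all $\sqrt n$ batches can be written by a single putRangeDist). Clean-up phase: for each bucket $j$ of $T$ in order, the client reads it, decrypts it, removes dummies, sorts the remaining $\sqrt n$ elements by $\rho(x)$, re-encrypts them, and writes them as bucket $j$ of $O$. Melbourne shuffle $\mathrm{shuffle}(I,\pi,O)$. Pick a random permutation $\pi_1$ (uniformly, secretly, and independently of everything else); run $\mathrm{shuffle\_pass}(I,T,\pi_1,O)$; set $I\leftarrow O$; run $\mathrm{shuffle\_pass}(I,T,\pi,O)$. Enc-IND-CPA security. A PPT adversary makes polynomially many queries to the oracles $\mathrm{Enc}_{key}$, $\mathrm{Dec}_{key}$ on sequences of messages, then submits two sequences $M_0,M_1$ of $l$ messages each; a challenger picks a secret bit $b$ and returns the sequence $C$ of encryptions of the messages of $M_b$; the adversary continues querying (but may not decrypt ciphertexts in $C$) and guesses $b$. The scheme is secure if every PPT adversary guesses correctly with probability at most $1/2+\mathrm{negl}(k)$. Shuffle-IND game between a shuffle $\mathcal S=(\mathrm{Setup},\mathrm{Shuffle})$ and a PPT adversary $\mathcal A$. $\mathrm{Setup}(1^k)$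 generates the encryption key (kept in the secret client state) and allocates a datastore on the server. $\mathrm{Shuffle}$ on an input array $A$ and a permutation $\pi$ (starting from $\mathrm{Enc}(A)$ on the server) returns $\mathrm{Enc}(\pi(A))$ together with the transcript $\alpha$, the sequence of all (request, response) pairs exchanged between client and server. (1) $\mathcal S$ runs Setup. (2) For polynomially many rounds, $\mathcal A$ picks an array $B_j$ and a permutation $\rho_j$; $\mathcal S$ runs Shuffle on $(B_j,\rho_j)$ and reveals the output array and transcript to $\mathcal A$. (3) $\mathcal A$ picks two challenges $(A_0,\tau_0),(A_1,\tau_1)$ of the same length. (4) $\mathcal S$ picks a secret bit $b$, runs Shuffle on $(A_b,\tau_b)$, and reveals the output array and transcript. (5) As in (2), for polynomially many further rounds, where $\mathcal A$ picks encrypted arrays $B_j$ and permutations $\rho_j$. (6) $\mathcal A$ outputs $b'$ and wins if $b'=b$. $\mathcal S$ is an oblivious shuffle over $n$ items if every PPT adversary wins with probability at most $1/2+\mathrm{negl}(k)$.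
   Formalization: "n polynomial in k" is taken to mean polynomially related: n is at most a polynomial in k and k at most a polynomial in n. For constant n (e.g. n = 4096, p = e) failure in the second pass has constant probability depending on the challenge permutation, so obliviousness fails. *)

theory Defs
  imports "HOL-Probability.Probability"
    "HOL-Computational_Algebra.Polynomial"
    "HOL-Combinatorics.Permutations"
    "HOL-Library.Discrete_Functions"
begin

section \<open>Asymptotics\<close>

definition negligible :: "(nat \<Rightarrow> real) \<Rightarrow> bool" where
  "negligible \<nu> \<longleftrightarrow> (\<forall>c::nat. eventually (\<lambda>k. \<bar>\<nu> k\<bar> < 1 / real k ^ c) sequentially)"

definition poly_bounded :: "(nat \<Rightarrow> nat) \<Rightarrow> bool" where
  "poly_bounded f \<longleftrightarrow> (\<exists>q :: nat poly. \<forall>k. f k \<le> poly q k)"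

text \<open>
  The two-sided reading of ``\<open>N\<close> is polynomial in \<open>k\<close>'': it holds for every nonconstant polynomial
  \<open>N\<close>. For bounded \<open>N\<close> a quantity negligible in \<open>N k\<close> need not be negligible in \<open>k\<close>.
\<close>
definition poly_related :: "(nat \<Rightarrow> nat) \<Rightarrow> bool" where
  "poly_related N \<longleftrightarrow> poly_bounded N \<and> (\<exists>q :: nat poly. \<forall>k. k \<le> poly q (N k))"


section \<open>Data\<close>

text \<open>
  Machines compute on binary trees. Lists are right spines, so every tree is the code of exactly one
  list of trees; naturals are coded in unary, hence \<open>size (num_data k) = k\<close> and \<open>num_data k\<close> plays
  the role of $1^k$.
\<close>
datatype data = Leaf | Node (left: data) (right: data)
  where "left Leaf = Leaf" | "right Leaf = Leaf"

primrec list_data :: "data list \<Rightarrow> data" where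
  "list_data [] = Leaf"
| "list_data (d # ds) = Node d (list_data ds)"

primrec data_list :: "data \<Rightarrow> data list" where
  "data_list Leaf = []"
| "data_list (Node d ds) = d # data_list ds"

definition num_data :: "nat \<Rightarrow> data" where
  "num_data n = list_data (replicate n Leaf)"

definition data_num :: "data \<Rightarrow> nat" where
  "data_num d = length (data_list d)"

definition bit_data :: "bool \<Rightarrow> data" where
  "bit_data b = (if b then Node Leaf Leaf else Leaf)"

definition data_bit :: "data \<Rightarrow> bool" where
  "data_bit d \<longleftrightarrow> d \<noteq> Leaf"

definition bits_data :: "bool list \<Rightarrow> data" where
  "bits_data bs = list_data (map bit_data bs)"

definition data_bits :: "data \<Rightarrow> bool list" where
  "data_bits d = map data_bit (data_list d)"

definition option_data :: "data option \<Rightarrow> data" where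
  "option_data r = (case r of None \<Rightarrow> Leaf | Some d \<Rightarrow> Node Leaf d)"


section \<open>Probabilistic polynomial-time machines\<close>

text \<open>
  Uniform probabilistic machines are programs of a WHILE language over trees. Assigning, sampling or
  exchanging a tree costs its size, so that polynomial cost is polynomial time in the usual sense
  (with unit cost, repeated doubling would build trees of exponential size).
  The machine interacts with its environment through \<open>Query\<close>.
\<close>

datatype expr = Var nat | Lf | Nd expr expr | Fst expr | Snd expr | Eq expr expr

datatype com =
    Skip
  | Assign nat expr
  | Seq com com
  | Cond expr com com
  | While expr com
  | Sample nat expr  \<comment> \<open>a uniformly random entry of the list denoted by the expression\<close>
  | Query nat expr

type_synonym store = "nat \<Rightarrow> data"

primrec denote :: "store \<Rightarrow> expr \<Rightarrow> data" where
  "denote \<sigma> (Var x) = \<sigma> x"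
| "denote \<sigma> Lf = Leaf"
| "denote \<sigma> (Nd e f) = Node (denote \<sigma> e) (denote \<sigma> f)"
| "denote \<sigma> (Fst e) = left (denote \<sigma> e)"
| "denote \<sigma> (Snd e) = right (denote \<sigma> e)"
| "denote \<sigma> (Eq e f) = bit_data (denote \<sigma> e = denote \<sigma> f)"

definition pick :: "data list \<Rightarrow> data pmf" where
  "pick ds = (if ds = [] then return_pmf Leaf else map_pmf (\<lambda>i. ds ! i) (pmf_of_set {..<length ds}))"

text \<open>
  An environment with state \<open>'s\<close> answers a query, or returns \<open>None\<close> if the query is not a legal move.
\<close>
type_synonym 's env = "'s \<Rightarrow> data \<Rightarrow> (data \<times> 's) option pmf"

text \<open>
  Pending commands, store, state of the environment (\<open>None\<close> after an illegal move, which also ends the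
  run), and the time used so far.
\<close>
type_synonym 's config = "com list \<times> store \<times> 's option \<times> nat"

fun step :: "'s env \<Rightarrow> 's config \<Rightarrow> 's config pmf" where
  "step R ([], \<sigma>, s, t) = return_pmf ([], \<sigma>, s, t)"
| "step R (Skip # cs, \<sigma>, s, t) = return_pmf (cs, \<sigma>, s, t + 1)"
| "step R (Assign x e # cs, \<sigma>, s, t) =
     (let d = denote \<sigma> e in return_pmf (cs, \<sigma>(x := d), s, t + 1 + size d))"
| "step R (Seq c1 c2 # cs, \<sigma>, s, t) = return_pmf (c1 # c2 # cs, \<sigma>, s, t + 1)"
| "step R (Cond e c1 c2 # cs, \<sigma>, s, t) =
     return_pmf ((if data_bit (denote \<sigma> e) then c1 else c2) # cs, \<sigma>, s, t + 1)"
| "step R (While e c # cs, \<sigma>, s, t) =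
     return_pmf (if data_bit (denote \<sigma> e) then c # While e c # cs else cs, \<sigma>, s, t + 1)"
| "step R (Sample x e # cs, \<sigma>, s, t) =
     map_pmf (\<lambda>d. (cs, \<sigma>(x := d), s, t + 1 + size d)) (pick (data_list (denote \<sigma> e)))"
| "step R (Query x e # cs, \<sigma>, None, t) = return_pmf ([], \<sigma>, None, t + 1)"
| "step R (Query x e # cs, \<sigma>, Some s, t) =
     (let d = denote \<sigma> e in
      map_pmf (\<lambda>r. case r of
          None \<Rightarrow> ([], \<sigma>, None, t + 1 + size d)
        | Some (a, s') \<Rightarrow> (cs, \<sigma>(x := a), Some s', t + 1 + size d + size a))
        (R s d))"

primrec run :: "'s env \<Rightarrow> nat \<Rightarrow> 's config \<Rightarrow> 's config pmf" where
  "run R 0 cfg = return_pmf cfg"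
| "run R (Suc t) cfg = bind_pmf (step R cfg) (run R t)"

definition init_config :: "com \<Rightarrow> data \<Rightarrow> 's \<Rightarrow> 's config" where
  "init_config c d s = ([c], (\<lambda>_. Leaf)(0 := d), Some s, 0)"

text \<open>Every step costs at least one unit, so time at most \<open>t\<close> implies at most \<open>t\<close> steps.\<close>
definition halted_by :: "nat \<Rightarrow> 's config \<Rightarrow> bool" where
  "halted_by t = (\<lambda>(cs, \<sigma>, s, u). cs = [] \<and> u \<le> t)"

text \<open>\<open>f\<close> is computed exactly by a machine without environment, in time polynomial in the input size.\<close>
definition poly_time :: "('a \<Rightarrow> data) \<Rightarrow> ('a \<Rightarrow> data pmf) \<Rightarrow> bool" where
  "poly_time code f \<longleftrightarrow>
     (\<exists>c (q :: nat poly). \<forall>a.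
        let t = poly q (size (code a));
            r = run (\<lambda>_ _. return_pmf None) t (init_config c (code a) ())
        in (\<forall>cfg \<in> set_pmf r. halted_by t cfg) \<and> map_pmf (\<lambda>(cs, \<sigma>, s, u). \<sigma> 0) r = f a)"


section \<open>Games\<close>

text \<open>
  An adversary receives \<open>input\<close> in variable 0, plays against the environment \<open>respond\<close>, and leaves its
  final answer in variable 0. An adversary that makes an illegal move does not win.
\<close>
record 's game =
  input :: data
  start :: "'s pmf"
  respond :: "'s env"
  wins :: "'s \<Rightarrow> data \<Rightarrow> bool"

definition play :: "'s game \<Rightarrow> com \<Rightarrow> nat \<Rightarrow> 's config pmf" where
  "play G A t = bind_pmf (start G) (\<lambda>s. run (respond G) t (init_config A (input G) s))"

definition won :: "'s game \<Rightarrow> 's config \<Rightarrow> bool" where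
  "won G = (\<lambda>(cs, \<sigma>, s, u). cs = [] \<and> (\<exists>s'. s = Some s' \<and> wins G s' (\<sigma> 0)))"

definition win_prob :: "'s game \<Rightarrow> com \<Rightarrow> real" where
  "win_prob G A = (SUP t. measure_pmf.prob (play G A t) {cfg. won G cfg})"

definition ppt :: "(nat \<Rightarrow> 's game) \<Rightarrow> com \<Rightarrow> bool" where
  "ppt G A \<longleftrightarrow>
     (\<exists>q :: nat poly. \<forall>k. \<forall>cfg \<in> set_pmf (play (G k) A (poly q k)). halted_by (poly q k) cfg)"

definition secure :: "(nat \<Rightarrow> 's game) \<Rightarrow> bool" where
  "secure G \<longleftrightarrow>
     (\<forall>A. ppt G A \<longrightarrow> (\<exists>\<nu>. negligible \<nu> \<and> (\<forall>k. win_prob (G k) A \<le> 1 / 2 + \<nu> k)))"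


section \<open>Symmetric encryption and Enc-IND-CPA\<close>

text \<open>
  The first argument of each algorithm is the security parameter. Messages are bit strings, keys and
  ciphertexts are arbitrary data.
\<close>
record scheme =
  gen :: "nat \<Rightarrow> data pmf"
  enc :: "nat \<Rightarrow> data \<Rightarrow> bool list \<Rightarrow> data pmf"
  dec :: "nat \<Rightarrow> data \<Rightarrow> data \<Rightarrow> bool list option"

definition symmetric_encryption :: "scheme \<Rightarrow> bool" where
  "symmetric_encryption E \<longleftrightarrow>
     poly_time num_data (gen E) \<and>
     poly_time (\<lambda>(k, key, m). Node (num_data k) (Node key (bits_data m)))
       (\<lambda>(k, key, m). enc E k key m) \<and>
     poly_time (\<lambda>(k, key, c). Node (num_data k) (Node key c))
       (\<lambda>(k, key, c). return_pmf (option_data (map_option bits_data (dec E k key c)))) \<and>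
     (\<forall>k. \<forall>key \<in> set_pmf (gen E k). \<forall>m. \<forall>c \<in> set_pmf (enc E k key m). dec E k key c = Some m)"

primrec seq_pmf :: "'a pmf list \<Rightarrow> 'a list pmf" where
  "seq_pmf [] = return_pmf []"
| "seq_pmf (p # ps) = bind_pmf p (\<lambda>x. map_pmf ((#) x) (seq_pmf ps))"

definition enc_all :: "scheme \<Rightarrow> nat \<Rightarrow> data \<Rightarrow> bool list list \<Rightarrow> data list pmf" where
  "enc_all E k key ms = seq_pmf (map (enc E k key) ms)"

datatype enc_query =
    EncQ "bool list list"
  | DecQ "data list"
  | EncChallenge "bool list list" "bool list list"

definition parse_enc_query :: "data \<Rightarrow> enc_query" where
  "parse_enc_query d =
     (let msgs = (\<lambda>d. map data_bits (data_list d)) in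
      if data_num (left d) = 0 then EncQ (msgs (right d))
      else if data_num (left d) = 1 then DecQ (data_list (right d))
      else EncChallenge (msgs (left (right d))) (msgs (right (right d))))"

text \<open>
  State: the key, the secret bit, and the challenge ciphertexts once they have been issued.
  As messages may have any length, corresponding challenge messages must have equal length.
\<close>
fun enc_respond :: "scheme \<Rightarrow> nat \<Rightarrow> (data \<times> bool \<times> data list option) env" where
  "enc_respond E k (key, b, C) d =
     (case parse_enc_query d of
        EncQ ms \<Rightarrow> map_pmf (\<lambda>cs. Some (list_data cs, (key, b, C))) (enc_all E k key ms)
      | DecQ cs \<Rightarrow>
          return_pmf
            (if C \<noteq> None \<and> set cs \<inter> set (the C) \<noteq> {} then None
             else Some (list_data (map (\<lambda>c. option_data (map_option bits_data (dec E k key c))) cs),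
                        (key, b, C)))
      | EncChallenge M0 M1 \<Rightarrow>
          if C = None \<and> map length M0 = map length M1
          then map_pmf (\<lambda>cs. Some (list_data cs, (key, b, Some cs)))
                 (enc_all E k key (if b then M1 else M0))
          else return_pmf None)"

definition enc_ind_game :: "scheme \<Rightarrow> nat \<Rightarrow> (data \<times> bool \<times> data list option) game" where
  "enc_ind_game E k =
     \<lparr> input = num_data k,
       start = map_pmf (\<lambda>(key, b). (key, b, None)) (pair_pmf (gen E k) (pmf_of_set UNIV)),
       respond = enc_respond E k,
       wins = (\<lambda>(key, b, C) d. data_bit d = b) \<rparr>"

definition enc_ind_cpa_secure :: "scheme \<Rightarrow> bool" where
  "enc_ind_cpa_secure E \<longleftrightarrow> secure (enc_ind_game E)"


section \<open>Elements and arrays\<close>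

text \<open>
  Keys are \<open>1, \<dots>, n\<close>; key 0 marks dummies. Position \<open>i\<close> of an array (\<open>1 \<le> i \<le> n\<close>) is index \<open>i - 1\<close>
  of the list representing it.
\<close>
type_synonym elem = "nat \<times> bool list"

definition key_width :: "nat \<Rightarrow> nat" where
  "key_width n = Suc (floor_log n)"

fun elem_bits :: "nat \<Rightarrow> elem \<Rightarrow> bool list" where
  "elem_bits n (x, v) = map (bit x) [0..<key_width n] @ v"

definition bits_elem :: "nat \<Rightarrow> bool list \<Rightarrow> elem" where
  "bits_elem n bs = (horner_sum of_bool 2 (take (key_width n) bs), drop (key_width n) bs)"

text \<open>All values consist of \<open>w\<close> bits, so that all elements have the same size.\<close>
definition valid_array :: "nat \<Rightarrow> nat \<Rightarrow> elem list \<Rightarrow> bool" where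
  "valid_array n w A \<longleftrightarrow>
     length A = n \<and> distinct (map fst A) \<and> (\<forall>(x, v) \<in> set A. x \<in> {1..n} \<and> length v = w)"

definition arranged :: "(nat \<Rightarrow> nat) \<Rightarrow> elem list \<Rightarrow> bool" where
  "arranged \<pi> A \<longleftrightarrow> (\<forall>i < length A. \<pi> (fst (A ! i)) = i + 1)"

definition encrypts_array :: "scheme \<Rightarrow> nat \<Rightarrow> data \<Rightarrow> nat \<Rightarrow> elem list \<Rightarrow> data list \<Rightarrow> bool" where
  "encrypts_array E k key n A C \<longleftrightarrow> list_all2 (\<lambda>e c. dec E k key c = Some (elem_bits n e)) A C"


section \<open>Storage model\<close>

datatype arr = InArr | TmpArr | OutArr

type_synonym server = "arr \<Rightarrow> data list"

text \<open>Locations in requests are 0-based offsets.\<close>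
datatype request =
    GetRange arr nat nat
  | PutRange arr nat "data list"
  | GetRangeDist arr "(nat \<times> nat) list"
  | PutRangeDist arr "(nat \<times> data list) list"

datatype response = Elements "data list" | Ack

type_synonym transcript = "(request \<times> response) list"

definition get_range :: "data list \<Rightarrow> nat \<Rightarrow> nat \<Rightarrow> data list" where
  "get_range xs loc l = take l (drop loc xs)"

definition put_range :: "data list \<Rightarrow> nat \<Rightarrow> data list \<Rightarrow> data list" where
  "put_range xs loc ys = take loc xs @ ys @ drop (loc + length ys) xs"

fun serve :: "request \<Rightarrow> server \<Rightarrow> response \<times> server" where
  "serve (GetRange S loc l) sv = (Elements (get_range (sv S) loc l), sv)"
| "serve (PutRange S loc ys) sv = (Ack, sv(S := put_range (sv S) loc ys))"
| "serve (GetRangeDist S rs) sv =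
     (Elements (concat (map (\<lambda>(loc, l). get_range (sv S) loc l) rs)), sv)"
| "serve (PutRangeDist S rs) sv =
     (Ack, sv(S := fold (\<lambda>(loc, ys) xs. put_range xs loc ys) rs (sv S)))"

text \<open>
  Client computations: randomised, acting on the server only through requests, which are recorded
  together with the responses. The result \<open>None\<close> stands for the output ``fail'', which stops the
  computation but keeps the transcript.
\<close>
type_synonym 'a client = "server \<times> transcript \<Rightarrow> ('a option \<times> server \<times> transcript) pmf"

definition return_client :: "'a \<Rightarrow> 'a client" where
  "return_client x = (\<lambda>s. return_pmf (Some x, s))"

definition fail_client :: "'a client" where
  "fail_client = (\<lambda>s. return_pmf (None, s))"

definition bind_client :: "'a client \<Rightarrow> ('a \<Rightarrow> 'b client) \<Rightarrow> 'b client" where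
  "bind_client m f =
     (\<lambda>s. bind_pmf (m s)
        (\<lambda>(r, s'). case r of None \<Rightarrow> return_pmf (None, s') | Some x \<Rightarrow> f x s'))"

adhoc_overloading Monad_Syntax.bind \<rightleftharpoons> bind_client

definition lift_client :: "'a pmf \<Rightarrow> 'a client" where
  "lift_client p = (\<lambda>s. map_pmf (\<lambda>x. (Some x, s)) p)"

definition send :: "request \<Rightarrow> response client" where
  "send q = (\<lambda>(sv, tr). let (a, sv') = serve q sv in return_pmf (Some a, sv', tr @ [(q, a)]))"

definition fetch :: "arr \<Rightarrow> nat \<Rightarrow> nat \<Rightarrow> data list client" where
  "fetch S loc l =
     bind_client (send (GetRange S loc l))
       (\<lambda>a. return_client (case a of Elements cs \<Rightarrow> cs | Ack \<Rightarrow> []))"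

primrec for_each :: "('a \<Rightarrow> unit client) \<Rightarrow> 'a list \<Rightarrow> unit client" where
  "for_each f [] = return_client ()"
| "for_each f (x # xs) = bind_client (f x) (\<lambda>_. for_each f xs)"


section \<open>The Melbourne shuffle\<close>

definition batch_size :: "real \<Rightarrow> nat \<Rightarrow> nat" where
  "batch_size p n = nat \<lceil>p * log 2 (real n)\<rceil>"

definition dec_elem :: "scheme \<Rightarrow> nat \<Rightarrow> data \<Rightarrow> nat \<Rightarrow> data \<Rightarrow> elem" where
  "dec_elem E k key n c = bits_elem n (the (dec E k key c))"

definition enc_elems :: "scheme \<Rightarrow> nat \<Rightarrow> data \<Rightarrow> nat \<Rightarrow> elem list \<Rightarrow> data list pmf" where
  "enc_elems E k key n es = enc_all E k key (map (elem_bits n) es)"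

text \<open>Buckets are numbered from 0, so position \<open>\<rho> x\<close> lies in bucket \<open>(\<rho> x - 1) div s\<close>.\<close>
definition distribute_bucket ::
  "scheme \<Rightarrow> nat \<Rightarrow> data \<Rightarrow> real \<Rightarrow> nat \<Rightarrow> nat \<Rightarrow> arr \<Rightarrow> arr \<Rightarrow> (nat \<Rightarrow> nat) \<Rightarrow> nat \<Rightarrow> unit client" where
  "distribute_bucket E k key p n w I T \<rho> i =
     (let s = floor_sqrt n; m = batch_size p n in do {
        cs \<leftarrow> fetch I (i * s) s;
        let es = map (dec_elem E k key n) cs;
        let batch = (\<lambda>j. filter (\<lambda>(x, v). (\<rho> x - 1) div s = j) es);
        if \<exists>j < s. length (batch j) > m then fail_client
        else do {
          let padded = (\<lambda>j. batch j @ replicate (m - length (batch j)) (0, replicate w False));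
          bs \<leftarrow> lift_client (seq_pmf (map (\<lambda>j. enc_elems E k key n (padded j)) [0..<s]));
          _ \<leftarrow> send (PutRangeDist T (map (\<lambda>j. (j * (s * m) + i * m, bs ! j)) [0..<s]));
          return_client ()
        }
      })"

definition clean_up_bucket ::
  "scheme \<Rightarrow> nat \<Rightarrow> data \<Rightarrow> real \<Rightarrow> nat \<Rightarrow> arr \<Rightarrow> (nat \<Rightarrow> nat) \<Rightarrow> arr \<Rightarrow> nat \<Rightarrow> unit client" where
  "clean_up_bucket E k key p n T \<rho> O' j =
     (let s = floor_sqrt n; m = batch_size p n in do {
        cs \<leftarrow> fetch T (j * (s * m)) (s * m);
        let es = filter (\<lambda>(x, v). x \<noteq> 0) (map (dec_elem E k key n) cs);
        ds \<leftarrow> lift_client (enc_elems E k key n (sort_key (\<lambda>(x, v). \<rho> x) es));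
        _ \<leftarrow> send (PutRange O' (j * s) ds);
        return_client ()
      })"

definition shuffle_pass ::
  "scheme \<Rightarrow> nat \<Rightarrow> data \<Rightarrow> real \<Rightarrow> nat \<Rightarrow> nat \<Rightarrow> arr \<Rightarrow> arr \<Rightarrow> (nat \<Rightarrow> nat) \<Rightarrow> arr \<Rightarrow> unit client" where
  "shuffle_pass E k key p n w I T \<rho> O' = do {
     _ \<leftarrow> for_each (distribute_bucket E k key p n w I T \<rho>) [0..<floor_sqrt n];
     for_each (clean_up_bucket E k key p n T \<rho> O') [0..<floor_sqrt n]
   }"

text \<open>
  A shuffle takes the encrypted input array and the desired permutation, and yields the encrypted
  output array, or \<open>None\<close> for ``fail'', together with the transcript.
\<close>
type_synonym shuffle = "data list \<Rightarrow> (nat \<Rightarrow> nat) \<Rightarrow> (data list option \<times> transcript) pmf"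

text \<open>``$I \leftarrow O$'' makes the second pass read the array written by the first one.\<close>
definition melbourne_shuffle ::
  "scheme \<Rightarrow> real \<Rightarrow> nat \<Rightarrow> nat \<Rightarrow> nat \<Rightarrow> data \<Rightarrow> shuffle" where
  "melbourne_shuffle E p n w k key C \<pi> =
     bind_pmf (pmf_of_set {\<sigma>. \<sigma> permutes {1..n}}) (\<lambda>\<pi>1.
       map_pmf (\<lambda>(r, sv, tr). (map_option (\<lambda>_. sv OutArr) r, tr))
         (bind_client (shuffle_pass E k key p n w InArr TmpArr \<pi>1 OutArr)
            (\<lambda>_. shuffle_pass E k key p n w OutArr TmpArr \<pi> OutArr)
            (\<lambda>S. case S of
                InArr \<Rightarrow> C
              | TmpArr \<Rightarrow> replicate (n * batch_size p n) Leaf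
              | OutArr \<Rightarrow> replicate n Leaf, [])))"


section \<open>Success with very high probability\<close>

text \<open>
  The bound on the failure probability is a function of \<open>n\<close> alone, uniform in all other data.
\<close>
definition succeeds_whp :: "scheme \<Rightarrow> (nat \<Rightarrow> nat \<Rightarrow> nat \<Rightarrow> data \<Rightarrow> shuffle) \<Rightarrow> bool" where
  "succeeds_whp E \<S> \<longleftrightarrow>
     (\<exists>\<nu>. negligible \<nu> \<and>
       (\<forall>n w k key A C \<pi>0 \<pi>.
          (\<exists>s. n = s\<^sup>2) \<and> key \<in> set_pmf (gen E k) \<and>
          \<pi>0 permutes {1..n} \<and> \<pi> permutes {1..n} \<and>
          valid_array n w A \<and> arranged \<pi>0 A \<and> encrypts_array E k key n A C \<longrightarrow>
            measure_pmf.prob (\<S> n w k key C \<pi>) {(r, tr). r = None} \<le> \<nu> n \<and>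
            (\<forall>D tr. (Some D, tr) \<in> set_pmf (\<S> n w k key C \<pi>) \<longrightarrow>
               (\<exists>B. valid_array n w B \<and> set B = set A \<and> arranged \<pi> B \<and>
                  list_all2 (\<lambda>e c. c \<in> set_pmf (enc E k key (elem_bits n e))) B D))))"


section \<open>Shuffle-IND\<close>

definition data_elems :: "data \<Rightarrow> elem list" where
  "data_elems d = map (\<lambda>d. (data_num (left d), data_bits (right d))) (data_list d)"

text \<open>A permutation is submitted as the list of its values at \<open>1, \<dots>, n\<close>.\<close>
definition data_perm :: "data \<Rightarrow> nat \<Rightarrow> nat" where
  "data_perm d =
     (\<lambda>x. if x \<in> {1..length (data_list d)} then data_num (data_list d ! (x - 1)) else x)"

fun arr_data :: "arr \<Rightarrow> data" where
  "arr_data InArr = num_data 0"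
| "arr_data TmpArr = num_data 1"
| "arr_data OutArr = num_data 2"

fun request_data :: "request \<Rightarrow> data" where
  "request_data (GetRange S loc l) =
     list_data [num_data 0, arr_data S, num_data loc, num_data l]"
| "request_data (PutRange S loc ys) =
     list_data [num_data 1, arr_data S, num_data loc, list_data ys]"
| "request_data (GetRangeDist S rs) =
     list_data [num_data 2, arr_data S,
       list_data (map (\<lambda>(loc, l). Node (num_data loc) (num_data l)) rs)]"
| "request_data (PutRangeDist S rs) =
     list_data [num_data 3, arr_data S,
       list_data (map (\<lambda>(loc, ys). Node (num_data loc) (list_data ys)) rs)]"

fun response_data :: "response \<Rightarrow> data" where
  "response_data (Elements cs) = option_data (Some (list_data cs))"
| "response_data Ack = option_data None"

definition outcome_data :: "data list option \<times> transcript \<Rightarrow> data" where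
  "outcome_data =
     (\<lambda>(r, tr). Node (option_data (map_option list_data r))
        (list_data (map (\<lambda>(q, a). Node (request_data q) (response_data a)) tr)))"

datatype shuffle_query =
    PlainQ "elem list" "nat \<Rightarrow> nat"
  | ShuffleChallenge "elem list" "nat \<Rightarrow> nat" "elem list" "nat \<Rightarrow> nat"
  | CryptQ "data list" "nat \<Rightarrow> nat"

definition parse_shuffle_query :: "data \<Rightarrow> shuffle_query" where
  "parse_shuffle_query d =
     (let a = left (right d); b = right (right d) in
      if data_num (left d) = 0 then PlainQ (data_elems a) (data_perm b)
      else if data_num (left d) = 1
      then ShuffleChallenge (data_elems (left a)) (data_perm (right a))
             (data_elems (left b)) (data_perm (right b))
      else CryptQ (data_list a) (data_perm b))"

text \<open>
  State: the key, the secret bit, and whether the challenge has been issued. Plain arrays may be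
  submitted before the challenge, encrypted arrays after it. Only arrays of \<open>n\<close> elements with distinct
  keys (respectively encryptions of such arrays) are legal: on other inputs, e.g. one mixing a
  challenge ciphertext with copies of another one, a shuffle is not defined.
\<close>
fun shuffle_respond ::
  "scheme \<Rightarrow> nat \<Rightarrow> nat \<Rightarrow> nat \<Rightarrow> (data \<Rightarrow> shuffle) \<Rightarrow> (data \<times> bool \<times> bool) env" where
  "shuffle_respond E n w k S (key, b, challenged) d =
     (let ok = (\<lambda>A \<pi>. valid_array n w A \<and> \<pi> permutes {1..n});
          on_plain = (\<lambda>A \<pi>. bind_pmf (enc_elems E k key n A) (\<lambda>C. S key C \<pi>))
      in case parse_shuffle_query d of
        PlainQ A \<pi> \<Rightarrow>
          if \<not> challenged \<and> ok A \<pi>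
          then map_pmf (\<lambda>r. Some (outcome_data r, (key, b, False))) (on_plain A \<pi>)
          else return_pmf None
      | ShuffleChallenge A0 \<tau>0 A1 \<tau>1 \<Rightarrow>
          if \<not> challenged \<and> ok A0 \<tau>0 \<and> ok A1 \<tau>1
          then map_pmf (\<lambda>r. Some (outcome_data r, (key, b, True)))
                 (if b then on_plain A1 \<tau>1 else on_plain A0 \<tau>0)
          else return_pmf None
      | CryptQ C \<pi> \<Rightarrow>
          if challenged \<and> (\<exists>A. ok A \<pi> \<and> encrypts_array E k key n A C)
          then map_pmf (\<lambda>r. Some (outcome_data r, (key, b, True))) (S key C \<pi>)
          else return_pmf None)"

text \<open>\<open>S key\<close> is the shuffle under the given key. The sizes \<open>n\<close> and \<open>w\<close> are public.\<close>
definition shuffle_ind_game ::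
  "scheme \<Rightarrow> nat \<Rightarrow> nat \<Rightarrow> nat \<Rightarrow> (data \<Rightarrow> shuffle) \<Rightarrow> (data \<times> bool \<times> bool) game" where
  "shuffle_ind_game E n w k S =
     \<lparr> input = list_data [num_data k, num_data n, num_data w],
       start = map_pmf (\<lambda>(key, b). (key, b, False)) (pair_pmf (gen E k) (pmf_of_set UNIV)),
       respond = shuffle_respond E n w k S,
       wins = (\<lambda>(key, b, challenged) d. data_bit d = b) \<rparr>"

definition oblivious_shuffle ::
  "scheme \<Rightarrow> (nat \<Rightarrow> nat) \<Rightarrow> (nat \<Rightarrow> nat) \<Rightarrow> (nat \<Rightarrow> nat \<Rightarrow> nat \<Rightarrow> data \<Rightarrow> shuffle) \<Rightarrow> bool" where
  "oblivious_shuffle E N W \<S> \<longleftrightarrow>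
     secure (\<lambda>k. shuffle_ind_game E (N k) (W k) k (\<S> (N k) (W k) k))"

end

theory Submission
  imports Defs
begin

text \<open>
  Once its permutations are fixed, a shuffle computes a list of elements (its plan) that does not
  depend on any ciphertext. What the server sees is a rearrangement of the encryptions of the plan,
  and the plan overflows with probability at most $2n/(m+1)!$ for batches of size $m$.

  An adversary against the shuffle yields hybrids in which the first $h$ of all encryptions are
  replaced by encryptions of zeros. In the first hybrid the adversary wins as often as in the game,
  up to failures. In the last one the two values of the secret bit give the same view, so that it
  wins with probability at most $1/2$. Neighbouring hybrids are distinguished only with the
  advantage of an adversary against the encryption scheme, which interprets the shuffle adversary
  step by step and knows the plaintexts of all ciphertexts that it has produced.

  The number $p$ and the functions $N$ and $W$ need not be computable. The reduction therefore guesses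
  all sizes and the position of the hybrid. Since a wrong guess may have a negative advantage, it
  first plays against a copy of the game that it simulates with its own key and bit, and then flips
  its answer in the actual game if it has lost the first one. A guess with advantage $\epsilon$ then contributes
  $2\epsilon^2 \ge 0$, and the right guess has inverse polynomial probability.
\<close>

section \<open>Polynomial-time programs over machines\<close>

text \<open>The view on which a query of the adversary depends contains the ciphertexts of earlier
  shuffles, so the plaintexts are not all known in advance, and the single challenge of the
  encryption game can cover only part of them. It is spent on one encryption; hence hybrids over
  individual encryptions, and a bound on their number. Failure is a second obstacle: whether the
  second pass overflows depends on the desired permutation, and so does the truncated transcript. In
  the hybrids a failing shuffle ends the run as a loss. Runs with different secret bits then need to
  agree only while both are alive, and as one answer cannot be right for both bits, their winning
  probabilities add up to at most 1. Finally, the reduction must be a WHILE program of polynomial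
  cost. It is never written down: the predicate \<open>ptm\<close> on probabilistic functions says
  that some such program exists, and its closure properties follow the shape of functional
  definitions. The adversary enters through an interpreter with a size limit, which keeps the
  reduction polynomial on views that the real game never produces, where the adversary has no time
  bound.\<close>

definition pmono :: "(nat => nat) => bool" where
  "pmono g \<longleftrightarrow> mono g \<and> poly_bounded g"

lemma poly_nat_mono: "x \<le> y ==> poly (q :: nat poly) x \<le> poly q y"
  by (induction q) (auto intro!: add_mono mult_mono)

lemma pmono_monoD: "pmono g ==> x \<le> y ==> g x \<le> g y"
  by (auto simp: pmono_def dest: monoD)

lemma pmono_const: "pmono (\<lambda>_. c)"
  unfolding pmono_def poly_bounded_def by (auto intro!: monoI exI[of _ "[:c:]"])

lemma pmono_id: "pmono (\<lambda>x. x)"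
  unfolding pmono_def poly_bounded_def by (auto intro!: monoI exI[of _ "[:0, 1:]"])

lemma pmono_add: assumes "pmono f" "pmono g" shows "pmono (\<lambda>x. f x + g x)"
proof -
  obtain p q :: "nat poly" where "\<forall>k. f k \<le> poly p k" "\<forall>k. g k \<le> poly q k"
    using assms by (auto simp: pmono_def poly_bounded_def)
  then have "\<forall>k. f k + g k \<le> poly (p + q) k" by (auto intro: add_mono)
  then have "poly_bounded (\<lambda>x. f x + g x)" unfolding poly_bounded_def by blast
  then show ?thesis using assms by (auto simp: pmono_def intro!: monoI add_mono dest: monoD)
qed

lemma pmono_mult: assumes "pmono f" "pmono g" shows "pmono (\<lambda>x. f x * g x)"
proof -
  obtain p q :: "nat poly" where "\<forall>k. f k \<le> poly p k" "\<forall>k. g k \<le> poly q k"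
    using assms by (auto simp: pmono_def poly_bounded_def)
  then have "\<forall>k. f k * g k \<le> poly (p * q) k" by (auto intro: mult_mono)
  then have "poly_bounded (\<lambda>x. f x * g x)" unfolding poly_bounded_def by blast
  then show ?thesis using assms by (auto simp: pmono_def intro!: monoI mult_mono dest: monoD)
qed

text \<open>A bound on the inner function may be inserted into the outer one because the outer one
  is monotone. Costs of composed programs have this form, hence \<open>pmono\<close> rather than
  \<open>poly_bounded\<close> alone.\<close>

lemma pmono_comp: assumes "pmono f" "pmono g" shows "pmono (\<lambda>x. f (g x))"
proof -
  obtain p q :: "nat poly" where *: "\<forall>k. f k \<le> poly p k" "\<forall>k. g k \<le> poly q k"
    using assms by (auto simp: pmono_def poly_bounded_def)
  have "f (g k) \<le> poly (pcompose p q) k" for k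
    using *(1)[rule_format, of "g k"] poly_nat_mono[OF *(2)[rule_format, of k], of p]
    using assms(1) *(2)[rule_format, of k] by (simp add: poly_pcompose pmono_def)
  then have "poly_bounded (\<lambda>x. f (g x))" unfolding poly_bounded_def by blast
  then show ?thesis using assms by (auto simp: pmono_def intro!: monoI dest: monoD)
qed

lemma pmono_Suc: "pmono f ==> pmono (\<lambda>x. Suc (f x))"
  using pmono_add[OF pmono_const[of 1]] by simp

lemma pmono_poly: "pmono (poly q)"
  unfolding pmono_def poly_bounded_def by (auto intro!: monoI poly_nat_mono)

lemmas pmono_intros = pmono_const pmono_id pmono_add pmono_mult pmono_Suc

lemma poly_bounded_pmono: assumes "poly_bounded f" shows "\<exists>g. pmono g \<and> (\<forall>x. f x \<le> g x)"
  using assms pmono_poly unfolding poly_bounded_def by blast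

lemma pmono_poly_bound: assumes "pmono f" shows "\<exists>q :: nat poly. \<forall>x. f x \<le> poly q x"
  using assms by (auto simp: pmono_def poly_bounded_def)

section \<open>Codes of types as trees, and their sizes\<close>

lemma list_data_inject: "list_data xs = list_data ys \<longleftrightarrow> xs = ys"
  by (induction xs arbitrary: ys) (case_tac ys; auto)+

lemma data_list_list_data [simp]: "data_list (list_data ds) = ds"
  by (induction ds) auto

lemma list_data_data_list [simp]: "list_data (data_list d) = d"
  by (induction d) auto

lemma list_data_Leaf [simp]: "list_data ds = Leaf \<longleftrightarrow> ds = []" "Leaf = list_data ds \<longleftrightarrow> ds = []"
  by (cases ds; simp)+

text \<open>An injection into trees is enough. \<open>decode\<close> inverts it on its range and is
  arbitrary elsewhere; programs work on codes, and \<open>decode\<close> only turns the content of a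
  variable back into the value that it represents.\<close>

class code =
  fixes code :: "'a => data"
  assumes code_inject [simp]: "code a = code b \<longleftrightarrow> a = b"
begin

definition sz :: "'a => nat" where "sz a = size (code a)"

definition decode :: "data => 'a" where "decode d = inv code d"

lemma decode_code [simp]: "decode (code a) = a"
  unfolding decode_def by (auto intro!: inv_f_f injI)

end

instantiation data :: code begin
definition code_data :: "data => data" where [simp]: "code_data d = d"
instance by standard simp
end

instantiation unit :: code begin
definition code_unit :: "unit => data" where [simp]: "code_unit u = Leaf"
instance by standard simp
end

instantiation bool :: code begin
definition code_bool :: "bool => data" where "code_bool b = bit_data b"
instance by standard (auto simp: code_bool_def bit_data_def)
end

instantiation nat :: code begin
definition code_nat :: "nat => data" where "code_nat n = num_data n"
instance by standard (auto simp: code_nat_def num_data_def list_data_inject replicate_eq_replicate)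
end

instantiation prod :: (code, code) code begin
definition code_prod :: "'a \<times> 'b => data" where "code_prod p = Node (code (fst p)) (code (snd p))"
instance by standard (auto simp: code_prod_def)
end

instantiation list :: (code) code begin
definition code_list :: "'a list => data" where "code_list xs = list_data (map code xs)"
instance by standard (simp add: code_list_def list_data_inject inj_map_eq_map inj_def)
end

instantiation option :: (code) code begin
definition code_option :: "'a option => data" where "code_option r = option_data (map_option code r)"
instance by standard (auto simp: code_option_def option_data_def split: option.splits)
end

lemma code_Pair [simp]: "code (a, b) = Node (code a) (code b)" by (simp add: code_prod_def)
lemma code_Nil [simp]: "code [] = Leaf" by (simp add: code_list_def)
lemma code_Cons [simp]: "code (x # xs) = Node (code x) (code xs)" by (simp add: code_list_def)
lemma code_None [simp]: "code None = Leaf" by (simp add: code_option_def option_data_def)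
lemma code_Some [simp]: "code (Some x) = Node Leaf (code x)" by (simp add: code_option_def option_data_def)
lemma code_0 [simp]: "code (0::nat) = Leaf" by (simp add: code_nat_def num_data_def)
lemma code_Suc [simp]: "code (Suc n) = Node Leaf (code n)" by (simp add: code_nat_def num_data_def)
lemma code_True [simp]: "code True = Node Leaf Leaf" by (simp add: code_bool_def bit_data_def)
lemma code_False [simp]: "code False = Leaf" by (simp add: code_bool_def bit_data_def)

lemma sz_Pair [simp]: "sz (a, b) = Suc (sz a + sz b)" by (simp add: sz_def)
lemma sz_Nil [simp]: "sz [] = 0" by (simp add: sz_def)
lemma sz_Cons [simp]: "sz (x # xs) = Suc (sz x + sz xs)" by (simp add: sz_def)
lemma sz_None [simp]: "sz None = 0" by (simp add: sz_def)
lemma sz_Some [simp]: "sz (Some x) = Suc (sz x)" by (simp add: sz_def)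
lemma sz_nat [simp]: "sz (n::nat) = n" by (induction n) (auto simp: sz_def)
lemma sz_True [simp]: "sz True = 1" by (simp add: sz_def)
lemma sz_False [simp]: "sz False = 0" by (simp add: sz_def)
lemma sz_unit [simp]: "sz (u::unit) = 0" by (simp add: sz_def)
lemma sz_data [simp]: "sz (d::data) = size d" by (simp add: sz_def)
lemma sz_append [simp]: "sz (xs @ ys) = sz xs + sz ys" by (induction xs) auto
lemma size_code: "size (code a) = sz a" by (simp add: sz_def)

lemma sz_mem: "x \<in> set xs ==> sz x \<le> sz xs" by (induction xs) auto
lemma length_le_sz: "length xs \<le> sz xs" by (induction xs) auto
lemma code_eq_Leaf [simp]:
  "code (xs :: 'a :: code list) = Leaf \<longleftrightarrow> xs = []" "code (ob :: 'a option) = Leaf \<longleftrightarrow> ob = None"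
  "code (n :: nat) = Leaf \<longleftrightarrow> n = 0" "code b = Leaf \<longleftrightarrow> \<not> b"
  by (simp_all add: code_list_def code_option_def option_data_def code_nat_def num_data_def code_bool_def bit_data_def split: option.splits)

section \<open>Probabilistic computations that may abort\<close>

definition obind :: "'a option pmf => ('a => 'b option pmf) => 'b option pmf" where
  "obind m f = bind_pmf m (\<lambda>r. case r of None => return_pmf None | Some x => f x)"

lemma obind_return [simp]: "obind (return_pmf (Some x)) f = f x" "obind (return_pmf None) f = return_pmf None"
  by (simp_all add: obind_def bind_return_pmf)

lemma obind_Some [simp]: "obind m (\<lambda>x. return_pmf (Some x)) = m"
proof -
  have "(\<lambda>r. case r of None => return_pmf None | Some x => return_pmf (Some x)) = (return_pmf :: 'a option => _)"
    by (auto simp: fun_eq_iff split: option.splits)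
  then show ?thesis by (simp add: obind_def bind_return_pmf')
qed

lemma obind_assoc: "obind (obind m f) g = obind m (\<lambda>x. obind (f x) g)"
  unfolding obind_def bind_assoc_pmf
  by (rule bind_pmf_cong[OF refl]) (auto split: option.splits simp: bind_return_pmf)

lemma set_obind: "Some y \<in> set_pmf (obind m f) \<longleftrightarrow> (\<exists>x. Some x \<in> set_pmf m \<and> Some y \<in> set_pmf (f x))"
  by (force simp: obind_def split: option.splits)

lemma map_obind: "map_pmf (map_option h) (obind m f) = obind m (\<lambda>x. map_pmf (map_option h) (f x))"
  unfolding obind_def map_bind_pmf by (rule bind_pmf_cong[OF refl]) (auto split: option.splits)

lemma obind_map: "obind (map_pmf (map_option h) m) f = obind m (\<lambda>x. f (h x))"
  unfolding obind_def bind_map_pmf by (rule bind_pmf_cong[OF refl]) (auto split: option.splits)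

lemma obind_cong: "m = m' ==> (\<And>x. Some x \<in> set_pmf m' ==> f x = f' x) ==> obind m f = obind m' f'"
  unfolding obind_def by (rule bind_pmf_cong) (auto split: option.splits)

section \<open>Executions and their cost\<close>

inductive reach :: "'s env => 's config => 's config pmf => bool" for R where
  reach_refl: "reach R c (return_pmf c)"
| reach_step: "(\<And>c'. c' \<in> set_pmf (step R c) ==> reach R c' (\<kappa> c')) ==>
    reach R c (bind_pmf (step R c) \<kappa>)"

text \<open>\<open>reach\<close> relates a configuration to a distribution over later ones in which
  different branches may have made different numbers of steps. \<open>run\<close> counts steps
  uniformly, so its runs do not compose sequentially when the running time is random; those of
  \<open>reach\<close> do.\<close>

lemma reach_trans:
  "reach R c \<mu> ==> (\<And>c'. c' \<in> set_pmf \<mu> ==> reach R c' (\<kappa> c')) ==> reach R c (bind_pmf \<mu> \<kappa>)"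
proof (induction rule: reach.induct)
  case (reach_step c \<kappa>0)
  have "reach R c' (bind_pmf (\<kappa>0 c') \<kappa>)" if "c' \<in> set_pmf (step R c)" for c'
    by (rule reach_step.IH[OF that]) (use reach_step.prems that in \<open>force simp: set_bind_pmf\<close>)
  then show ?case unfolding bind_assoc_pmf by (rule reach.reach_step)
qed (simp add: bind_return_pmf)

lemma reach_step_return: "step R c = return_pmf c' ==> reach R c' \<mu> ==> reach R c \<mu>"
  using reach.reach_step[of R c "\<lambda>_. \<mu>"] by (simp add: bind_return_pmf)

abbreviation cfg_time :: "'s config => nat" where "cfg_time c \<equiv> snd (snd (snd c))"
abbreviation cfg_cmds :: "'s config => com list" where "cfg_cmds c \<equiv> fst c"

lemma step_time: "c' \<in> set_pmf (step R c) ==> cfg_cmds c \<noteq> [] ==> cfg_time c < cfg_time c'"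
  by (cases "(R, c)" rule: step.cases) (auto simp: Let_def split: option.splits prod.splits if_splits)

lemma step_halted [simp]: "cfg_cmds c = [] ==> step R c = return_pmf c"
  by (cases c) auto

lemma run_halted: assumes "cfg_cmds c = []" shows "run R t c = return_pmf c"
proof -
  obtain \<sigma> s u where c: "c = ([], \<sigma>, s, u)" using assms by (cases c) auto
  show ?thesis unfolding c by (induction t) (auto simp: bind_return_pmf)
qed

lemma reach_time: "reach R c \<mu> ==> c' \<in> set_pmf \<mu> ==> cfg_time c \<le> cfg_time c'"
proof (induction rule: reach.induct)
  case (reach_step c \<kappa>)
  then obtain c1 where c1: "c1 \<in> set_pmf (step R c)" "c' \<in> set_pmf (\<kappa> c1)" by auto
  then have "cfg_time c1 \<le> cfg_time c'" using reach_step by auto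
  then show ?case using step_time[OF c1(1)] step_halted[of c R] c1 by (cases "cfg_cmds c = []") auto
qed simp

text \<open>The way back to \<open>run\<close>. A halted configuration is a fixed point of
  \<open>step\<close>, and every other step takes at least one unit of time, so as many steps as
  units of time allowed lead to all end points.\<close>

lemma run_reach:
  "reach R c \<mu> ==> (\<And>c'. c' \<in> set_pmf \<mu> ==> cfg_cmds c' = [] \<and> cfg_time c' \<le> cfg_time c + t) ==>
    run R t c = \<mu>"
proof (induction arbitrary: t rule: reach.induct)
  case (reach_refl c)
  have "cfg_cmds c = []" using reach_refl[of c] by simp
  then show ?case by (rule run_halted)
next
  case (reach_step c \<kappa>)
  show ?case
  proof (cases "cfg_cmds c = []")
    case True
    note st = step_halted[OF True, of R]
    have "run R t c = \<kappa> c" by (rule reach_step.IH) (use reach_step.prems in \<open>simp_all add: st bind_return_pmf\<close>)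
    then show ?thesis by (simp add: st bind_return_pmf)
  next
    case False
    \<comment> \<open>Some end point lies strictly later than \<open>c\<close>, so the remaining
      allowance is positive.\<close>
    obtain c1 where c1: "c1 \<in> set_pmf (step R c)" using set_pmf_not_empty by fast
    obtain c2 where c2: "c2 \<in> set_pmf (\<kappa> c1)" using set_pmf_not_empty by fast
    have "cfg_time c < cfg_time c2"
      using step_time[OF c1 False] reach_time[OF reach_step(1)[OF c1] c2] by simp
    moreover have "cfg_time c2 \<le> cfg_time c + t" using reach_step.prems[of c2] c1 c2 by auto
    ultimately obtain t' where t: "t = Suc t'" by (cases t) auto
    have "run R t' c1 = \<kappa> c1" if c1: "c1 \<in> set_pmf (step R c)" for c1
    proof (rule reach_step.IH[OF c1])
      fix c' assume "c' \<in> set_pmf (\<kappa> c1)"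
      then have "c' \<in> set_pmf (bind_pmf (step R c) \<kappa>)" using c1 by auto
      from reach_step.prems[OF this] show "cfg_cmds c' = [] \<and> cfg_time c' \<le> cfg_time c1 + t'"
        using step_time[OF c1 False] t by auto
    qed
    then show ?thesis unfolding t by (auto intro: bind_pmf_cong)
  qed
qed

definition outc :: "'s config => (store \<times> 's) option" where
  "outc = (\<lambda>(cs, \<sigma>, s, u). map_option (Pair \<sigma>) s)"

text \<open>An illegal move empties the list of pending commands, so the continuation
  \<open>cs\<close> is left over only if the environment is alive.\<close>

definition fin :: "com list => nat => 's config => bool" where
  "fin cs T c \<longleftrightarrow> cfg_time c \<le> T \<and> cfg_cmds c = (if outc c = None then [] else cs)"

text \<open>The quantifiers over the pending commands and the starting time make the statement
  usable in every context: \<open>l\<close> is run to completion with whatever follows it still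
  pending.\<close>

definition exl :: "'s env => com list => store => 's => nat => (store \<times> 's) option pmf => bool" where
  "exl R l \<sigma> w N \<nu> \<longleftrightarrow>
     (\<forall>cs u. \<exists>\<mu>. reach R (l @ cs, \<sigma>, Some w, u) \<mu> \<and>
        (\<forall>c \<in> set_pmf \<mu>. fin cs (u + N) c) \<and> map_pmf outc \<mu> = \<nu>)"

lemma exl_Nil: "exl R [] \<sigma> w 0 (return_pmf (Some (\<sigma>, w)))"
  unfolding exl_def
proof (intro allI)
  fix cs u
  show "\<exists>\<mu>. reach R ([] @ cs, \<sigma>, Some w, u) \<mu> \<and> (\<forall>c \<in> set_pmf \<mu>. fin cs (u + 0) c) \<and> map_pmf outc \<mu> = return_pmf (Some (\<sigma>, w))"
    by (rule exI[of _ "return_pmf (cs, \<sigma>, Some w, u)"]) (auto simp: outc_def fin_def intro: reach_refl)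
qed

lemma exl_mono: "exl R l \<sigma> w N \<nu> ==> N \<le> N' ==> exl R l \<sigma> w N' \<nu>"
  unfolding exl_def fin_def by (meson add_left_mono order_trans)

text \<open>A branch that made an illegal move in the first part has no pending commands left and
  skips the second part; \<open>obind\<close> does the same to the outcome.\<close>

lemma exl_append:
  assumes "exl R l1 \<sigma> w N1 \<nu>1"
    and "\<And>\<sigma>' w'. Some (\<sigma>', w') \<in> set_pmf \<nu>1 ==> exl R l2 \<sigma>' w' N2 (\<kappa> (\<sigma>', w'))"
  shows "exl R (l1 @ l2) \<sigma> w (N1 + N2) (obind \<nu>1 \<kappa>)"
  unfolding exl_def
proof (intro allI)
  fix cs u
  obtain \<mu>1 where \<mu>1: "reach R (l1 @ l2 @ cs, \<sigma>, Some w, u) \<mu>1" "\<And>c. c \<in> set_pmf \<mu>1 ==> fin (l2 @ cs) (u + N1) c"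
      "map_pmf outc \<mu>1 = \<nu>1"
    using assms(1) unfolding exl_def by blast
  have "\<exists>\<mu>. reach R c \<mu> \<and> (\<forall>c' \<in> set_pmf \<mu>. fin cs (u + (N1 + N2)) c') \<and>
      map_pmf outc \<mu> = (case outc c of None => return_pmf None | Some x => \<kappa> x)" if c: "c \<in> set_pmf \<mu>1" for c
  proof -
    obtain cs' \<sigma>' s u' where ce: "c = (cs', \<sigma>', s, u')" by (cases c)
    note f = \<mu>1(2)[OF c, unfolded ce fin_def]
    show ?thesis
    proof (cases s)
      case None
      then show ?thesis using f ce
        by (intro exI[of _ "return_pmf c"]) (auto simp: outc_def fin_def intro: reach_refl)
    next
      case (Some w')
      have "outc c \<in> set_pmf \<nu>1" using c \<mu>1(3) by auto
      then have "Some (\<sigma>', w') \<in> set_pmf \<nu>1" using ce Some by (simp add: outc_def)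
      from assms(2)[OF this] obtain \<mu> where "reach R (l2 @ cs, \<sigma>', Some w', u') \<mu>"
        "\<And>c'. c' \<in> set_pmf \<mu> ==> fin cs (u' + N2) c'" "map_pmf outc \<mu> = \<kappa> (\<sigma>', w')"
        unfolding exl_def by blast
      moreover have "cs' = l2 @ cs" "u' \<le> u + N1" using f Some by (auto simp: outc_def)
      ultimately show ?thesis using ce Some by (intro exI[of _ \<mu>]) (fastforce simp: outc_def fin_def)
    qed
  qed
  then obtain K where K: "\<And>c. c \<in> set_pmf \<mu>1 ==> reach R c (K c)"
      "\<And>c c'. c \<in> set_pmf \<mu>1 ==> c' \<in> set_pmf (K c) ==> fin cs (u + (N1 + N2)) c'"
      "\<And>c. c \<in> set_pmf \<mu>1 ==> map_pmf outc (K c) = (case outc c of None => return_pmf None | Some x => \<kappa> x)"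
    by metis
  have "reach R ((l1 @ l2) @ cs, \<sigma>, Some w, u) (bind_pmf \<mu>1 K)"
    using reach_trans[OF \<mu>1(1) K(1)] by simp
  moreover have "\<forall>c \<in> set_pmf (bind_pmf \<mu>1 K). fin cs (u + (N1 + N2)) c" using K(2) by (auto simp only: set_bind_pmf UN_iff)
  moreover have "map_pmf outc (bind_pmf \<mu>1 K) = obind \<nu>1 \<kappa>"
    unfolding obind_def \<mu>1(3)[symmetric] map_bind_pmf bind_map_pmf by (rule bind_pmf_cong) (auto simp: K)
  ultimately show "\<exists>\<mu>. reach R ((l1 @ l2) @ cs, \<sigma>, Some w, u) \<mu> \<and> (\<forall>c \<in> set_pmf \<mu>. fin cs (u + (N1 + N2)) c) \<and> map_pmf outc \<mu> = obind \<nu>1 \<kappa>"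
    by blast
qed

lemma exl_step:
  assumes "\<And>cs u. step R (c # cs, \<sigma>, Some w, u) = return_pmf (l @ cs, \<sigma>', Some w, u + K)"
    and "exl R l \<sigma>' w N \<nu>"
  shows "exl R [c] \<sigma> w (N + K) \<nu>"
  unfolding exl_def
proof (intro allI)
  fix cs u
  obtain \<mu> where *: "reach R (l @ cs, \<sigma>', Some w, u + K) \<mu>"
    "\<forall>c \<in> set_pmf \<mu>. fin cs (u + K + N) c" "map_pmf outc \<mu> = \<nu>"
    using assms(2) unfolding exl_def by blast
  have "reach R ([c] @ cs, \<sigma>, Some w, u) \<mu>"
    using reach_step_return[OF assms(1) *(1)] by simp
  moreover have "u + (N + K) = u + K + N" by simp
  ultimately show "\<exists>\<mu>. reach R ([c] @ cs, \<sigma>, Some w, u) \<mu> \<and>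
      (\<forall>c \<in> set_pmf \<mu>. fin cs (u + (N + K)) c) \<and> map_pmf outc \<mu> = \<nu>"
    using *(2,3) by metis
qed

lemma exl_assign:
  "exl R [Assign x e] \<sigma> w (1 + size (denote \<sigma> e)) (return_pmf (Some (\<sigma>(x := denote \<sigma> e), w)))"
  using exl_step[OF _ exl_Nil, of R "Assign x e" \<sigma> w "\<sigma>(x := denote \<sigma> e)" "1 + size (denote \<sigma> e)"]
  by (simp add: Let_def)

lemma exl_seq: "exl R [c, c'] \<sigma> w N \<nu> ==> exl R [Seq c c'] \<sigma> w (N + 1) \<nu>"
  by (rule exl_step[where l = "[c, c']"]) auto

lemma exl_Seq:
  assumes "exl R [c1] \<sigma> w N1 \<nu>1"
    and "\<And>\<sigma>' w'. Some (\<sigma>', w') \<in> set_pmf \<nu>1 ==> exl R [c2] \<sigma>' w' N2 (\<kappa> (\<sigma>', w'))"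
  shows "exl R [Seq c1 c2] \<sigma> w (N1 + N2 + 1) (obind \<nu>1 \<kappa>)"
  using exl_seq[of R c1 c2] exl_append[OF assms] by simp

lemma exl_Cond:
  assumes "exl R [if data_bit (denote \<sigma> e) then c1 else c2] \<sigma> w N \<nu>"
  shows "exl R [Cond e c1 c2] \<sigma> w (N + 1) \<nu>"
  by (rule exl_step[OF _ assms]) simp

lemma exl_While_False:
  assumes "denote \<sigma> e = Leaf"
  shows "exl R [While e c] \<sigma> w 1 (return_pmf (Some (\<sigma>, w)))"
  using exl_step[OF _ exl_Nil, of R "While e c" \<sigma> w \<sigma> 1] assms by (simp add: data_bit_def)

text \<open>The common form of sampling and querying, the instructions with random results.
  \<open>T\<close> is the time charged for a result.\<close>

lemma exl_branch:
  fixes R :: "'s env" and \<nu> :: "(store \<times> 's) option pmf" and T :: "(store \<times> 's) option => nat"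
  assumes "\<And>cs u. step R (c # cs, \<sigma>, Some (w :: 's), u) = map_pmf (\<lambda>r. case r of
        None => ([], \<sigma>, None, u + T None) | Some (\<sigma>', w') => (cs, \<sigma>', Some w', u + T (Some (\<sigma>', w')))) \<nu>"
    and "\<And>r. r \<in> set_pmf \<nu> ==> T r \<le> N"
  shows "exl R [c] \<sigma> w N \<nu>"
  unfolding exl_def
proof (intro allI)
  fix cs :: "com list" and u
  let ?m = "map_pmf (\<lambda>r. case r of
        None => ([], \<sigma>, None, u + T None) | Some (\<sigma>', w') => (cs, \<sigma>', Some w', u + T (Some (\<sigma>', w')))) \<nu>"
  have "reach R ([c] @ cs, \<sigma>, Some w, u) ?m"
    using reach_step[of R "(c # cs, \<sigma>, Some w, u)" return_pmf] assms(1)[of cs u]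
    by (auto intro: reach_refl simp: bind_return_pmf')
  moreover have "map_pmf outc ?m = \<nu>"
    unfolding pmf.map_comp by (rule trans[OF map_pmf_cong[OF refl, where g = id]])
      (auto simp: outc_def split: option.splits)
  moreover have "\<forall>c \<in> set_pmf ?m. fin cs (u + N) c"
  proof
    fix c assume "c \<in> set_pmf ?m"
    then obtain r where r: "r \<in> set_pmf \<nu>" "c = (case r of
        None => ([], \<sigma>, None, u + T None) | Some (\<sigma>', w') => (cs, \<sigma>', Some w', u + T (Some (\<sigma>', w'))))"
      by (auto simp only: set_map_pmf image_iff)
    then show "fin cs (u + N) c" using assms(2)[OF r(1)] by (cases r) (auto simp: fin_def outc_def)
  qed
  ultimately show "\<exists>\<mu>. reach R ([c] @ cs, \<sigma>, Some w, u) \<mu> \<and>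
     (\<forall>c \<in> set_pmf \<mu>. fin cs (u + N) c) \<and> map_pmf outc \<mu> = \<nu>"
    by blast
qed

lemma exl_Sample:
  assumes "\<And>d. d \<in> set_pmf (pick (data_list (denote \<sigma> e))) ==> size d \<le> N"
  shows "exl R [Sample x e] \<sigma> w (1 + N)
    (map_pmf (\<lambda>d. Some (\<sigma>(x := d), w)) (pick (data_list (denote \<sigma> e))))"
  by (rule exl_branch[where T = "\<lambda>r. case r of None => 0 | Some (\<sigma>', w') => 1 + size (\<sigma>' x)"])
    (use assms in \<open>auto simp: pmf.map_comp o_def\<close>)

lemma exl_Query:
  assumes "\<And>a w'. Some (a, w') \<in> set_pmf (R w (denote \<sigma> e)) ==> size a \<le> N"
  shows "exl R [Query x e] \<sigma> w (1 + size (denote \<sigma> e) + N)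
    (map_pmf (map_option (\<lambda>(a, w'). (\<sigma>(x := a), w'))) (R w (denote \<sigma> e)))"
  by (rule exl_branch[where T = "\<lambda>r. case r of None => 1 + size (denote \<sigma> e)
        | Some (\<sigma>', w') => 1 + size (denote \<sigma> e) + size (\<sigma>' x)"])
    (use assms in \<open>auto simp: pmf.map_comp o_def Let_def option.case_distrib split: option.splits intro!: map_pmf_cong\<close>)

section \<open>Functions acting on an environment\<close>

type_synonym ('w, 'a) M = "'w => ('a \<times> 'w) option pmf"

definition ret :: "'a => ('w, 'a) M" where "ret x = (\<lambda>w. return_pmf (Some (x, w)))"

definition bnd :: "('w, 'a) M => ('a => ('w, 'b) M) => ('w, 'b) M" (infixl "\<then>" 54) where
  "bnd m f = (\<lambda>w. obind (m w) (\<lambda>(x, w'). f x w'))"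

lemma ret_bnd [simp]: "ret x \<then> f = f x" by (simp add: ret_def bnd_def)
lemma bnd_ret [simp]: "m \<then> ret = m" by (simp add: ret_def bnd_def split_def)
lemma bnd_assoc: "m \<then> f \<then> g = m \<then> (\<lambda>x. f x \<then> g)"
  by (simp add: bnd_def obind_assoc split_def)

lemma set_ret [simp]: "Some (y, w') \<in> set_pmf (ret x w) \<longleftrightarrow> y = x \<and> w' = w" by (auto simp: ret_def)
lemma set_bnd: "Some (y, w') \<in> set_pmf ((m \<then> f) w) \<longleftrightarrow>
    (\<exists>x w1. Some (x, w1) \<in> set_pmf (m w) \<and> Some (y, w') \<in> set_pmf (f x w1))"
  by (auto simp: bnd_def set_obind)

primrec foldM :: "('x => 'st => ('w, 'st) M) => 'x list => 'st => ('w, 'st) M" where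
  "foldM f [] st = ret st"
| "foldM f (x # xs) st = f x st \<then> foldM f xs"

text \<open>A while loop cut off after \<open>n\<close> rounds, which makes it a total function. It
  agrees with the loop once the guard is known to be false after \<open>n\<close> rounds.\<close>

primrec iterM :: "('s => bool) => ('s => ('w, 's) M) => nat => 's => ('w, 's) M" where
  "iterM g f 0 s = ret s"
| "iterM g f (Suc n) s = (if g s then f s \<then> iterM g f n else ret s)"

text \<open>\<open>kp\<close> is the part of the environment's state that enters the bounds, the
  security parameter in the application. It is constant during a run, so that one polynomial in
  \<open>kp\<close> and the size of the query bounds all answers. \<open>Inv\<close> excludes states
  with oversized secrets, such as keys outside the support of key generation.\<close>

locale machine =
  fixes R :: "'w env" and kp :: "'w => nat" and Inv :: "'w set" and rb :: "nat => nat"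
  assumes rb: "pmono rb"
    and R_inv: "w \<in> Inv ==> Some (a, w') \<in> set_pmf (R w d) ==>
      w' \<in> Inv \<and> kp w' = kp w \<and> size a \<le> rb (kp w + size d)"
begin

text \<open>The variables form a stack: the result goes to variable \<open>v\<close>, everything
  below \<open>v\<close> is preserved, and what lies above is scratch space. \<open>N\<close> bounds
  both the time and the size of the result, so that one number is passed on in compositions.\<close>

definition spec :: "nat => com => store => 'w => nat => ('b :: code \<times> 'w) option pmf => bool" where
  "spec v c \<sigma> w N F \<longleftrightarrow> (\<exists>\<nu>. exl R [c] \<sigma> w N \<nu> \<and>
     (\<forall>\<sigma>' w'. Some (\<sigma>', w') \<in> set_pmf \<nu> \<longrightarrow>
        (\<forall>x<v. \<sigma>' x = \<sigma> x) \<and> w' \<in> Inv \<and> kp w' = kp w \<and> size (\<sigma>' v) \<le> N) \<and>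
     map_pmf (map_option (\<lambda>(\<sigma>', w'). (\<sigma>' v, w'))) \<nu> = map_pmf (map_option (map_prod code id)) F)"

lemma spec_mono: "spec v c \<sigma> w N F ==> N \<le> N' ==> spec v c \<sigma> w N' F"
  unfolding spec_def by (meson exl_mono order_trans)

text \<open>Sequencing and unrolling a loop once differ only in the instruction \<open>D\<close>
  that starts them, hence the hypothesis \<open>comb\<close>. The second program is verified for
  every value that the first may leave in \<open>v1\<close>, given that the variables below are
  intact.\<close>

lemma spec_two:
  assumes "spec v1 c1 \<sigma> w N1 F" "v \<le> v1"
    and "\<And>b \<sigma>' w'. Some (b, w') \<in> set_pmf F ==> \<sigma>' v1 = code b ==> (\<And>x. x < v1 ==> \<sigma>' x = \<sigma> x) ==>
        w' \<in> Inv ==> kp w' = kp w ==> sz b \<le> N1 ==> spec v c2 \<sigma>' w' N2 (G b w')"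
    and comb: "\<And>\<nu>. exl R [c1, c2] \<sigma> w (N1 + N2) \<nu> ==> exl R [D] \<sigma> w (N1 + N2 + 1) \<nu>"
  shows "spec v D \<sigma> w (N1 + N2 + 1) (obind F (\<lambda>(b, w'). G b w'))"
proof -
  let ?P = "map_option (\<lambda>(\<sigma>' :: store, w' :: 'w). (\<sigma>' v, w'))" and ?P1 = "map_option (\<lambda>(\<sigma>' :: store, w' :: 'w). (\<sigma>' v1, w'))"
  obtain \<nu>1 where n1: "exl R [c1] \<sigma> w N1 \<nu>1"
     "\<And>\<sigma>' w'. Some (\<sigma>', w') \<in> set_pmf \<nu>1 ==> (\<forall>x<v1. \<sigma>' x = \<sigma> x) \<and> w' \<in> Inv \<and> kp w' = kp w \<and> size (\<sigma>' v1) \<le> N1"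
     "map_pmf ?P1 \<nu>1 = map_pmf (map_option (map_prod code id)) F"
    using assms(1) unfolding spec_def by blast
  have ex_b: "\<exists>b. \<sigma>' v1 = code b \<and> Some (b, w') \<in> set_pmf F" if "Some (\<sigma>', w') \<in> set_pmf \<nu>1" for \<sigma>' w'
  proof -
    have "?P1 (Some (\<sigma>', w')) \<in> set_pmf (map_pmf (map_option (map_prod code id)) F)"
      unfolding n1(3)[symmetric] using that by (intro pmf.set_map[THEN equalityD2, THEN subsetD] imageI)
    then show ?thesis by (auto simp: map_option_case split: option.splits)
  qed
  \<comment> \<open>The second program is specified for values, but the outcome of the first is a
    store; \<open>decode\<close> reads the value off variable \<open>v1\<close>.\<close>
  define Q where "Q p \<nu>2 \<longleftrightarrow> exl R [c2] (fst p) (snd p) N2 \<nu>2 \<and>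
     (\<forall>\<sigma>' w'. Some (\<sigma>', w') \<in> set_pmf \<nu>2 \<longrightarrow>
        (\<forall>x<v. \<sigma>' x = fst p x) \<and> w' \<in> Inv \<and> kp w' = kp (snd p) \<and> size (\<sigma>' v) \<le> N2) \<and>
     map_pmf ?P \<nu>2 = map_pmf (map_option (map_prod code id)) (G (decode (fst p v1)) (snd p))" for p \<nu>2
  have "\<exists>\<nu>2. Q p \<nu>2"
    if p1: "Some p \<in> set_pmf \<nu>1" for p
  proof -
    obtain \<sigma>' w' where p: "p = (\<sigma>', w')" by (cases p)
    obtain b where b: "\<sigma>' v1 = code b" "Some (b, w') \<in> set_pmf F" using ex_b[OF p1[unfolded p]] by blast
    have "spec v c2 \<sigma>' w' N2 (G b w')"
      by (rule assms(3)[OF b(2), of \<sigma>', OF b(1)]) (use n1(2)[OF p1[unfolded p]] b(1) in \<open>auto simp: sz_def\<close>)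
    then show ?thesis unfolding Q_def spec_def p fst_conv snd_conv b(1) decode_code .
  qed
  then obtain K where KQ: "\<And>p. Some p \<in> set_pmf \<nu>1 ==> Q p (K p)" by metis
  then have K: "\<And>p. Some p \<in> set_pmf \<nu>1 ==> exl R [c2] (fst p) (snd p) N2 (K p)"
    "\<And>p \<sigma>' w'. Some p \<in> set_pmf \<nu>1 ==> Some (\<sigma>', w') \<in> set_pmf (K p) ==>
        (\<forall>x<v. \<sigma>' x = fst p x) \<and> w' \<in> Inv \<and> kp w' = kp (snd p) \<and> size (\<sigma>' v) \<le> N2"
    "\<And>p. Some p \<in> set_pmf \<nu>1 ==> map_pmf ?P (K p) = map_pmf (map_option (map_prod code id)) (G (decode (fst p v1)) (snd p))"
    unfolding Q_def by blast+
  have "exl R ([c1] @ [c2]) \<sigma> w (N1 + N2) (obind \<nu>1 K)"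
    by (rule exl_append[OF n1(1)]) (use K(1) in force)
  then have "exl R [D] \<sigma> w (N1 + N2 + 1) (obind \<nu>1 K)" by (intro comb) simp
  moreover have "(\<forall>x<v. \<sigma>' x = \<sigma> x) \<and> w' \<in> Inv \<and> kp w' = kp w \<and> size (\<sigma>' v) \<le> N1 + N2 + 1"
    if "Some (\<sigma>', w') \<in> set_pmf (obind \<nu>1 K)" for \<sigma>' w'
  proof -
    from that obtain p where p: "Some p \<in> set_pmf \<nu>1" "Some (\<sigma>', w') \<in> set_pmf (K p)" by (auto simp: set_obind)
    show ?thesis using K(2)[OF p] n1(2)[of "fst p" "snd p"] p(1) assms(2) by simp
  qed
  moreover have "map_pmf ?P (obind \<nu>1 K) = map_pmf (map_option (map_prod code id)) (obind F (\<lambda>(b, w'). G b w'))"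
  proof -
    have "map_pmf ?P (obind \<nu>1 K) = obind \<nu>1 (\<lambda>p. map_pmf (map_option (map_prod code id)) (G (decode (fst p v1)) (snd p)))"
      unfolding map_obind by (rule obind_cong) (auto simp: K(3))
    also have "\<dots> = obind (map_pmf ?P1 \<nu>1) (\<lambda>p. map_pmf (map_option (map_prod code id)) (G (decode (fst p)) (snd p)))"
      by (simp add: obind_map split_def)
    also have "\<dots> = map_pmf (map_option (map_prod code id)) (obind F (\<lambda>(b, w'). G b w'))"
      unfolding n1(3) obind_map map_obind by (simp add: split_def)
    finally show ?thesis .
  qed
  ultimately show ?thesis unfolding spec_def by blast
qed

lemmas spec_Seq = spec_two[OF _ _ _ exl_seq]

lemma exl_while: "denote \<sigma> e \<noteq> Leaf ==> exl R [c, While e c] \<sigma> w N \<nu> ==> exl R [While e c] \<sigma> w (N + 1) \<nu>"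
  by (rule exl_step[where l = "[c, While e c]"]) (auto simp: data_bit_def)

lemmas spec_While_True = spec_two[OF _ _ _ exl_while]

lemma spec_While_False:
  assumes "w \<in> Inv" "denote \<sigma> e = Leaf" "\<sigma> v = code b"
  shows "spec v (While e c) \<sigma> w (1 + sz b) (return_pmf (Some (b, w)))"
  unfolding spec_def using exl_mono[OF exl_While_False[OF assms(2), of R c w]] assms(1,3)
  by (intro exI[of _ "return_pmf (Some (\<sigma>, w))"]) (auto simp: sz_def)

lemma spec_Cond:
  assumes "spec v (if data_bit (denote \<sigma> e) then c1 else c2) \<sigma> w N F"
  shows "spec v (Cond e c1 c2) \<sigma> w (N + 1) F"
proof -
  obtain \<nu> where "exl R [if data_bit (denote \<sigma> e) then c1 else c2] \<sigma> w N \<nu>"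
     "\<And>\<sigma>' w'. Some (\<sigma>', w') \<in> set_pmf \<nu> ==> (\<forall>x<v. \<sigma>' x = \<sigma> x) \<and> w' \<in> Inv \<and> kp w' = kp w \<and> size (\<sigma>' v) \<le> N"
     "map_pmf (map_option (\<lambda>(\<sigma>', w'). (\<sigma>' v, w'))) \<nu> = map_pmf (map_option (map_prod code id)) F"
    using assms unfolding spec_def by blast
  then show ?thesis unfolding spec_def
    by (intro exI[of _ \<nu>] conjI exl_Cond allI impI) (auto intro: le_SucI)
qed

lemma spec_Assign:
  assumes "w \<in> Inv" "denote \<sigma> e = code b"
  shows "spec v (Assign v e) \<sigma> w (1 + sz b) (return_pmf (Some (b, w)))"
  unfolding spec_def using exl_assign[of R v e \<sigma> w] assms
  by (intro exI[of _ "return_pmf (Some (\<sigma>(v := denote \<sigma> e), w))"]) (auto simp: sz_def)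

lemma spec_Assign_Seq:
  assumes "w \<in> Inv" "x \<ge> v" "spec v c (\<sigma>(x := denote \<sigma> e)) w N F"
  shows "spec v (Seq (Assign x e) c) \<sigma> w (N + size (denote \<sigma> e) + 2) F"
proof -
  obtain \<nu> where n: "exl R [c] (\<sigma>(x := denote \<sigma> e)) w N \<nu>"
     "\<And>\<sigma>' w'. Some (\<sigma>', w') \<in> set_pmf \<nu> ==> (\<forall>y<v. \<sigma>' y = (\<sigma>(x := denote \<sigma> e)) y) \<and> w' \<in> Inv \<and> kp w' = kp w \<and> size (\<sigma>' v) \<le> N"
     "map_pmf (map_option (\<lambda>(\<sigma>', w'). (\<sigma>' v, w'))) \<nu> = map_pmf (map_option (map_prod code id)) F"
    using assms(3) unfolding spec_def by blast
  have "exl R [Seq (Assign x e) c] \<sigma> w (1 + size (denote \<sigma> e) + N + 1) (obind (return_pmf (Some (\<sigma>(x := denote \<sigma> e), w))) (\<lambda>_. \<nu>))"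
    by (rule exl_Seq[OF exl_assign]) (use n in simp)
  then have "exl R [Seq (Assign x e) c] \<sigma> w (N + size (denote \<sigma> e) + 2) \<nu>" by (simp add: add.commute add.left_commute)
  then show ?thesis unfolding spec_def using n(2,3) assms(2)
    by (intro exI[of _ \<nu>]) (fastforce)
qed

text \<open>A program is required for every base \<open>v\<close> of the stack, since a subprogram
  must be placed above the values that its caller still needs.\<close>

definition ptm :: "('a :: code => ('w, 'b :: code) M) => bool" where
  "ptm f \<longleftrightarrow> (\<forall>v. \<exists>c g. pmono g \<and>
     (\<forall>w\<in>Inv. \<forall>\<sigma> a. \<sigma> v = code a \<longrightarrow> spec v c \<sigma> w (g (kp w + sz a)) (f a w)))"

abbreviation pt :: "('a :: code => 'b :: code) => bool" where "pt f \<equiv> ptm (\<lambda>a. ret (f a))"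

lemma ptmE:
  assumes "ptm f"
  obtains c g where "pmono g" "\<And>w \<sigma> a. w \<in> Inv ==> \<sigma> v = code a ==> spec v c \<sigma> w (g (kp w + sz a)) (f a w)"
  using assms unfolding ptm_def by metis

lemma spec_result:
  assumes "spec v c \<sigma> w N F" "Some (b, w') \<in> set_pmf F"
  shows "w' \<in> Inv \<and> kp w' = kp w \<and> sz b \<le> N"
proof -
  obtain \<nu> where n: "\<And>\<sigma>' w'. Some (\<sigma>', w') \<in> set_pmf \<nu> ==> w' \<in> Inv \<and> kp w' = kp w \<and> size (\<sigma>' v) \<le> N"
     "map_pmf (map_option (\<lambda>(\<sigma>', w'). (\<sigma>' v, w'))) \<nu> = map_pmf (map_option (map_prod code id)) F"
    using assms(1) unfolding spec_def by blast
  have "map_option (map_prod code id) (Some (b, w')) \<in> set_pmf (map_pmf (map_option (\<lambda>(\<sigma>', w'). (\<sigma>' v, w'))) \<nu>)"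
    unfolding n(2) using assms(2) by (intro pmf.set_map[THEN equalityD2, THEN subsetD] imageI)
  then obtain \<sigma>' where "Some (\<sigma>', w') \<in> set_pmf \<nu>" "\<sigma>' v = code b" by (auto simp: map_option_case split: option.splits)
  then show ?thesis using n(1)[of \<sigma>' w'] by (auto simp: sz_def)
qed

lemma ptm_result:
  assumes "ptm f"
  obtains g where "pmono g" "\<And>w a b w'. w \<in> Inv ==> Some (b, w') \<in> set_pmf (f a w) ==>
      w' \<in> Inv \<and> kp w' = kp w \<and> sz b \<le> g (kp w + sz a)"
proof -
  obtain c g where cg: "pmono g" "\<And>w \<sigma> a. w \<in> Inv ==> \<sigma> 0 = code a ==> spec 0 c \<sigma> w (g (kp w + sz a)) (f a w)"
    by (rule ptmE[OF assms, where v = 0]) blast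
  show ?thesis
  proof (rule that[OF cg(1)])
    fix w a b w' assume "w \<in> Inv" "Some (b, w') \<in> set_pmf (f a w)"
    then show "w' \<in> Inv \<and> kp w' = kp w \<and> sz b \<le> g (kp w + sz a)"
      by (intro spec_result[OF cg(2)[of w "\<lambda>_. code a" a]]) auto
  qed
qed

lemma pt_result:
  assumes "pt f"
  obtains g where "pmono g" "\<And>w a. w \<in> Inv ==> sz (f a) \<le> g (kp w + sz a)"
proof -
  obtain g where g: "pmono g" "\<And>w a b w'. w \<in> Inv ==> Some (b, w') \<in> set_pmf (ret (f a) w) ==>
      w' \<in> Inv \<and> kp w' = kp w \<and> sz b \<le> g (kp w + sz a)" by (rule ptm_result[OF assms]) blast
  show ?thesis by (rule that[OF g(1)]) (use g(2) in simp)
qed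

text \<open>A program sees only codes. A function computed on one type is therefore computed on
  another type with the same codes, as for numbers and lists of units, or trees and lists of
  trees.\<close>

lemma ptm_transfer:
  fixes f' :: "'c :: code => ('w, 'd :: code) M"
  assumes "ptm f" "\<And>a'. code (r a') = code a'"
    and "\<And>a' w. w \<in> Inv ==> map_pmf (map_option (map_prod code id)) (f' a' w) = map_pmf (map_option (map_prod code id)) (f (r a') w)"
  shows "ptm f'"
  unfolding ptm_def
proof
  fix v
  obtain c g where cg: "pmono g" "\<And>w \<sigma> a. w \<in> Inv ==> \<sigma> v = code a ==> spec v c \<sigma> w (g (kp w + sz a)) (f a w)"
    by (rule ptmE[OF assms(1), where v = v]) blast
  show "\<exists>c g. pmono g \<and> (\<forall>w\<in>Inv. \<forall>\<sigma> a. \<sigma> v = code a \<longrightarrow> spec v c \<sigma> w (g (kp w + sz a)) (f' a w))"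
  proof (intro exI[of _ c] exI[of _ g] conjI cg(1) ballI allI impI)
    fix w \<sigma> and a :: 'c assume "w \<in> Inv" "\<sigma> v = code a"
    then show "spec v c \<sigma> w (g (kp w + sz a)) (f' a w)"
      using cg(2)[of w \<sigma> "r a"] assms(2)[of a] assms(3)[of w a] by (auto simp: spec_def sz_def)
  qed
qed

lemma pt_transfer:
  assumes "pt f" "\<And>a'. code (r a') = code a'" "\<And>a'. code (f' a') = code (f (r a'))"
  shows "pt f'"
  by (rule ptm_transfer[OF assms(1,2)]) (auto simp: ret_def assms(3))

section \<open>Closure under expressions, pairing, composition and case distinction\<close>

lemma pt_expr:
  assumes e: "\<And>v \<sigma> a. \<sigma> v = code a ==> denote \<sigma> (E v) = code (f a)"
    and "pmono g" "\<And>a. sz (f a) \<le> g (sz a)"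
  shows "pt f"
  unfolding ptm_def
proof
  fix v
  have "spec v (Assign v (E v)) \<sigma> w (1 + g (kp w + sz a)) (ret (f a) w)" if "w \<in> Inv" "\<sigma> v = code a" for \<sigma> w a
    unfolding ret_def by (rule spec_mono[OF spec_Assign[OF that(1) e[of \<sigma> v a, OF that(2)]]])
      (use assms(3)[of a] pmono_monoD[OF assms(2), of "sz a" "kp w + sz a"] in simp)
  then show "\<exists>c g. pmono g \<and> (\<forall>w\<in>Inv. \<forall>\<sigma> a. \<sigma> v = code a \<longrightarrow> spec v c \<sigma> w (g (kp w + sz a)) (ret (f a) w))"
    using pmono_add[OF pmono_const[of 1] assms(2)] by blast
qed

lemma pt_id: "pt (\<lambda>a. a)"
  by (rule pt_expr[where g = "\<lambda>x. x" and E = Var]) (auto intro: pmono_id)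

lemma ex_const_expr: "\<exists>e. \<forall>\<sigma>. denote \<sigma> e = d"
proof (induction d)
  case Leaf
  then show ?case by (intro exI[of _ Lf]) simp
next
  case (Node d1 d2)
  then show ?case by (metis denote.simps(3))
qed

lemma pt_const: "pt (\<lambda>_. c)"
proof -
  obtain e where "\<And>\<sigma>. denote \<sigma> e = code c" using ex_const_expr by blast
  then show ?thesis by (intro pt_expr[where g = "\<lambda>_. sz c" and E = "\<lambda>_. e"]) (auto intro: pmono_const)
qed

lemma pt_expr_le:
  assumes "\<And>v \<sigma> a. \<sigma> v = code a ==> denote \<sigma> (E v) = code (f a)" "\<And>a. sz (f a) \<le> sz a + K"
  shows "pt f"
  using assms by (intro pt_expr[where g = "\<lambda>x. x + K" and E = E]) (auto intro: pmono_intros)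

lemma pt_fst0: "pt fst"
  by (rule pt_expr_le[where E = "\<lambda>v. Fst (Var v)"]) (auto simp: code_prod_def sz_def)

lemma pt_snd0: "pt snd"
  by (rule pt_expr_le[where E = "\<lambda>v. Snd (Var v)"]) (auto simp: code_prod_def sz_def)

text \<open>The argument is copied to \<open>v + 1\<close> and \<open>f\<close> is run on the copy;
  then variable \<open>v\<close> is replaced by the pair of argument and result. As \<open>g\<close>
  receives the argument too, nothing is lost along a sequence of bindings, and functions of several
  variables become functions of nested pairs.\<close>

lemma ptm_pair:
  assumes "ptm f" "ptm (\<lambda>p. g (fst p) (snd p))"
  shows "ptm (\<lambda>a. f a \<then> g a)"
  unfolding ptm_def
proof
  fix v
  obtain c1 g1 where c1: "pmono g1" "\<And>w \<sigma> a. w \<in> Inv ==> \<sigma> (v+1) = code a ==> spec (v+1) c1 \<sigma> w (g1 (kp w + sz a)) (f a w)"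
    by (rule ptmE[OF assms(1), where v = "v + 1"]) blast
  obtain c2 g2 where c2: "pmono g2" "\<And>w \<sigma> p. w \<in> Inv ==> \<sigma> v = code p ==> spec v c2 \<sigma> w (g2 (kp w + sz p)) (g (fst p) (snd p) w)"
    by (rule ptmE[OF assms(2), where v = v]) blast
  define N2 where "N2 = (\<lambda>x. g2 (x + (g1 x + 1)))"
  define N where "N = (\<lambda>x. g1 x + (N2 x + (x + g1 x + 1) + 2) + 1 + x + 2)"
  have "spec v (Seq (Assign (v+1) (Var v)) (Seq c1 (Seq (Assign v (Nd (Var v) (Var (v+1)))) c2))) \<sigma> w (N (kp w + sz a)) ((f a \<then> g a) w)"
    if w: "w \<in> Inv" and s: "\<sigma> v = code a" for w \<sigma> a
  proof -
    let ?x = "kp w + sz a"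
    have "spec v (Seq c1 (Seq (Assign v (Nd (Var v) (Var (v+1)))) c2)) (\<sigma>(v+1 := code a)) w
        (g1 ?x + (N2 ?x + (?x + g1 ?x + 1) + 2) + 1) (obind (f a w) (\<lambda>(b, w'). g a b w'))"
    proof (rule spec_Seq[OF c1(2)[OF w]])
      fix b \<sigma>' w' assume *: "Some (b, w') \<in> set_pmf (f a w)" "\<sigma>' (v+1) = code b" "\<And>x. x < v+1 ==> \<sigma>' x = (\<sigma>(v+1 := code a)) x"
        "w' \<in> Inv" "kp w' = kp w" "sz b \<le> g1 ?x"
      have v: "\<sigma>' v = code a" using *(3)[of v] s by simp
      have "spec v c2 (\<sigma>'(v := code (a, b))) w' (g2 (kp w' + sz (a, b))) (g (fst (a,b)) (snd (a,b)) w')"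
        by (rule c2(2)[OF *(4)]) simp
      then have "spec v c2 (\<sigma>'(v := denote \<sigma>' (Nd (Var v) (Var (v+1))))) w' (g2 (kp w' + sz (a, b))) (g a b w')"
        using v *(2) by simp
      from spec_Assign_Seq[OF *(4) order_refl this]
      have "spec v (Seq (Assign v (Nd (Var v) (Var (v+1)))) c2) \<sigma>' w'
          (g2 (kp w' + sz (a, b)) + sz (a, b) + 2) (g a b w')" using v *(2) by (simp add: sz_def)
      then show "spec v (Seq (Assign v (Nd (Var v) (Var (v+1)))) c2) \<sigma>' w' (N2 ?x + (?x + g1 ?x + 1) + 2) (g a b w')"
        by (rule spec_mono) (use *(5,6) pmono_monoD[OF c2(1), of "kp w + sz (a,b)" "?x + (g1 ?x + 1)"] in \<open>simp add: N2_def\<close>)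
    qed simp_all
    then have "spec v (Seq c1 (Seq (Assign v (Nd (Var v) (Var (v+1)))) c2)) (\<sigma>(v+1 := denote \<sigma> (Var v))) w
        (g1 ?x + (N2 ?x + (?x + g1 ?x + 1) + 2) + 1) ((f a \<then> g a) w)" using s by (simp add: bnd_def)
    from spec_Assign_Seq[OF w _ this] show ?thesis
      by (rule spec_mono) (use s in \<open>simp_all add: N_def sz_def\<close>)
  qed
  moreover have "pmono N" unfolding N_def N2_def by (intro pmono_intros pmono_comp[OF c2(1)] c1(1))
  ultimately show "\<exists>c g'. pmono g' \<and> (\<forall>w\<in>Inv. \<forall>\<sigma> a. \<sigma> v = code a \<longrightarrow> spec v c \<sigma> w (g' (kp w + sz a)) ((f a \<then> g a) w))"
    by blast
qed

lemma ptm_comp: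
  assumes "ptm h" "pt f"
  shows "ptm (\<lambda>a. h (f a))"
  unfolding ptm_def
proof
  fix v
  obtain c1 g1 where c1: "pmono g1" "\<And>w \<sigma> a. w \<in> Inv ==> \<sigma> v = code a ==> spec v c1 \<sigma> w (g1 (kp w + sz a)) (ret (f a) w)"
    by (rule ptmE[OF assms(2), where v = v]) blast
  obtain c2 g2 where c2: "pmono g2" "\<And>w \<sigma> p. w \<in> Inv ==> \<sigma> v = code p ==> spec v c2 \<sigma> w (g2 (kp w + sz p)) (h p w)"
    by (rule ptmE[OF assms(1), where v = v]) blast
  have "spec v (Seq c1 c2) \<sigma> w (g1 (kp w + sz a) + g2 ((kp w + sz a) + g1 (kp w + sz a)) + 1) (h (f a) w)"
    if w: "w \<in> Inv" and s: "\<sigma> v = code a" for w \<sigma> a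
  proof -
    have "spec v (Seq c1 c2) \<sigma> w (g1 (kp w + sz a) + g2 ((kp w + sz a) + g1 (kp w + sz a)) + 1) (obind (ret (f a) w) (\<lambda>(b, w'). h b w'))"
    proof (rule spec_Seq[OF c1(2)[OF w, of \<sigma> a, OF s] order_refl])
      fix b \<sigma>' w' assume *: "Some (b, w') \<in> set_pmf (ret (f a) w)" "\<sigma>' v = code b" "w' \<in> Inv" "kp w' = kp w" "sz b \<le> g1 (kp w + sz a)"
      show "spec v c2 \<sigma>' w' (g2 ((kp w + sz a) + g1 (kp w + sz a))) (h b w')"
        by (rule spec_mono[OF c2(2)[OF *(3), of \<sigma>' b, OF *(2)] pmono_monoD[OF c2(1)]]) (use *(4,5) in simp)
    qed
    then show ?thesis by (simp add: ret_def)
  qed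
  moreover have "pmono (\<lambda>x. g1 x + g2 (x + g1 x) + 1)" by (intro pmono_intros pmono_comp[OF c2(1)] c1(1))
  ultimately show "\<exists>c g'. pmono g' \<and> (\<forall>w\<in>Inv. \<forall>\<sigma> a. \<sigma> v = code a \<longrightarrow> spec v c \<sigma> w (g' (kp w + sz a)) (h (f a) w))"
    by blast
qed

lemma pt_Pair:
  assumes "pt f" "pt g" shows "pt (\<lambda>a. (f a, g a))"
proof -
  have "ptm (\<lambda>a. ret (f a) \<then> (\<lambda>b. ret (g a) \<then> (\<lambda>c. ret (b, c))))"
  proof (rule ptm_pair[OF assms(1)], rule ptm_pair)
    show "pt (\<lambda>p. g (fst p))" by (rule ptm_comp[OF assms(2) pt_fst0])
    show "pt (\<lambda>p. (snd (fst p), snd p))"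
      by (rule pt_expr_le[where E = "\<lambda>v. Nd (Snd (Fst (Var v))) (Snd (Var v))"]) (auto simp: code_prod_def sz_def)
  qed
  then show ?thesis by simp
qed

lemma pt_fst: "pt f ==> pt (\<lambda>a. fst (f a))" by (rule ptm_comp[OF pt_fst0])
lemma pt_snd: "pt f ==> pt (\<lambda>a. snd (f a))" by (rule ptm_comp[OF pt_snd0])

lemma pt_eq: assumes "pt f" "pt g" shows "pt (\<lambda>a. f a = g a)"
proof -
  have "pt (\<lambda>p. fst p = snd p)"
    by (rule pt_expr[where E = "\<lambda>v. Eq (Fst (Var v)) (Snd (Var v))" and g = "\<lambda>_. 1"])
       (auto simp: code_prod_def sz_def code_bool_def bit_data_def intro: pmono_const)
  from ptm_comp[OF this pt_Pair[OF assms]] show ?thesis by simp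
qed

text \<open>The expression \<open>E\<close> has to denote \<open>r a\<close> only when the test
  succeeds. This is how the case distinctions below take apart an option or a list: \<open>r\<close>
  strips the constructor whose presence was tested.\<close>

lemma ptm_if_expr:
  fixes b :: "'a :: code => bool" and r :: "'a => 'c :: code" and h :: "'c => ('w, 'b :: code) M"
  assumes b: "pt b" and h: "ptm h" and f: "ptm f"
    and e: "\<And>v \<sigma> a. \<sigma> v = code a ==> b a ==> denote \<sigma> (E v) = code (r a)" and r: "\<And>a. b a ==> sz (r a) \<le> sz a"
  shows "ptm (\<lambda>a. if b a then h (r a) else f a)"
  unfolding ptm_def
proof
  fix v
  obtain c1 g1 where c1: "pmono g1" "\<And>w \<sigma> a. w \<in> Inv ==> \<sigma> (v+1) = code a ==> spec (v+1) c1 \<sigma> w (g1 (kp w + sz a)) (ret (b a) w)"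
    by (rule ptmE[OF b, where v = "v+1"]) blast
  obtain c2 g2 where c2: "pmono g2" "\<And>w \<sigma> p. w \<in> Inv ==> \<sigma> v = code p ==> spec v c2 \<sigma> w (g2 (kp w + sz p)) (h p w)"
    by (rule ptmE[OF h, where v = v]) blast
  obtain c3 g3 where c3: "pmono g3" "\<And>w \<sigma> p. w \<in> Inv ==> \<sigma> v = code p ==> spec v c3 \<sigma> w (g3 (kp w + sz p)) (f p w)"
    by (rule ptmE[OF f, where v = v]) blast
  let ?P = "Seq (Assign (v+1) (Var v)) (Seq c1 (Cond (Var (v+1)) (Seq (Assign v (E v)) c2) c3))"
  define N where "N = (\<lambda>x. (g1 x + (g2 x + x + 2 + g3 x + 1) + 1) + x + 2)"
  have "spec v ?P \<sigma> w (N (kp w + sz a)) ((if b a then h (r a) else f a) w)"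
    if w: "w \<in> Inv" and s: "\<sigma> v = code a" for w \<sigma> a
  proof -
    let ?x = "kp w + sz a"
    have "spec v (Seq c1 (Cond (Var (v+1)) (Seq (Assign v (E v)) c2) c3)) (\<sigma>(v+1 := code a)) w
        (g1 ?x + (g2 ?x + ?x + 2 + g3 ?x + 1) + 1) (obind (ret (b a) w) (\<lambda>(y, w'). if y then h (r a) w' else f a w'))"
    proof (rule spec_Seq[OF c1(2)[OF w]])
      fix y \<sigma>' w' assume *: "Some (y, w') \<in> set_pmf (ret (b a) w)" "\<sigma>' (v+1) = code y" "\<And>x. x < v+1 ==> \<sigma>' x = (\<sigma>(v+1 := code a)) x"
        "w' \<in> Inv" "kp w' = kp w"
      have y: "y = b a" using *(1) by simp
      have v: "\<sigma>' v = code a" using *(3)[of v] s by simp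
      have "spec v (if data_bit (denote \<sigma>' (Var (v+1))) then Seq (Assign v (E v)) c2 else c3) \<sigma>' w' (g2 ?x + ?x + 2 + g3 ?x) (if y then h (r a) w' else f a w')"
      proof (cases "b a")
        case True
        note ev = e[of \<sigma>' v a, OF v True]
        have "spec v c2 (\<sigma>'(v := denote \<sigma>' (E v))) w' (g2 (kp w' + sz (r a))) (h (r a) w')"
          by (rule c2(2)[OF *(4)]) (simp add: ev)
        from spec_Assign_Seq[OF *(4) order_refl this]
        have "spec v (Seq (Assign v (E v)) c2) \<sigma>' w' (g2 ?x + ?x + 2 + g3 ?x) (h (r a) w')"
          by (rule spec_mono) (use pmono_monoD[OF c2(1), of "kp w' + sz (r a)" ?x] *(5) r[OF True] in \<open>simp add: ev size_code\<close>)
        then show ?thesis using True y *(2) by (simp add: data_bit_def)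
      next
        case False
        have "spec v c3 \<sigma>' w' (g2 ?x + ?x + 2 + g3 ?x) (f a w')"
          by (rule spec_mono[OF c3(2)[OF *(4), of \<sigma>' a, OF v]]) (use *(5) in simp)
        then show ?thesis using False y *(2) by (simp add: data_bit_def)
      qed
      then show "spec v (Cond (Var (v+1)) (Seq (Assign v (E v)) c2) c3) \<sigma>' w' (g2 ?x + ?x + 2 + g3 ?x + 1) (if y then h (r a) w' else f a w')"
        by (rule spec_Cond)
    qed simp_all
    then have "spec v (Seq c1 (Cond (Var (v+1)) (Seq (Assign v (E v)) c2) c3)) (\<sigma>(v+1 := denote \<sigma> (Var v))) w
        (g1 ?x + (g2 ?x + ?x + 2 + g3 ?x + 1) + 1) ((if b a then h (r a) else f a) w)" using s by (cases "b a") (simp_all add: ret_def)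
    from spec_Assign_Seq[OF w _ this] show ?thesis
      by (rule spec_mono) (use s in \<open>simp_all add: N_def sz_def\<close>)
  qed
  moreover have "pmono N" unfolding N_def by (intro pmono_intros c1(1) c2(1) c3(1))
  ultimately show "\<exists>c g'. pmono g' \<and> (\<forall>w\<in>Inv. \<forall>\<sigma> a. \<sigma> v = code a \<longrightarrow> spec v c \<sigma> w (g' (kp w + sz a)) ((if b a then h (r a) else f a) w))"
    by blast
qed

lemma ptm_if: "pt b ==> ptm h ==> ptm f ==> ptm (\<lambda>a. if b a then h a else f a)"
  by (rule ptm_if_expr[where E = Var and r = "\<lambda>a. a"]) auto

lemma pt_if: assumes "pt b" "pt h" "pt f" shows "pt (\<lambda>a. if b a then h a else f a)"
  using ptm_if[OF assms] by (simp add: if_distrib cong: if_cong)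

lemma pt_cong: "pt f ==> (\<And>a. f a = g a) ==> pt g" by simp

lemma pt_not: "pt b ==> pt (\<lambda>a. \<not> b a)"
  by (rule pt_cong[OF pt_if[OF _ pt_const[of False] pt_const[of True]]]) auto
lemma pt_conj: "pt b ==> pt c ==> pt (\<lambda>a. b a \<and> c a)"
  by (rule pt_cong[OF pt_if[of b c "\<lambda>_. False"]]) (auto intro: pt_const)
lemma pt_disj: "pt b ==> pt c ==> pt (\<lambda>a. b a \<or> c a)"
  by (rule pt_cong[OF pt_if[of b "\<lambda>_. True" c]]) (auto intro: pt_const)

lemma ptm_case_option:
  assumes "pt ob" "ptm f" "ptm (\<lambda>p. g (fst p) (snd p))"
  shows "ptm (\<lambda>a. case ob a of None => f a | Some x => g a x)"
proof -
  have "ptm (\<lambda>p. if \<not> snd p = None then (\<lambda>q. g (fst q) (snd q)) (fst p, the (snd p)) else f (fst p))"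
    by (rule ptm_if_expr[where E = "\<lambda>v. Nd (Fst (Var v)) (Snd (Snd (Var v)))", OF pt_not[OF pt_eq[OF pt_snd0 pt_const]] assms(3) ptm_comp[OF assms(2) pt_fst0]])
       (auto simp: code_prod_def sz_def)
  from ptm_comp[OF this pt_Pair[OF pt_id assms(1)]] show ?thesis
    by (rule back_subst[where P = ptm]) (rule ext, simp split: option.splits)
qed

lemma pt_case_option:
  assumes "pt ob" "pt f" "pt (\<lambda>p. g (fst p) (snd p))"
  shows "pt (\<lambda>a. case ob a of None => f a | Some x => g a x)"
  using ptm_case_option[OF assms(1,2), of "\<lambda>a x. ret (g a x)", OF assms(3)]
  by (rule back_subst[where P = ptm]) (rule ext, simp split: option.splits)

lemma ptm_case_list:
  assumes "pt l" "ptm f" "ptm (\<lambda>p. g (fst (fst p)) (snd (fst p)) (snd p))"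
  shows "ptm (\<lambda>a. case l a of [] => f a | x # xs => g a x xs)"
proof -
  have "ptm (\<lambda>p. if \<not> snd p = [] then (\<lambda>q. g (fst (fst q)) (snd (fst q)) (snd q)) ((fst p, hd (snd p)), tl (snd p)) else f (fst p))"
    by (rule ptm_if_expr[where E = "\<lambda>v. Nd (Nd (Fst (Var v)) (Fst (Snd (Var v)))) (Snd (Snd (Var v)))", OF pt_not[OF pt_eq[OF pt_snd0 pt_const]] assms(3) ptm_comp[OF assms(2) pt_fst0]])
       (auto simp: code_prod_def sz_def neq_Nil_conv)
  from ptm_comp[OF this pt_Pair[OF pt_id assms(1)]] show ?thesis
    by (rule back_subst[where P = ptm]) (rule ext, simp split: list.splits)
qed

lemma pt_case_list:
  assumes "pt l" "pt f" "pt (\<lambda>p. g (fst (fst p)) (snd (fst p)) (snd p))"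
  shows "pt (\<lambda>a. case l a of [] => f a | x # xs => g a x xs)"
  using ptm_case_list[OF assms(1,2), of "\<lambda>a x xs. ret (g a x xs)", OF assms(3)]
  by (rule back_subst[where P = ptm]) (rule ext, simp split: list.splits)

end

section \<open>Bounded loops and folds\<close>

context machine begin

text \<open>The guard of a loop is an expression, while \<open>g\<close> is an arbitrary computed
  function. The loop variable therefore holds the pair of the guard's value and the state, and the
  body computes the next guard along with the next state.\<close>

lemma spec_iter:
  fixes f :: "'s :: code => ('w, 's) M"
  assumes gc: "pmono gc" and
    c: "\<And>w \<sigma> b s. w \<in> Inv ==> \<sigma> v = code (b :: bool, s) ==>
      spec v c \<sigma> w (gc (kp w + sz (b, s))) ((f s \<then> (\<lambda>s'. ret (g s', s'))) w)"
  shows "w \<in> Inv ==> kp w = k ==> \<sigma> v = code (g s, s) ==>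
    (\<And>m s' w'. m \<le> n ==> Some (s', w') \<in> set_pmf (iterM g f m s w) ==> sz s' \<le> S) ==>
    (\<And>s' w'. Some (s', w') \<in> set_pmf (iterM g f n s w) ==> \<not> g s') ==>
    spec v (While (Fst (Var v)) c) \<sigma> w (S + 3 + n * (gc (k + S + 2) + 1)) ((iterM g f n s \<then> (\<lambda>s'. ret (g s', s'))) w)"
proof (induction n arbitrary: \<sigma> s w)
  case 0
  have ng: "\<not> g s" using 0(5)[of s w] by simp
  have sS: "sz s \<le> S" using 0(4)[of 0 s w] by simp
  have sp: "spec v (While (Fst (Var v)) c) \<sigma> w (1 + sz (g s, s)) (return_pmf (Some ((g s, s), w)))"
    by (rule spec_While_False) (use 0 ng in auto)
  have eq: "(iterM g f 0 s \<then> (\<lambda>s'. ret (g s', s'))) w = return_pmf (Some ((g s, s), w))" unfolding iterM.simps ret_bnd by (simp add: ret_def)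
  show ?case unfolding eq by (rule spec_mono[OF sp]) (use sS ng in simp)
next
  case (Suc n)
  have sS: "sz s \<le> S" using Suc.prems(4)[of 0 s w] by simp
  show ?case
  proof (cases "g s")
    case False
    have sp: "spec v (While (Fst (Var v)) c) \<sigma> w (1 + sz (g s, s)) (return_pmf (Some ((g s, s), w)))"
      by (rule spec_While_False) (use Suc.prems False in auto)
    have eq: "(iterM g f (Suc n) s \<then> (\<lambda>s'. ret (g s', s'))) w = return_pmf (Some ((g s, s), w))"
      using False unfolding iterM.simps by (simp only: if_False ret_bnd) (simp add: ret_def)
    show ?thesis unfolding eq by (rule spec_mono[OF sp]) (use sS False in simp)
  next
    case True
    have szp: "sz (g s, s) \<le> S + 2" using sS True by simp
    have "spec v c \<sigma> w (gc (k + S + 2)) ((f s \<then> (\<lambda>s'. ret (g s', s'))) w)"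
      by (rule spec_mono[OF c[OF Suc.prems(1), of \<sigma> "g s" s, OF Suc.prems(3)] pmono_monoD[OF gc]]) (use szp Suc.prems(2) in simp)
    then have sp: "spec v (While (Fst (Var v)) c) \<sigma> w (gc (k + S + 2) + (S + 3 + n * (gc (k + S + 2) + 1)) + 1)
        (obind ((f s \<then> (\<lambda>s'. ret (g s', s'))) w) (\<lambda>(p, w'). (iterM g f n (snd p) \<then> (\<lambda>s'. ret (g s', s'))) w'))"
    proof (rule spec_While_True[OF _ order_refl])
      fix p \<sigma>' w' assume *: "Some (p, w') \<in> set_pmf ((f s \<then> (\<lambda>s'. ret (g s', s'))) w)" "\<sigma>' v = code p" "w' \<in> Inv" "kp w' = kp w"
      obtain s1 where s1: "Some (s1, w') \<in> set_pmf (f s w)" "p = (g s1, s1)" using *(1) by (auto simp: set_bnd)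
      show "spec v (While (Fst (Var v)) c) \<sigma>' w' (S + 3 + n * (gc (k + S + 2) + 1)) ((iterM g f n (snd p) \<then> (\<lambda>s'. ret (g s', s'))) w')"
        unfolding s1(2) snd_conv
      proof (rule Suc.IH[OF *(3)])
        show "kp w' = k" using *(4) Suc.prems(2) by simp
        show "\<sigma>' v = code (g s1, s1)" using *(2) s1(2) by simp
        show "sz s' \<le> S" if "m \<le> n" "Some (s', w'') \<in> set_pmf (iterM g f m s1 w')" for m s' w''
          using Suc.prems(4)[of "Suc m" s' w''] that s1(1) True by (auto simp: set_bnd)
        show "\<not> g s'" if "Some (s', w'') \<in> set_pmf (iterM g f n s1 w')" for s' w''
          using Suc.prems(5)[of s' w''] that s1(1) True by (auto simp: set_bnd)
      qed
    qed (use Suc.prems True in auto)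
    have eq: "(iterM g f (Suc n) s \<then> (\<lambda>s'. ret (g s', s'))) w =
        obind ((f s \<then> (\<lambda>s'. ret (g s', s'))) w) (\<lambda>(p, w'). (iterM g f n (snd p) \<then> (\<lambda>s'. ret (g s', s'))) w')"
      using True by (simp add: bnd_def ret_def obind_assoc split_def)
    show ?thesis unfolding eq by (rule spec_mono[OF sp]) simp
  qed
qed

text \<open>Polynomially many rounds of a polynomial-time body need not be polynomial, since the
  state may grow in each of them. Hence the hypothesis that all intermediate states are bounded in
  terms of the input; the total time is then the number of rounds times the cost at that
  size.\<close>

lemma ptm_iter:
  fixes f :: "'s :: code => ('w, 's) M" and i :: "'a :: code => 's"
  assumes f: "ptm f" and g: "pt g" and i: "pt i" and h: "pmono h"
    and N: "\<And>w a. w \<in> Inv ==> N a \<le> h (kp w + sz a)"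
    and S: "\<And>w a m s' w'. w \<in> Inv ==> m \<le> N a ==> Some (s', w') \<in> set_pmf (iterM g f m (i a) w) ==> sz s' \<le> h (kp w + sz a)"
    and stop: "\<And>w a s' w'. w \<in> Inv ==> Some (s', w') \<in> set_pmf (iterM g f (N a) (i a) w) ==> \<not> g s'"
  shows "ptm (\<lambda>a. iterM g f (N a) (i a))"
proof -
  have body: "ptm (\<lambda>p :: bool \<times> 's. f (snd p) \<then> (\<lambda>s'. ret (g s', s')))"
    by (intro ptm_pair ptm_comp[OF f] pt_snd0 pt_Pair ptm_comp[OF g])
  have init: "pt (\<lambda>a. (g (i a), i a))" by (intro pt_Pair ptm_comp[OF g] i)
  have "ptm (\<lambda>a. iterM g f (N a) (i a) \<then> (\<lambda>s'. ret (g s', s')))"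
    unfolding ptm_def
  proof
    fix v
    obtain c1 g1 where c1: "pmono g1" "\<And>w \<sigma> a. w \<in> Inv ==> \<sigma> v = code a ==> spec v c1 \<sigma> w (g1 (kp w + sz a)) (ret (g (i a), i a) w)"
      by (rule ptmE[OF init, where v = v]) blast
    obtain c gc where c: "pmono gc" "\<And>w \<sigma> (p :: bool \<times> 's). w \<in> Inv ==> \<sigma> v = code p ==> spec v c \<sigma> w (gc (kp w + sz p)) ((f (snd p) \<then> (\<lambda>s'. ret (g s', s'))) w)"
      by (rule ptmE[OF body, where v = v]) blast
    let ?T = "\<lambda>x. h x + 3 + h x * (gc (x + h x + 2) + 1)"
    have "spec v (Seq c1 (While (Fst (Var v)) c)) \<sigma> w (g1 (kp w + sz a) + ?T (kp w + sz a) + 1) ((iterM g f (N a) (i a) \<then> (\<lambda>s'. ret (g s', s'))) w)"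
      if w: "w \<in> Inv" and s: "\<sigma> v = code a" for w \<sigma> and a :: 'a
    proof -
      let ?x = "kp w + sz a"
      have "spec v (Seq c1 (While (Fst (Var v)) c)) \<sigma> w (g1 ?x + ?T ?x + 1)
          (obind (ret (g (i a), i a) w) (\<lambda>(p, w'). (iterM g f (N a) (snd p) \<then> (\<lambda>s'. ret (g s', s'))) w'))"
      proof (rule spec_Seq[OF c1(2)[OF w, of \<sigma> a, OF s] order_refl])
        fix p \<sigma>' w' assume *: "Some (p, w') \<in> set_pmf (ret (g (i a), i a) w)" "\<sigma>' v = code p" "w' \<in> Inv" "kp w' = kp w"
        have p: "p = (g (i a), i a)" "w' = w" using *(1) by simp_all
        have "spec v (While (Fst (Var v)) c) \<sigma>' w (h ?x + 3 + N a * (gc (kp w + h ?x + 2) + 1)) ((iterM g f (N a) (i a) \<then> (\<lambda>s'. ret (g s', s'))) w)"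
        proof (rule spec_iter[OF c(1)])
          show "spec v c \<sigma> w (gc (kp w + sz (b, s))) ((f s \<then> (\<lambda>s'. ret (g s', s'))) w)"
            if "w \<in> Inv" "\<sigma> v = code (b, s)" for w \<sigma> s and b :: bool using c(2)[OF that(1), of \<sigma> "(b, s)", OF that(2)] by simp
          show "sz s' \<le> h ?x" if "m \<le> N a" "Some (s', w') \<in> set_pmf (iterM g f m (i a) w)" for m s' w'
            using S[OF w that] .
          show "\<not> g s'" if "Some (s', w') \<in> set_pmf (iterM g f (N a) (i a) w)" for s' w' using stop[OF w that] .
        qed (use w *(2) p in auto)
        then show "spec v (While (Fst (Var v)) c) \<sigma>' w' (?T ?x) ((iterM g f (N a) (snd p) \<then> (\<lambda>s'. ret (g s', s'))) w')"
          unfolding p snd_conv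
        proof (rule spec_mono)
          have "gc (kp w + h ?x + 2) \<le> gc (?x + h ?x + 2)" by (rule pmono_monoD[OF c(1)]) simp
          then have "N a * (gc (kp w + h ?x + 2) + 1) \<le> h ?x * (gc (?x + h ?x + 2) + 1)"
            by (intro mult_le_mono N[OF w]) simp
          then show "h ?x + 3 + N a * (gc (kp w + h ?x + 2) + 1) \<le> ?T ?x" by simp
        qed
      qed
      then show ?thesis by (simp add: ret_def)
    qed
    moreover have "pmono (\<lambda>x. g1 x + ?T x + 1)" by (intro pmono_intros pmono_comp[OF c(1)] h c1(1))
    ultimately show "\<exists>c g'. pmono g' \<and> (\<forall>w\<in>Inv. \<forall>\<sigma> a. \<sigma> v = code a \<longrightarrow>
        spec v c \<sigma> w (g' (kp w + sz a)) ((iterM g f (N a) (i a) \<then> (\<lambda>s'. ret (g s', s'))) w))" by blast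
  qed
  then have "ptm (\<lambda>a. (iterM g f (N a) (i a) \<then> (\<lambda>s'. ret (g s', s'))) \<then> (\<lambda>p. ret (snd p)))"
    by (rule ptm_pair) (intro pt_snd pt_snd0)
  then show ?thesis by (simp add: bnd_assoc)
qed

lemma foldM_iterM:
  "length xs \<le> n ==> iterM (\<lambda>s. fst (snd s) \<noteq> [])
     (\<lambda>s. case fst (snd s) of [] => ret s | x # xs' => f (fst s) x (snd (snd s)) \<then> (\<lambda>st'. ret (fst s, xs', st'))) n (a, xs, st) =
   foldM (f a) xs st \<then> (\<lambda>st'. ret (a, [], st'))"
  by (induction n arbitrary: xs st; case_tac xs) (auto simp: bnd_assoc)

text \<open>The growth per round may depend on the argument and the entry, but not on the
  accumulator; this excludes repeated doubling. \<open>J\<close> is an invariant for growth bounds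
  that hold only on well-formed accumulators.\<close>

lemma ptm_foldM:
  fixes f :: "'a :: code => 'x :: code => 'st :: code => ('w, 'st) M"
  assumes l: "pt l" and i: "pt i" and f: "ptm (\<lambda>p. f (fst (fst p)) (snd (fst p)) (snd p))" and G: "pmono G"
    and J0: "\<And>a. J a (i a)"
    and grow: "\<And>a x st w st' w'. w \<in> Inv ==> J a st ==> x \<in> set (l a) ==> Some (st', w') \<in> set_pmf (f a x st w) ==>
        J a st' \<and> sz st' \<le> sz st + G (kp w + sz a + sz x)"
  shows "ptm (\<lambda>a. foldM (f a) (l a) (i a))"
proof -
  let ?g = "\<lambda>s :: 'a \<times> 'x list \<times> 'st. fst (snd s) \<noteq> []"
  let ?f = "\<lambda>s. case fst (snd s) of [] => ret s | x # xs' => f (fst s) x (snd (snd s)) \<then> (\<lambda>st'. ret (fst s, xs', st'))"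
  have f': "ptm (\<lambda>p. f (F p) (X p) (T p))" if "pt F" "pt X" "pt T" for F :: "'p :: code => 'a" and X T
    using ptm_comp[OF f pt_Pair[OF pt_Pair[OF that(1,2)] that(3)]] by simp
  have pf: "ptm ?f"
    by (intro ptm_case_list ptm_pair f' pt_Pair pt_fst pt_snd pt_id)
  have pg: "pt ?g" by (intro pt_not pt_eq pt_fst pt_snd pt_id pt_const)
  obtain gl where gl: "pmono gl" "\<And>w a. w \<in> Inv ==> sz (l a) \<le> gl (kp w + sz a)" by (rule pt_result[OF l]) blast
  obtain gi where gi: "pmono gi" "\<And>w a. w \<in> Inv ==> sz (i a) \<le> gi (kp w + sz a)" by (rule pt_result[OF i]) blast
  obtain gf where gf: "pmono gf" "\<And>w p b w'. w \<in> Inv ==> Some (b, w') \<in> set_pmf (f (fst (fst p)) (snd (fst p)) (snd p) w) ==>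
      w' \<in> Inv \<and> kp w' = kp w \<and> sz b \<le> gf (kp w + sz p)" by (rule ptm_result[OF f]) blast
  have bound: "sz s' \<le> sz a + sz xs + sz st + 2 + length xs * G (k + sz a + Z)"
    if "m \<le> length xs" "Some (s', w') \<in> set_pmf (iterM ?g ?f m (a, xs, st) w)" "w \<in> Inv" "kp w = k" "set xs \<subseteq> set (l a)"
      "J a st" "Z \<ge> sz (l a)" for m a xs st w s' w' k Z
    using that
  proof (induction m arbitrary: xs st w)
    case 0
    then show ?case by auto
  next
    case (Suc m)
    then obtain x xs' where xs: "xs = x # xs'" by (cases xs) auto
    from Suc.prems(2) obtain st1 w1 where 1: "Some (st1, w1) \<in> set_pmf (f a x st w)"
      "Some (s', w') \<in> set_pmf (iterM ?g ?f m (a, xs', st1) w1)" unfolding xs by (auto simp: set_bnd)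
    have 2: "w1 \<in> Inv \<and> kp w1 = kp w" using gf(2)[of w st1 w1 "((a, x), st)"] 1(1) Suc.prems by auto
    have 3: "J a st1 \<and> sz st1 \<le> sz st + G (kp w + sz a + sz x)" using grow[OF Suc.prems(3,6) _ 1(1)] Suc.prems(5) xs by simp
    have "sz x \<le> Z" using sz_mem[of x "l a"] Suc.prems(5,7) xs by simp
    then have "G (kp w + sz a + sz x) \<le> G (k + sz a + Z)" using Suc.prems(4) by (intro pmono_monoD[OF G]) simp
    moreover have "sz s' \<le> sz a + sz xs' + sz st1 + 2 + length xs' * G (k + sz a + Z)"
      by (rule Suc.IH[OF _ 1(2)]) (use Suc.prems 2 3 xs in auto)
    ultimately show ?case using 3 xs by simp
  qed
  \<comment> \<open>One polynomial that dominates both the number of rounds and the size of every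
    state, which consists of the argument, the remaining list and the accumulator.\<close>
  let ?h = "\<lambda>x. (gl x + 1) * (x + gl x + gi x + 2 + G (x + gl x))"
  have "ptm (\<lambda>a. iterM ?g ?f (length (l a)) (a, l a, i a))"
  proof (rule ptm_iter[OF pf pg, where h = ?h])
    show "pt (\<lambda>a. (a, l a, i a))" by (intro pt_Pair pt_id l i)
    show "pmono ?h" by (intro pmono_intros gl gi pmono_comp[OF G])
    show "length (l a) \<le> ?h (kp w + sz a)" if "w \<in> Inv" for w a
      using length_le_sz[of "l a"] gl(2)[OF that, of a] by (auto simp: algebra_simps)
    show "sz s' \<le> ?h (kp w + sz a)" if "w \<in> Inv" "m \<le> length (l a)" "Some (s', w') \<in> set_pmf (iterM ?g ?f m (a, l a, i a) w)" for w a m s' w'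
    proof -
      let ?x = "kp w + sz a"
      have "sz s' \<le> sz a + sz (l a) + sz (i a) + 2 + length (l a) * G (kp w + sz a + gl ?x)"
        by (rule bound[OF that(2,3,1) refl order_refl J0 gl(2)[OF that(1)]])
      also have "\<dots> \<le> ?x + gl ?x + gi ?x + 2 + gl ?x * G (?x + gl ?x)"
        using gl(2)[OF that(1), of a] gi(2)[OF that(1), of a] length_le_sz[of "l a"]
        by (intro add_mono mult_le_mono) auto
      also have "\<dots> \<le> ?h ?x" by (simp add: algebra_simps)
      finally show ?thesis .
    qed
    show "\<not> ?g s'" if "w \<in> Inv" "Some (s', w') \<in> set_pmf (iterM ?g ?f (length (l a)) (a, l a, i a) w)" for w a s' w'
      using that(2) by (auto simp: foldM_iterM set_bnd)
  qed
  then have "ptm (\<lambda>a. iterM ?g ?f (length (l a)) (a, l a, i a) \<then> (\<lambda>s. ret (snd (snd s))))"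
    by (rule ptm_pair) (intro pt_snd pt_snd0)
  then show ?thesis by (simp add: foldM_iterM bnd_assoc)
qed

lemma foldM_ret: "foldM (\<lambda>x st. ret (f x st)) xs st = ret (fold f xs st)"
  by (induction xs arbitrary: st) auto

lemma pt_fold:
  fixes f :: "'a :: code => 'x :: code => 'st :: code => 'st"
  assumes l: "pt l" and i: "pt i" and f: "pt (\<lambda>p. f (fst (fst p)) (snd (fst p)) (snd p))"
    and J0: "\<And>a. J a (i a)"
    and grow: "\<And>a x st. J a st ==> x \<in> set (l a) ==> J a (f a x st) \<and> sz (f a x st) \<le> sz st + G (sz a + sz x)"
    and G: "pmono G"
  shows "pt (\<lambda>a. fold (f a) (l a) (i a))"
proof -
  have "ptm (\<lambda>a. foldM (\<lambda>x st. ret (f a x st)) (l a) (i a))"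
  proof (rule ptm_foldM[OF l i f G, where J = J])
    fix a x st st' and w w' :: 'w assume "J a st" "x \<in> set (l a)" "Some (st', w') \<in> set_pmf (ret (f a x st) w)"
    then show "J a st' \<and> sz st' \<le> sz st + G (kp w + sz a + sz x)"
      using grow[of a st x] pmono_monoD[OF G, of "sz a + sz x" "kp w + sz a + sz x"] by fastforce
  qed (rule J0)
  then show ?thesis by (simp add: foldM_ret)
qed

end

section \<open>A library of list and number functions\<close>

lemma sz_map_le: "(\<And>x. x \<in> set xs ==> sz (f x) \<le> B) ==> sz (map f xs) \<le> length xs * (B + 1)"
  by (induction xs) (auto intro: order_trans add_mono)

lemma sz_rev [simp]: "sz (rev xs) = sz xs" by (induction xs) auto

lemma sz_replicate [simp]: "sz (replicate n x) = n * Suc (sz x)" by (induction n) auto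

lemma sz_filter: "sz (filter P xs) \<le> sz xs" by (induction xs) auto

lemma code_nat_units: "code (n :: nat) = code (replicate n ())" by (induction n) auto

lemma code_data_list: "code (ds :: data list) = list_data ds"
  by (induction ds) auto

text \<open>List access with a default value, hence specified at every index, as the function
  computed by a program must be.\<close>

primrec nthd :: "'x => 'x list => nat => 'x" where
  "nthd d [] i = d"
| "nthd d (x # xs) i = (case i of 0 => x | Suc j => nthd d xs j)"

lemma nthd_eq: "i < length xs ==> nthd d xs i = xs ! i"
  by (induction xs arbitrary: i) (auto simp: nth_Cons split: nat.splits)

lemma size_left_right: "size (left d) \<le> size d" "size (right d) \<le> size d"
  by (cases d; simp)+

context machine begin

lemmas pt_intros0 = pt_id pt_const pt_Pair pt_fst pt_snd pt_eq pt_not pt_conj pt_disj pt_if pt_case_option pt_case_list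

lemma pt_Cons: assumes "pt x" "pt l" shows "pt (\<lambda>a. x a # l a)"
proof -
  have "pt (\<lambda>p. fst p # snd p)"
    by (rule pt_expr_le[where E = "\<lambda>v. Var v"]) (auto simp: code_prod_def sz_def)
  from ptm_comp[OF this pt_Pair[OF assms]] show ?thesis by simp
qed

lemma pt_Some: assumes "pt f" shows "pt (\<lambda>a. Some (f a))"
proof -
  have "pt Some" by (rule pt_expr_le[where E = "\<lambda>v. Nd Lf (Var v)" and K = 1]) (auto simp: sz_def)
  from ptm_comp[OF this assms] show ?thesis .
qed

lemma pt_tl: assumes "pt l" shows "pt (\<lambda>a. tl (l a))"
  by (rule pt_cong[OF pt_case_list[OF assms pt_const[of "[]"], of "\<lambda>_ _ xs. xs"]])
    (auto intro: pt_intros0 split: list.splits)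

lemma pt_Suc: assumes "pt f" shows "pt (\<lambda>a. Suc (f a))"
proof -
  have "pt Suc" by (rule pt_expr_le[where E = "\<lambda>v. Nd Lf (Var v)" and K = 1]) auto
  from ptm_comp[OF this assms] show ?thesis .
qed

text \<open>Numbers are coded in unary, so a number and the list of that many units have the same
  code; arithmetic becomes list processing.\<close>

lemma pt_nat_units: assumes "pt f" shows "pt (\<lambda>a. replicate (f a :: nat) ())"
  by (rule pt_transfer[OF assms refl]) (simp add: code_nat_units)

lemma pt_units_nat: assumes "pt f" shows "pt (\<lambda>a. length (f a :: unit list))"
  by (rule pt_transfer[OF assms refl]) (simp add: code_nat_units replicate_length_same)

lemma pt_pred: assumes "pt f" shows "pt (\<lambda>a. f a - Suc 0)"
  by (rule pt_cong[OF pt_units_nat[OF pt_tl[OF pt_nat_units[OF assms]]]]) simp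

lemma pt_left: assumes "pt f" shows "pt (\<lambda>a. left (f a))"
proof -
  have "pt left"
    by (rule pt_expr_le[where E = "\<lambda>v. Fst (Var v)" and K = 0]) (auto simp: size_left_right)
  from ptm_comp[OF this assms] show ?thesis .
qed

lemma pt_right: assumes "pt f" shows "pt (\<lambda>a. right (f a))"
proof -
  have "pt right"
    by (rule pt_expr_le[where E = "\<lambda>v. Snd (Var v)" and K = 0]) (auto simp: size_left_right)
  from ptm_comp[OF this assms] show ?thesis .
qed

lemma pt_Node: assumes "pt f" "pt g" shows "pt (\<lambda>a. Node (f a) (g a))"
  by (rule pt_transfer[OF pt_Pair[OF assms] refl]) simp

lemma pt_code: "pt f ==> pt (\<lambda>a. code (f a))"
  by (rule pt_transfer[of f "\<lambda>a. a"]) simp_all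

lemma pt_data_list: "pt f ==> pt (\<lambda>a. data_list (f a))"
  by (rule pt_transfer[of f "\<lambda>a. a"]) (simp_all add: code_data_list)

lemma pt_list_data: "pt f ==> pt (\<lambda>a. list_data (f a))"
  by (rule pt_transfer[of f "\<lambda>a. a"]) (simp_all add: code_data_list)

lemma pt_data_bit: "pt f ==> pt (\<lambda>a. data_bit (f a))"
  unfolding data_bit_def by (intro pt_intros0)

lemma pt_rev: assumes "pt l" shows "pt (\<lambda>a. rev (l a))"
proof -
  have "pt (\<lambda>a. fold (\<lambda>x st. x # st) (l a) [])"
    by (rule pt_fold[OF assms pt_const, where J = "\<lambda>_ _. True" and G = "\<lambda>x. x + 1"])
      (auto intro!: pmono_intros pt_Cons pt_intros0)
  then show ?thesis by (simp add: fold_Cons_rev cong: )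
qed

lemma pt_append: assumes "pt l" "pt r" shows "pt (\<lambda>a. l a @ r a)"
proof -
  have "pt (\<lambda>a. fold (\<lambda>x st. x # st) (rev (l a)) (r a))"
    by (rule pt_fold[OF pt_rev[OF assms(1)] assms(2), where J = "\<lambda>_ _. True" and G = "\<lambda>x. x + 1"])
      (auto intro!: pmono_intros pt_Cons pt_intros0)
  then show ?thesis by (simp add: fold_Cons_rev)
qed

text \<open>The size of each new entry is bounded independently of the accumulator, so appending it
  meets the growth condition of \<open>ptm_foldM\<close>.\<close>

lemma ptm_mapM:
  assumes l: "pt l" and f: "ptm (\<lambda>p. f (fst p) (snd p))"
  shows "ptm (\<lambda>a. foldM (\<lambda>x acc. f a x \<then> (\<lambda>y. ret (acc @ [y]))) (l a) [])"
proof -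
  obtain g where g: "pmono g" "\<And>w p b w'. w \<in> Inv ==> Some (b, w') \<in> set_pmf (f (fst p) (snd p) w) ==>
      w' \<in> Inv \<and> kp w' = kp w \<and> sz b \<le> g (kp w + sz p)" by (rule ptm_result[OF f]) blast
  have f': "ptm (\<lambda>p. f (F p) (X p))" if "pt F" "pt X" for F :: "'p :: code => _" and X
    using ptm_comp[OF f pt_Pair[OF that]] by simp
  show ?thesis
  proof (rule ptm_foldM[OF l pt_const, where J = "\<lambda>_ _. True" and G = "\<lambda>x. g (x + 1) + 1"])
    show "ptm (\<lambda>p. f (fst (fst p)) (snd (fst p)) \<then> (\<lambda>y. ret (snd p @ [y])))"
      by (intro ptm_pair f' pt_append pt_Cons pt_intros0)
    show "pmono (\<lambda>x. g (x + 1) + 1)" by (intro pmono_intros pmono_comp[OF g(1)])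
    fix a x st st' and w w' :: 'w
    assume "w \<in> Inv" "Some (st', w') \<in> set_pmf ((f a x \<then> (\<lambda>y. ret (st @ [y]))) w)"
    then show "True \<and> sz st' \<le> sz st + (g (kp w + sz a + sz x + 1) + 1)"
      using g(2)[of w _ _ "(a, x)"] by (fastforce simp: set_bnd add.assoc)
  qed simp
qed

lemma foldM_map: "foldM (\<lambda>x acc. ret (f x) \<then> (\<lambda>y. ret (acc @ [y]))) xs acc = ret (acc @ map f xs)"
  by (induction xs arbitrary: acc) auto

lemma pt_map: assumes "pt l" "pt (\<lambda>p. f (fst p) (snd p))" shows "pt (\<lambda>a. map (f a) (l a))"
  using ptm_mapM[OF assms(1), of "\<lambda>a x. ret (f a x)", OF assms(2)]
  by (simp only: foldM_map append_Nil)

lemma pt_concat: assumes "pt l" shows "pt (\<lambda>a. concat (l a))"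
proof -
  have eq: "fold (\<lambda>x st. st @ x) xs acc = acc @ concat xs" for xs acc by (induction xs arbitrary: acc) auto
  have "pt (\<lambda>a. fold (\<lambda>x st. st @ x) (l a) [])"
    by (rule pt_fold[OF assms pt_const, where J = "\<lambda>_ _. True" and G = "\<lambda>x. x"])
      (auto intro!: pmono_intros pt_append pt_intros0)
  then show ?thesis by (simp add: eq)
qed

lemma pt_filter: assumes "pt l" "pt (\<lambda>p. P (fst p) (snd p))" shows "pt (\<lambda>a. filter (P a) (l a))"
proof -
  have eq: "concat (map (\<lambda>x. if P a x then [x] else []) xs) = filter (P a) xs" for a xs by (induction xs) auto
  have "pt (\<lambda>a. concat (map (\<lambda>x. if P a x then [x] else []) (l a)))"
    by (intro pt_concat pt_map assms pt_if pt_Cons pt_intros0)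
  then show ?thesis by (simp add: eq)
qed

lemma pt_length: assumes "pt l" shows "pt (\<lambda>a. length (l a))"
  by (rule pt_cong[OF pt_units_nat[OF pt_map[OF assms pt_const[of "()"]]]]) simp

lemma pt_null: "pt l ==> pt (\<lambda>a. l a = [])" by (intro pt_intros0)

lemma pt_ball: assumes "pt l" "pt (\<lambda>p. P (fst p) (snd p))" shows "pt (\<lambda>a. \<forall>x \<in> set (l a). P a x)"
  by (rule pt_cong[OF pt_null[OF pt_filter[OF assms(1), of "\<lambda>a x. \<not> P a x"]]])
    (auto intro: pt_not assms simp: filter_empty_conv)

lemma pt_bex: assumes "pt l" "pt (\<lambda>p. P (fst p) (snd p))" shows "pt (\<lambda>a. \<exists>x \<in> set (l a). P a x)"
  by (rule pt_cong[OF pt_not[OF pt_null[OF pt_filter[OF assms]]]]) (auto simp: filter_empty_conv)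

lemma pt_add: assumes "pt f" "pt g" shows "pt (\<lambda>a. f a + g a :: nat)"
  by (rule pt_cong[OF pt_units_nat[OF pt_append[OF pt_nat_units[OF assms(1)] pt_nat_units[OF assms(2)]]]]) simp

lemma pt_mult: assumes "pt f" "pt g" shows "pt (\<lambda>a. f a * g a :: nat)"
proof -
  have "pt (\<lambda>a. concat (map (\<lambda>_. replicate (g a) ()) (replicate (f a) ())))"
    by (intro pt_concat pt_map pt_nat_units assms ptm_comp[OF assms(2)] pt_intros0)
  from pt_length[OF this] show ?thesis by (simp add: length_concat sum_list_replicate map_replicate_const)
qed

lemma pt_drop: assumes "pt n" "pt l" shows "pt (\<lambda>a. drop (n a) (l a))"
proof -
  have eq: "fold (\<lambda>_ st. tl st) (replicate n ()) xs = drop n xs" for n and xs :: "'x list"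
    by (induction n arbitrary: xs) (auto simp: drop_Suc)
  have "pt (\<lambda>a. fold (\<lambda>_ st. tl st) (replicate (n a) ()) (l a))"
  proof (rule pt_fold[OF pt_nat_units[OF assms(1)] assms(2), where J = "\<lambda>_ _. True" and G = "\<lambda>x. x"])
    show "True \<and> sz (tl st) \<le> sz st + (sz a + sz x)" for st :: "'b list" and a :: 'a and x :: unit by (cases st) auto
  qed (auto intro!: pmono_intros pt_tl pt_intros0)
  then show ?thesis by (simp only: eq)
qed

lemma pt_take: assumes "pt n" "pt l" shows "pt (\<lambda>a. take (n a) (l a))"
proof -
  have eq: "rev (drop (length xs - n) (rev xs)) = take n xs" for n and xs :: "'x list"
    by (cases "n \<le> length xs") (simp_all add: rev_drop)
  have sub: "pt (\<lambda>a. length (l a) - n a)"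
    by (rule pt_cong[OF pt_length[OF pt_drop[OF assms]]]) simp
  have "pt (\<lambda>a. rev (drop (length (l a) - n a) (rev (l a))))"
    by (intro pt_rev pt_drop sub assms)
  then show ?thesis by (simp add: eq)
qed

lemma pt_diff: assumes "pt f" "pt g" shows "pt (\<lambda>a. f a - g a :: nat)"
  by (rule pt_cong[OF pt_length[OF pt_drop[OF assms(2) pt_nat_units[OF assms(1)]]]]) simp

lemma pt_le: assumes "pt f" "pt g" shows "pt (\<lambda>a. f a \<le> (g a :: nat))"
  by (rule pt_cong[OF pt_eq[OF pt_diff[OF assms] pt_const[of 0]]]) simp

lemma pt_less: assumes "pt f" "pt g" shows "pt (\<lambda>a. f a < (g a :: nat))"
  by (rule pt_cong[OF pt_not[OF pt_le[OF assms(2,1)]]]) auto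

lemma pt_replicate: assumes "pt n" "pt x" shows "pt (\<lambda>a. replicate (n a) (x a))"
  by (rule pt_cong[OF pt_map[OF pt_nat_units[OF assms(1)], of "\<lambda>a _. x a"]])
    (auto simp: map_replicate_const intro: ptm_comp[OF assms(2)] pt_fst0)

lemma pt_upt: assumes "pt f" "pt g" shows "pt (\<lambda>a. [f a ..< g a])"
proof -
  have eq: "fold (\<lambda>_ st. st @ [length st + c]) (replicate n ()) acc = acc @ [length acc + c ..< length acc + c + n]" for n c acc
    by (induction n arbitrary: acc) (auto simp: upt_conv_Cons)
  have szb: "sz (st @ [length st + c]) \<le> sz st + N" if "length st + c < N" for st c N
    using that by simp
  have "pt (\<lambda>a. fold (\<lambda>_ st. st @ [length st + 0]) (replicate (f a) ()) [])" if "pt f" for f :: "'a => nat"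
  proof -
    have sq: "sz xs \<ge> length xs" for xs :: "nat list" by (rule length_le_sz)
    have "pt (\<lambda>p. fold (\<lambda>_ st. st @ [length st + 0]) (replicate (f p) ()) [])"
      if "pt f" for f :: "'a => nat"
    proof -
      \<comment> \<open>The entry appended in a round is the current length. The test bounds it by
        \<open>p\<close>, which makes the growth independent of the accumulator; it never fails in
        the run from the empty list.\<close>
      have "pt (\<lambda>p :: nat. fold (\<lambda>x st. if length st < p then st @ [length st + 0] else st) (replicate p ()) [])"
        by (rule pt_fold[OF pt_nat_units[OF pt_id] pt_const, where J = "\<lambda>_ _. True" and G = "\<lambda>x. x"])
          (auto intro!: pmono_intros pt_append pt_Cons pt_length pt_if pt_less pt_add pt_intros0)
      moreover have "fold (\<lambda>x st. if length st < p then st @ [length st + 0] else st) (replicate n ()) acc = fold (\<lambda>_ st. st @ [length st + 0]) (replicate n ()) acc"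
        if "length acc + n \<le> p" for n p acc
        using that by (induction n arbitrary: acc) auto
      ultimately have "pt (\<lambda>p :: nat. fold (\<lambda>_ st. st @ [length st + 0]) (replicate p ()) [])" by simp
      from ptm_comp[OF this that] show ?thesis .
    qed
    from this[OF that] show ?thesis .
  qed
  then have up: "pt (\<lambda>a. [0 ..< f a])" if "pt f" for f :: "'a => nat" using that unfolding eq by simp
  have "pt (\<lambda>a. filter (\<lambda>i. f a \<le> i) [0 ..< g a])"
    by (intro pt_filter up pt_le assms(2) ptm_comp[OF assms(1)] pt_intros0)
  moreover have "filter (\<lambda>i. m \<le> i) [0 ..< n] = [m ..< n]" for m n
    by (induction n) (auto simp: upt_Suc)
  ultimately show ?thesis by simp
qed

lemma pt_poly: assumes "pt f" shows "pt (\<lambda>a. poly (q :: nat poly) (f a))"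
proof -
  have "pt (\<lambda>x. poly q x)"
    by (induction q) (auto intro!: pt_const pt_add pt_mult pt_id)
  from ptm_comp[OF this assms] show ?thesis .
qed

lemma pt_nthd: assumes "pt d" "pt l" "pt i" shows "pt (\<lambda>a. nthd (d a) (l a) (i a))"
proof -
  have eq: "nthd d xs i = (case drop i xs of [] => d | y # _ => y)" for d :: 'x and xs i
    by (induction xs arbitrary: i) (auto split: nat.splits)
  show ?thesis unfolding eq by (intro pt_case_list pt_drop assms pt_intros0)
qed

end

section \<open>Programs as data, sampling, queries and the size of a tree\<close>

instance expr :: countable by countable_datatype
instance com :: countable by countable_datatype

text \<open>Any enumeration serves: the commands handled by the interpreter are those of one fixed
  program, finitely many, so their codes have bounded size.\<close>

instantiation com :: code begin
definition code_com :: "com => data" where "code_com c = code (to_nat c)"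
instance by standard (simp add: code_com_def)
end

definition lift :: "'a pmf => ('w, 'a) M" where
  "lift p = (\<lambda>w. map_pmf (\<lambda>x. Some (x, w)) p)"

lemma lift_return [simp]: "lift (return_pmf x) = ret x" by (simp add: lift_def ret_def)
lemma lift_bnd: "lift p \<then> f = (\<lambda>w. bind_pmf p (\<lambda>x. f x w))"
  by (simp add: lift_def bnd_def obind_def bind_map_pmf)
lemma lift_bnd_lift: "lift p \<then> (\<lambda>x. lift (f x)) = lift (bind_pmf p f)"
  by (simp add: lift_bnd) (simp add: lift_def map_bind_pmf)
lemma lift_bnd_ret: "lift p \<then> (\<lambda>x. ret (f x)) = lift (map_pmf f p)"
  unfolding lift_bnd by (simp add: lift_def ret_def map_pmf_def bind_assoc_pmf bind_return_pmf)
lemma set_lift [simp]: "Some (x, w') \<in> set_pmf (lift p w) \<longleftrightarrow> x \<in> set_pmf p \<and> w' = w" by (auto simp: lift_def)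
lemma lift_fst: "map_pmf (map_option fst) (lift p w) = map_pmf Some p" by (simp add: lift_def pmf.map_comp o_def)

text \<open>One step of counting the nodes of a tree with an explicit stack. Sizes are needed at run
  time, for the limit of the interpreter and for the time bounds of given machines.\<close>

definition flat_step :: "data list \<times> nat => data list \<times> nat" where
  "flat_step s = (case fst s of [] => s
     | d # r => if d = Leaf then (r, snd s) else (left d # right d # r, Suc (snd s)))"

lemma flat_step_simps [simp]:
  "flat_step (Leaf # r, n) = (r, n)" "flat_step (Node a b # r, n) = (a # b # r, Suc n)"
  by (simp_all add: flat_step_def)

text \<open>A tree with \<open>size d\<close> inner nodes has one leaf more, and each of these is
  taken off the stack once.\<close>

lemma flat_iter:
  "(\<Sum>d\<leftarrow>st. 2 * size d + 1) \<le> m ==>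
    iterM (\<lambda>s. fst s \<noteq> []) (\<lambda>s. ret (flat_step s)) m (st, n) = ret ([], n + (\<Sum>d\<leftarrow>st. size d))"
proof (induction m arbitrary: st n)
  case (Suc m)
  show ?case
  proof (cases st)
    case (Cons d r)
    then show ?thesis using Suc.prems by (cases d) (simp_all add: Suc.IH add.assoc)
  qed simp
qed (cases st; simp)

lemma flat_size:
  "Some (s', w') \<in> set_pmf (iterM (\<lambda>s. fst s \<noteq> []) (\<lambda>s. ret (flat_step s)) m (st, n) w) ==>
    sz s' \<le> sz st + n + m + 1"
proof (induction m arbitrary: st n)
  case (Suc m)
  show ?case
  proof (cases st)
    case (Cons d r)
    then show ?thesis using Suc.prems Suc.IH by (cases d) fastforce+
  qed (use Suc.prems in simp)
qed simp

context machine begin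

lemma ptm_pick: assumes "pt l" shows "ptm (\<lambda>a. lift (pick (l a)))"
proof -
  have "ptm (\<lambda>l. lift (pick l))" unfolding ptm_def
  proof
    fix v
    have "spec v (Sample v (Var v)) \<sigma> w (1 + (kp w + sz l)) (lift (pick l) w)" if w: "w \<in> Inv" and s: "\<sigma> v = code l" for w \<sigma> l
    proof -
      have sl: "data_list (denote \<sigma> (Var v)) = l" using s by (simp add: code_data_list)
      have szd: "size d \<le> kp w + sz l" if "d \<in> set_pmf (pick l)" for d
        using that sz_mem[of d l] by (auto simp: pick_def lessThan_empty_iff split: if_splits)
      have "exl R [Sample v (Var v)] \<sigma> w (1 + (kp w + sz l)) (map_pmf (\<lambda>d. Some (\<sigma>(v := d), w)) (pick l))"
        using exl_Sample[of \<sigma> "Var v" "kp w + sz l" R v w] szd unfolding sl by blast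
      then show ?thesis unfolding spec_def using w szd
        by (intro exI[of _ "map_pmf (\<lambda>d. Some (\<sigma>(v := d), w)) (pick l)"])
           (auto simp: lift_def pmf.map_comp o_def intro: le_SucI)
    qed
    then show "\<exists>c g. pmono g \<and> (\<forall>w\<in>Inv. \<forall>\<sigma> a. \<sigma> v = code a \<longrightarrow> spec v c \<sigma> w (g (kp w + sz a)) (lift (pick a) w))"
      by (intro exI[of _ "Sample v (Var v)"] exI[of _ "\<lambda>x. 1 + x"]) (auto intro!: pmono_intros)
  qed
  from ptm_comp[OF this assms] show ?thesis .
qed

lemma ptm_query: assumes "pt f" shows "ptm (\<lambda>a w. R w (f a))"
proof -
  have "ptm (\<lambda>d w. R w d)" unfolding ptm_def
  proof
    fix v
    have "spec v (Query v (Var v)) \<sigma> w (1 + (kp w + sz d) + rb (kp w + sz d)) (R w d)" if w: "w \<in> Inv" and s: "\<sigma> v = code d" for w \<sigma> d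
    proof -
      have sl: "denote \<sigma> (Var v) = d" using s by simp
      let ?n = "map_pmf (map_option (\<lambda>(a, w'). (\<sigma>(v := a), w'))) (R w d)"
      have "exl R [Query v (Var v)] \<sigma> w (1 + size d + rb (kp w + size d)) ?n"
        using exl_Query[of R w \<sigma> "Var v" "rb (kp w + size d)" v] R_inv[OF w] unfolding sl by blast
      then have "exl R [Query v (Var v)] \<sigma> w (1 + (kp w + sz d) + rb (kp w + sz d)) ?n"
        by (rule exl_mono) simp
      moreover have "map_pmf (map_option (\<lambda>(\<sigma>', w'). (\<sigma>' v, w'))) ?n = map_pmf (map_option (map_prod code id)) (R w d)"
        unfolding pmf.map_comp by (rule map_pmf_cong) (auto simp: option.map_comp o_def split_def map_prod_def)
      moreover have "(\<forall>x<v. \<sigma>' x = \<sigma> x) \<and> w' \<in> Inv \<and> kp w' = kp w \<and> size (\<sigma>' v) \<le> 1 + (kp w + sz d) + rb (kp w + sz d)"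
        if "Some (\<sigma>', w') \<in> set_pmf ?n" for \<sigma>' w'
      proof -
        from that obtain a where "\<sigma>' = \<sigma>(v := a)" "Some (a, w') \<in> set_pmf (R w d)" by (auto simp: map_option_case split: option.splits)
        then show ?thesis using R_inv[OF w] by fastforce
      qed
      ultimately show ?thesis unfolding spec_def by blast
    qed
    then show "\<exists>c g. pmono g \<and> (\<forall>w\<in>Inv. \<forall>\<sigma> a. \<sigma> v = code a \<longrightarrow> spec v c \<sigma> w (g (kp w + sz a)) (R w a))"
      using rb by (intro exI[of _ "Query v (Var v)"] exI[of _ "\<lambda>x. 1 + x + rb x"]) (auto intro!: pmono_intros)
  qed
  from ptm_comp[OF this assms] show ?thesis .
qed

lemma pt_size: assumes "pt f" shows "pt (\<lambda>a. size (f a :: data))"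
proof -
  have "ptm (\<lambda>d. iterM (\<lambda>s. fst s \<noteq> []) (\<lambda>s. ret (flat_step s)) (2 * size d + 1) ([d], 0))"
  proof (rule ptm_iter[where h = "\<lambda>x. 3 * x + 3"])
    show "pt flat_step" unfolding flat_step_def
      by (intro pt_case_list pt_if pt_Pair pt_Cons pt_left pt_right pt_Suc pt_intros0)
    show "sz s' \<le> 3 * (kp w + sz d) + 3" if "m \<le> 2 * size d + 1"
      "Some (s', w') \<in> set_pmf (iterM (\<lambda>s. fst s \<noteq> []) (\<lambda>s. ret (flat_step s)) m ([d], 0) w)" for d m s' and w w' :: 'w
      using flat_size[OF that(2)] that(1) by simp
    show "\<not> fst s' \<noteq> []" if "Some (s', w') \<in> set_pmf (iterM (\<lambda>s. fst s \<noteq> []) (\<lambda>s. ret (flat_step s)) (2 * size d + 1) ([d], 0) w)" for d s' and w w' :: 'w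
      using that by (subst (asm) flat_iter) auto
  qed (auto intro!: pmono_intros pt_Pair pt_Cons pt_intros0)
  then have "ptm (\<lambda>d. iterM (\<lambda>s. fst s \<noteq> []) (\<lambda>s. ret (flat_step s)) (2 * size d + 1) ([d], 0) \<then> (\<lambda>s. ret (snd s)))"
    by (rule ptm_pair) (intro pt_snd pt_snd0)
  moreover have "iterM (\<lambda>s. fst s \<noteq> []) (\<lambda>s. ret (flat_step s)) (2 * size d + 1) ([d], 0) \<then> (\<lambda>s. ret (snd s)) = (ret (size d) :: ('w, nat) M)" for d
    by (subst flat_iter) auto
  ultimately have "pt (\<lambda>d :: data. size d)" by (simp only:)
  from ptm_comp[OF this assms] show ?thesis .
qed

end

section \<open>An interpreter for programs\<close>

primrec evars :: "expr => nat" where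
  "evars (Var x) = Suc x" | "evars Lf = 0" | "evars (Nd e f) = max (evars e) (evars f)"
| "evars (Fst e) = evars e" | "evars (Snd e) = evars e" | "evars (Eq e f) = max (evars e) (evars f)"

primrec cvars :: "com => nat" where
  "cvars Skip = 0" | "cvars (Assign x e) = max (Suc x) (evars e)"
| "cvars (Seq c1 c2) = max (cvars c1) (cvars c2)"
| "cvars (Cond e c1 c2) = max (evars e) (max (cvars c1) (cvars c2))"
| "cvars (While e c) = max (evars e) (cvars c)"
| "cvars (Sample x e) = max (Suc x) (evars e)"
| "cvars (Query x e) = max (Suc x) (evars e)"

primrec subs :: "com => com list" where
  "subs Skip = [Skip]" | "subs (Assign x e) = [Assign x e]"
| "subs (Seq c1 c2) = Seq c1 c2 # subs c1 @ subs c2"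
| "subs (Cond e c1 c2) = Cond e c1 c2 # subs c1 @ subs c2"
| "subs (While e c) = While e c # subs c"
| "subs (Sample x e) = [Sample x e]"
| "subs (Query x e) = [Query x e]"

text \<open>The commands that one step may newly make pending; a loop puts itself back. The
  subcommands of a program are closed under this.\<close>

primrec kids :: "com => com list" where
  "kids Skip = []" | "kids (Assign x e) = []"
| "kids (Seq c1 c2) = [c1, c2]" | "kids (Cond e c1 c2) = [c1, c2]" | "kids (While e c) = [c, While e c]"
| "kids (Sample x e) = []" | "kids (Query x e) = []"

lemma subs_self: "c \<in> set (subs c)" by (cases c) auto
lemma subs_kids: "c' \<in> set (subs c) ==> set (kids c') \<subseteq> set (subs c)"
  by (induction c) (auto simp: subs_self)
lemma subs_cvars: "c' \<in> set (subs c) ==> cvars c' \<le> cvars c"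
  by (induction c) auto

lemma denote_cong: "(\<And>x. x < evars e ==> \<sigma> x = \<tau> x) ==> denote \<sigma> e = denote \<tau> e"
  by (induction e) auto

type_synonym 'g ist = "com list \<times> data list \<times> 'g option"

definition den :: "data list => expr => data" where "den st e = denote (nthd Leaf st) e"

text \<open>Values larger than \<open>B\<close> abort the run. An interpreted program may receive
  answers for which it has no time bound; the limit keeps the interpreter polynomial in this case
  too.\<close>

definition put :: "nat => com list => data list => nat => data => 'g option => ('w, 'g ist) M" where
  "put B cs st x d g = ret (if size d \<le> B then (cs, st[x := d], g) else ([], st, None))"

fun istep :: "nat => (data => 'g => ('w, (data \<times> 'g) option) M) => com => com list => data list => 'g option => ('w, 'g ist) M" where
  "istep B h Skip cs st g = ret (cs, st, g)"
| "istep B h (Assign x e) cs st g = put B cs st x (den st e) g"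
| "istep B h (Seq c1 c2) cs st g = ret (c1 # c2 # cs, st, g)"
| "istep B h (Cond e c1 c2) cs st g = ret ((if data_bit (den st e) then c1 else c2) # cs, st, g)"
| "istep B h (While e c) cs st g = ret (if data_bit (den st e) then c # While e c # cs else cs, st, g)"
| "istep B h (Sample x e) cs st g = lift (pick (data_list (den st e))) \<then> (\<lambda>d. put B cs st x d g)"
| "istep B h (Query x e) cs st g = (case g of None => ret ([], st, None) | Some g' =>
     h (den st e) g' \<then> (\<lambda>r. case r of None => ret ([], st, None) | Some q => put B cs st x (fst q) (Some (snd q))))"

text \<open>Membership in the finite list \<open>S\<close> allows a distinction of cases by command,
  so that in each case the expression to be evaluated is a constant of the interpreting
  program.\<close>

definition rstep :: "com list => nat => (data => 'g => ('w, (data \<times> 'g) option) M) => 'g ist => ('w, 'g ist) M" where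
  "rstep S B h s = (case fst s of [] => ret s
     | c # cs => if c \<in> set S then istep B h c cs (fst (snd s)) (snd (snd s)) else ret s)"

definition interp :: "com list => nat => (data => 'g => ('w, (data \<times> 'g) option) M) => nat => 'g ist => ('w, 'g ist) M" where
  "interp S B h n s = foldM (\<lambda>_. rstep S B h) (replicate n ()) s"

lemma interp_0 [simp]: "interp S B h 0 s = ret s" by (simp add: interp_def)
lemma interp_Suc: "interp S B h (Suc n) s = rstep S B h s \<then> interp S B h n"
proof -
  have "(\<lambda>s. foldM (\<lambda>_. rstep S B h) (replicate n ()) s) = interp S B h n" by (simp add: interp_def fun_eq_iff)
  then show ?thesis by (simp add: interp_def)
qed

context machine begin

lemma pt_den: assumes "pt st" shows "pt (\<lambda>a. den (st a) e)"
  unfolding den_def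
  by (induction e)
     (auto intro!: pt_nthd assms pt_const pt_Node pt_left pt_right pt_if pt_eq simp: bit_data_def)

lemma pt_list_update:
  fixes st :: "'a :: code => data list"
  assumes "pt st" "pt d" shows "pt (\<lambda>a. (st a)[x := d a])"
proof -
  have "pt (\<lambda>p. (fst p)[x := snd p :: data])"
  proof (induction x)
    case 0
    have "pt (\<lambda>p. case fst p of [] => [] | _ # t => snd p # t)" by (intro pt_case_list pt_Cons pt_intros0)
    then show ?case by (rule pt_cong) (auto split: list.splits)
  next
    case (Suc x)
    have s: "pt (\<lambda>a. (A a)[x := D a])" if "pt A" "pt D" for A :: "((data list \<times> data) \<times> data) \<times> data list => data list" and D
      using ptm_comp[OF Suc pt_Pair[OF that]] by simp
    have "pt (\<lambda>p. case fst p of [] => [] | h # t => h # t[x := snd p :: data])"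
      by (intro pt_case_list pt_Cons s pt_intros0)
    then show ?case by (rule pt_cong) (auto split: list.splits)
  qed
  from ptm_comp[OF this pt_Pair[OF assms]] show ?thesis by simp
qed

lemma ptm_put: assumes "pt B" "pt cs" "pt st" "pt d" "pt g"
  shows "ptm (\<lambda>a. put (B a) (cs a) (st a) x (d a) (g a))"
  unfolding put_def by (intro pt_if pt_le pt_size assms pt_Pair pt_list_update pt_const)

lemma ptm_istep:
  assumes h: "ptm (\<lambda>p. h (fst (fst p)) (snd (fst p)) (snd p))"
    and "pt a" "pt B" "pt cs" "pt st" "pt g"
  shows "ptm (\<lambda>q. istep (B q) (h (a q)) c (cs q) (st q) (g q))"
proof -
  have h': "ptm (\<lambda>q. h (F q) (X q) (T q))" if "pt F" "pt X" "pt T" for F X T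
    using ptm_comp[OF h pt_Pair[OF pt_Pair[OF that(1,2)] that(3)]] by simp
  have lf: "pt (\<lambda>p. F (fst p))" if "pt F" for F by (rule ptm_comp[OF that pt_fst0])
  have lf2: "pt (\<lambda>p. F (fst (fst p)))" if "pt F" for F by (rule ptm_comp[OF that]) (intro pt_intros0)
  show ?thesis
    by (cases c; simp only: istep.simps)
      (intro pt_Pair ptm_put assms pt_den pt_data_bit pt_Cons pt_if pt_const ptm_pair ptm_pick pt_data_list
        ptm_case_option pt_null h' lf lf2 pt_fst pt_snd pt_Some pt_id)+
qed

lemma ptm_rstep:
  assumes h: "ptm (\<lambda>p. h (fst (fst p)) (snd (fst p)) (snd p))"
    and "pt a" "pt B" "pt s"
  shows "ptm (\<lambda>q. rstep S (B q) (h (a q)) (s q))"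
proof -
  let ?lf = "\<lambda>q. fst (fst q)"
  have lf2: "pt (\<lambda>p. F (fst (fst p)))" if "pt F" for F by (rule ptm_comp[OF that]) (intro pt_intros0)
  have "ptm (\<lambda>q. if snd (fst q) \<in> set S then istep (B (?lf q)) (h (a (?lf q))) (snd (fst q)) (snd q) (fst (snd (s (?lf q)))) (snd (snd (s (?lf q)))) else ret (s (?lf q)))"
  proof (induction S)
    case Nil
    then show ?case by (simp add: lf2[OF assms(4)])
  next
    case (Cons c S)
    have "ptm (\<lambda>q. if snd (fst q) = c then istep (B (?lf q)) (h (a (?lf q))) c (snd q) (fst (snd (s (?lf q)))) (snd (snd (s (?lf q))))
        else if snd (fst q) \<in> set S then istep (B (?lf q)) (h (a (?lf q))) (snd (fst q)) (snd q) (fst (snd (s (?lf q)))) (snd (snd (s (?lf q)))) else ret (s (?lf q)))"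
      by (intro ptm_if Cons ptm_istep[OF h] lf2 assms pt_fst pt_snd pt_eq pt_intros0)
    then show ?case by (rule back_subst[where P = ptm]) auto
  qed
  then show ?thesis unfolding rstep_def by (intro ptm_case_list pt_fst assms(4))
qed

text \<open>One step adds at most one value of size \<open>B\<close>, the children of one command,
  and the growth of the simulated environment; none of these bounds depends on the state of the
  interpreter, as \<open>ptm_foldM\<close> requires.\<close>

lemma ptm_interp:
  fixes h :: "'a :: code => data => 'g :: code => ('w, (data \<times> 'g) option) M"
  assumes h: "ptm (\<lambda>p. h (fst (fst p)) (snd (fst p)) (snd p))"
    and B: "pt B" and n: "pt n" and i: "pt i" and G: "pmono G"
    and grow: "\<And>a d g w r g' w'. w \<in> Inv ==> Some (Some (r, g'), w') \<in> set_pmf (h a d g w) ==> sz g' \<le> sz g + G (kp w + sz a)"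
  shows "ptm (\<lambda>a. interp S (B a) (h a) (n a) (i a))"
proof -
  obtain gB where gB: "pmono gB" "\<And>w a. w \<in> Inv ==> sz (B a) \<le> gB (kp w + sz a)" by (rule pt_result[OF B]) blast
  \<comment> \<open>A bound for the commands pushed in one step, constant because \<open>S\<close>
    is fixed.\<close>
  define K where "K = (\<Sum>c\<leftarrow>S. sz (kids c)) + 1"
  have K: "sz (kids c) < K" if "c \<in> set S" for c
    using that member_le_sum_list[of "sz (kids c)" "map (\<lambda>c. sz (kids c)) S"] by (auto simp: K_def)
  have upd: "sz (st[x := d]) \<le> sz st + size d" for st x and d :: data
    by (induction st arbitrary: x) (auto split: nat.splits simp: add.assoc intro: order_trans)
  have put: "sz st' \<le> sz cs + sz st + sz g + B + 3" if "Some (st', w') \<in> set_pmf (put B cs st x d g w)" for st' and w' w :: 'w and cs st x d and g :: "'g option" and B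
    using that upd[of st x d] by (auto simp: put_def split: if_splits)
  show ?thesis unfolding interp_def
  proof (rule ptm_foldM[where J = "\<lambda>_ _. True" and G = "\<lambda>x. gB x + K + 5 + G x"])
    show "pt (\<lambda>a. replicate (n a) ())" by (rule pt_nat_units[OF n])
    show "ptm (\<lambda>p. rstep S (B (fst (fst p))) (h (fst (fst p))) (snd p))"
      by (rule ptm_rstep[OF h]) (intro ptm_comp[OF B] pt_intros0)+
    show "pmono (\<lambda>x. gB x + K + 5 + G x)" by (intro pmono_intros gB(1) G)
    fix a and x :: unit and s s' :: "'g ist" and w w' :: 'w
    assume w: "w \<in> Inv" and r: "Some (s', w') \<in> set_pmf (rstep S (B a) (h a) s w)"
    obtain cs0 st g where s: "s = (cs0, st, g)" by (cases s)
    have GBm: "B a \<le> gB (kp w + sz a + sz x)" using gB(2)[OF w, of a] by simp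
    have "sz s' \<le> sz s + (gB (kp w + sz a + sz x) + K + 5 + G (kp w + sz a + sz x))"
    proof (cases "\<exists>c cs. cs0 = c # cs \<and> c \<in> set S")
      case False
      then have "s' = s" using r s by (auto simp: rstep_def split: list.splits if_splits)
      then show ?thesis by simp
    next
      case True
      then obtain c cs where c: "cs0 = c # cs" "c \<in> set S" by blast
      have r': "Some (s', w') \<in> set_pmf (istep (B a) (h a) c cs st g w)" using r s c by (simp add: rstep_def)
      show ?thesis
      proof (cases c)
        case (Query y e)
        show ?thesis
        proof (cases g)
          case None
          then show ?thesis using r' Query s by simp
        next
          case (Some g0)
          from r' Some Query obtain q w1 where q: "Some (q, w1) \<in> set_pmf (h a (den st e) g0 w)"
            "Some (s', w') \<in> set_pmf ((case q of None => ret ([], st, None) | Some q => put (B a) cs st y (fst q) (Some (snd q))) w1)"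
            by (auto simp: set_bnd)
          show ?thesis
          proof (cases q)
            case None
            then show ?thesis using q s by simp
          next
            case (Some q')
            then have "sz (snd q') \<le> sz g0 + G (kp w + sz a)" using grow[OF w, of "fst q'" "snd q'"] q(1) by simp
            then show ?thesis using put[of s' w' "B a" cs st y "fst q'" "Some (snd q')" w1] q(2) Some \<open>g = Some g0\<close> s c GBm by simp
          qed
        qed
      next
        case (Assign y e)
        then show ?thesis using put[of s' w' "B a" cs st y "den st e" g w] r' s c GBm by simp
      next
        case (Sample y e)
        then obtain d w1 where "Some (s', w') \<in> set_pmf (put (B a) cs st y d g w1)" using r' by (auto simp: set_bnd)
        from put[OF this] show ?thesis using s c GBm by simp
      qed (use r' s c K[OF c(2)] in auto)
    qed
    then show "True \<and> sz s' \<le> sz s + (gB (kp w + sz a + sz x) + K + 5 + G (kp w + sz a + sz x))" by simp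
  qed (simp_all add: i)
qed

end

lemma nthd_map: "x < V ==> nthd Leaf (map \<sigma> [0..<V]) x = \<sigma> x"
  by (simp add: nthd_eq)

definition proj :: "nat => 'g config => 'g ist" where
  "proj V = (\<lambda>(cs, \<sigma>, s, u). (cs, map \<sigma> [0..<V], s))"

lemma run_time: "c' \<in> set_pmf (run R n c) ==> cfg_time c \<le> cfg_time c'"
proof (induction n arbitrary: c)
  case (Suc n)
  then obtain c1 where c1: "c1 \<in> set_pmf (step R c)" "c' \<in> set_pmf (run R n c1)" by auto
  then have "cfg_time c1 \<le> cfg_time c'" using Suc.IH by auto
  then show ?case using step_time[OF c1(1)] step_halted[of c R] c1 by (cases "cfg_cmds c = []") auto
qed simp

text \<open>Storing a value costs its size, so a step that ends within time \<open>B\<close> stores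
  no value above the limit, and the interpreter does not abort.\<close>

lemma istep_step:
  assumes h: "\<And>d g. h d g = lift (H d g)"
    and V: "cvars c \<le> V" and t: "\<And>c'. c' \<in> set_pmf (step (\<lambda>g d. H d g) (c # cs, \<sigma>, s, u)) ==> cfg_time c' \<le> B"
  shows "istep B h c cs (map \<sigma> [0..<V]) s = lift (map_pmf (proj V) (step (\<lambda>g d. H d g) (c # cs, \<sigma>, s, u)))"
proof -
  have den: "den (map \<sigma> [0..<V]) e = denote \<sigma> e" if "evars e \<le> V" for e
    unfolding den_def using that by (intro denote_cong nthd_map) simp
  have upd: "(map \<sigma> [0..<V])[x := d] = map (\<sigma>(x := d)) [0..<V]" if "x < V" for x d
    using that by (intro nth_equalityI) (auto simp: nth_list_update)
  show ?thesis
  proof (cases c)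
    case (Assign x e)
    then show ?thesis using V t by (simp add: den upd put_def proj_def Let_def)
  next
    case (Sample x e)
    let ?P = "pick (data_list (denote \<sigma> e))"
    have sb: "size d \<le> B" if "d \<in> set_pmf ?P" for d
      using t[of "(cs, \<sigma>(x := d), s, u + 1 + size d)"] that Sample by simp
    have "istep B h c cs (map \<sigma> [0..<V]) s = lift (map_pmf (\<lambda>d. if size d \<le> B then (cs, (map \<sigma> [0..<V])[x := d], s) else ([], map \<sigma> [0..<V], None)) ?P)"
      using Sample V by (simp add: den put_def lift_bnd_ret)
    also have "map_pmf (\<lambda>d. if size d \<le> B then (cs, (map \<sigma> [0..<V])[x := d], s) else ([], map \<sigma> [0..<V], None)) ?P
        = map_pmf (proj V) (step (\<lambda>g d. H d g) (c # cs, \<sigma>, s, u))"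
      using Sample V sb by (simp add: pmf.map_comp o_def proj_def) (intro map_pmf_cong refl, simp add: upd)
    finally show ?thesis .
  next
    case (Query x e)
    show ?thesis
    proof (cases s)
      case None
      then show ?thesis using Query by (simp add: proj_def)
    next
      case (Some g)
      let ?P = "H (denote \<sigma> e) g"
      have sb: "size a \<le> B" if "Some (a, g') \<in> set_pmf ?P" for a g'
        using t[of "(cs, \<sigma>(x := a), Some g', u + 1 + size (denote \<sigma> e) + size a)"] that Query Some by (force simp: Let_def)
      let ?F = "\<lambda>r. case r of None => ([], map \<sigma> [0..<V], None) | Some q =>
          (if size (fst q) \<le> B then (cs, (map \<sigma> [0..<V])[x := fst q], Some (snd q)) else ([], map \<sigma> [0..<V], None))"
      have eqF: "(\<lambda>r. case r of None => ret ([], map \<sigma> [0..<V], None) | Some q => put B cs (map \<sigma> [0..<V]) x (fst q) (Some (snd q))) = (\<lambda>r. ret (?F r))"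
        by (auto simp: fun_eq_iff put_def split: option.splits)
      have "istep B h c cs (map \<sigma> [0..<V]) s = lift ?P \<then> (\<lambda>r. case r of None => ret ([], map \<sigma> [0..<V], None) | Some q => put B cs (map \<sigma> [0..<V]) x (fst q) (Some (snd q)))"
        using Query V Some by (simp add: den h)
      also have "\<dots> = lift (map_pmf ?F ?P)" unfolding arg_cong[OF eqF, of "bnd (lift ?P)"] by (rule lift_bnd_ret)
      finally have "istep B h c cs (map \<sigma> [0..<V]) s = lift (map_pmf ?F ?P)" .
      moreover have "map_pmf ?F ?P = map_pmf (proj V) (step (\<lambda>g d. H d g) (c # cs, \<sigma>, s, u))"
        using Query V Some sb by (simp add: pmf.map_comp o_def Let_def)
          (intro map_pmf_cong refl, auto simp: upd proj_def split: option.splits)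
      ultimately show ?thesis by simp
    qed
  qed (use V in \<open>simp_all add: den proj_def\<close>)
qed

lemma interp_run:
  fixes H :: "data => 'g => (data \<times> 'g) option pmf"
  assumes h: "\<And>d g. h d g = lift (H d g)" and V: "cvars c0 \<le> V"
  shows "set cs \<subseteq> set (subs c0) ==> (\<And>c'. c' \<in> set_pmf (run (\<lambda>g d. H d g) n (cs, \<sigma>, s, u)) ==> cfg_time c' \<le> B) ==>
    interp (subs c0) B h n (cs, map \<sigma> [0..<V], s) = lift (map_pmf (proj V) (run (\<lambda>g d. H d g) n (cs, \<sigma>, s, u)))"
proof (induction n arbitrary: cs \<sigma> s u)
  case 0
  then show ?case by (simp add: proj_def)
next
  case (Suc n)
  let ?R = "\<lambda>g d. H d g"
  show ?case
  proof (cases cs)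
    case Nil
    then show ?thesis using Suc.IH[OF Suc.prems(1), of \<sigma> s u] Suc.prems(2)
      by (simp add: interp_Suc rstep_def bind_return_pmf)
  next
    case (Cons c cs')
    have c: "c \<in> set (subs c0)" using Suc.prems(1) Cons by simp
    have t1: "cfg_time c1 \<le> B" if "c1 \<in> set_pmf (step ?R (c # cs', \<sigma>, s, u))" for c1
    proof -
      obtain c2 where "c2 \<in> set_pmf (run ?R n c1)" using set_pmf_not_empty by fast
      moreover from this have "c2 \<in> set_pmf (run ?R (Suc n) (cs, \<sigma>, s, u))" using that Cons by auto
      ultimately show ?thesis using run_time[of c2 ?R n c1] Suc.prems(2)[of c2] by simp
    qed
    have st: "istep B h c cs' (map \<sigma> [0..<V]) s = lift (map_pmf (proj V) (step ?R (c # cs', \<sigma>, s, u)))"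
      by (rule istep_step[OF h]) (use subs_cvars[OF c] V t1 in auto)
    have sub: "set (cfg_cmds c1) \<subseteq> set (subs c0)" if "c1 \<in> set_pmf (step ?R (c # cs', \<sigma>, s, u))" for c1
      using that Suc.prems(1) Cons subs_kids[OF c]
      by (cases c; cases s; auto simp: Let_def split: option.splits if_splits; blast)
    have IH: "interp (subs c0) B h n (proj V c1) = lift (map_pmf (proj V) (run ?R n c1))"
      if c1: "c1 \<in> set_pmf (step ?R (c # cs', \<sigma>, s, u))" for c1
    proof -
      obtain cs1 \<sigma>1 s1 u1 where e: "c1 = (cs1, \<sigma>1, s1, u1)" by (cases c1)
      have "cfg_time c' \<le> B" if "c' \<in> set_pmf (run ?R n (cs1, \<sigma>1, s1, u1))" for c'
        by (rule Suc.prems(2)) (use that c1 Cons e in \<open>auto simp del: split_paired_Ex\<close>)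
      then show ?thesis using Suc.IH[of cs1 \<sigma>1 s1 u1] sub[OF c1] by (simp add: e proj_def)
    qed
    have "interp (subs c0) B h (Suc n) (cs, map \<sigma> [0..<V], s) =
       lift (map_pmf (proj V) (step ?R (c # cs', \<sigma>, s, u))) \<then> interp (subs c0) B h n"
      unfolding interp_Suc rstep_def using Cons c st by simp
    also have "\<dots> = lift (map_pmf (proj V) (run ?R (Suc n) (cs, \<sigma>, s, u)))"
      using Cons unfolding lift_bnd
      by (simp add: bind_map_pmf map_bind_pmf lift_def fun_eq_iff)
         (intro allI bind_pmf_cong refl, simp add: IH lift_def)
    finally show ?thesis .
  qed
qed

context machine begin

text \<open>The given machine uses variables of its own choice and expects the others to be empty.
  Interpreting it, with its store kept as a list, avoids any renaming; it has no environment, so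
  every query is answered as an illegal move.\<close>

lemma poly_time_ptm:
  assumes "poly_time code (f :: 'a :: code => data pmf)"
  shows "ptm (\<lambda>a. lift (f a))"
proof -
  obtain c and q :: "nat poly" where "\<forall>a. (\<forall>cfg \<in> set_pmf (run (\<lambda>_ _. return_pmf None) (poly q (sz a)) (init_config c (code a) ())). halted_by (poly q (sz a)) cfg)
      \<and> map_pmf (\<lambda>(cs, \<sigma>, s, u). \<sigma> 0) (run (\<lambda>_ _. return_pmf None) (poly q (sz a)) (init_config c (code a) ())) = f a"
    using assms unfolding poly_time_def Let_def sz_def by blast
  then have
    fin: "\<And>(a :: 'a) cfg. cfg \<in> set_pmf (run (\<lambda>_ _. return_pmf None) (poly q (sz a)) (init_config c (code a) ())) ==> halted_by (poly q (sz a)) cfg"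
    and res: "\<And>a. map_pmf (\<lambda>(cs, \<sigma>, s, u). \<sigma> 0) (run (\<lambda>_ _. return_pmf None) (poly q (sz a)) (init_config c (code a) ())) = f a"
    by blast+
  let ?V = "Suc (cvars c)"
  let ?h = "\<lambda>(_ :: 'a) (_ :: data) (_ :: unit). ret None :: ('w, (data \<times> unit) option) M"
  have "ptm (\<lambda>a. interp (subs c) (poly q (sz a)) (?h a) (poly q (sz a)) ([c], code a # replicate (cvars c) Leaf, Some ()))"
    unfolding sz_def
    by (rule ptm_interp[where G = "\<lambda>_. 0"])
      (auto intro!: pt_const pt_poly pt_size pt_code pt_id pt_Pair pt_Cons pmono_const)
  then have "ptm (\<lambda>a. interp (subs c) (poly q (sz a)) (?h a) (poly q (sz a)) ([c], code a # replicate (cvars c) Leaf, Some ())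
       \<then> (\<lambda>s. ret (nthd Leaf (fst (snd s)) 0)))"
    by (rule ptm_pair) (intro pt_nthd pt_intros0)
  moreover have "interp (subs c) (poly q (sz a)) (?h a) (poly q (sz a)) ([c], code a # replicate (cvars c) Leaf, Some ())
       \<then> (\<lambda>s. ret (nthd Leaf (fst (snd s)) 0)) = lift (f a)" for a
  proof -
    let ?\<sigma> = "(\<lambda>_. Leaf)(0 := code a)"
    have init: "code a # replicate (cvars c) Leaf = map ?\<sigma> [0..<?V]"
      by (rule nth_equalityI) (auto simp: nth_Cons simp del: upt_Suc split: nat.splits)
    have "interp (subs c) (poly q (sz a)) (?h a) (poly q (sz a)) ([c], map ?\<sigma> [0..<?V], Some ()) =
       lift (map_pmf (proj ?V) (run (\<lambda>_ _. return_pmf None) (poly q (sz a)) ([c], ?\<sigma>, Some (), 0)))"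
      by (rule interp_run[where H = "\<lambda>_ _. return_pmf None"])
        (use fin[of _ a] in \<open>auto simp: subs_self halted_by_def init_config_def\<close>)
    then have "interp (subs c) (poly q (sz a)) (?h a) (poly q (sz a)) ([c], map ?\<sigma> [0..<?V], Some ()) \<then> (\<lambda>s. ret (nthd Leaf (fst (snd s)) 0))
       = lift (map_pmf (\<lambda>(cs, \<sigma>, s, u). \<sigma> 0) (run (\<lambda>_ _. return_pmf None) (poly q (sz a)) (init_config c (code a) ())))"
      by (simp add: lift_bnd_ret pmf.map_comp o_def proj_def split_def init_config_def nthd_eq del: upt_Suc)
    then show ?thesis unfolding init res .
  qed
  ultimately show ?thesis by simp
qed

end

section \<open>The plan of a shuffle\<close>

definition chunk :: "nat => 'x list => nat => 'x list" where
  "chunk l xs q = take l (drop (q * l) xs)"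

lemma length_chunk: "Suc q * l \<le> length xs ==> length (chunk l xs q) = l"
  by (simp add: chunk_def)

lemma concat_chunks:
  "(a + c) * l \<le> length xs ==> concat (map (chunk l xs) [a..<a + c]) = take (c * l) (drop (a * l) xs)"
proof (induction c)
  case (Suc c)
  have IH: "concat (map (chunk l xs) [a..<a + c]) = take (c * l) (drop (a * l) xs)" using Suc by simp
  have ch: "chunk l xs (a + c) = take l (drop (c * l) (drop (a * l) xs))" by (simp add: chunk_def algebra_simps)
  have "concat (map (chunk l xs) [a..<a + Suc c]) = take (c * l) (drop (a * l) xs) @ take l (drop (c * l) (drop (a * l) xs))"
    by (simp add: IH ch)
  also have "\<dots> = take (c * l + l) (drop (a * l) xs)" by (simp only: take_add)
  finally show ?case by (simp add: add.commute)
qed simp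

lemma concat_chunks0: "length xs = c * l ==> concat (map (chunk l xs) [0..<c]) = xs"
  using concat_chunks[of 0 c l xs] by simp

lemma chunk_concat:
  "(\<And>x. x \<in> set xss ==> length x = l) ==> q < length xss ==> chunk l (concat xss) q = xss ! q"
proof (induction xss arbitrary: q)
  case (Cons x xss)
  show ?case
  proof (cases q)
    case 0
    then show ?thesis using Cons.prems(1)[of x] by (simp add: chunk_def)
  next
    case (Suc r)
    then show ?thesis using Cons by (simp add: chunk_def)
  qed
qed simp

lemma chunk_put_range:
  assumes "length ys = l" "Suc q * l \<le> length xs"
  shows "chunk l (put_range xs (q * l) ys) q' = (if q' = q then ys else chunk l xs q')"
proof (cases "q' = q")
  case True
  then show ?thesis using assms by (simp add: chunk_def put_range_def)
next
  case False
  show ?thesis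
  proof (cases "q' < q")
    case True
    then have "Suc q' * l \<le> q * l" by (intro mult_le_mono1) simp
    then have le: "q' * l + l \<le> q * l" by simp
    then have "take l (drop (q' * l) (take (q * l) xs)) = take l (drop (q' * l) xs)"
      by (simp add: drop_take min_def)
    then show ?thesis using assms le False by (simp add: chunk_def put_range_def drop_append)
  next
    case F2: False
    then have "Suc q * l \<le> q' * l" using False by (intro mult_le_mono1) simp
    then have le: "q * l + l \<le> q' * l" by simp
    have qq: "q * l \<le> q' * l" using le by linarith
    have z: "q * l - q' * l = 0" "drop (q' * l) (take (q * l) xs) = []" using qq min.coboundedI2[OF qq, of "length xs"] by (simp_all del: mult_le_cancel2)
    show ?thesis using assms False le by (simp add: chunk_def put_range_def drop_append z)
  qed
qed

lemma length_put_range: "loc + length ys \<le> length xs ==> length (put_range xs loc ys) = length xs"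
  by (simp add: put_range_def)

lemma nth_chunks_eq:
  assumes "length xs = c * l" "length ys = c * l" "\<And>q. q < c ==> chunk l xs q = chunk l ys q"
  shows "xs = ys"
proof -
  have "map (chunk l xs) [0..<c] = map (chunk l ys) [0..<c]" using assms(3) by simp
  then show ?thesis using concat_chunks0[OF assms(1)] concat_chunks0[OF assms(2)] by metis
qed

lemma seq_pmf_append: "seq_pmf (ps @ qs) = bind_pmf (seq_pmf ps) (\<lambda>a. map_pmf (\<lambda>b. a @ b) (seq_pmf qs))"
proof (induction ps)
  case Nil
  have "(@) [] = (\<lambda>x :: 'a list. x)" by auto
  then show ?case by (simp add: bind_return_pmf)
next
  case (Cons p ps)
  have "(@) (x # xa) = (\<lambda>b. x # xa @ b)" for x :: 'a and xa by auto
  then show ?case using Cons by (simp add: bind_assoc_pmf map_bind_pmf bind_map_pmf pmf.map_comp o_def)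
qed

lemma set_seq_pmf: "xs \<in> set_pmf (seq_pmf ps) \<longleftrightarrow> list_all2 (\<lambda>x p. x \<in> set_pmf p) xs ps"
  by (induction ps arbitrary: xs) (auto simp: list_all2_Cons2)

lemma seq_pmf_length: "xs \<in> set_pmf (seq_pmf ps) ==> length xs = length ps"
  by (auto simp: set_seq_pmf dest: list_all2_lengthD)

lemma enc_elems_append: "enc_elems E k key n (xs @ ys) =
    bind_pmf (enc_elems E k key n xs) (\<lambda>a. map_pmf (\<lambda>b. a @ b) (enc_elems E k key n ys))"
  by (simp add: enc_elems_def enc_all_def seq_pmf_append)

lemma enc_elems_Nil [simp]: "enc_elems E k key n [] = return_pmf []"
  by (simp add: enc_elems_def enc_all_def)

lemma enc_elems_length: "cs \<in> set_pmf (enc_elems E k key n es) ==> length cs = length es"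
  by (auto simp: enc_elems_def enc_all_def dest: seq_pmf_length)

text \<open>Encryptions are independent, so encrypting batches of equal length separately is the
  same as encrypting their concatenation and cutting the ciphertexts into chunks.\<close>

lemma seq_chunks:
  assumes "\<And>x. x \<in> set Ls ==> length x = l"
  shows "seq_pmf (map (enc_elems E k key n) Ls) =
    map_pmf (\<lambda>cs. map (chunk l cs) [0..<length Ls]) (enc_elems E k key n (concat Ls))"
proof -
  have cc: "map_pmf concat (seq_pmf (map (enc_elems E k key n) Ls)) = enc_elems E k key n (concat Ls)"
  proof (induction Ls)
    case (Cons L Ls)
    show ?case by (simp add: enc_elems_append map_bind_pmf pmf.map_comp o_def Cons[symmetric])
  qed simp
  have "map_pmf (\<lambda>cs. map (chunk l cs) [0..<length Ls]) (enc_elems E k key n (concat Ls)) =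
     map_pmf (\<lambda>css. map (chunk l (concat css)) [0..<length Ls]) (seq_pmf (map (enc_elems E k key n) Ls))"
    unfolding cc[symmetric] by (simp add: pmf.map_comp o_def)
  also have "\<dots> = map_pmf (\<lambda>css. css) (seq_pmf (map (enc_elems E k key n) Ls))"
  proof (rule map_pmf_cong[OF refl])
    fix css assume c: "css \<in> set_pmf (seq_pmf (map (enc_elems E k key n) Ls))"
    then have la: "list_all2 (\<lambda>c L. c \<in> set_pmf (enc_elems E k key n L)) css Ls"
      by (simp add: set_seq_pmf list_all2_map2)
    have len: "length css = length Ls" using la by (rule list_all2_lengthD)
    have "length c = l" if c: "c \<in> set css" for c
    proof -
      obtain i where "i < length css" "c = css ! i" using c by (auto simp: in_set_conv_nth)
      then have "c \<in> set_pmf (enc_elems E k key n (Ls ! i))" "Ls ! i \<in> set Ls"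
        using list_all2_nthD[OF la] len by auto
      then show ?thesis using assms enc_elems_length by metis
    qed
    then show "map (chunk l (concat css)) [0..<length Ls] = css"
      using len by (intro nth_equalityI) (auto simp: chunk_concat)
  qed
  finally show ?thesis by simp
qed

text \<open>If the randomness of a round does not depend on the state of the server, that of all
  rounds can be drawn in advance. \<open>Ok\<close> is an invariant of the server under which the
  rounds have this form.\<close>

lemma for_each_seq:
  fixes f :: "'x => unit client"
  assumes "\<And>i sv tr. i \<in> set is ==> Ok sv ==> f i (sv, tr) = map_pmf (\<lambda>c. (Some (), U i c sv, tr @ tri i c)) (P i)"
    and "\<And>i sv c. i \<in> set is ==> Ok sv ==> c \<in> set_pmf (P i) ==> Ok (U i c sv)"
  shows "Ok sv ==> for_each f is (sv, tr) =
    map_pmf (\<lambda>css. (Some (), fold (\<lambda>(i, c). U i c) (zip is css) sv, tr @ concat (map (\<lambda>(i, c). tri i c) (zip is css))))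
      (seq_pmf (map P is))"
  using assms
proof (induction "is" arbitrary: sv tr)
  case Nil
  then show ?case by (simp add: return_client_def)
next
  case (Cons i "is")
  have "for_each f (i # is) (sv, tr) = bind_pmf (P i) (\<lambda>c. for_each f is (U i c sv, tr @ tri i c))"
    using Cons.prems by (simp add: bind_client_def bind_map_pmf)
  also have "\<dots> = bind_pmf (P i) (\<lambda>c. map_pmf (\<lambda>css. (Some (), fold (\<lambda>(i, c). U i c) (zip is css) (U i c sv),
      (tr @ tri i c) @ concat (map (\<lambda>(i, c). tri i c) (zip is css)))) (seq_pmf (map P is)))"
    by (rule bind_pmf_cong[OF refl], rule Cons.IH) (use Cons.prems in auto)
  also have "\<dots> = map_pmf (\<lambda>css. (Some (), fold (\<lambda>(i, c). U i c) (zip (i # is) css) sv, tr @ concat (map (\<lambda>(i, c). tri i c) (zip (i # is) css))))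
      (seq_pmf (map P (i # is)))"
    by (simp add: map_bind_pmf pmf.map_comp o_def)
  finally show ?case .
qed

text \<open>Earlier rounds either fail themselves or preserve \<open>Ok\<close>, and round
  \<open>i0\<close> fails from every such state.\<close>

lemma for_each_fail:
  fixes f :: "'x => unit client"
  assumes "\<And>i sv tr r sv' tr'. i \<in> set is ==> Ok sv ==> (r, sv', tr') \<in> set_pmf (f i (sv, tr)) ==> r \<noteq> None ==> Ok sv'"
    and "i0 \<in> set is" "\<And>sv tr r sv' tr'. Ok sv ==> (r, sv', tr') \<in> set_pmf (f i0 (sv, tr)) ==> r = None"
  shows "Ok sv ==> (r, sv', tr') \<in> set_pmf (for_each f is (sv, tr)) ==> r = None"
  using assms
proof (induction "is" arbitrary: sv tr)
  case (Cons i "is")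
  from Cons.prems(2) obtain r1 sv1 tr1 where 1: "(r1, sv1, tr1) \<in> set_pmf (f i (sv, tr))"
    "(r, sv', tr') \<in> set_pmf (case r1 of None => return_pmf (None, sv1, tr1) | Some x => for_each f is (sv1, tr1))"
    by (auto simp: bind_client_def)
  show ?case
  proof (cases r1)
    case (Some x)
    have Ok: "Ok sv1" using Cons.prems(3)[OF _ Cons.prems(1) 1(1)] Some by simp
    have "i \<noteq> i0" using Cons.prems(5)[OF Cons.prems(1)] 1(1) Some by auto
    then have i0: "i0 \<in> set is" using Cons.prems(4) by simp
    show ?thesis
    proof (rule Cons.IH[OF Ok _ _ i0])
      show "(r, sv', tr') \<in> set_pmf (for_each f is (sv1, tr1))" using 1 Some by simp
      show "Ok sv'" if "i \<in> set is" "Ok sv" "(r, sv', tr') \<in> set_pmf (f i (sv, tr))" "r \<noteq> None" for i sv tr r sv' tr'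
        using Cons.prems(3)[OF _ that(2,3,4)] that(1) by simp
      show "r = None" if "Ok sv" "(r, sv', tr') \<in> set_pmf (f i0 (sv, tr))" for sv tr r sv' tr'
        using Cons.prems(5)[OF that] .
    qed
  qed (use 1 in simp)
qed simp

section \<open>The plaintexts written by a shuffle and its transcript\<close>

definition in_bucket :: "nat => (nat => nat) => nat => elem => bool" where
  "in_bucket s \<rho> j e \<longleftrightarrow> j * s \<le> \<rho> (fst e) - 1 \<and> \<rho> (fst e) - 1 < j * s + s"

definition batch :: "nat => (nat => nat) => elem list => nat => nat => elem list" where
  "batch s \<rho> es i j = filter (in_bucket s \<rho> j) (chunk s es i)"

definition overflow :: "nat => nat => (nat => nat) => elem list => bool" where
  "overflow s m \<rho> es \<longleftrightarrow> (\<exists>i \<in> set [0..<s]. \<exists>j \<in> set [0..<s]. m < length (batch s \<rho> es i j))"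

definition padded :: "nat => nat => nat => (nat => nat) => elem list => nat => nat => elem list" where
  "padded s m w \<rho> es i j = batch s \<rho> es i j @ replicate (m - length (batch s \<rho> es i j)) (0, replicate w False)"

definition row :: "nat => nat => nat => (nat => nat) => elem list => nat => elem list" where
  "row s m w \<rho> es i = concat (map (padded s m w \<rho> es i) [0..<s])"

text \<open>Sorting by position, as a bucket sort with one bucket per position. The range from
  \<open>0\<close> to \<open>n\<close> gives the effect of a whole pass.\<close>

definition seg :: "(nat => nat) => elem list => nat => nat => elem list" where
  "seg \<rho> es a b = concat (map (\<lambda>q. filter (\<lambda>e. \<rho> (fst e) = Suc q) es) [a..<b])"

definition tmp_plan :: "nat => nat => nat => (nat => nat) => elem list => elem list" where
  "tmp_plan s m w \<rho> es = concat (map (row s m w \<rho> es) [0..<s])"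

text \<open>The order is that in which the client encrypts: temporary and output array of the first
  pass, then those of the second, whose input is the array arranged by
  \<open>\<rho>1\<close>.\<close>

definition plan :: "nat => nat => nat => (nat => nat) => (nat => nat) => elem list => elem list option" where
  "plan s m w \<rho>1 \<rho>2 es =
     (if overflow s m \<rho>1 es then None
      else if overflow s m \<rho>2 (seg \<rho>1 es 0 (s * s)) then None
      else Some ((tmp_plan s m w \<rho>1 es @ seg \<rho>1 es 0 (s * s)) @
        tmp_plan s m w \<rho>2 (seg \<rho>1 es 0 (s * s)) @ seg \<rho>2 (seg \<rho>1 es 0 (s * s)) 0 (s * s)))"

text \<open>The temporary array is a matrix of batches that is written by rows and read by columns:
  batch \<open>j\<close> of row \<open>i\<close> is chunk \<open>i * s + j\<close> of the
  ciphertexts \<open>ct\<close>, but it is stored at place \<open>j * s + i\<close>.\<close>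

definition pass_view :: "nat => nat => arr => data list => data list => data list => transcript" where
  "pass_view s m I C ct co =
     concat (map (\<lambda>i.
        [(GetRange I (i * s) s, Elements (chunk s C i)),
         (PutRangeDist TmpArr (map (\<lambda>j. (j * (s * m) + i * m, chunk m ct (i * s + j))) [0..<s]), Ack)]) [0..<s]) @
     concat (map (\<lambda>j.
        [(GetRange TmpArr (j * (s * m)) (s * m), Elements (concat (map (\<lambda>i. chunk m ct (i * s + j)) [0..<s]))),
         (PutRange OutArr (j * s) (chunk s co j), Ack)]) [0..<s])"

definition view :: "nat => nat => data list => data list => data list option \<times> transcript" where
  "view s m C cs =
     (let L = s * s * m; n = s * s;
          ct1 = take L cs; co1 = take n (drop L cs); ct2 = take L (drop (L + n) cs); co2 = drop (L + n + L) cs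
      in (Some co2, pass_view s m InArr C ct1 co1 @ pass_view s m OutArr co1 ct2 co2))"

lemma mset_seg: "mset (seg \<rho> es a b) = mset (filter (\<lambda>e. a < \<rho> (fst e) \<and> \<rho> (fst e) \<le> b) es)"
proof (cases "a \<le> b")
  case True
  then show ?thesis
  proof (induction b rule: dec_induct)
    case base
    then show ?case by (simp add: seg_def filter_False)
  next
    case (step b)
    have "mset (filter (\<lambda>e. a < \<rho> (fst e) \<and> \<rho> (fst e) \<le> Suc b) es) =
        mset (filter (\<lambda>e. a < \<rho> (fst e) \<and> \<rho> (fst e) \<le> b) es) + mset (filter (\<lambda>e. \<rho> (fst e) = Suc b) es)"
      using step(1) by (induction es) auto
    then show ?case using step by (simp add: seg_def)
  qed
next
  case False
  then have "filter (\<lambda>e. a < \<rho> (fst e) \<and> \<rho> (fst e) \<le> b) es = []" by (auto simp: filter_empty_conv)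
  then show ?thesis using False by (simp add: seg_def)
qed

lemma sorted_seg: "sorted (map (\<lambda>e. \<rho> (fst e)) (seg \<rho> es a b))"
proof (cases "a \<le> b")
  case True
  then show ?thesis
  proof (induction b rule: dec_induct)
    case (step b)
    have "sorted (map (\<lambda>e. \<rho> (fst e)) (filter (\<lambda>e. \<rho> (fst e) = Suc b) es))"
      by (induction es) auto
    moreover have "\<rho> (fst e) \<le> b" if "e \<in> set (seg \<rho> es a b)" for e
      using that by (auto simp: seg_def)
    ultimately show ?case using step
      by (simp add: seg_def sorted_append)
  qed (simp add: seg_def)
qed (simp add: seg_def)

lemma valid_inj:
  assumes "valid_array n w es" "\<rho> permutes {1..n}"
  shows "inj_on (\<lambda>e. \<rho> (fst e)) (set es)"
  using assms(1) permutes_inj[OF assms(2)] by (auto simp: valid_array_def distinct_map inj_on_def dest: injD)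

lemma valid_keys: assumes "valid_array n w es" shows "fst ` set es = {1..n}"
proof (rule card_subset_eq)
  show "fst ` set es \<subseteq> {1..n}" using assms by (auto simp: valid_array_def)
  show "card (fst ` set es) = card {1..n}" using assms distinct_card[of "map fst es"] by (simp add: valid_array_def)
qed simp

lemma valid_pos:
  assumes "valid_array n w es" "\<rho> permutes {1..n}" "e \<in> set es"
  shows "1 \<le> \<rho> (fst e) \<and> \<rho> (fst e) \<le> n"
  using assms permutes_in_image[OF assms(2), of "fst e"] by (auto simp: valid_array_def)

lemma valid_single:
  assumes "valid_array n w es" "\<rho> permutes {1..n}" "q < n"
  shows "\<exists>e \<in> set es. filter (\<lambda>e. \<rho> (fst e) = Suc q) es = [e] \<and> \<rho> (fst e) = Suc q"
proof -
  obtain x where x: "x \<in> {1..n}" "\<rho> x = Suc q"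
    using permutes_image[OF assms(2)] assms(3) by (metis Suc_le_eq atLeastAtMost_iff imageE le_add1 plus_1_eq_Suc)
  then have "x \<in> fst ` set es" using valid_keys[OF assms(1)] by simp
  then obtain e where e: "e \<in> set es" "fst e = x" by (metis imageE)
  have d: "distinct es" using assms(1) by (auto simp: valid_array_def distinct_map)
  let ?F = "filter (\<lambda>e. \<rho> (fst e) = Suc q) es"
  have F: "set ?F = {e}" using e x valid_inj[OF assms(1,2)] by (auto simp: inj_on_def)
  have "length ?F = 1" using distinct_card[OF distinct_filter[OF d], of "\<lambda>e. \<rho> (fst e) = Suc q"] F by simp
  then obtain e' where "?F = [e']" by (auto simp: length_Suc_conv)
  then have "?F = [e]" using F by simp
  then show ?thesis using e x by auto
qed

lemma length_seg:
  assumes "valid_array n w es" "\<rho> permutes {1..n}" "b \<le> n"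
  shows "length (seg \<rho> es a b) = b - a"
proof -
  have "length (seg \<rho> es a b) = (\<Sum>q\<leftarrow>[a..<b]. length (filter (\<lambda>e. \<rho> (fst e) = Suc q) es))"
    by (simp add: seg_def length_concat o_def)
  also have "map (\<lambda>q. length (filter (\<lambda>e. \<rho> (fst e) = Suc q) es)) [a..<b] = map (\<lambda>_. 1) [a..<b]"
  proof (rule map_cong[OF refl])
    fix q assume "q \<in> set [a..<b]"
    then obtain e where "filter (\<lambda>e. \<rho> (fst e) = Suc q) es = [e]" using valid_single[OF assms(1,2), of q] assms(3) by auto
    then show "length (filter (\<lambda>e. \<rho> (fst e) = Suc q) es) = 1" by simp
  qed
  finally show ?thesis by (simp add: map_replicate_const sum_list_replicate)
qed

lemma mset_seg_all:
  assumes "valid_array n w es" "\<rho> permutes {1..n}"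
  shows "mset (seg \<rho> es 0 n) = mset es"
proof -
  have "filter (\<lambda>e. 0 < \<rho> (fst e) \<and> \<rho> (fst e) \<le> n) es = es"
    using valid_pos[OF assms] by (auto intro!: filter_True simp: Suc_le_eq)
  then show ?thesis by (simp add: mset_seg)
qed

lemma valid_seg:
  assumes "valid_array n w es" "\<rho> permutes {1..n}"
  shows "valid_array n w (seg \<rho> es 0 n)"
proof -
  have ms: "mset (seg \<rho> es 0 n) = mset es" by (rule mset_seg_all[OF assms])
  then have "mset (map fst (seg \<rho> es 0 n)) = mset (map fst es)" by simp
  then have "distinct (map fst (seg \<rho> es 0 n)) = distinct (map fst es)" by (rule mset_eq_imp_distinct_iff)
  moreover have "set (seg \<rho> es 0 n) = set es" using ms by (rule mset_eq_setD)
  moreover have "length (seg \<rho> es 0 n) = length es" using ms by (rule mset_eq_length)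
  ultimately show ?thesis using assms(1) by (simp add: valid_array_def)
qed

lemma concat_singles: "(\<And>q. q \<in> set xs ==> F q = [h q]) ==> concat (map F xs) = map h xs"
  by (induction xs) auto

lemma nth_seg:
  assumes "valid_array n w es" "\<rho> permutes {1..n}" "i < n"
  shows "\<rho> (fst (seg \<rho> es 0 n ! i)) = Suc i"
proof -
  have "seg \<rho> es 0 n = map (\<lambda>q. hd (filter (\<lambda>e. \<rho> (fst e) = Suc q) es)) [0..<n]"
    unfolding seg_def
  proof (rule concat_singles)
    fix q assume "q \<in> set [0..<n]"
    then obtain e where "filter (\<lambda>e. \<rho> (fst e) = Suc q) es = [e]" using valid_single[OF assms(1,2), of q] by auto
    then show "filter (\<lambda>e. \<rho> (fst e) = Suc q) es = [hd (filter (\<lambda>e. \<rho> (fst e) = Suc q) es)]" by simp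
  qed
  moreover obtain e where "filter (\<lambda>e. \<rho> (fst e) = Suc i) es = [e]" "\<rho> (fst e) = Suc i"
    using valid_single[OF assms] by blast
  ultimately show ?thesis using assms(3) by simp
qed

lemma arranged_seg:
  assumes "valid_array n w es" "\<rho> permutes {1..n}"
  shows "arranged \<rho> (seg \<rho> es 0 n)"
  using nth_seg[OF assms] length_seg[OF assms, of n 0] by (simp add: arranged_def)

text \<open>\<open>in_bucket\<close> uses comparisons because the plan is also computed by the
  reduction, where a division would have to be programmed.\<close>

lemma in_bucket_div:
  assumes "0 < s" "1 \<le> \<rho> (fst e)"
  shows "in_bucket s \<rho> j e \<longleftrightarrow> (\<rho> (fst e) - 1) div s = j"
proof
  assume "in_bucket s \<rho> j e"
  then show "(\<rho> (fst e) - 1) div s = j" unfolding in_bucket_def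
    by (intro div_nat_eqI) (auto simp: mult.commute)
next
  assume "(\<rho> (fst e) - 1) div s = j"
  then show "in_bucket s \<rho> j e" unfolding in_bucket_def
    using div_times_less_eq_dividend[of "\<rho> (fst e) - 1" s] dividend_less_div_times[OF assms(1), of "\<rho> (fst e) - 1"] by auto
qed

lemma length_padded:
  "\<not> overflow s m \<rho> es ==> i < s ==> j < s ==> length (padded s m w \<rho> es i j) = m"
  unfolding overflow_def padded_def by (auto simp: not_less)

lemma length_row: "\<not> overflow s m \<rho> es ==> i < s ==> length (row s m w \<rho> es i) = s * m"
proof -
  assume a: "\<not> overflow s m \<rho> es" "i < s"
  have "map (\<lambda>j. length (padded s m w \<rho> es i j)) [0..<s] = map (\<lambda>_. m) [0..<s]" using a by (simp add: length_padded)
  then show ?thesis by (simp add: row_def length_concat o_def map_replicate_const sum_list_replicate)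
qed

lemma length_tmp_plan: "\<not> overflow s m \<rho> es ==> length (tmp_plan s m w \<rho> es) = s * s * m"
proof -
  assume a: "\<not> overflow s m \<rho> es"
  have "map (\<lambda>i. length (row s m w \<rho> es i)) [0..<s] = map (\<lambda>_. s * m) [0..<s]" using a by (simp add: length_row)
  then show ?thesis by (simp add: tmp_plan_def length_concat o_def map_replicate_const sum_list_replicate)
qed

text \<open>The batches for bucket \<open>j\<close>, taken over all rows and without dummies,
  contain the elements of the array with a position in that bucket. Positions are distinct, so the
  sorted arrangement of this multiset is unique, and \<open>seg\<close> is one.\<close>

lemma sort_bucket:
  assumes "valid_array (s * s) w es" "\<rho> permutes {1..s * s}" "j < s"
  shows "sort_key (\<lambda>(x, v). \<rho> x) (filter (\<lambda>(x, v). x \<noteq> 0) (concat (map (\<lambda>i. padded s m w \<rho> es i j) [0..<s]))) = seg \<rho> es (j * s) (j * s + s)"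
proof -
  have s: "0 < s" using assms(3) by simp
  have nz: "fst e \<noteq> 0" if "e \<in> set es" for e using that assms(1) by (auto simp: valid_array_def)
  have sub: "set (chunk s es i) \<subseteq> set es" for i unfolding chunk_def by (meson set_drop_subset set_take_subset subset_trans)
  have "filter (\<lambda>(x, v). x \<noteq> 0) (padded s m w \<rho> es i j) = batch s \<rho> es i j" for i
  proof -
    have "filter (\<lambda>(x, v). x \<noteq> 0) (batch s \<rho> es i j) = batch s \<rho> es i j"
      using nz sub[of i] by (intro filter_True) (fastforce simp: batch_def)
    then show ?thesis by (simp add: padded_def)
  qed
  then have "filter (\<lambda>(x, v). x \<noteq> 0) (concat (map (\<lambda>i. padded s m w \<rho> es i j) [0..<s])) = concat (map (\<lambda>i. batch s \<rho> es i j) [0..<s])"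
    by (simp add: filter_concat o_def)
  also have "\<dots> = filter (in_bucket s \<rho> j) (concat (map (chunk s es) [0..<s]))"
    by (simp add: batch_def filter_concat o_def)
  also have "concat (map (chunk s es) [0..<s]) = es" using assms(1) by (intro concat_chunks0) (simp add: valid_array_def)
  finally have 1: "filter (\<lambda>(x, v). x \<noteq> 0) (concat (map (\<lambda>i. padded s m w \<rho> es i j) [0..<s])) = filter (in_bucket s \<rho> j) es" .
  have "in_bucket s \<rho> j e \<longleftrightarrow> j * s < \<rho> (fst e) \<and> \<rho> (fst e) \<le> j * s + s" if "e \<in> set es" for e
    using valid_pos[OF assms(1,2) that] by (auto simp: in_bucket_def)
  then have 2: "filter (in_bucket s \<rho> j) es = filter (\<lambda>e. j * s < \<rho> (fst e) \<and> \<rho> (fst e) \<le> j * s + s) es"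
    by (intro filter_cong) auto
  have k: "(\<lambda>(x, v). \<rho> x) = (\<lambda>e :: elem. \<rho> (fst e))" by auto
  show ?thesis unfolding 1 2 k
    by (rule sort_key_inj_key_eq) (auto simp: mset_seg sorted_seg intro: inj_on_subset[OF valid_inj[OF assms(1,2)]])
qed

lemma less_key_width: "x \<le> n ==> x < 2 ^ key_width n"
proof -
  assume x: "x \<le> n"
  have "n < 2 ^ Suc (floor_log n)"
    using floor_log_exp2_gt[of n] by (cases "n = 0") auto
  then show ?thesis using x by (simp add: key_width_def)
qed

lemma bits_elem_bits: "fst e \<le> n ==> bits_elem n (elem_bits n e) = e"
  by (cases e) (simp add: bits_elem_def horner_sum_bit_eq_take_bit take_bit_nat_eq_self less_key_width)

lemma map_chunk: "map f (chunk l xs q) = chunk l (map f xs) q"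
  by (simp add: chunk_def take_map drop_map)

lemma chunk_chunk: assumes "j < s" shows "chunk m (chunk (s * m) xs i) j = chunk m xs (i * s + j)"
proof -
  have "j * m + m \<le> s * m" using mult_le_mono1[of "Suc j" s m] assms by simp
  then have "min m (s * m - j * m) = m" by linarith
  then show ?thesis by (simp add: chunk_def take_drop[symmetric] drop_take algebra_simps)
qed

text \<open>The value written depends only on the place, so order and repetition of the writes have
  no influence.\<close>

lemma fold_put_range:
  assumes "\<And>q ys. (q, ys) \<in> set qs ==> ys = val q \<and> length ys = m \<and> Suc q * m \<le> length X"
  shows "length (fold (\<lambda>(q, ys) xs. put_range xs (q * m) ys) qs X) = length X \<and>
    chunk m (fold (\<lambda>(q, ys) xs. put_range xs (q * m) ys) qs X) q' = (if q' \<in> fst ` set qs then val q' else chunk m X q')"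
  using assms
proof (induction qs arbitrary: X)
  case (Cons a qs)
  obtain q ys where a: "a = (q, ys)" by (cases a)
  have q: "ys = val q" "length ys = m" "Suc q * m \<le> length X" using Cons.prems[of q ys] a by auto
  have len: "length (put_range X (q * m) ys) = length X" using q by (intro length_put_range) simp
  have IH: "length (fold (\<lambda>(q, ys) xs. put_range xs (q * m) ys) qs (put_range X (q * m) ys)) = length (put_range X (q * m) ys) \<and>
    chunk m (fold (\<lambda>(q, ys) xs. put_range xs (q * m) ys) qs (put_range X (q * m) ys)) q' =
     (if q' \<in> fst ` set qs then val q' else chunk m (put_range X (q * m) ys) q')"
    by (rule Cons.IH) (use Cons.prems len in auto)
  show ?case using IH len q a by (auto simp: chunk_put_range)
qed simp

lemma seg_append: "a \<le> b ==> b \<le> c ==> seg \<rho> es a b @ seg \<rho> es b c = seg \<rho> es a c"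
  using upt_add_eq_append[of a b "c - b"] by (simp add: seg_def)

lemma concat_segs: "concat (map (\<lambda>j. seg \<rho> es (j * s) (j * s + s)) [0..<c]) = seg \<rho> es 0 (c * s)"
proof (induction c)
  case (Suc c)
  then have "concat (map (\<lambda>j. seg \<rho> es (j * s) (j * s + s)) [0..<Suc c]) = seg \<rho> es 0 (c * s) @ seg \<rho> es (c * s) (c * s + s)"
    by simp
  also have "\<dots> = seg \<rho> es 0 (c * s + s)" by (rule seg_append) auto
  finally show ?case by (simp add: add.commute)
qed (simp add: seg_def)

lemma enc_elems_dec:
  assumes "symmetric_encryption E" "key \<in> set_pmf (gen E k)" "cs \<in> set_pmf (enc_elems E k key n es)"
  shows "encrypts_array E k key n es cs"
proof -
  have "list_all2 (\<lambda>c e. c \<in> set_pmf (enc E k key (elem_bits n e))) cs es"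
    using assms(3) by (simp add: enc_elems_def enc_all_def set_seq_pmf list_all2_map2)
  then have "list_all2 (\<lambda>e c. dec E k key c = Some (elem_bits n e)) es cs"
    using assms(1,2) unfolding symmetric_encryption_def
    by (auto simp: list_all2_conv_all_nth)
  then show ?thesis by (simp add: encrypts_array_def)
qed

lemma map_dec_elem:
  assumes "encrypts_array E k key n es cs" "\<And>e. e \<in> set es ==> fst e \<le> n"
  shows "map (dec_elem E k key n) cs = es"
proof (rule nth_equalityI)
  show "length (map (dec_elem E k key n) cs) = length es"
    using assms(1) by (auto simp: encrypts_array_def dest: list_all2_lengthD)
  fix i assume "i < length (map (dec_elem E k key n) cs)"
  then have "i < length es" "dec E k key (cs ! i) = Some (elem_bits n (es ! i))"
    using assms(1) by (auto simp: encrypts_array_def list_all2_conv_all_nth)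
  then show "map (dec_elem E k key n) cs ! i = es ! i"
    using assms(2)[of "es ! i"] assms(1)
    by (auto simp: dec_elem_def bits_elem_bits encrypts_array_def dest: list_all2_lengthD simp del: elem_bits.simps)
qed

section \<open>The arrays on the server during a pass\<close>

definition put_row :: "nat => nat => nat => data list => (nat \<times> data list) list" where
  "put_row s m i c = map (\<lambda>j. (j * (s * m) + i * m, chunk m c j)) [0..<s]"

definition put_all :: "(nat \<times> data list) list => data list => data list" where
  "put_all rs X = fold (\<lambda>(loc, ys) xs. put_range xs loc ys) rs X"

definition tmp_arr :: "nat => nat => data list => data list => data list" where
  "tmp_arr s m ct X = fold (\<lambda>i. put_all (put_row s m i (chunk (s * m) ct i))) [0..<s] X"

lemma put_row_mult: "map (\<lambda>(q, ys). (q * m, ys)) (map (\<lambda>j. (j * s + i, chunk m c j)) [0..<s]) = put_row s m i c"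
  by (simp add: put_row_def algebra_simps)

lemma fold_fst_mult: "fold (\<lambda>(q, ys) xs. put_range xs (q * m) ys) qs X = put_all (map (\<lambda>(q, ys). (q * m, ys)) qs) X"
  unfolding put_all_def by (induction qs arbitrary: X) auto

lemma tmp_arr:
  assumes "length ct = s * s * m" "length X = s * s * m"
  shows "length (tmp_arr s m ct X) = s * s * m"
    and "i < s ==> j < s ==> chunk m (tmp_arr s m ct X) (j * s + i) = chunk m ct (i * s + j)"
proof -
  let ?qs = "concat (map (\<lambda>i. map (\<lambda>j. (j * s + i, chunk m ct (i * s + j))) [0..<s]) [0..<s])"
  \<comment> \<open>Transposition of the matrix of batches: place \<open>j * s + i\<close> receives
    chunk \<open>i * s + j\<close>.\<close>
  define val where "val q = chunk m ct ((q mod s) * s + q div s)" for q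
  have eq: "tmp_arr s m ct X = fold (\<lambda>(q, ys) xs. put_range xs (q * m) ys) ?qs X"
  proof -
    have "fold (\<lambda>i. put_all (put_row s m i (chunk (s * m) ct i))) is X = fold (\<lambda>(q, ys) xs. put_range xs (q * m) ys)
        (concat (map (\<lambda>i. map (\<lambda>j. (j * s + i, chunk m ct (i * s + j))) [0..<s]) is)) X" for "is" X
    proof (induction "is" arbitrary: X)
      case (Cons i "is")
      have "put_row s m i (chunk (s * m) ct i) = map (\<lambda>(q, ys). (q * m, ys)) (map (\<lambda>j. (j * s + i, chunk m ct (i * s + j))) [0..<s])"
        by (simp add: put_row_def chunk_chunk add_mult_distrib mult.assoc)
      then show ?case using Cons by (simp add: fold_fst_mult del: map_map)
    qed simp
    then show ?thesis by (simp add: tmp_arr_def)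
  qed
  have le: "Suc (j * s + i) * m \<le> s * s * m" if "i < s" "j < s" for i j
  proof -
    have "j * s + s \<le> s * s" using that mult_le_mono1[of "Suc j" s s] by simp
    then have "Suc (j * s + i) \<le> s * s" using that by simp
    then show ?thesis by (rule mult_le_mono1)
  qed
  have qs: "ys = val q \<and> length ys = m \<and> Suc q * m \<le> length X" if "(q, ys) \<in> set ?qs" for q ys
  proof -
    from that obtain i j where ij: "i < s" "j < s" "q = j * s + i" "ys = chunk m ct (i * s + j)" by auto
    then have "val q = ys" by (simp add: val_def)
    moreover have "length ys = m" unfolding ij(4) by (rule length_chunk) (use le[OF ij(2,1)] assms in simp)
    ultimately show ?thesis using le[OF ij(1,2)] ij(3) assms(2) by simp
  qed
  show "length (tmp_arr s m ct X) = s * s * m" unfolding eq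
    by (rule trans[OF conjunct1[OF fold_put_range[of ?qs val m X, OF qs]] assms(2)])
  show "chunk m (tmp_arr s m ct X) (j * s + i) = chunk m ct (i * s + j)" if ij: "i < s" "j < s"
  proof -
    have "j * s + i \<in> fst ` set ?qs" using ij by force
    then have "chunk m (tmp_arr s m ct X) (j * s + i) = val (j * s + i)"
      unfolding eq using conjunct2[OF fold_put_range[of ?qs val m X "j * s + i", OF qs]] by simp
    then show ?thesis using ij by (simp add: val_def)
  qed
qed

lemma put_out:
  assumes "length co = s * s" "length X = s * s"
  shows "fold (\<lambda>j X. put_range X (j * s) (chunk s co j)) [0..<s] X = co"
proof -
  let ?qs = "map (\<lambda>j. (j, chunk s co j)) [0..<s]"
  have qs: "ys = chunk s co q \<and> length ys = s \<and> Suc q * s \<le> length X" if "(q, ys) \<in> set ?qs" for q ys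
  proof -
    from that have q: "q < s" "ys = chunk s co q" by auto
    have "Suc q * s \<le> s * s" using q by (intro mult_le_mono1) simp
    then show ?thesis using q assms by (auto intro: length_chunk)
  qed
  have eq: "fold (\<lambda>j X. put_range X (j * s) (chunk s co j)) [0..<s] X = fold (\<lambda>(q, ys) xs. put_range xs (q * s) ys) ?qs X"
    by (simp add: fold_map o_def)
  show ?thesis unfolding eq
  proof (rule nth_chunks_eq[of _ s s])
    show "length (fold (\<lambda>(q, ys) xs. put_range xs (q * s) ys) ?qs X) = s * s"
      by (rule trans[OF conjunct1[OF fold_put_range[of ?qs "chunk s co" s X, OF qs]] assms(2)])
    show "chunk s (fold (\<lambda>(q, ys) xs. put_range xs (q * s) ys) ?qs X) q = chunk s co q" if "q < s" for q
      using conjunct2[OF fold_put_range[of ?qs "chunk s co" s X q, OF qs]] that by force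
  qed (rule assms(1))
qed

lemma fold_upd: "fold (\<lambda>i sv. sv(a := F i (sv a))) is sv = sv(a := fold F is (sv a))" for sv :: "'x => 'y"
  by (induction "is" arbitrary: sv) auto

lemma zip_map_self: "zip xs (map g xs) = map (\<lambda>x. (x, g x)) xs" by (induction xs) auto

section \<open>The two phases of a pass\<close>

context
  fixes E :: scheme and k :: nat and key :: data and p :: real and s w :: nat
    and n m :: nat and \<rho> :: "nat => nat" and es :: "elem list"
  assumes E: "symmetric_encryption E" "key \<in> set_pmf (gen E k)"
    and n_def: "n = s * s" and m_def: "m = batch_size p n"
    and valid: "valid_array n w es" and perm: "\<rho> permutes {1..n}"
begin

lemma floor_sqrt_n: "floor_sqrt n = s"
  using floor_sqrt_inverse_power2[of s] by (simp add: n_def power2_eq_square)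

lemma keys_le: "e \<in> set es ==> fst e \<le> n" using valid by (auto simp: valid_array_def)

definition Ok1 :: "arr => data list => server => bool" where
  "Ok1 I C sv \<longleftrightarrow> sv I = C \<and> length (sv TmpArr) = s * s * m \<and> length (sv OutArr) = n"

definition row_overflow :: "nat => bool" where
  "row_overflow i \<longleftrightarrow> (\<exists>j<s. m < length (batch s \<rho> es i j))"

lemma overflow_rows: "overflow s m \<rho> es \<longleftrightarrow> (\<exists>i<s. row_overflow i)"
  by (simp add: overflow_def row_overflow_def Bex_def)

lemma distribute_bucket_eq:
  assumes C: "encrypts_array E k key n es C" and ok: "sv I = C" and i: "i < s"
  shows "distribute_bucket E k key p n w I TmpArr \<rho> i (sv, tr) =
    (if row_overflow i then return_pmf (None, sv, tr @ [(GetRange I (i * s) s, Elements (chunk s C i))])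
     else map_pmf (\<lambda>c. (Some (), sv(TmpArr := put_all (put_row s m i c) (sv TmpArr)),
         tr @ [(GetRange I (i * s) s, Elements (chunk s C i)), (PutRangeDist TmpArr (put_row s m i c), Ack)]))
       (enc_elems E k key n (row s m w \<rho> es i)))"
proof -
  have g: "get_range (sv I) (i * s) s = chunk s C i" using ok by (simp add: get_range_def chunk_def)
  have d: "map (dec_elem E k key n) (chunk s C i) = chunk s es i"
    using map_dec_elem[OF C keys_le] by (simp add: map_chunk)
  have sub: "set (chunk s es i) \<subseteq> set es" unfolding chunk_def by (meson set_drop_subset set_take_subset subset_trans)
  have b: "filter (\<lambda>(x, v). (\<rho> x - 1) div s = j) (chunk s es i) = batch s \<rho> es i j" for j
    unfolding batch_def
  proof (rule filter_cong[OF refl])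
    fix e assume "e \<in> set (chunk s es i)"
    then have "1 \<le> \<rho> (fst e)" using sub valid_pos[OF valid perm] by blast
    then show "(case e of (x, v) => (\<rho> x - 1) div s = j) = in_bucket s \<rho> j e"
      using in_bucket_div[of s \<rho> e j] i by (cases e) auto
  qed
  show ?thesis
  proof (cases "row_overflow i")
    case True
    then have ex: "\<exists>j<s. m < length (batch s \<rho> es i j)" by (simp add: row_overflow_def)
    show ?thesis using True ex
      by (simp add: distribute_bucket_def floor_sqrt_n Let_def m_def[symmetric] bind_client_def fetch_def send_def
        return_client_def fail_client_def bind_return_pmf g d b[unfolded One_nat_def] del: length_filter_map)
  next
    case False
    then have nex: "\<not> (\<exists>j<s. m < length (batch s \<rho> es i j))" by (simp add: row_overflow_def)
    have len: "length x = m" if "x \<in> set (map (padded s m w \<rho> es i) [0..<s])" for x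
    proof -
      obtain j where j: "j < s" "x = padded s m w \<rho> es i j" using \<open>x \<in> _\<close> by auto
      then have "length (batch s \<rho> es i j) \<le> m" using nex leI by blast
      then show ?thesis using j by (simp add: padded_def)
    qed
    have sq: "seq_pmf (map (\<lambda>j. enc_elems E k key n (padded s m w \<rho> es i j)) [0..<s]) =
        map_pmf (\<lambda>cs. map (chunk m cs) [0..<s]) (enc_elems E k key n (row s m w \<rho> es i))"
      using seq_chunks[of "map (padded s m w \<rho> es i) [0..<s]" m E k key n, OF len] by (simp add: o_def row_def)
    have pr: "map (\<lambda>j. (j * (s * m) + i * m, map (chunk m c) [0..<s] ! j)) [0..<s] = put_row s m i c" for c
      by (simp add: put_row_def)
    show ?thesis using False nex
      by (simp add: distribute_bucket_def floor_sqrt_n Let_def m_def[symmetric] bind_client_def fetch_def send_def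
        return_client_def fail_client_def bind_return_pmf g d b[unfolded One_nat_def] lift_client_def bind_map_pmf pmf.map_comp o_def
        flip: padded_def[of s m w \<rho> es i] del: length_filter_map)
        (auto simp: sq bind_map_pmf pr map_pmf_def put_all_def bind_assoc_pmf bind_return_pmf)
  qed
qed

lemma distribution_eq:
  assumes C: "encrypts_array E k key n es C" and ok: "Ok1 I C sv" and I: "I \<noteq> TmpArr" and nov: "\<not> overflow s m \<rho> es"
  shows "for_each (distribute_bucket E k key p n w I TmpArr \<rho>) [0..<s] (sv, tr) =
    map_pmf (\<lambda>ct. (Some (), sv(TmpArr := tmp_arr s m ct (sv TmpArr)), tr @ concat (map (\<lambda>i.
        [(GetRange I (i * s) s, Elements (chunk s C i)),
         (PutRangeDist TmpArr (map (\<lambda>j. (j * (s * m) + i * m, chunk m ct (i * s + j))) [0..<s]), Ack)]) [0..<s])))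
      (enc_elems E k key n (tmp_plan s m w \<rho> es))"
proof -
  let ?tri = "\<lambda>i c. [(GetRange I (i * s) s, Elements (chunk s C i)), (PutRangeDist TmpArr (put_row s m i c), Ack)]"
  let ?U = "\<lambda>i c sv. sv(TmpArr := put_all (put_row s m i c) (sv TmpArr))"
  have nr: "\<not> row_overflow i" if "i < s" for i using nov that by (auto simp: overflow_rows)
  have Ok: "Ok1 I C (?U i c sv)" if "i \<in> set [0..<s]" "Ok1 I C sv" "c \<in> set_pmf (enc_elems E k key n (row s m w \<rho> es i))" for i c sv
  proof -
    have i: "i < s" using that by simp
    note ok1 = that(2)
    have lc: "length c = s * m" using enc_elems_length[OF that(3)] length_row[OF nov i] by simp
    have le: "Suc (j * s + i) * m \<le> s * s * m" if j: "j < s" for j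
    proof -
      have "j * s + s \<le> s * s" using j mult_le_mono1[of "Suc j" s s] by simp
      then have "Suc (j * s + i) \<le> s * s" using i by simp
      then show ?thesis by (rule mult_le_mono1)
    qed
    let ?qs = "map (\<lambda>j. (j * s + i, chunk m c j)) [0..<s]"
    have "ys = chunk m c (q div s) \<and> length ys = m \<and> Suc q * m \<le> length (sv TmpArr)" if q: "(q, ys) \<in> set ?qs" for q ys
    proof -
      from q obtain j where j: "j < s" "q = j * s + i" "ys = chunk m c j" by auto
      have "Suc j * m \<le> s * m" using j by (intro mult_le_mono1) simp
      then have "length ys = m" using lc j by (auto intro: length_chunk)
      then show ?thesis using j i le[OF j(1)] ok1 by (auto simp: Ok1_def)
    qed
    then have "length (put_all (map (\<lambda>(q, ys). (q * m, ys)) ?qs) (sv TmpArr)) = length (sv TmpArr)"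
      unfolding fold_fst_mult[symmetric] by (rule conjunct1[OF fold_put_range[of ?qs "\<lambda>q. chunk m c (q div s)" m "sv TmpArr"]])
    then show ?thesis using ok1 I unfolding put_row_mult by (simp add: Ok1_def)
  qed
  have "for_each (distribute_bucket E k key p n w I TmpArr \<rho>) [0..<s] (sv, tr) =
    map_pmf (\<lambda>css. (Some (), fold (\<lambda>(i, c). ?U i c) (zip [0..<s] css) sv, tr @ concat (map (\<lambda>(i, c). ?tri i c) (zip [0..<s] css))))
      (seq_pmf (map (\<lambda>i. enc_elems E k key n (row s m w \<rho> es i)) [0..<s]))"
    by (rule for_each_seq[where Ok = "Ok1 I C" and U = ?U and tri = ?tri and P = "\<lambda>i. enc_elems E k key n (row s m w \<rho> es i)", OF _ Ok ok]) (use distribute_bucket_eq[OF C] nr in \<open>auto simp: Ok1_def\<close>)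
  also have "seq_pmf (map (\<lambda>i. enc_elems E k key n (row s m w \<rho> es i)) [0..<s]) =
      map_pmf (\<lambda>ct. map (chunk (s * m) ct) [0..<s]) (enc_elems E k key n (tmp_plan s m w \<rho> es))"
  proof -
    have "length x = s * m" if "x \<in> set (map (row s m w \<rho> es) [0..<s])" for x using that length_row[OF nov] by auto
    from seq_chunks[of "map (row s m w \<rho> es) [0..<s]" "s * m" E k key n, OF this] show ?thesis
      by (simp add: o_def tmp_plan_def)
  qed
  finally have eq: "for_each (distribute_bucket E k key p n w I TmpArr \<rho>) [0..<s] (sv, tr) = map_pmf (\<lambda>css. (Some (), fold (\<lambda>(i, c). ?U i c) (zip [0..<s] css) sv, tr @ concat (map (\<lambda>(i, c). ?tri i c) (zip [0..<s] css))))
      (map_pmf (\<lambda>ct. map (chunk (s * m) ct) [0..<s]) (enc_elems E k key n (tmp_plan s m w \<rho> es)))" .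
  have per: "(Some (), fold (\<lambda>(i, c). ?U i c) (zip [0..<s] (map (chunk (s * m) ct) [0..<s])) sv,
       tr @ concat (map (\<lambda>(i, c). ?tri i c) (zip [0..<s] (map (chunk (s * m) ct) [0..<s])))) =
     (Some (), sv(TmpArr := tmp_arr s m ct (sv TmpArr)), tr @ concat (map (\<lambda>i. [(GetRange I (i * s) s, Elements (chunk s C i)),
        (PutRangeDist TmpArr (map (\<lambda>j. (j * (s * m) + i * m, chunk m ct (i * s + j))) [0..<s]), Ack)]) [0..<s]))" for ct
  proof -
    have 1: "fold (\<lambda>i sv. sv(TmpArr := put_all (put_row s m i (chunk (s * m) ct i)) (sv TmpArr))) [0..<s] sv = sv(TmpArr := tmp_arr s m ct (sv TmpArr))"
      unfolding tmp_arr_def by (rule fold_upd[of TmpArr "\<lambda>i. put_all (put_row s m i (chunk (s * m) ct i))"])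
    have 2: "put_row s m i (chunk (s * m) ct i) = map (\<lambda>j. (j * (s * m) + i * m, chunk m ct (i * s + j))) [0..<s]" for i
      by (simp add: put_row_def chunk_chunk)
    show ?thesis unfolding zip_map_self fold_map o_def prod.case 1 by (simp add: o_def 2)
  qed
  show ?thesis unfolding eq pmf.map_comp o_def per ..
qed

text \<open>Whether a row overflows is determined by the elements alone, so an overflowing row stops
  every run that gets as far as this row.\<close>

lemma distribution_fail:
  assumes C: "encrypts_array E k key n es C" and ok: "Ok1 I C sv" and I: "I \<noteq> TmpArr" and ov: "overflow s m \<rho> es"
    and r: "(r, sv', tr') \<in> set_pmf (for_each (distribute_bucket E k key p n w I TmpArr \<rho>) [0..<s] (sv, tr))"
  shows "r = None"
proof -
  obtain i0 where i0: "i0 < s" "row_overflow i0" using ov by (auto simp: overflow_rows)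
  show ?thesis
  proof (rule for_each_fail[where Ok = "\<lambda>sv. sv I = C" and ?i0.0 = i0, OF _ _ _ _ r])
    note A = distribute_bucket_eq[OF C]
    show "sv' I = C" if "i \<in> set [0..<s]" "sv I = C" "(r, sv', tr') \<in> set_pmf (distribute_bucket E k key p n w I TmpArr \<rho> i (sv, tr))" "r \<noteq> None" for i sv tr r sv' tr'
      using that A[of sv I i tr] I by (auto split: if_splits)
    show "r = None" if "sv I = C" "(r, sv', tr') \<in> set_pmf (distribute_bucket E k key p n w I TmpArr \<rho> i0 (sv, tr))" for sv tr r sv' tr'
      using that A[of sv I i0 tr] i0 by auto
  qed (use i0 ok in \<open>auto simp: Ok1_def\<close>)
qed

end

lemma bind_client_map:
  "f st = map_pmf (\<lambda>c. (Some (), A c)) P ==> bind_client f (\<lambda>_. g) st = bind_pmf P (\<lambda>c. g (A c))"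
  by (simp add: bind_client_def bind_map_pmf)

context
  fixes E :: scheme and k :: nat and key :: data and p :: real and s w :: nat
    and n m :: nat and \<rho> :: "nat => nat" and es :: "elem list"
  assumes E: "symmetric_encryption E" "key \<in> set_pmf (gen E k)"
    and n_def: "n = s * s" and m_def: "m = batch_size p n"
    and valid: "valid_array n w es" and perm: "\<rho> permutes {1..n}"
begin

lemma clean_up_eq:
  assumes nov: "\<not> overflow s m \<rho> es" and ct: "ct \<in> set_pmf (enc_elems E k key n (tmp_plan s m w \<rho> es))"
    and X: "sv TmpArr = tmp_arr s m ct X0" "length X0 = s * s * m" and O: "length (sv OutArr) = n"
  shows "for_each (clean_up_bucket E k key p n TmpArr \<rho> OutArr) [0..<s] (sv, tr) =
    map_pmf (\<lambda>co. (Some (), sv(OutArr := co), tr @ concat (map (\<lambda>j.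
        [(GetRange TmpArr (j * (s * m)) (s * m), Elements (concat (map (\<lambda>i. chunk m ct (i * s + j)) [0..<s]))),
         (PutRange OutArr (j * s) (chunk s co j), Ack)]) [0..<s])))
      (enc_elems E k key n (seg \<rho> es 0 n))"
proof -
  let ?el = "\<lambda>j. concat (map (\<lambda>i. chunk m ct (i * s + j)) [0..<s])"
  let ?tri = "\<lambda>j c. [(GetRange TmpArr (j * (s * m)) (s * m), Elements (?el j)), (PutRange OutArr (j * s) c, Ack)]"
  let ?U = "\<lambda>j c sv. sv(OutArr := put_range (sv OutArr) (j * s) c)"
  let ?P = "\<lambda>j. enc_elems E k key n (seg \<rho> es (j * s) (j * s + s))"
  let ?Ok = "\<lambda>sv'. sv' TmpArr = sv TmpArr \<and> length (sv' OutArr) = n"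
  have lct: "length ct = s * s * m" using enc_elems_length[OF ct] length_tmp_plan[OF nov] by simp
  have kt: "fst e \<le> n" if e: "e \<in> set (tmp_plan s m w \<rho> es)" for e
  proof -
    obtain i j where "e \<in> set (padded s m w \<rho> es i j)" using e by (auto simp: tmp_plan_def row_def)
    then consider "e \<in> set (chunk s es i)" | "fst e = 0" by (auto simp: padded_def batch_def)
    then show ?thesis
    proof cases
      case 1
      then have "e \<in> set es" unfolding chunk_def by (meson in_set_dropD in_set_takeD)
      then show ?thesis using valid by (auto simp: valid_array_def)
    qed simp
  qed
  have dct: "map (dec_elem E k key n) ct = tmp_plan s m w \<rho> es"
    by (rule map_dec_elem[OF enc_elems_dec[OF E ct] kt])
  have pad: "map (dec_elem E k key n) (chunk m ct (i * s + j)) = padded s m w \<rho> es i j" if "i < s" "j < s" for i j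
  proof -
    have "chunk m (tmp_plan s m w \<rho> es) (i * s + j) = chunk m (chunk (s * m) (tmp_plan s m w \<rho> es) i) j"
      using that by (simp add: chunk_chunk)
    also have "chunk (s * m) (tmp_plan s m w \<rho> es) i = map (row s m w \<rho> es) [0..<s] ! i"
      unfolding tmp_plan_def using that length_row[OF nov] by (intro chunk_concat) auto
    also have "\<dots> = row s m w \<rho> es i" using that by simp
    also have "chunk m (row s m w \<rho> es i) j = map (padded s m w \<rho> es i) [0..<s] ! j"
      unfolding row_def using that length_padded[OF nov] by (intro chunk_concat) auto
    finally show ?thesis using that by (simp add: map_chunk dct)
  qed
  have step: "clean_up_bucket E k key p n TmpArr \<rho> OutArr j (sv', tr) = map_pmf (\<lambda>c. (Some (), ?U j c sv', tr @ ?tri j c)) (?P j)"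
    if j: "j \<in> set [0..<s]" and ok: "?Ok sv'" for j sv' tr
  proof -
    have j: "j < s" using j by simp
    have le: "(j * s + s) * m \<le> s * s * m"
    proof -
      have "j * s + s \<le> s * s" using j mult_le_mono1[of "Suc j" s s] by simp
      then show ?thesis by (rule mult_le_mono1)
    qed
    have "get_range (sv' TmpArr) (j * (s * m)) (s * m) = concat (map (chunk m (sv TmpArr)) [j * s..<j * s + s])"
      using concat_chunks[of "j * s" s m "sv TmpArr"] le tmp_arr(1)[OF lct X(2)] ok X(1)
      by (simp add: get_range_def mult.assoc)
    also have "map (chunk m (sv TmpArr)) [j * s..<j * s + s] = map (\<lambda>i. chunk m (sv TmpArr) (j * s + i)) [0..<s]"
      by (rule nth_equalityI) auto
    also have "\<dots> = map (\<lambda>i. chunk m ct (i * s + j)) [0..<s]"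
      unfolding X(1) using tmp_arr(2)[OF lct X(2) _ j] by simp
    finally have g: "get_range (sv' TmpArr) (j * (s * m)) (s * m) = ?el j" .
    have "map (dec_elem E k key n) (?el j) = concat (map (\<lambda>i. padded s m w \<rho> es i j) [0..<s])"
      unfolding map_concat map_map o_def using pad j by (intro arg_cong[where f = concat] map_cong) auto
    then have so: "sort_key (\<lambda>(x, v). \<rho> x) (filter (\<lambda>(x, v). x \<noteq> 0) (map (dec_elem E k key n) (?el j))) = seg \<rho> es (j * s) (j * s + s)"
      using sort_bucket[OF valid[unfolded n_def] perm[unfolded n_def] j] by simp
    show ?thesis
      unfolding clean_up_bucket_def floor_sqrt_n[OF E n_def m_def valid perm] m_def[symmetric] Let_def
      by (simp add: bind_client_def fetch_def send_def return_client_def bind_return_pmf g lift_client_def bind_map_pmf so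
        del: filter_map map_concat neq0_conv) (simp add: map_pmf_def)
  qed
  have Ok: "?Ok (?U j c sv')" if "j \<in> set [0..<s]" "?Ok sv'" "c \<in> set_pmf (?P j)" for j sv' c
  proof -
    have j: "j < s" using that by simp
    have le: "j * s + s \<le> s * s" using j mult_le_mono1[of "Suc j" s s] by simp
    have "length c = s" using enc_elems_length[OF that(3)] length_seg[OF valid perm, of "j * s + s" "j * s"] le n_def by simp
    then show ?thesis using that(2) le n_def by (simp add: length_put_range)
  qed
  have "for_each (clean_up_bucket E k key p n TmpArr \<rho> OutArr) [0..<s] (sv, tr) =
    map_pmf (\<lambda>css. (Some (), fold (\<lambda>(i, c). ?U i c) (zip [0..<s] css) sv, tr @ concat (map (\<lambda>(i, c). ?tri i c) (zip [0..<s] css))))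
      (seq_pmf (map ?P [0..<s]))"
    by (rule for_each_seq[where Ok = ?Ok and U = ?U and tri = ?tri and P = ?P, OF step Ok]) (use O in auto)
  also have "seq_pmf (map ?P [0..<s]) = map_pmf (\<lambda>co. map (chunk s co) [0..<s]) (enc_elems E k key n (seg \<rho> es 0 n))"
  proof -
    have "length x = s" if x: "x \<in> set (map (\<lambda>j. seg \<rho> es (j * s) (j * s + s)) [0..<s])" for x
    proof -
      obtain j where j: "j < s" "x = seg \<rho> es (j * s) (j * s + s)" using x by auto
      have "j * s + s \<le> s * s" using j mult_le_mono1[of "Suc j" s s] by simp
      then show ?thesis using j length_seg[OF valid perm, of "j * s + s" "j * s"] n_def by simp
    qed
    from seq_chunks[of "map (\<lambda>j. seg \<rho> es (j * s) (j * s + s)) [0..<s]" s E k key n, OF this]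
    show ?thesis by (simp add: o_def concat_segs n_def)
  qed
  finally have eq: "for_each (clean_up_bucket E k key p n TmpArr \<rho> OutArr) [0..<s] (sv, tr) =
    map_pmf (\<lambda>css. (Some (), fold (\<lambda>(i, c). ?U i c) (zip [0..<s] css) sv, tr @ concat (map (\<lambda>(i, c). ?tri i c) (zip [0..<s] css))))
      (map_pmf (\<lambda>co. map (chunk s co) [0..<s]) (enc_elems E k key n (seg \<rho> es 0 n)))" .
  have per: "(Some (), fold (\<lambda>(i, c). ?U i c) (zip [0..<s] (map (chunk s co) [0..<s])) sv,
       tr @ concat (map (\<lambda>(i, c). ?tri i c) (zip [0..<s] (map (chunk s co) [0..<s])))) =
     (Some (), sv(OutArr := co), tr @ concat (map (\<lambda>j. ?tri j (chunk s co j)) [0..<s]))"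
    if "co \<in> set_pmf (enc_elems E k key n (seg \<rho> es 0 n))" for co
  proof -
    have lco: "length co = s * s" using enc_elems_length[OF that] length_seg[OF valid perm, of n 0] n_def by simp
    have "fold (\<lambda>j sv. sv(OutArr := put_range (sv OutArr) (j * s) (chunk s co j))) [0..<s] sv =
       sv(OutArr := fold (\<lambda>j X. put_range X (j * s) (chunk s co j)) [0..<s] (sv OutArr))"
      by (rule fold_upd[of OutArr "\<lambda>j X. put_range X (j * s) (chunk s co j)"])
    then have 1: "fold (\<lambda>j sv. sv(OutArr := put_range (sv OutArr) (j * s) (chunk s co j))) [0..<s] sv = sv(OutArr := co)"
      using put_out[OF lco] O n_def by simp
    show ?thesis unfolding zip_map_self fold_map o_def prod.case 1 by (simp add: o_def)
  qed
  show ?thesis unfolding eq pmf.map_comp o_def by (rule map_pmf_cong[OF refl per])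
qed

text \<open>\<open>T\<close> hides what is left in the temporary array; the next pass relies on its
  length only. Both phases are merged into one sequence of encryptions, which is split again at
  \<open>s * s * m\<close>.\<close>

lemma pass_eq:
  assumes C: "encrypts_array E k key n es C" and sv: "sv I = C" "length (sv TmpArr) = s * s * m" "length (sv OutArr) = n"
    and I: "I \<noteq> TmpArr" and nov: "\<not> overflow s m \<rho> es"
  shows "\<exists>T. (\<forall>ct. length ct = s * s * m \<longrightarrow> length (T ct) = s * s * m) \<and> shuffle_pass E k key p n w I TmpArr \<rho> OutArr (sv, tr) =
    map_pmf (\<lambda>c. (Some (), sv(TmpArr := T (take (s * s * m) c), OutArr := drop (s * s * m) c),
        tr @ pass_view s m I C (take (s * s * m) c) (drop (s * s * m) c)))
      (enc_elems E k key n (tmp_plan s m w \<rho> es @ seg \<rho> es 0 n))"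
proof (intro exI[of _ "\<lambda>ct. tmp_arr s m ct (sv TmpArr)"] conjI allI impI tmp_arr(1) sv(2))
  let ?L = "s * s * m"
  let ?tr1 = "\<lambda>ct. concat (map (\<lambda>i. [(GetRange I (i * s) s, Elements (chunk s C i)),
         (PutRangeDist TmpArr (map (\<lambda>j. (j * (s * m) + i * m, chunk m ct (i * s + j))) [0..<s]), Ack)]) [0..<s])"
  let ?tr2 = "\<lambda>ct co. concat (map (\<lambda>j.
        [(GetRange TmpArr (j * (s * m)) (s * m), Elements (concat (map (\<lambda>i. chunk m ct (i * s + j)) [0..<s]))),
         (PutRange OutArr (j * s) (chunk s co j), Ack)]) [0..<s])"
  have ok: "Ok1 s n m I C sv" unfolding Ok1_def[OF E n_def m_def valid perm] using sv by simp
  have "shuffle_pass E k key p n w I TmpArr \<rho> OutArr (sv, tr) =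
     bind_pmf (enc_elems E k key n (tmp_plan s m w \<rho> es)) (\<lambda>ct. for_each (clean_up_bucket E k key p n TmpArr \<rho> OutArr) [0..<s]
        (sv(TmpArr := tmp_arr s m ct (sv TmpArr)), tr @ ?tr1 ct))"
    unfolding shuffle_pass_def floor_sqrt_n[OF E n_def m_def valid perm]
    by (rule bind_client_map, rule distribution_eq[OF E n_def m_def valid perm C ok I nov])
  also have "\<dots> = bind_pmf (enc_elems E k key n (tmp_plan s m w \<rho> es)) (\<lambda>ct.
      map_pmf (\<lambda>co. (Some (), sv(TmpArr := tmp_arr s m ct (sv TmpArr), OutArr := co), (tr @ ?tr1 ct) @ ?tr2 ct co)) (enc_elems E k key n (seg \<rho> es 0 n)))"
    by (rule bind_pmf_cong[OF refl], rule clean_up_eq[OF nov _ _ sv(2)]) (use sv in auto)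
  also have "\<dots> = bind_pmf (enc_elems E k key n (tmp_plan s m w \<rho> es)) (\<lambda>ct.
      map_pmf (\<lambda>co. (Some (), sv(TmpArr := tmp_arr s m (take ?L (ct @ co)) (sv TmpArr), OutArr := drop ?L (ct @ co)),
         tr @ pass_view s m I C (take ?L (ct @ co)) (drop ?L (ct @ co)))) (enc_elems E k key n (seg \<rho> es 0 n)))"
    by (rule bind_pmf_cong[OF refl]) (use enc_elems_length length_tmp_plan[OF nov] in \<open>fastforce simp: pass_view_def\<close>)
  also have "\<dots> = map_pmf (\<lambda>c. (Some (), sv(TmpArr := tmp_arr s m (take ?L c) (sv TmpArr), OutArr := drop ?L c),
        tr @ pass_view s m I C (take ?L c) (drop ?L c))) (enc_elems E k key n (tmp_plan s m w \<rho> es @ seg \<rho> es 0 n))"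
    by (simp add: enc_elems_append map_bind_pmf pmf.map_comp o_def)
  finally show "shuffle_pass E k key p n w I TmpArr \<rho> OutArr (sv, tr) =
    map_pmf (\<lambda>c. (Some (), sv(TmpArr := tmp_arr s m (take ?L c) (sv TmpArr), OutArr := drop ?L c),
        tr @ pass_view s m I C (take ?L c) (drop ?L c))) (enc_elems E k key n (tmp_plan s m w \<rho> es @ seg \<rho> es 0 n))" .
qed

lemma pass_fail:
  assumes C: "encrypts_array E k key n es C" and sv: "sv I = C" "length (sv TmpArr) = s * s * m" "length (sv OutArr) = n"
    and I: "I \<noteq> TmpArr" and ov: "overflow s m \<rho> es"
    and r: "(r, sv', tr') \<in> set_pmf (shuffle_pass E k key p n w I TmpArr \<rho> OutArr (sv, tr))"
  shows "r = None"
proof -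
  have ok: "Ok1 s n m I C sv" unfolding Ok1_def[OF E n_def m_def valid perm] using sv by simp
  show ?thesis using r distribution_fail[OF E n_def m_def valid perm C ok I ov]
    unfolding shuffle_pass_def floor_sqrt_n[OF E n_def m_def valid perm]
    by (fastforce simp: bind_client_def split: option.splits)
qed

end

text \<open>The plaintexts are determined by \<open>\<pi>1\<close>, \<open>\<pi>\<close> and
  \<open>es\<close> before anything is encrypted, because decryption inverts encryption and
  \<open>bits_elem\<close> inverts \<open>elem_bits\<close>. Failing runs are summarised by a
  distribution \<open>\<kappa>\<close> of which only the missing output is recorded.\<close>

theorem melbourne_shuffle_plan:
  assumes E: "symmetric_encryption E" "key \<in> set_pmf (gen E k)"
    and n: "n = s * s" and m: "m = batch_size p n"
    and valid: "valid_array n w es" and C: "encrypts_array E k key n es C" and \<pi>: "\<pi> permutes {1..n}"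
  shows "\<exists>\<kappa>. (\<forall>\<pi>1. \<forall>r \<in> set_pmf (\<kappa> \<pi>1). fst r = None) \<and> melbourne_shuffle E p n w k key C \<pi> =
    bind_pmf (pmf_of_set {\<sigma>. \<sigma> permutes {1..n}}) (\<lambda>\<pi>1. case plan s m w \<pi>1 \<pi> es of
        None => \<kappa> \<pi>1 | Some ms => map_pmf (view s m C) (enc_elems E k key n ms))"
proof -
  define sv0 where "sv0 = (\<lambda>S. case S of InArr => C | TmpArr => replicate (n * batch_size p n) Leaf | OutArr => replicate n Leaf)"
  define G where "G \<pi>1 = map_pmf (\<lambda>(r, sv, tr). (map_option (\<lambda>_. sv OutArr) r, tr :: transcript))
         (bind_client (shuffle_pass E k key p n w InArr TmpArr \<pi>1 OutArr)
            (\<lambda>_. shuffle_pass E k key p n w OutArr TmpArr \<pi> OutArr) (sv0, []))" for \<pi>1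
  \<comment> \<open>In the remaining cases a dummy failure is returned, so that the claim about
    \<open>\<kappa>\<close> holds for all \<open>\<pi>1\<close>.\<close>
  define \<kappa> where "\<kappa> \<pi>1 = (if plan s m w \<pi>1 \<pi> es = None \<and> \<pi>1 permutes {1..n} then G \<pi>1 else return_pmf (None, []))" for \<pi>1
  have sv0: "sv0 InArr = C" "length (sv0 TmpArr) = s * s * m" "length (sv0 OutArr) = n" by (simp_all add: sv0_def n m)
  let ?L = "s * s * m"
  have body: "(plan s m w \<pi>1 \<pi> es = None \<longrightarrow> (\<forall>r \<in> set_pmf (G \<pi>1). fst r = None)) \<and>
      (\<forall>ms. plan s m w \<pi>1 \<pi> es = Some ms \<longrightarrow> G \<pi>1 = map_pmf (view s m C) (enc_elems E k key n ms))"
    if \<pi>1: "\<pi>1 permutes {1..n}" for \<pi>1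
  proof (cases "overflow s m \<pi>1 es")
    case True
    then show ?thesis using pass_fail[OF E n m valid \<pi>1 C sv0] by (fastforce simp: plan_def G_def bind_client_def split: option.splits)
  next
    case nov1: False
    let ?es1 = "seg \<pi>1 es 0 n"
    have valid1: "valid_array n w ?es1" by (rule valid_seg[OF valid \<pi>1])
    let ?pl1 = "tmp_plan s m w \<pi>1 es @ ?es1" and ?pl2 = "tmp_plan s m w \<pi> ?es1 @ seg \<pi> ?es1 0 n"
    obtain T where T: "\<And>ct. length ct = ?L ==> length (T ct) = ?L"
      "shuffle_pass E k key p n w InArr TmpArr \<pi>1 OutArr (sv0, []) =
        map_pmf (\<lambda>c. (Some (), sv0(TmpArr := T (take ?L c), OutArr := drop ?L c), [] @ pass_view s m InArr C (take ?L c) (drop ?L c)))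
        (enc_elems E k key n ?pl1)"
      using pass_eq[OF E n m valid \<pi>1 C sv0 _ nov1] by blast
    define sv1 where "sv1 c = sv0(TmpArr := T (take ?L c), OutArr := drop ?L c)" for c
    have l1: "length (tmp_plan s m w \<pi>1 es) = ?L" by (rule length_tmp_plan[OF nov1])
    have sv1: "encrypts_array E k key n ?es1 (drop ?L c)" "length (sv1 c TmpArr) = ?L" "length (sv1 c OutArr) = n" "length c = ?L + n"
      if c: "c \<in> set_pmf (enc_elems E k key n ?pl1)" for c
    proof -
      have enc: "encrypts_array E k key n ?pl1 c" by (rule enc_elems_dec[OF E c])
      show lc: "length c = ?L + n" using enc_elems_length[OF c] l1 length_seg[OF valid \<pi>1, of n 0] by simp
      then show "length (sv1 c TmpArr) = ?L" "length (sv1 c OutArr) = n" by (simp_all add: sv1_def T(1))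
      have "drop ?L ?pl1 = ?es1" using l1 by simp
      then show "encrypts_array E k key n ?es1 (drop ?L c)"
        using enc unfolding encrypts_array_def by (metis list_all2_dropI)
    qed
    have G: "G \<pi>1 = bind_pmf (enc_elems E k key n ?pl1) (\<lambda>c. map_pmf (\<lambda>(r, sv, tr). (map_option (\<lambda>_. sv OutArr) r, tr))
        (shuffle_pass E k key p n w OutArr TmpArr \<pi> OutArr (sv1 c, pass_view s m InArr C (take ?L c) (drop ?L c))))"
    proof -
      have "bind_client (shuffle_pass E k key p n w InArr TmpArr \<pi>1 OutArr) (\<lambda>_. shuffle_pass E k key p n w OutArr TmpArr \<pi> OutArr) (sv0, []) =
        bind_pmf (enc_elems E k key n ?pl1) (\<lambda>c. shuffle_pass E k key p n w OutArr TmpArr \<pi> OutArr (sv1 c, pass_view s m InArr C (take ?L c) (drop ?L c)))"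
        by (rule bind_client_map) (simp add: T(2) sv1_def)
      then show ?thesis unfolding G_def by (simp only: map_bind_pmf)
    qed
    show ?thesis
    proof (cases "overflow s m \<pi> ?es1")
      case True
      have "fst r = None" if "r \<in> set_pmf (G \<pi>1)" for r
      proof -
        from that obtain c r' sv' tr' where c: "c \<in> set_pmf (enc_elems E k key n ?pl1)"
          "(r', sv', tr') \<in> set_pmf (shuffle_pass E k key p n w OutArr TmpArr \<pi> OutArr (sv1 c, pass_view s m InArr C (take ?L c) (drop ?L c)))"
          "r = (map_option (\<lambda>_. sv' OutArr) r', tr')" unfolding G by auto
        have "r' = None" by (rule pass_fail[OF E n m valid1 \<pi> sv1(1)[OF c(1)] _ sv1(2,3)[OF c(1)] _ True c(2)]) (simp_all add: sv1_def)
        then show ?thesis using c by simp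
      qed
      then show ?thesis using True nov1 by (auto simp: plan_def n)
    next
      case nov2: False
      have "G \<pi>1 = bind_pmf (enc_elems E k key n ?pl1) (\<lambda>c. map_pmf (\<lambda>c'. view s m C (c @ c')) (enc_elems E k key n ?pl2))"
        unfolding G
      proof (rule bind_pmf_cong[OF refl])
        fix c assume c: "c \<in> set_pmf (enc_elems E k key n ?pl1)"
        have o: "sv1 c OutArr = drop ?L c" by (simp add: sv1_def)
        obtain T' where T': "shuffle_pass E k key p n w OutArr TmpArr \<pi> OutArr (sv1 c, pass_view s m InArr C (take ?L c) (drop ?L c)) =
          map_pmf (\<lambda>c'. (Some (), (sv1 c)(TmpArr := T' (take ?L c'), OutArr := drop ?L c'),
            pass_view s m InArr C (take ?L c) (drop ?L c) @ pass_view s m OutArr (drop ?L c) (take ?L c') (drop ?L c')))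
          (enc_elems E k key n ?pl2)"
          using pass_eq[OF E n m valid1 \<pi> sv1(1)[OF c] o sv1(2,3)[OF c] _ nov2] by blast
        show "map_pmf (\<lambda>(r, sv, tr). (map_option (\<lambda>_. sv OutArr) r, tr))
          (shuffle_pass E k key p n w OutArr TmpArr \<pi> OutArr (sv1 c, pass_view s m InArr C (take ?L c) (drop ?L c))) =
          map_pmf (\<lambda>c'. view s m C (c @ c')) (enc_elems E k key n ?pl2)"
          unfolding T' pmf.map_comp
        proof (rule map_pmf_cong[OF refl])
          fix c'
          have "view s m C (c @ c') = (Some (drop ?L c'), pass_view s m InArr C (take ?L c) (drop ?L c) @ pass_view s m OutArr (drop ?L c) (take ?L c') (drop ?L c'))"
            using sv1(4)[OF c] by (simp add: view_def Let_def n)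
          then show "((\<lambda>(r, sv, tr). (map_option (\<lambda>_. sv OutArr) r, tr)) \<circ> (\<lambda>c'. (Some (), (sv1 c)(TmpArr := T' (take ?L c'), OutArr := drop ?L c'),
            pass_view s m InArr C (take ?L c) (drop ?L c) @ pass_view s m OutArr (drop ?L c) (take ?L c') (drop ?L c')))) c' = view s m C (c @ c')"
            by simp
        qed
      qed
      also have "\<dots> = map_pmf (view s m C) (enc_elems E k key n (?pl1 @ ?pl2))"
        by (simp only: enc_elems_append[of E k key n ?pl1 ?pl2] map_bind_pmf pmf.map_comp o_def)
      finally show ?thesis using nov1 nov2 by (simp add: plan_def n)
    qed
  qed
  have "melbourne_shuffle E p n w k key C \<pi> = bind_pmf (pmf_of_set {\<sigma>. \<sigma> permutes {1..n}}) G"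
    by (simp add: melbourne_shuffle_def G_def[abs_def] sv0_def)
  also have "\<dots> = bind_pmf (pmf_of_set {\<sigma>. \<sigma> permutes {1..n}}) (\<lambda>\<pi>1. case plan s m w \<pi>1 \<pi> es of
        None => \<kappa> \<pi>1 | Some ms => map_pmf (view s m C) (enc_elems E k key n ms))"
  proof (rule bind_pmf_cong[OF refl])
    fix \<pi>1 assume "\<pi>1 \<in> set_pmf (pmf_of_set {\<sigma>. \<sigma> permutes {1..n}})"
    moreover have "finite {\<sigma>. \<sigma> permutes {1..n}}" by (rule finite_permutations) simp
    moreover have "{\<sigma>. \<sigma> permutes {1..n}} \<noteq> {}" using permutes_id by blast
    ultimately have p1: "\<pi>1 permutes {1..n}" by simp
    show "G \<pi>1 = (case plan s m w \<pi>1 \<pi> es of None => \<kappa> \<pi>1 | Some ms => map_pmf (view s m C) (enc_elems E k key n ms))"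
      using body[OF p1] p1 by (auto simp: \<kappa>_def split: option.splits)
  qed
  finally show ?thesis using body by (intro exI[of _ \<kappa>]) (auto simp: \<kappa>_def)
qed

section \<open>The failure probability\<close>

lemma count_symmetric:
  assumes "x \<in> A" "y \<in> A" "x \<notin> K" "y \<notin> K"
  shows "card {\<sigma>. \<sigma> permutes A \<and> \<sigma> ` K \<subseteq> J \<and> \<sigma> y \<in> J} = card {\<sigma>. \<sigma> permutes A \<and> \<sigma> ` K \<subseteq> J \<and> \<sigma> x \<in> J}"
proof (rule bij_betw_same_card)
  let ?t = "\<lambda>\<sigma>. \<sigma> \<circ> Transposition.transpose x y"
  have t: "Transposition.transpose x y permutes A" using assms by (intro permutes_swap_id)
  have tK: "Transposition.transpose x y z = z" if "z \<in> K" for z using assms that by (auto simp: Transposition.transpose_def)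
  show "bij_betw ?t {\<sigma>. \<sigma> permutes A \<and> \<sigma> ` K \<subseteq> J \<and> \<sigma> y \<in> J} {\<sigma>. \<sigma> permutes A \<and> \<sigma> ` K \<subseteq> J \<and> \<sigma> x \<in> J}"
    by (rule bij_betw_byWitness[where f' = ?t])
      (auto simp: o_assoc[symmetric] tK intro: permutes_compose[OF t])
qed

text \<open>Double counting of the pairs of a permutation that maps \<open>K\<close> into
  \<open>J\<close> and a further point \<open>y\<close> that it also maps into \<open>J\<close>.
  Each permutation has \<open>card J - card K\<close> such points, and by symmetry every
  \<open>y\<close> outside \<open>K\<close> belongs to the same number of permutations.\<close>

lemma count_step:
  assumes A: "finite A" and J: "J \<subseteq> A" and K: "K \<subseteq> A" and x: "x \<in> A - K"
  shows "(card A - card K) * card {\<sigma>. \<sigma> permutes A \<and> \<sigma> ` insert x K \<subseteq> J} =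
    (card J - card K) * card {\<sigma>. \<sigma> permutes A \<and> \<sigma> ` K \<subseteq> J}"
proof -
  let ?S = "{\<sigma>. \<sigma> permutes A \<and> \<sigma> ` K \<subseteq> J}"
  have finS: "finite ?S" by (rule finite_subset[OF _ finite_permutations[OF A]]) auto
  have "(\<Sum>y\<in>A - K. card {\<sigma> \<in> ?S. \<sigma> y \<in> J}) = (\<Sum>y\<in>A - K. card {\<sigma>. \<sigma> permutes A \<and> \<sigma> ` insert x K \<subseteq> J})"
  proof (rule sum.cong[OF refl])
    fix y assume "y \<in> A - K"
    then have "card {\<sigma>. \<sigma> permutes A \<and> \<sigma> ` K \<subseteq> J \<and> \<sigma> y \<in> J} = card {\<sigma>. \<sigma> permutes A \<and> \<sigma> ` K \<subseteq> J \<and> \<sigma> x \<in> J}"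
      using x by (intro count_symmetric) auto
    moreover have "{\<sigma> \<in> ?S. \<sigma> y \<in> J} = {\<sigma>. \<sigma> permutes A \<and> \<sigma> ` K \<subseteq> J \<and> \<sigma> y \<in> J}" by auto
    moreover have "{\<sigma>. \<sigma> permutes A \<and> \<sigma> ` insert x K \<subseteq> J} = {\<sigma>. \<sigma> permutes A \<and> \<sigma> ` K \<subseteq> J \<and> \<sigma> x \<in> J}" by auto
    ultimately show "card {\<sigma> \<in> ?S. \<sigma> y \<in> J} = card {\<sigma>. \<sigma> permutes A \<and> \<sigma> ` insert x K \<subseteq> J}" by simp
  qed
  also have "\<dots> = (card A - card K) * card {\<sigma>. \<sigma> permutes A \<and> \<sigma> ` insert x K \<subseteq> J}"
    using K A by (simp add: card_Diff_subset finite_subset)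
  finally have 1: "(\<Sum>y\<in>A - K. card {\<sigma> \<in> ?S. \<sigma> y \<in> J}) = (card A - card K) * card {\<sigma>. \<sigma> permutes A \<and> \<sigma> ` insert x K \<subseteq> J}" .
  have "(\<Sum>y\<in>A - K. card {\<sigma> \<in> ?S. \<sigma> y \<in> J}) = (\<Sum>\<sigma>\<in>?S. card {y \<in> A - K. \<sigma> y \<in> J})"
  proof -
    have "card {\<sigma> \<in> ?S. \<sigma> y \<in> J} = (\<Sum>\<sigma>\<in>?S. if \<sigma> y \<in> J then 1 else 0)" for y
      using finS by (simp only: card_eq_sum sum.inter_filter)
    moreover have "card {y \<in> A - K. \<sigma> y \<in> J} = (\<Sum>y\<in>A - K. if \<sigma> y \<in> J then 1 else 0)" for \<sigma>
      using A by (simp only: card_eq_sum sum.inter_filter finite_Diff)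
    ultimately show ?thesis by (simp only: sum.swap[of _ "A - K"])
  qed
  also have "\<dots> = (\<Sum>\<sigma>\<in>?S. card J - card K)"
  proof (rule sum.cong[OF refl])
    fix \<sigma> assume s: "\<sigma> \<in> ?S"
    then have p: "\<sigma> permutes A" and sub: "\<sigma> ` K \<subseteq> J" by auto
    have inj: "inj_on \<sigma> B" for B using permutes_inj[OF p] by (rule inj_on_subset) simp
    have "\<sigma> ` {y \<in> A - K. \<sigma> y \<in> J} = J - \<sigma> ` K"
    proof safe
      fix z assume z: "z \<in> J" "z \<notin> \<sigma> ` K"
      then obtain y where "y \<in> A" "z = \<sigma> y" using permutes_image[OF p] J by blast
      then show "z \<in> \<sigma> ` {y \<in> A - K. \<sigma> y \<in> J}" using z by auto
    qed (use injD[OF permutes_inj[OF p]] in auto)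
    then have "card {y \<in> A - K. \<sigma> y \<in> J} = card (J - \<sigma> ` K)" using card_image[OF inj] by metis
    also have "\<dots> = card J - card K"
      using sub K A J card_image[OF inj, of K] by (subst card_Diff_subset) (auto intro: finite_subset)
    finally show "card {y \<in> A - K. \<sigma> y \<in> J} = card J - card K" .
  qed
  also have "\<dots> = (card J - card K) * card ?S" by simp
  finally show ?thesis using 1 by simp
qed

text \<open>Each further point of \<open>K\<close> multiplies the number of permutations by
  \<open>(card J - card K) / (card A - card K)\<close>, which is at most
  \<open>card J / card A\<close> because \<open>J\<close> is contained in \<open>A\<close>.\<close>

lemma count_bound:
  assumes A: "finite A" and J: "J \<subseteq> A" and K: "K \<subseteq> A"
  shows "card {\<sigma>. \<sigma> permutes A \<and> \<sigma> ` K \<subseteq> J} * card A ^ card K \<le> card J ^ card K * fact (card A)"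
proof -
  have "finite K" using A K finite_subset by auto
  then show ?thesis using K
  proof (induction K)
    case empty
    then show ?case using card_permutations[OF refl A] by simp
  next
    case (insert x K)
    let ?N = "card {\<sigma>. \<sigma> permutes A \<and> \<sigma> ` K \<subseteq> J}" and ?N' = "card {\<sigma>. \<sigma> permutes A \<and> \<sigma> ` insert x K \<subseteq> J}"
    have xx: "x \<in> A - K" and KA: "K \<subseteq> A" using insert by auto
    have lt: "card K < card A" using xx KA A by (intro psubset_card_mono) auto
    have JA: "card J \<le> card A" using J A by (rule card_mono[rotated])
    have "(card A - card K) * (card A * ?N') = card A * ((card A - card K) * ?N')" by (rule mult.left_commute)
    also have "\<dots> = (card A * (card J - card K)) * ?N" unfolding count_step[OF A J KA xx] by (rule mult.assoc[symmetric])
    also have "\<dots> \<le> ((card A - card K) * card J) * ?N"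
    proof (rule mult_le_mono1)
      have "card K * card J \<le> card A * card K" using JA by (simp add: mult.commute)
      then have "card A * card J - card A * card K \<le> card A * card J - card K * card J" by (rule diff_le_mono2)
      then show "card A * (card J - card K) \<le> (card A - card K) * card J" by (simp only: diff_mult_distrib diff_mult_distrib2)
    qed
    also have "\<dots> = (card A - card K) * (card J * ?N)" by (rule mult.assoc)
    finally have le: "card A * ?N' \<le> card J * ?N" using lt by simp
    have "?N' * card A ^ card (insert x K) = (card A * ?N') * card A ^ card K" using insert by simp
    also have "\<dots> \<le> (card J * ?N) * card A ^ card K" using le by (rule mult_le_mono1)
    also have "\<dots> = card J * (?N * card A ^ card K)" by simp
    also have "\<dots> \<le> card J * (card J ^ card K * fact (card A))" using insert.IH[OF KA] by (rule mult_le_mono2)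
    finally show ?case using insert by simp
  qed
qed

text \<open>In the event considered, some subset of \<open>Suc m\<close> keys is mapped into
  \<open>J\<close>. There are \<open>s choose Suc m\<close> candidates, each with probability at
  most \<open>(s / n) ^ Suc m = 1 / s ^ Suc m\<close>, and \<open>s choose Suc m\<close> is at most
  \<open>s ^ Suc m / fact (Suc m)\<close>.\<close>

lemma prob_many_hits:
  fixes s m :: nat
  assumes n: "n = s * s" and s: "0 < s" and K0: "K0 \<subseteq> {1..n}" "card K0 = s" and J: "J \<subseteq> {1..n}" "card J = s"
  shows "measure_pmf.prob (pmf_of_set {\<sigma>. \<sigma> permutes {1..n}}) {\<sigma>. m < card {x \<in> K0. \<sigma> x \<in> J}} \<le> 1 / fact (Suc m)"
proof -
  let ?P = "{\<sigma>. \<sigma> permutes {1..n}}" and ?KS = "{K. K \<subseteq> K0 \<and> card K = Suc m}"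
  have fin: "finite ?P" by (rule finite_permutations) simp
  have ne: "?P \<noteq> {}" using permutes_id by blast
  have cP: "card ?P = fact n" using card_permutations[of "{1..n}" n] by simp
  have fK0: "finite K0" using K0(1) by (rule finite_subset) simp
  have fKS: "finite ?KS" using fK0 by (intro finite_subset[of ?KS "Pow K0"]) auto
  have sub: "{\<sigma>. m < card {x \<in> K0. \<sigma> x \<in> J}} \<subseteq> (\<Union>K\<in>?KS. {\<sigma>. \<sigma> ` K \<subseteq> J})"
  proof
    fix \<sigma> assume "\<sigma> \<in> {\<sigma>. m < card {x \<in> K0. \<sigma> x \<in> J}}"
    then have "Suc m \<le> card {x \<in> K0. \<sigma> x \<in> J}" by simp
    then obtain K where "K \<subseteq> {x \<in> K0. \<sigma> x \<in> J}" "card K = Suc m" by (meson obtain_subset_with_card_n)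
    then show "\<sigma> \<in> (\<Union>K\<in>?KS. {\<sigma>. \<sigma> ` K \<subseteq> J})" by auto
  qed
  have each: "measure_pmf.prob (pmf_of_set ?P) {\<sigma>. \<sigma> ` K \<subseteq> J} \<le> 1 / real s ^ Suc m" if K: "K \<in> ?KS" for K
  proof -
    let ?N = "card {\<sigma>. \<sigma> permutes {1..n} \<and> \<sigma> ` K \<subseteq> J}"
    have "?N * n ^ Suc m \<le> s ^ Suc m * fact n"
      using count_bound[of "{1..n}" J K] K K0 J by auto
    then have "real (?N * n ^ Suc m) \<le> real (s ^ Suc m * fact n)" by (simp only: of_nat_le_iff)
    then have "(real ?N * real s ^ Suc m) * real s ^ Suc m \<le> fact n * real s ^ Suc m"
      by (simp add: n power_mult_distrib mult_ac)
    then have "real ?N * real s ^ Suc m \<le> fact n" using s by (simp only: mult_le_cancel_right) simp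
    then have "real ?N / fact n \<le> 1 / real s ^ Suc m" using s by (simp add: field_simps)
    moreover have "?P \<inter> {\<sigma>. \<sigma> ` K \<subseteq> J} = {\<sigma>. \<sigma> permutes {1..n} \<and> \<sigma> ` K \<subseteq> J}" by auto
    ultimately show ?thesis unfolding measure_pmf_of_set[OF ne fin] cP by simp
  qed
  have "measure_pmf.prob (pmf_of_set ?P) {\<sigma>. m < card {x \<in> K0. \<sigma> x \<in> J}} \<le> measure_pmf.prob (pmf_of_set ?P) (\<Union>K\<in>?KS. {\<sigma>. \<sigma> ` K \<subseteq> J})"
    by (rule measure_pmf.finite_measure_mono[OF sub]) simp
  also have "\<dots> \<le> (\<Sum>K\<in>?KS. measure_pmf.prob (pmf_of_set ?P) {\<sigma>. \<sigma> ` K \<subseteq> J})"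
    by (rule measure_pmf.finite_measure_subadditive_finite[OF fKS]) simp
  also have "\<dots> \<le> (\<Sum>K\<in>?KS. 1 / real s ^ Suc m)" by (rule sum_mono) (rule each)
  also have "\<dots> = real (s choose Suc m) / real s ^ Suc m" using n_subsets[OF fK0, of "Suc m"] K0(2) by simp
  also have "\<dots> \<le> 1 / fact (Suc m)"
  proof -
    have "fact (Suc m) * (s choose Suc m) \<le> s ^ Suc m" using binomial_fact_pow[of s "Suc m"] by (simp only: mult.commute)
    then have "real (fact (Suc m) * (s choose Suc m)) \<le> real (s ^ Suc m)" by (simp only: of_nat_le_iff)
    then show ?thesis using s by (simp add: field_simps del: fact_Suc)
  qed
  finally show ?thesis .
qed

text \<open>Union bound over the \<open>s * s = n\<close> pairs of buckets.\<close>

lemma prob_overflow: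
  fixes s m :: nat
  assumes n: "n = s * s" and valid: "valid_array n w es"
    and hit: "\<And>\<sigma>. \<sigma> permutes {1..n} ==> bad \<sigma> ==> \<exists>i<s. \<exists>j<s. m < card {x \<in> K i j. \<sigma> x \<in> J i j}"
    and K: "\<And>i j. i < s ==> j < s ==> K i j \<subseteq> {1..n} \<and> card (K i j) = s \<and> J i j \<subseteq> {1..n} \<and> card (J i j) = s"
  shows "measure_pmf.prob (pmf_of_set {\<sigma>. \<sigma> permutes {1..n}}) {\<sigma>. bad \<sigma>} \<le> real n / fact (Suc m)"
proof -
  let ?P = "{\<sigma>. \<sigma> permutes {1..n}}"
  let ?Q = "pmf_of_set ?P"
  have fin: "finite ?P" by (rule finite_permutations) simp
  have ne: "?P \<noteq> {}" using permutes_id by blast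
  have "measure_pmf.prob ?Q {\<sigma>. bad \<sigma>} = measure_pmf.prob ?Q ({\<sigma>. bad \<sigma>} \<inter> ?P)"
    using measure_Int_set_pmf[of ?Q "{\<sigma>. bad \<sigma>}"] set_pmf_of_set[OF ne fin] by simp
  also have "\<dots> \<le> measure_pmf.prob ?Q (\<Union>q\<in>{..<s} \<times> {..<s}. {\<sigma>. m < card {x \<in> K (fst q) (snd q). \<sigma> x \<in> J (fst q) (snd q)}})"
    by (rule measure_pmf.finite_measure_mono) (use hit in force, simp)
  also have "\<dots> \<le> (\<Sum>q\<in>{..<s} \<times> {..<s}. measure_pmf.prob ?Q {\<sigma>. m < card {x \<in> K (fst q) (snd q). \<sigma> x \<in> J (fst q) (snd q)}})"
    by (rule measure_pmf.finite_measure_subadditive_finite) simp_all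
  also have "\<dots> \<le> (\<Sum>q\<in>{..<s} \<times> {..<s}. 1 / fact (Suc m))"
  proof (rule sum_mono)
    fix q assume "q \<in> {..<s} \<times> {..<s}"
    then have "fst q < s" "snd q < s" by auto
    then show "measure_pmf.prob ?Q {\<sigma>. m < card {x \<in> K (fst q) (snd q). \<sigma> x \<in> J (fst q) (snd q)}} \<le> 1 / fact (Suc m)"
      using K[of "fst q" "snd q"] by (intro prob_many_hits[OF n]) auto
  qed
  also have "\<dots> = real n / fact (Suc m)" by (simp add: n)
  finally show ?thesis .
qed

lemma distinct_keys_length:
  assumes "distinct (map fst es)" shows "length (filter P es) = card (fst ` {e \<in> set es. P e})"
proof -
  have d: "distinct (map fst (filter P es))" using assms by (rule distinct_map_filter)
  have "length (filter P es) = length (map fst (filter P es))" by simp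
  also have "\<dots> = card (set (map fst (filter P es)))" using distinct_card[OF d] by simp
  finally show ?thesis by simp
qed

lemma card_positions: "card {x \<in> {1..n :: nat}. a < \<pi> x \<and> \<pi> x \<le> b} = b - a" if \<pi>: "\<pi> permutes {1..n}" and b: "b \<le> n" for a b
proof -
  have "\<pi> ` {x \<in> {1..n}. a < \<pi> x \<and> \<pi> x \<le> b} = {a<..b}"
  proof safe
    fix y assume "y \<in> {a<..b}"
    then have "y \<in> {1..n}" using b by auto
    then obtain x where "x \<in> {1..n}" "y = \<pi> x" using permutes_image[OF \<pi>] by blast
    then show "y \<in> \<pi> ` {x \<in> {1..n}. a < \<pi> x \<and> \<pi> x \<le> b}" using \<open>y \<in> {a<..b}\<close> by auto
  qed auto
  moreover have "inj_on \<pi> {x \<in> {1..n}. a < \<pi> x \<and> \<pi> x \<le> b}" using permutes_inj[OF \<pi>] by (rule inj_on_subset) simp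
  ultimately show ?thesis using card_image by fastforce
qed

lemma bucket_le: "j < s ==> j * s + s \<le> s * (s :: nat)"
  using mult_le_mono1[of "Suc j" s s] by simp

text \<open>Both passes are the same experiment with the roles of source and target exchanged. In
  the first, the keys of a fixed input bucket are sent by the random permutation into an output
  bucket. In the second, the keys with final position in a fixed bucket have been sent by it into an
  intermediate bucket. Hence the factor 2.\<close>

lemma prob_plan_None:
  assumes n: "n = s * s" and valid: "valid_array n w es" and \<pi>: "\<pi> permutes {1..n}"
  shows "measure_pmf.prob (pmf_of_set {\<sigma>. \<sigma> permutes {1..n}}) {\<sigma>. plan s m w \<sigma> \<pi> es = None} \<le> 2 * real n / fact (Suc m)"
proof -
  let ?Q = "pmf_of_set {\<sigma>. \<sigma> permutes {1..n}}"
  have dk: "distinct (map fst es)" and len: "length es = n" using valid by (auto simp: valid_array_def)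
  have dke: "\<And>e f. e \<in> set es ==> f \<in> set es ==> fst e = fst f ==> e = f" using dk by (auto simp: distinct_map inj_on_def)
  have o1: "measure_pmf.prob ?Q {\<sigma>. overflow s m \<sigma> es} \<le> real n / fact (Suc m)"
  proof (rule prob_overflow[OF n valid])
    fix \<sigma> assume s: "\<sigma> permutes {1..n}" and "overflow s m \<sigma> es"
    then obtain i j where ij: "i < s" "j < s" "m < length (filter (in_bucket s \<sigma> j) (chunk s es i))"
      by (auto simp: overflow_def batch_def)
    have sub: "set (chunk s es i) \<subseteq> set es" unfolding chunk_def by (meson set_drop_subset set_take_subset subset_trans)
    have dc: "distinct (map fst (chunk s es i))" using dk by (simp add: chunk_def take_map[symmetric] drop_map[symmetric])
    have "fst ` {e \<in> set (chunk s es i). in_bucket s \<sigma> j e} \<subseteq> {x \<in> fst ` set (chunk s es i). \<sigma> x \<in> {j * s<..j * s + s}}"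
    proof clarsimp
      fix x v assume xv: "(x, v) \<in> set (chunk s es i)" "in_bucket s \<sigma> j (x, v)"
      then have "1 \<le> \<sigma> x" using valid_pos[OF valid s, of "(x, v)"] sub by auto
      then show "x \<in> fst ` set (chunk s es i) \<and> j * s < \<sigma> x \<and> \<sigma> x \<le> j * s + s"
        using xv by (force simp: in_bucket_def)
    qed
    then have "card (fst ` {e \<in> set (chunk s es i). in_bucket s \<sigma> j e}) \<le> card {x \<in> fst ` set (chunk s es i). \<sigma> x \<in> {j * s<..j * s + s}}"
      by (intro card_mono) auto
    then show "\<exists>i<s. \<exists>j<s. m < card {x \<in> fst ` set (chunk s es i). \<sigma> x \<in> {j * s<..j * s + s}}"
      using ij distinct_keys_length[OF dc, of "in_bucket s \<sigma> j"] by (intro exI[of _ i] exI[of _ j] conjI) auto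
  next
    fix i j assume ij: "i < s" "j < s"
    have sub: "set (chunk s es i) \<subseteq> set es" unfolding chunk_def by (meson set_drop_subset set_take_subset subset_trans)
    have dc: "distinct (map fst (chunk s es i))" using dk by (simp add: chunk_def take_map[symmetric] drop_map[symmetric])
    have "length (chunk s es i) = s" using bucket_le[OF ij(1)] len n by (intro length_chunk) simp
    then have "card (fst ` set (chunk s es i)) = s" using distinct_card[OF dc] by simp
    moreover have "fst ` set (chunk s es i) \<subseteq> {1..n}" using sub valid_keys[OF valid] by blast
    ultimately show "fst ` set (chunk s es i) \<subseteq> {1..n} \<and> card (fst ` set (chunk s es i)) = s \<and> {j * s<..j * s + s} \<subseteq> {1..n} \<and> card {j * s<..j * s + s} = s"
      using bucket_le[OF ij(2)] n by auto
  qed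
  have o2: "measure_pmf.prob ?Q {\<sigma>. overflow s m \<pi> (seg \<sigma> es 0 n)} \<le> real n / fact (Suc m)"
  proof (rule prob_overflow[OF n valid])
    fix \<sigma> assume s: "\<sigma> permutes {1..n}" and "overflow s m \<pi> (seg \<sigma> es 0 n)"
    then obtain i j where ij: "i < s" "j < s" "m < length (filter (in_bucket s \<pi> j) (chunk s (seg \<sigma> es 0 n) i))"
      by (auto simp: overflow_def batch_def)
    \<comment> \<open>Bucket \<open>i\<close> of the intermediate array holds the elements that the
      random permutation sends there.\<close>
    have "chunk s (concat (map (\<lambda>j. seg \<sigma> es (j * s) (j * s + s)) [0..<s])) i = map (\<lambda>j. seg \<sigma> es (j * s) (j * s + s)) [0..<s] ! i"
    proof (rule chunk_concat)
      fix x assume "x \<in> set (map (\<lambda>j. seg \<sigma> es (j * s) (j * s + s)) [0..<s])"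
      then obtain j where "j < s" "x = seg \<sigma> es (j * s) (j * s + s)" by auto
      then show "length x = s" using length_seg[OF valid s, of "j * s + s" "j * s"] bucket_le[of j s] n by simp
    qed (use ij in simp)
    then have ch: "chunk s (seg \<sigma> es 0 n) i = seg \<sigma> es (i * s) (i * s + s)" using ij by (simp add: concat_segs n)
    have ms: "mset (seg \<sigma> es (i * s) (i * s + s)) = mset (filter (\<lambda>e. i * s < \<sigma> (fst e) \<and> \<sigma> (fst e) \<le> i * s + s) es)" by (rule mset_seg)
    have sets: "set (seg \<sigma> es (i * s) (i * s + s)) = {e \<in> set es. i * s < \<sigma> (fst e) \<and> \<sigma> (fst e) \<le> i * s + s}"
      using mset_eq_setD[OF ms] by auto
    have "mset (map fst (seg \<sigma> es (i * s) (i * s + s))) = mset (map fst (filter (\<lambda>e. i * s < \<sigma> (fst e) \<and> \<sigma> (fst e) \<le> i * s + s) es))"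
      using ms by simp
    then have dc: "distinct (map fst (seg \<sigma> es (i * s) (i * s + s)))"
      using mset_eq_imp_distinct_iff distinct_map_filter[OF dk] by blast
    have "fst ` {e \<in> set (seg \<sigma> es (i * s) (i * s + s)). in_bucket s \<pi> j e} \<subseteq>
        {x \<in> {x \<in> {1..n}. j * s < \<pi> x \<and> \<pi> x \<le> j * s + s}. \<sigma> x \<in> {i * s<..i * s + s}}"
    proof (rule image_subsetI)
      fix e assume e: "e \<in> {e \<in> set (seg \<sigma> es (i * s) (i * s + s)). in_bucket s \<pi> j e}"
      then have es: "e \<in> set es" using sets by auto
      then show "fst e \<in> {x \<in> {x \<in> {1..n}. j * s < \<pi> x \<and> \<pi> x \<le> j * s + s}. \<sigma> x \<in> {i * s<..i * s + s}}"
        using e sets valid_pos[OF valid \<pi> es] valid_keys[OF valid] by (force simp: in_bucket_def)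
    qed
    then have "card (fst ` {e \<in> set (seg \<sigma> es (i * s) (i * s + s)). in_bucket s \<pi> j e}) \<le>
        card {x \<in> {x \<in> {1..n}. j * s < \<pi> x \<and> \<pi> x \<le> j * s + s}. \<sigma> x \<in> {i * s<..i * s + s}}"
      by (intro card_mono) auto
    then show "\<exists>i<s. \<exists>j<s. m < card {x \<in> {x \<in> {1..n}. j * s < \<pi> x \<and> \<pi> x \<le> j * s + s}. \<sigma> x \<in> {i * s<..i * s + s}}"
      using ij distinct_keys_length[OF dc, of "in_bucket s \<pi> j"] unfolding ch
      by (intro exI[of _ i] exI[of _ j] conjI) auto
  next
    fix i j assume ij: "i < s" "j < s"
    show "{x \<in> {1..n}. j * s < \<pi> x \<and> \<pi> x \<le> j * s + s} \<subseteq> {1..n} \<and> card {x \<in> {1..n}. j * s < \<pi> x \<and> \<pi> x \<le> j * s + s} = s \<and>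
      {i * s<..i * s + s} \<subseteq> {1..n} \<and> card {i * s<..i * s + s} = s"
      using card_positions[OF \<pi>, of "j * s + s" "j * s"] bucket_le[OF ij(1)] bucket_le[OF ij(2)] n by auto
  qed
  have "measure_pmf.prob ?Q {\<sigma>. plan s m w \<sigma> \<pi> es = None} \<le>
      measure_pmf.prob ?Q ({\<sigma>. overflow s m \<sigma> es} \<union> {\<sigma>. overflow s m \<pi> (seg \<sigma> es 0 n)})"
    by (rule measure_pmf.finite_measure_mono) (auto simp: plan_def n split: if_splits)
  also have "\<dots> \<le> measure_pmf.prob ?Q {\<sigma>. overflow s m \<sigma> es} + measure_pmf.prob ?Q {\<sigma>. overflow s m \<pi> (seg \<sigma> es 0 n)}"
    by (rule measure_Un_le) simp_all
  finally show ?thesis using o1 o2 by simp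
qed

section \<open>The failure bound and its asymptotics\<close>

definition fail_bound :: "real => nat => real" where
  "fail_bound p n = 2 * real n / fact (Suc (batch_size p n))"

lemma measure_bind_pmf: "measure_pmf.prob (bind_pmf M f) X = (\<integral>x. measure_pmf.prob (f x) X \<partial>measure_pmf M)"
proof -
  have i: "integrable (measure_pmf M) (\<lambda>x. measure_pmf.prob (f x) X)"
    by (rule measure_pmf.integrable_const_bound[where B = 1]) auto
  have "ennreal (measure_pmf.prob (bind_pmf M f) X) = (\<integral>\<^sup>+x. ennreal (measure_pmf.prob (f x) X) \<partial>measure_pmf M)"
    by (simp add: measure_pmf.emeasure_eq_measure[symmetric])
  also have "\<dots> = ennreal (\<integral>x. measure_pmf.prob (f x) X \<partial>measure_pmf M)"
    by (rule nn_integral_eq_integral[OF i]) simp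
  finally show ?thesis by (simp add: integral_nonneg_AE)
qed

lemma prob_fail:
  assumes E: "symmetric_encryption E" "key \<in> set_pmf (gen E k)"
    and n: "n = s * s" and valid: "valid_array n w es" and C: "encrypts_array E k key n es C" and \<pi>: "\<pi> permutes {1..n}"
  shows "measure_pmf.prob (melbourne_shuffle E p n w k key C \<pi>) {(r, tr). r = None} \<le> fail_bound p n"
proof -
  let ?Q = "pmf_of_set {\<sigma>. \<sigma> permutes {1..n}}" and ?m = "batch_size p n"
  obtain \<kappa> where eq: "melbourne_shuffle E p n w k key C \<pi> =
    bind_pmf ?Q (\<lambda>\<pi>1. case plan s ?m w \<pi>1 \<pi> es of None => \<kappa> \<pi>1 | Some ms => map_pmf (view s ?m C) (enc_elems E k key n ms))"
    using melbourne_shuffle_plan[OF E n refl valid C \<pi>] by blast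
  let ?F = "\<lambda>\<pi>1. case plan s ?m w \<pi>1 \<pi> es of None => \<kappa> \<pi>1 | Some ms => map_pmf (view s ?m C) (enc_elems E k key n ms)"
  have "measure_pmf.prob (melbourne_shuffle E p n w k key C \<pi>) {(r, tr). r = None} = (\<integral>x. measure_pmf.prob (?F x) {(r, tr). r = None} \<partial>?Q)"
    unfolding eq by (rule measure_bind_pmf)
  \<comment> \<open>A view always carries an output, so failures occur only where the plan is
    missing.\<close>
  also have "\<dots> \<le> (\<integral>x. indicator {\<sigma>. plan s ?m w \<sigma> \<pi> es = None} x \<partial>?Q)"
  proof (rule integral_mono)
    show "measure_pmf.prob (?F x) {(r, tr). r = None} \<le> indicator {\<sigma>. plan s ?m w \<sigma> \<pi> es = None} x" for x
    proof (cases "plan s ?m w x \<pi> es")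
      case (Some ms)
      have "view s ?m C -` {(r, tr). r = None} = {}" by (auto simp: view_def Let_def)
      then show ?thesis using Some by (simp add: measure_map_pmf)
    qed simp
  qed (auto intro!: measure_pmf.integrable_const_bound[where B = 1] AE_pmfI)
  also have "\<dots> = measure_pmf.prob ?Q {\<sigma>. plan s ?m w \<sigma> \<pi> es = None}" by simp
  also have "\<dots> \<le> fail_bound p n" unfolding fail_bound_def by (rule prob_plan_None[OF n valid \<pi>])
  finally show ?thesis .
qed

text \<open>A single term of the exponential series.\<close>

lemma power_over_fact_le_exp: "real N ^ N / fact N \<le> exp (real N)"
proof -
  have "(\<Sum>i\<in>{N}. inverse (fact i) *\<^sub>R real N ^ i) \<le> (\<Sum>i. inverse (fact i) *\<^sub>R real N ^ i)"
    by (rule sum_le_suminf[OF summable_exp_generic]) auto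
  then show ?thesis by (simp add: exp_def field_simps)
qed

text \<open>For \<open>N = m + 1\<close>, which is at least \<open>e log n\<close>, the estimate
  \<open>fact N \<ge> (N / e) ^ N\<close> gives \<open>fact N \<ge> (log n) ^ N\<close>, and for
  \<open>log n \<ge> 2 ^ (c + 3)\<close> this is at least
  \<open>(2 ^ N) ^ (c + 3) \<ge> n ^ (c + 3)\<close>. The constant \<open>e\<close> in the
  hypothesis on \<open>p\<close> cancels the one in the estimate of the factorial. Of the three
  extra factors \<open>n\<close>, one cancels the numerator, one absorbs the 2, and one makes the
  inequality strict.\<close>

lemma fail_bound_small:
  assumes p: "p \<ge> exp 1" and n: "log 2 (real n) \<ge> 2 ^ (c + 3)" "n > 0"
  shows "fail_bound p n < 1 / real n ^ c"
proof -
  define N where "N = Suc (batch_size p n)"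
  let ?l = "log 2 (real n)"
  have l1: "?l \<ge> 1" using n one_le_power[of "2::real" "c + 3"] by linarith
  have nl: "real n = 2 powr ?l" using n(2) by simp
  have n2: "real n \<ge> 2"
    using powr_mono[OF l1, of 2] unfolding nl[symmetric] by simp
  have "p * ?l \<le> real (batch_size p n)" unfolding batch_size_def by linarith
  moreover have "exp 1 * ?l \<le> p * ?l" using p l1 by (intro mult_right_mono) auto
  ultimately have Nl: "exp 1 * ?l \<le> real N" unfolding N_def by linarith
  have "1 * ?l \<le> exp 1 * ?l" using l1 by (intro mult_right_mono) auto
  then have lN: "?l \<le> real N" using Nl by linarith
  have nN: "real n \<le> 2 ^ N"
    using powr_mono[OF lN, of 2] unfolding nl[symmetric] by (simp add: powr_realpow)
  have "real n ^ (c + 3) \<le> (2 ^ N) ^ (c + 3)" using nN by (intro power_mono) auto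
  also have "\<dots> = (2 ^ (c + 3)) ^ N" by (simp only: power_mult[symmetric] mult.commute)
  also have "\<dots> \<le> ?l ^ N" using n by (intro power_mono) auto
  also have "\<dots> \<le> (real N / exp 1) ^ N" using Nl l1 by (intro power_mono) (auto simp: field_simps)
  also have "\<dots> \<le> fact N"
  proof -
    have "exp (real N) = exp 1 ^ N" by (simp add: exp_of_nat_mult[symmetric])
    then show ?thesis using power_over_fact_le_exp[of N] by (simp add: power_divide field_simps)
  qed
  finally have F: "real n ^ (c + 3) \<le> fact N" .
  have pos: "real n ^ (c + 3) > 0" using n2 by simp
  have "fail_bound p n \<le> 2 * real n / real n ^ (c + 3)"
    unfolding fail_bound_def N_def[symmetric] using F pos by (intro divide_left_mono) auto
  also have "\<dots> \<le> real n * real n / real n ^ (c + 3)" using n2 pos by (intro divide_right_mono mult_right_mono) auto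
  also have "\<dots> = 1 / (real n * real n ^ c)" using n2 by (simp add: power_add field_simps power3_eq_cube)
  also have "\<dots> < 1 / real n ^ c" using n2 by (simp add: field_simps)
  finally show ?thesis .
qed

lemma fail_bound_nonneg: "0 \<le> fail_bound p n" by (simp add: fail_bound_def)

lemma negligible_fail_bound: assumes "p \<ge> exp 1" shows "negligible (fail_bound p)"
  unfolding negligible_def
proof
  fix c
  have "\<forall>\<^sub>F n in sequentially. log 2 (real n) \<ge> 2 ^ (c + 3)"
    using eventually_ge_at_top[of "2 ^ (2 ^ (c + 3))"]
  proof eventually_elim
    case (elim n)
    then show ?case using le_log2_of_power[of "2 ^ (c + 3)" n] by simp
  qed
  moreover have "\<forall>\<^sub>F n in sequentially. n > (0 :: nat)" by (rule eventually_gt_at_top)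
  ultimately show "\<forall>\<^sub>F k in sequentially. \<bar>fail_bound p k\<bar> < 1 / real k ^ c"
    by eventually_elim (use fail_bound_small[OF assms] fail_bound_nonneg in simp)
qed

theorem melbourne_succeeds_whp:
  assumes p: "p \<ge> exp 1" and E: "symmetric_encryption E"
  shows "succeeds_whp E (melbourne_shuffle E p)"
  unfolding succeeds_whp_def
proof (intro exI[of _ "fail_bound p"] conjI negligible_fail_bound p allI impI, goal_cases)
  case (1 n w k key A C \<pi>0 \<pi>)
  then obtain s where n: "n = s * s" by (auto simp: power2_eq_square)
  from 1 n show ?case by (intro prob_fail[OF E _ n]) auto
next
  case (2 n w k key A C \<pi>0 \<pi> D tr)
  then obtain s where n: "n = s * s" by (auto simp: power2_eq_square)
  let ?m = "batch_size p n"
  from 2 have key: "key \<in> set_pmf (gen E k)" and \<pi>: "\<pi> permutes {1..n}" and valid: "valid_array n w A"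
    and C: "encrypts_array E k key n A C" and out: "(Some D, tr) \<in> set_pmf (melbourne_shuffle E p n w k key C \<pi>)" by auto
  obtain \<kappa> where \<kappa>: "\<And>\<pi>1 r. r \<in> set_pmf (\<kappa> \<pi>1) ==> fst r = None" and eq: "melbourne_shuffle E p n w k key C \<pi> =
    bind_pmf (pmf_of_set {\<sigma>. \<sigma> permutes {1..n}}) (\<lambda>\<pi>1. case plan s ?m w \<pi>1 \<pi> A of None => \<kappa> \<pi>1 | Some ms => map_pmf (view s ?m C) (enc_elems E k key n ms))"
    using melbourne_shuffle_plan[OF E key n refl valid C \<pi>] by blast
  have fin: "finite {\<sigma>. \<sigma> permutes {1..n}}" by (rule finite_permutations) simp
  have ne: "{\<sigma>. \<sigma> permutes {1..n}} \<noteq> {}" using permutes_id by blast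
  from out obtain \<pi>1 where \<pi>1: "\<pi>1 permutes {1..n}"
    "(Some D, tr) \<in> set_pmf (case plan s ?m w \<pi>1 \<pi> A of None => \<kappa> \<pi>1 | Some ms => map_pmf (view s ?m C) (enc_elems E k key n ms))"
    unfolding eq by (auto simp: set_pmf_of_set[OF ne fin, simplified])
  obtain ms where ms: "plan s ?m w \<pi>1 \<pi> A = Some ms" using \<pi>1(2) \<kappa>[of "(Some D, tr)" \<pi>1] by (auto split: option.splits)
  then obtain cs where cs: "cs \<in> set_pmf (enc_elems E k key n ms)" "(Some D, tr) = view s ?m C cs" using \<pi>1(2) by auto
  let ?es1 = "seg \<pi>1 A 0 n" let ?L = "s * s * ?m"
  have valid1: "valid_array n w ?es1" by (rule valid_seg[OF valid \<pi>1(1)])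
  let ?B = "seg \<pi> ?es1 0 n"
  have nov: "\<not> overflow s ?m \<pi>1 A" "\<not> overflow s ?m \<pi> ?es1" and
    ms': "ms = (tmp_plan s ?m w \<pi>1 A @ ?es1) @ tmp_plan s ?m w \<pi> ?es1 @ ?B"
    using ms by (auto simp: plan_def n split: if_splits)
  have "list_all2 (\<lambda>c e. c \<in> set_pmf (enc E k key (elem_bits n e))) cs ms"
    using cs(1) by (simp add: enc_elems_def enc_all_def set_seq_pmf list_all2_map2)
  then have "list_all2 (\<lambda>c e. c \<in> set_pmf (enc E k key (elem_bits n e))) (drop (?L + n + ?L) cs) (drop (?L + n + ?L) ms)"
    by (rule list_all2_dropI)
  \<comment> \<open>The last \<open>n\<close> entries of the plan are the array written by the
    second pass.\<close>
  moreover have "drop (?L + n + ?L) ms = ?B"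
    unfolding ms' using length_tmp_plan[OF nov(1)] length_tmp_plan[OF nov(2)] length_seg[OF valid \<pi>1(1), of n 0] by simp
  moreover have "drop (?L + n + ?L) cs = D" using cs(2) by (simp add: view_def Let_def n)
  ultimately have "list_all2 (\<lambda>e c. c \<in> set_pmf (enc E k key (elem_bits n e))) ?B D"
    by (simp add: list_all2_conv_all_nth)
  moreover have "set ?B = set A"
    using mset_eq_setD[OF mset_seg_all[OF valid1 \<pi>]] mset_eq_setD[OF mset_seg_all[OF valid \<pi>1(1)]] by simp
  ultimately show ?case using valid_seg[OF valid1 \<pi>] arranged_seg[OF valid1 \<pi>] by blast
qed

section \<open>The interpreted adversary\<close>

definition nat_pick :: "nat list => nat pmf" where
  "nat_pick xs = (if xs = [] then return_pmf 0 else map_pmf (\<lambda>i. xs ! i) (pmf_of_set {..<length xs}))"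

lemma nat_pick_pick: "map_pmf code (nat_pick xs) = pick (map code xs)"
proof (cases "xs = []")
  case False
  have "map_pmf (\<lambda>i. code (xs ! i)) (pmf_of_set {..<length xs}) = map_pmf (\<lambda>i. map code xs ! i) (pmf_of_set {..<length xs})"
    using False by (intro map_pmf_cong refl) (auto simp: set_pmf_of_set lessThan_empty_iff)
  then show ?thesis using False by (simp add: nat_pick_def pick_def pmf.map_comp o_def)
qed (simp add: nat_pick_def pick_def)

lemma nat_pick_set: assumes "distinct xs" "xs \<noteq> []" shows "nat_pick xs = pmf_of_set (set xs)"
proof -
  have "bij_betw (\<lambda>i. xs ! i) {..<length xs} (set xs)" using assms(1) by (intro bij_betw_nth) auto
  then have "map_pmf (\<lambda>i. xs ! i) (pmf_of_set {..<length xs}) = pmf_of_set (set xs)"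
    by (rule map_pmf_of_set_bij_betw) (use assms in auto)
  then show ?thesis using assms by (simp add: nat_pick_def)
qed

definition perm_step :: "nat list \<times> nat list => (nat list \<times> nat list) pmf" where
  "perm_step st = map_pmf (\<lambda>r. (filter (\<lambda>x. \<not> x = r) (fst st), snd st @ [r])) (nat_pick (fst st))"

definition permM :: "nat => nat list \<times> nat list => ('w, nat list \<times> nat list) M" where
  "permM n st = foldM (\<lambda>(_ :: unit) st. lift (perm_step st)) (replicate n ()) st"

definition rand_perm :: "nat => ('w, nat list) M" where
  "rand_perm n = permM n ([1..<n+1], []) \<then> (\<lambda>st. ret (snd st))"

lemma permM_0 [simp]: "permM 0 = ret" by (simp add: permM_def fun_eq_iff)
lemma permM_Suc: "(permM (Suc n) st :: ('w, _) M) = lift (perm_step st) \<then> permM n"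
proof -
  have "(foldM (\<lambda>(_ :: unit) st. lift (perm_step st)) (replicate n ()) :: _ => ('w, _) M) = permM n" by (simp add: permM_def fun_eq_iff)
  then show ?thesis by (simp add: permM_def)
qed

text \<open>A uniform first element followed by a uniform ordering of the rest is a uniform
  ordering, by \<open>random_permutation_of_set\<close>; \<open>acc\<close> is the part drawn so
  far.\<close>

lemma rand_perm_aux:
  fixes acc :: "nat list"
  shows "distinct rem ==> length rem = n ==>
    (permM n (rem, acc) :: ('w, _) M) =
    lift (map_pmf (\<lambda>xs. ([], acc @ xs)) (pmf_of_set (permutations_of_set (set rem))))"
proof (induction n arbitrary: rem acc)
  case 0
  then show ?case by (simp add: pmf_of_set_singleton)
next
  case (Suc n)
  have ne: "rem \<noteq> []" using Suc.prems by auto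
  have IH: "(permM n (filter (\<lambda>x. \<not> x = r) rem, acc @ [r]) :: ('w, _) M) =
    lift (map_pmf (\<lambda>xs. ([], acc @ r # xs)) (pmf_of_set (permutations_of_set (set rem - {r}))))" if "r \<in> set rem" for r
  proof -
    have "length (filter (\<lambda>x. \<not> x = r) rem) = n"
    proof -
      have "distinct (filter (\<lambda>x. \<not> x = r) rem)" using Suc.prems(1) by (rule distinct_filter)
      then have "length (filter (\<lambda>x. \<not> x = r) rem) = card (set (filter (\<lambda>x. \<not> x = r) rem))" by (rule distinct_card[symmetric])
      also have "set (filter (\<lambda>x. \<not> x = r) rem) = set rem - {r}" by auto
      finally show ?thesis using Suc.prems \<open>r \<in> set rem\<close> by (simp add: distinct_card)
    qed
    moreover have "set (filter (\<lambda>x. \<not> x = r) rem) = set rem - {r}" by auto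
    ultimately show ?thesis using Suc.IH[of "filter (\<lambda>x. \<not> x = r) rem" "acc @ [r]"] Suc.prems(1) by simp
  qed
  have "(permM (Suc n) (rem, acc) :: ('w, _) M) =
     (\<lambda>w. bind_pmf (pmf_of_set (set rem)) (\<lambda>r. permM n (filter (\<lambda>x. \<not> x = r) rem, acc @ [r]) w))"
    using nat_pick_set[OF Suc.prems(1) ne] by (simp add: permM_Suc perm_step_def lift_bnd bind_map_pmf)
  also have "\<dots> = (\<lambda>w. bind_pmf (pmf_of_set (set rem)) (\<lambda>r. lift (map_pmf (\<lambda>xs. ([], acc @ r # xs)) (pmf_of_set (permutations_of_set (set rem - {r})))) w))"
    using ne by (intro ext bind_pmf_cong refl) (simp add: IH)
  also have "\<dots> = lift (map_pmf (\<lambda>xs. ([], acc @ xs)) (pmf_of_set (permutations_of_set (set rem))))"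
    unfolding lift_def using ne by (subst random_permutation_of_set) (auto simp: map_bind_pmf map_pmf_def bind_assoc_pmf bind_return_pmf)
  finally show ?case .
qed

text \<open>Permutations enter programs as the list of their values. Outside the list this is the
  identity, in agreement with \<open>data_perm\<close>.\<close>

definition perm_fun :: "nat list => nat => nat" where
  "perm_fun ps x = (if 1 \<le> x \<and> x \<le> length ps then nthd 0 ps (x - Suc 0) else x)"

lemma perm_fun_nth: "x \<in> {1..length ps} ==> perm_fun ps x = ps ! (x - 1)"
  by (auto simp: perm_fun_def nthd_eq)

lemma data_perm_fun: "data_perm d = perm_fun (map data_num (data_list d))"
  by (auto simp: fun_eq_iff data_perm_def perm_fun_def nthd_eq)

lemma perm_fun_bij: "bij_betw perm_fun (permutations_of_set {1..n}) {\<sigma>. \<sigma> permutes {1..n}}"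
proof (rule bij_betw_byWitness[where f' = "\<lambda>\<sigma>. map \<sigma> [1..<n+1]"])
  have len: "length ps = n" if "ps \<in> permutations_of_set {1..n}" for ps
    using length_finite_permutations_of_set[OF that] by simp
  show "\<forall>ps\<in>permutations_of_set {1..n}. map (perm_fun ps) [1..<n+1] = ps"
  proof
    fix ps assume "ps \<in> permutations_of_set {1..n}"
    then show "map (perm_fun ps) [1..<n+1] = ps"
      using len by (intro nth_equalityI) (auto simp: perm_fun_nth simp del: upt_Suc)
  qed
  show "\<forall>\<sigma>\<in>{\<sigma>. \<sigma> permutes {1..n}}. perm_fun (map \<sigma> [1..<n+1]) = \<sigma>"
  proof safe
    fix \<sigma> assume s: "\<sigma> permutes {1..n}"
    show "perm_fun (map \<sigma> [1..<n+1]) = \<sigma>"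
    proof
      fix x show "perm_fun (map \<sigma> [1..<n+1]) x = \<sigma> x"
      proof (cases "x \<in> {1..n}")
        case True
        then have "perm_fun (map \<sigma> [1..<n+1]) x = map \<sigma> [1..<n+1] ! (x - 1)" by (intro perm_fun_nth) auto
        then show ?thesis using True by (subst (asm) nth_map) (auto simp del: upt_Suc)
      next
        case False
        then show ?thesis using permutes_not_in[OF s, of x] by (auto simp: perm_fun_def simp del: upt_Suc)
      qed
    qed
  qed
  show "perm_fun ` permutations_of_set {1..n} \<subseteq> {\<sigma>. \<sigma> permutes {1..n}}"
  proof safe
    fix ps assume ps: "ps \<in> permutations_of_set {1..n}"
    have d: "distinct ps" "set ps = {1..n}" using permutations_of_setD[OF ps] by auto
    have "bij_betw (perm_fun ps) {1..n} {1..n}" unfolding bij_betw_def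
    proof
      have im: "perm_fun ps ` {1..n} = (\<lambda>i. ps ! i) ` {..<n}"
      proof -
        have "perm_fun ps ` {1..n} = (\<lambda>x. ps ! (x - 1)) ` {1..n}"
          using len[OF ps] by (intro image_cong refl) (auto simp: perm_fun_nth)
        also have "\<dots> = (\<lambda>i. ps ! i) ` ((\<lambda>x. x - 1) ` {1..n})" by (simp add: image_image)
        also have "(\<lambda>x. x - 1) ` {1..n} = {..<n}" by (auto simp: image_iff intro!: bexI[of _ "Suc _"])
        finally show ?thesis .
      qed
      also have "\<dots> = {1..n}" using d(2) len[OF ps] by (auto simp: set_conv_nth)
      finally show "perm_fun ps ` {1..n} = {1..n}" .
      then show "inj_on (perm_fun ps) {1..n}" by (intro eq_card_imp_inj_on) auto
    qed
    then show "perm_fun ps permutes {1..n}"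
      using len[OF ps] by (intro bij_imp_permutes) (auto simp: perm_fun_def)
  qed
  show "(\<lambda>\<sigma>. map \<sigma> [1..<n+1]) ` {\<sigma>. \<sigma> permutes {1..n}} \<subseteq> permutations_of_set {1..n}"
  proof safe
    fix \<sigma> assume s: "\<sigma> permutes {1..n}"
    show "map \<sigma> [1..<n+1] \<in> permutations_of_set {1..n}"
      using permutes_image[OF s] inj_on_subset[OF permutes_inj[OF s]]
      by (intro permutations_of_setI) (auto simp: distinct_map atLeastLessThanSuc_atLeastAtMost simp del: upt_Suc)
  qed
qed

lemma rand_perm_lift: "(rand_perm n :: ('w, _) M) = lift (pmf_of_set (permutations_of_set {1..n}))"
proof -
  have "set [1..<n+1] = {1..n}" by auto
  then have "(permM n ([1..<n+1], []) :: ('w, _) M) = lift (map_pmf (Pair []) (pmf_of_set (permutations_of_set {1..n})))"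
    using rand_perm_aux[of "[1..<n+1]" n "[]"] by (simp del: upt_Suc)
  then show ?thesis
    unfolding rand_perm_def by (simp add: lift_bnd_ret pmf.map_comp o_def del: upt_Suc)
qed

lemma map_perm_fun: "map_pmf perm_fun (pmf_of_set (permutations_of_set {1..n})) = pmf_of_set {\<sigma>. \<sigma> permutes {1..n}}"
  by (rule map_pmf_of_set_bij_betw[OF perm_fun_bij]) auto

lemma rand_perm_permutes: "Some (ps, w') \<in> set_pmf (rand_perm n w) ==> perm_fun ps permutes {1..n} \<and> length ps = n"
  using perm_fun_bij[of n] by (auto simp: rand_perm_lift length_finite_permutations_of_set bij_betw_def)

section \<open>Elements, legality checks and replies as computable functions\<close>

definition ebits :: "nat => nat => bool list" where "ebits kw x = map (bit x) [0..<kw]"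
definition msg :: "nat => elem => bool list" where "msg kw e = ebits kw (fst e) @ snd e"

lemma elem_bits_msg: "elem_bits n e = msg (key_width n) e"
  by (cases e) (simp add: msg_def ebits_def)

text \<open>Halving a unary number by counting every second unit; the flag is the parity.\<close>

definition half :: "nat => nat \<times> bool" where
  "half x = fold (\<lambda>(_ :: unit) st. if snd st then (Suc (fst st), False) else (fst st, True)) (replicate x ()) (0, False)"

lemma half: "half x = (x div 2, odd x)"
proof -
  have "fold (\<lambda>(_ :: unit) st. if snd st then (Suc (fst st), False) else (fst st, True)) (replicate x ()) (a, b) =
      (a + (x + of_bool b) div 2, odd (x + of_bool b))" for a b
    by (induction x arbitrary: a b) auto
  then show ?thesis by (simp add: half_def)
qed

definition mapM :: "('x => ('w, 'y) M) => 'x list => ('w, 'y list) M" where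
  "mapM f xs = foldM (\<lambda>x acc. f x \<then> (\<lambda>y. ret (acc @ [y]))) xs []"

text \<open>The third condition concerns lists longer than \<open>n\<close>, which denote a
  permutation of \<open>{1..n}\<close> only if they fix the excess positions. Shorter lists are
  completed by the identity.\<close>

definition perm_check :: "nat => nat list => bool" where
  "perm_check n ps \<longleftrightarrow> (\<forall>x \<in> set [1..<n+1]. 1 \<le> perm_fun ps x \<and> perm_fun ps x \<le> n) \<and>
     (\<forall>x \<in> set [1..<n+1]. \<forall>y \<in> set [1..<n+1]. perm_fun ps x = perm_fun ps y \<longrightarrow> x = y) \<and>
     (\<forall>x \<in> set [n+1..<length ps + 1]. perm_fun ps x = x)"

lemma perm_check: "perm_check n ps \<longleftrightarrow> perm_fun ps permutes {1..n}"
proof -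
  have sets: "set [1..<n+1] = {1..n}" "set [n+1..<length ps + 1] = {n+1..length ps}" by auto
  have eq: "perm_check n ps \<longleftrightarrow> (\<forall>x\<in>{1..n}. perm_fun ps x \<in> {1..n}) \<and> inj_on (perm_fun ps) {1..n} \<and>
      (\<forall>x\<in>{n+1..length ps}. perm_fun ps x = x)"
    unfolding perm_check_def sets inj_on_def by (simp only: atLeastAtMost_iff)
  show ?thesis
  proof
    assume c: "perm_check n ps"
    have sub: "perm_fun ps ` {1..n} \<subseteq> {1..n}" using c unfolding eq by blast
    have "bij_betw (perm_fun ps) {1..n} {1..n}"
      using c endo_inj_surj[OF _ sub] unfolding eq bij_betw_def by simp
    then show "perm_fun ps permutes {1..n}"
    proof (rule bij_imp_permutes)
      fix x assume x: "x \<notin> {1..n}"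
      show "perm_fun ps x = x"
      proof (cases "x \<in> {n+1..length ps}")
        case True
        then show ?thesis using c unfolding eq by blast
      next
        case False
        then show ?thesis using x by (auto simp: perm_fun_def)
      qed
    qed
  next
    assume p: "perm_fun ps permutes {1..n}"
    have "inj_on (perm_fun ps) {1..n}" using permutes_inj[OF p] by (rule inj_on_subset) simp
    moreover have "\<forall>x\<in>{1..n}. perm_fun ps x \<in> {1..n}" using permutes_in_image[OF p] by blast
    moreover have "\<forall>x\<in>{n+1..length ps}. perm_fun ps x = x" using permutes_not_in[OF p] by simp
    ultimately show "perm_check n ps" unfolding eq by blast
  qed
qed

definition array_check :: "nat => nat => elem list => bool" where
  "array_check n w A \<longleftrightarrow> length A = n \<and> (\<forall>e \<in> set A. length (filter (\<lambda>f. fst f = fst e) A) \<le> 1) \<and>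
     (\<forall>e \<in> set A. 1 \<le> fst e \<and> fst e \<le> n \<and> length (snd e) = w)"

lemma distinct_filter_le: "distinct (map f A) \<longleftrightarrow> (\<forall>e \<in> set A. length (filter (\<lambda>g. f g = f e) A) \<le> 1)"
proof -
  have cnt: "length (filter (\<lambda>g. f g = y) A) = count (mset (map f A)) y" for y
    by (induction A) auto
  show ?thesis unfolding cnt
  proof
    assume "distinct (map f A)"
    then show "\<forall>e\<in>set A. count (mset (map f A)) (f e) \<le> 1" by (simp only: distinct_count_atmost_1) simp
  next
    assume le: "\<forall>e\<in>set A. count (mset (map f A)) (f e) \<le> 1"
    have "count (mset (map f A)) a = (if a \<in> set (map f A) then 1 else 0)" for a
    proof (cases "a \<in> set (map f A)")
      case True
      then have "count (mset (map f A)) a \<le> 1" using le by auto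
      moreover have "0 < count (mset (map f A)) a" using True by (simp only: count_greater_zero_iff set_mset_mset)
      ultimately have "count (mset (map f A)) a = 1" by linarith
      then show ?thesis using True by (simp only: if_True)
    next
      case False
      then have "count (mset (map f A)) a = 0" by (simp only: count_mset_0_iff) simp
      then show ?thesis using False by (simp only: if_False)
    qed
    then show "distinct (map f A)" unfolding distinct_count_atmost_1 by blast
  qed
qed

lemma array_check: "array_check n w A \<longleftrightarrow> valid_array n w A"
  by (auto simp: array_check_def valid_array_def distinct_filter_le)

text \<open>The key is searched among \<open>1\<close> to \<open>n\<close> instead of being computed
  from its bits: \<open>kw\<close> may be a wrong guess, and a number of \<open>kw\<close> bits can
  have a unary code of exponential size. The search also rejects key 0, the mark of dummies.\<close>

definition find_elem :: "nat => nat => bool list option => elem option" where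
  "find_elem n kw r = (case r of None => None | Some bs =>
     (case filter (\<lambda>x. ebits kw x = take kw bs) [1..<n+1] of [] => None | x # _ => Some (x, drop kw bs)))"

definition outcome_tree :: "nat => nat => data => data list => data list => data list => data list" where
  "outcome_tree s m I C ct co =
     concat (map (\<lambda>i.
        [Node (list_data [num_data 0, I, num_data (i * s), num_data s]) (Node Leaf (list_data (chunk s C i))),
         Node (list_data [num_data 3, num_data 1, list_data (map (\<lambda>j. Node (num_data (j * (s * m) + i * m)) (list_data (chunk m ct (i * s + j)))) [0..<s])]) Leaf]) [0..<s]) @
     concat (map (\<lambda>j.
        [Node (list_data [num_data 0, num_data 1, num_data (j * (s * m)), num_data (s * m)]) (Node Leaf (list_data (concat (map (\<lambda>i. chunk m ct (i * s + j)) [0..<s])))),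
         Node (list_data [num_data 1, num_data 2, num_data (j * s), list_data (chunk s co j)]) Leaf]) [0..<s])"

lemma outcome_view:
  "outcome_data (view s m C cs) = Node (Node Leaf (list_data (drop (s * s * m + s * s + s * s * m) cs)))
     (list_data (outcome_tree s m (num_data 0) C (take (s * s * m) cs) (take (s * s) (drop (s * s * m) cs)) @
        outcome_tree s m (num_data 2) (take (s * s) (drop (s * s * m) cs)) (take (s * s * m) (drop (s * s * m + s * s) cs))
          (drop (s * s * m + s * s + s * s * m) cs)))"
  by (simp add: outcome_data_def view_def Let_def option_data_def outcome_tree_def pass_view_def map_concat o_def)

section \<open>Polynomial time of the checks, the plan and the replies\<close>

context machine begin

lemma ptm_nat_pick: assumes "pt l" shows "ptm (\<lambda>a. lift (nat_pick (l a)))"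
proof -
  have "ptm (\<lambda>l :: data list. lift (pick l))" by (rule ptm_pick[OF pt_id])
  then have "ptm (\<lambda>l. lift (nat_pick l))"
  proof (rule ptm_transfer[where r = "map code"])
    show "code (map code xs) = code xs" for xs :: "nat list" unfolding code_data_list by (simp add: code_list_def)
    show "map_pmf (map_option (map_prod code id)) (lift (nat_pick xs) w) = map_pmf (map_option (map_prod code id)) (lift (pick (map code xs)) w)" for xs w
      unfolding nat_pick_pick[symmetric] by (simp add: lift_def pmf.map_comp o_def)
  qed
  from ptm_comp[OF this assms] show ?thesis .
qed

lemma pt_num_data: "pt f ==> pt (\<lambda>a. num_data (f a))"
  using pt_code[of f] by (simp add: code_nat_def)

lemma pt_data_num: "pt f ==> pt (\<lambda>a. data_num (f a))"
  unfolding data_num_def by (intro pt_length pt_data_list)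

lemma pt_data_bits: "pt f ==> pt (\<lambda>a. data_bits (f a))"
  unfolding data_bits_def by (intro pt_map pt_data_list pt_data_bit pt_intros0)

lemma pt_data_elems: "pt f ==> pt (\<lambda>a. data_elems (f a))"
  unfolding data_elems_def by (intro pt_map pt_data_list pt_Pair pt_data_num pt_data_bits pt_left pt_right pt_intros0)

lemma ptm_rand_perm: assumes "pt n" shows "ptm (\<lambda>a. rand_perm (n a))"
proof -
  have "ptm (\<lambda>n. foldM (\<lambda>(_ :: unit) st. lift (perm_step st)) (replicate n ()) ([1..<n+1], []))"
  proof (rule ptm_foldM[where J = "\<lambda>n st. set (fst st) \<subseteq> {0..n}" and G = "\<lambda>x. x + 2"])
    have "ptm (\<lambda>st. lift (nat_pick (fst st)) \<then> (\<lambda>r. ret (filter (\<lambda>x. \<not> x = r) (fst st), snd st @ [r])))"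
      by (intro ptm_pair ptm_nat_pick pt_Pair pt_filter pt_append pt_Cons pt_not pt_eq pt_intros0)
    then have "ptm (\<lambda>st. lift (perm_step st))" by (simp add: perm_step_def lift_bnd_ret)
    then show "ptm (\<lambda>p. lift (perm_step (snd p)))" by (rule ptm_comp) (rule pt_snd0)
    fix n :: nat and x :: unit and st st' and w w' :: 'w
    assume J: "set (fst st) \<subseteq> {0..n}" and "Some (st', w') \<in> set_pmf (lift (perm_step st) w)"
    then obtain r where r: "r \<in> set_pmf (nat_pick (fst st))" "st' = (filter (\<lambda>x. \<not> x = r) (fst st), snd st @ [r])"
      by (auto simp: perm_step_def)
    \<comment> \<open>The invariant bounds the number drawn, and with it the growth in this
      round.\<close>
    have "r \<le> n"
    proof (cases "fst st = []")
      case False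
      then obtain i where "i < length (fst st)" "r = fst st ! i"
        using r(1) by (auto simp: nat_pick_def lessThan_empty_iff)
      then have "r \<in> {0..n}" using subsetD[OF J nth_mem, of i] by simp
      then show ?thesis by simp
    qed (use r(1) in \<open>simp add: nat_pick_def\<close>)
    then show "set (fst st') \<subseteq> {0..n} \<and> sz st' \<le> sz st + (kp w + sz n + sz x + 2)"
      using r(2) J sz_filter[of "\<lambda>x. \<not> x = r" "fst st"] by (cases st) auto
  qed (auto intro!: pmono_intros pt_nat_units pt_id pt_Pair pt_upt pt_const pt_add pt_Suc simp del: upt_Suc)
  then have "ptm (\<lambda>n. rand_perm n)" unfolding rand_perm_def permM_def by (intro ptm_pair pt_snd pt_intros0)
  from ptm_comp[OF this assms] show ?thesis .
qed

lemma pt_half: "pt half"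
  unfolding half_def
  by (rule pt_fold[where J = "\<lambda>_ _. True" and G = "\<lambda>x. x + 2"])
    (auto intro!: pmono_intros pt_nat_units pt_if pt_Pair pt_Suc pt_intros0)

lemma pt_bit: assumes "pt x" "pt i" shows "pt (\<lambda>a. bit (x a :: nat) (i a))"
proof -
  have e: "fold (\<lambda>(_ :: unit) y. fst (half y)) (replicate i ()) x = x div 2 ^ i" for i x
    by (induction i arbitrary: x) (simp_all add: half div_mult2_eq)
  have "pt (\<lambda>p :: nat \<times> nat. fold (\<lambda>(_ :: unit) y. fst (half y)) (replicate (snd p) ()) (fst p))"
  proof (rule pt_fold[where J = "\<lambda>_ _. True" and G = "\<lambda>x. x"])
    show "pt (\<lambda>p :: ((nat \<times> nat) \<times> unit) \<times> nat. fst (half (snd p)))" by (intro pt_fst ptm_comp[OF pt_half] pt_snd0)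
  qed (auto intro!: pmono_intros pt_nat_units pt_intros0 simp: half)
  then have "pt (\<lambda>p :: nat \<times> nat. snd (half (fst p div 2 ^ snd p)))"
    unfolding e by (intro pt_snd ptm_comp[OF pt_half])
  then have "pt (\<lambda>p :: nat \<times> nat. bit (fst p) (snd p))"
    by (rule pt_cong) (simp add: half bit_iff_odd)
  from ptm_comp[OF this pt_Pair[OF assms]] show ?thesis by simp
qed

lemma pt_ebits: assumes "pt kw" "pt x" shows "pt (\<lambda>a. ebits (kw a) (x a))"
proof -
  have "pt (\<lambda>p. ebits (fst p) (snd p))" unfolding ebits_def
    by (intro pt_map pt_upt pt_bit pt_intros0)
  from ptm_comp[OF this pt_Pair[OF assms]] show ?thesis by simp
qed

lemma pt_msg: assumes "pt kw" "pt e" shows "pt (\<lambda>a. msg (kw a) (e a))"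
  unfolding msg_def by (intro pt_append pt_ebits pt_fst pt_snd assms)

lemma ptm_mapM': assumes "pt l" "ptm (\<lambda>p. f (fst p) (snd p))" shows "ptm (\<lambda>a. mapM (f a) (l a))"
  unfolding mapM_def by (rule ptm_mapM[OF assms])

lemma pt_perm_fun: assumes "pt ps" "pt x" shows "pt (\<lambda>a. perm_fun (ps a) (x a))"
proof -
  have "pt (\<lambda>p. perm_fun (fst p) (snd p))" unfolding perm_fun_def
    by (intro pt_if pt_conj pt_le pt_length pt_nthd pt_pred pt_intros0)
  from ptm_comp[OF this pt_Pair[OF assms]] show ?thesis by simp
qed

lemma pt_imp: "pt b ==> pt c ==> pt (\<lambda>a. b a \<longrightarrow> c a)"
  by (rule pt_cong[OF pt_disj[OF pt_not]]) auto

lemma pt_perm_check: assumes "pt n" "pt ps" shows "pt (\<lambda>a. perm_check (n a) (ps a))"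
proof -
  have "pt (\<lambda>p. perm_check (fst p) (snd p))" unfolding perm_check_def
    by (intro pt_conj pt_ball pt_imp pt_le pt_length pt_perm_fun pt_upt pt_add pt_intros0)
  from ptm_comp[OF this pt_Pair[OF assms]] show ?thesis by simp
qed

lemma pt_array_check: assumes "pt n" "pt w" "pt A" shows "pt (\<lambda>a. array_check (n a) (w a) (A a))"
proof -
  have "pt (\<lambda>p. array_check (fst p) (fst (snd p)) (snd (snd p)))" unfolding array_check_def
    by (intro pt_conj pt_ball pt_imp pt_le pt_length pt_filter pt_add pt_intros0)
  from ptm_comp[OF this pt_Pair[OF assms(1) pt_Pair[OF assms(2,3)]]] show ?thesis by simp
qed

lemma pt_find_elem: assumes "pt n" "pt kw" "pt r" shows "pt (\<lambda>a. find_elem (n a) (kw a) (r a))"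
proof -
  have "pt (\<lambda>p. find_elem (fst p) (fst (snd p)) (snd (snd p)))" unfolding find_elem_def
    by (intro pt_case_option pt_case_list pt_filter pt_upt pt_add pt_ebits pt_take pt_drop pt_Some pt_Pair pt_eq pt_fst pt_snd pt_id pt_const)
  from ptm_comp[OF this pt_Pair[OF assms(1) pt_Pair[OF assms(2,3)]]] show ?thesis by simp
qed

lemma pt_chunk: assumes "pt l" "pt xs" "pt q" shows "pt (\<lambda>a. chunk (l a) (xs a) (q a))"
  unfolding chunk_def by (intro pt_take pt_drop pt_mult assms)

lemma pt_batch: assumes "pt s" "pt ps" "pt es" "pt i" "pt j" shows "pt (\<lambda>a. batch (s a) (perm_fun (ps a)) (es a) (i a) (j a))"
proof -
  have "pt (\<lambda>p. batch (fst p) (perm_fun (fst (snd p))) (fst (snd (snd p))) (fst (snd (snd (snd p)))) (snd (snd (snd (snd p)))))"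
    unfolding batch_def in_bucket_def One_nat_def
    by (intro pt_filter pt_chunk pt_conj pt_le pt_less pt_mult pt_add pt_pred pt_perm_fun pt_fst pt_snd pt_id)
  from ptm_comp[OF this pt_Pair[OF assms(1) pt_Pair[OF assms(2) pt_Pair[OF assms(3) pt_Pair[OF assms(4,5)]]]]] show ?thesis by simp
qed

lemma pt_overflow: assumes "pt s" "pt m" "pt ps" "pt es" shows "pt (\<lambda>a. overflow (s a) (m a) (perm_fun (ps a)) (es a))"
proof -
  have "pt (\<lambda>p. overflow (fst p) (fst (snd p)) (perm_fun (fst (snd (snd p)))) (snd (snd (snd p))))"
    unfolding overflow_def by (intro pt_bex pt_upt pt_less pt_length pt_batch pt_fst pt_snd pt_id pt_const)
  from ptm_comp[OF this pt_Pair[OF assms(1) pt_Pair[OF assms(2) pt_Pair[OF assms(3,4)]]]] show ?thesis by simp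
qed

lemma pt_tmp_plan: assumes "pt s" "pt m" "pt w" "pt ps" "pt es" shows "pt (\<lambda>a. tmp_plan (s a) (m a) (w a) (perm_fun (ps a)) (es a))"
proof -
  have "pt (\<lambda>p. tmp_plan (fst p) (fst (snd p)) (fst (snd (snd p))) (perm_fun (fst (snd (snd (snd p))))) (snd (snd (snd (snd p)))))"
    unfolding tmp_plan_def row_def padded_def
    by (intro pt_concat pt_map pt_upt pt_append pt_batch pt_replicate pt_Pair pt_diff pt_length pt_fst pt_snd pt_id pt_const)
  from ptm_comp[OF this pt_Pair[OF assms(1) pt_Pair[OF assms(2) pt_Pair[OF assms(3) pt_Pair[OF assms(4,5)]]]]] show ?thesis by simp
qed

lemma pt_seg: assumes "pt ps" "pt es" "pt x" "pt y" shows "pt (\<lambda>a. seg (perm_fun (ps a)) (es a) (x a) (y a))"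
proof -
  have "pt (\<lambda>p. seg (perm_fun (fst p)) (fst (snd p)) (fst (snd (snd p))) (snd (snd (snd p))))"
    unfolding seg_def
    by (intro pt_concat pt_map pt_upt pt_filter pt_eq pt_perm_fun pt_Suc pt_fst pt_snd pt_id)
  from ptm_comp[OF this pt_Pair[OF assms(1) pt_Pair[OF assms(2) pt_Pair[OF assms(3,4)]]]] show ?thesis by simp
qed

lemma pt_plan: assumes "pt s" "pt m" "pt w" "pt ps" "pt qs" "pt es"
  shows "pt (\<lambda>a. plan (s a) (m a) (w a) (perm_fun (ps a)) (perm_fun (qs a)) (es a))"
  unfolding plan_def
  by (intro pt_if pt_overflow pt_const pt_Some pt_append pt_tmp_plan pt_seg pt_mult assms)

lemma pt_outcome_tree: assumes "pt s" "pt m" "pt I" "pt C" "pt ct" "pt co"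
  shows "pt (\<lambda>a. outcome_tree (s a) (m a) (I a) (C a) (ct a) (co a))"
proof -
  have "pt (\<lambda>p. outcome_tree (fst p) (fst (snd p)) (fst (snd (snd p))) (fst (snd (snd (snd p)))) (fst (snd (snd (snd (snd p))))) (snd (snd (snd (snd (snd p))))))"
    unfolding outcome_tree_def
    by (intro pt_append pt_concat pt_map pt_upt pt_Cons pt_Node pt_list_data pt_num_data pt_chunk pt_mult pt_add pt_fst pt_snd pt_id pt_const)
  from ptm_comp[OF this pt_Pair[OF assms(1) pt_Pair[OF assms(2) pt_Pair[OF assms(3) pt_Pair[OF assms(4) pt_Pair[OF assms(5,6)]]]]]]
  show ?thesis by simp
qed

lemma pt_outcome_view: assumes "pt s" "pt m" "pt C" "pt cs"
  shows "pt (\<lambda>a. outcome_data (view (s a) (m a) (C a) (cs a)))"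
  unfolding outcome_view
  by (intro pt_Node pt_const pt_list_data pt_append pt_outcome_tree pt_drop pt_take pt_add pt_mult pt_num_data assms)

end

section \<open>The shuffle game with encryption left to handlers\<close>

definition enc_seq :: "('x => bool => bool => bool list => ('w, data) M) => 'x => nat => nat => bool list list => ('w, data list) M" where
  "enc_seq ench x j i ms = mapM (\<lambda>q. ench x (i + q < j) (i + q = j) (nthd [] ms q)) [0..<length ms]"

text \<open>Ciphertexts produced by the reduction itself are looked up. The challenge ciphertext is
  among them, and a query for its decryption would be an illegal move.\<close>

definition dec_one :: "('x => data => ('w, bool list option) M) => 'x => (data \<times> bool list) list => data => ('w, bool list option) M" where
  "dec_one dech x tab c = (case filter (\<lambda>t. fst t = c) tab of [] => dech x c | t # _ => ret (Some (snd t)))"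

definition zipd :: "data list => bool list list => (data \<times> bool list) list" where
  "zipd cs ms = map (\<lambda>q. (nthd Leaf cs q, nthd [] ms q)) [0..<length cs]"

lemma zipd: "length cs = length ms ==> zipd cs ms = zip cs ms"
  by (intro nth_equalityI) (auto simp: zipd_def nthd_eq)

text \<open>State of the simulated shuffle game: the number of encryptions made so far, the table of
  produced ciphertexts with their plaintexts, and whether the challenge has been issued. The key is
  left to the handlers.\<close>

type_synonym gst = "nat \<times> (data \<times> bool list) list \<times> bool"

text \<open>\<open>pre\<close> marks queries on plain arrays, where the input array itself is
  encrypted first.\<close>

definition plaintexts :: "nat => bool => elem list => elem list => bool list list" where
  "plaintexts kw pre A pl = map (msg kw) ((if pre then A else []) @ pl)"

definition reply :: "nat => nat => bool => data list => nat => (data \<times> bool list) list => bool => bool list list => data list => data \<times> gst" where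
  "reply s m pre C i tab ch ms cs =
     (outcome_data (view s m (if pre then take (s * s) cs else C) (if pre then drop (s * s) cs else cs)),
      i + length ms, tab @ zipd cs ms, ch)"

text \<open>An overflow yields \<open>None\<close>, which ends the interpreted run like an illegal
  move. \<open>i\<close> counts the encryptions made before and \<open>j\<close> is the position of
  the hybrid; the handler \<open>ench\<close> is told whether an encryption comes before that
  position or is the one at it.\<close>

definition run_shuffle :: "('x => bool => bool => bool list => ('w, data) M) => 'x => nat => nat => nat => nat => nat =>
    nat => (data \<times> bool list) list => bool => data list => elem list => nat list => bool => ('w, (data \<times> gst) option) M" where
  "run_shuffle ench x s m w kw j i tab pre C A ps ch =
     rand_perm (s * s) \<then> (\<lambda>ps1. case plan s m w (perm_fun ps1) (perm_fun ps) A of None => ret None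
       | Some pl => enc_seq ench x j i (plaintexts kw pre A pl) \<then>
           (\<lambda>cs. ret (Some (reply s m pre C i tab ch (plaintexts kw pre A pl) cs))))"

definition ok :: "nat => nat => elem list => nat list => bool" where
  "ok n w A ps \<longleftrightarrow> array_check n w A \<and> perm_check n ps"

definition found :: "nat => nat => bool list option list => elem list" where
  "found n kw rs = concat (map (\<lambda>r. case find_elem n kw r of None => [] | Some e => [e]) rs)"

definition num_list :: "data => nat list" where "num_list d = map data_num (data_list d)"

text \<open>\<open>b\<close> is the secret bit of the shuffle game, which the reduction draws
  itself. Whether a submitted list encrypts some legal array is decided by decrypting it.\<close>

definition answer :: "('x => bool => bool => bool list => ('w, data) M) => ('x => data => ('w, bool list option) M) => 'x =>
    nat => nat => nat => nat => nat => bool => data => gst => ('w, (data \<times> gst) option) M" where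
  "answer ench dech x s m w kw j b d g =
     (if data_num (left d) = 0 then
        (if \<not> snd (snd g) \<and> ok (s * s) w (data_elems (left (right d))) (num_list (right (right d)))
         then run_shuffle ench x s m w kw j (fst g) (fst (snd g)) True [] (data_elems (left (right d))) (num_list (right (right d))) False
         else ret None)
      else if data_num (left d) = 1 then
        (if \<not> snd (snd g) \<and> ok (s * s) w (data_elems (left (left (right d)))) (num_list (right (left (right d)))) \<and>
            ok (s * s) w (data_elems (left (right (right d)))) (num_list (right (right (right d))))
         then run_shuffle ench x s m w kw j (fst g) (fst (snd g)) True []
           (if b then data_elems (left (right (right d))) else data_elems (left (left (right d))))
           (if b then num_list (right (right (right d))) else num_list (right (left (right d)))) True
         else ret None)
      else if snd (snd g) then
        mapM (dec_one dech x (fst (snd g))) (data_list (left (right d))) \<then> (\<lambda>rs.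
          if (\<forall>r \<in> set rs. find_elem (s * s) kw r \<noteq> None) \<and> ok (s * s) w (found (s * s) kw rs) (num_list (right (right d)))
          then run_shuffle ench x s m w kw j (fst g) (fst (snd g)) False (data_list (left (right d))) (found (s * s) kw rs) (num_list (right (right d))) True
          else ret None)
      else ret None)"

text \<open>\<open>B\<close> is both the number of interpreted steps and the limit on sizes. The
  list of variables has room for variable 0, which holds the input, and for all variables of
  \<open>A\<close>.\<close>

definition play_adv :: "com => ('x => bool => bool => bool list => ('w, data) M) => ('x => data => ('w, bool list option) M) => 'x =>
    nat => nat => nat => nat => nat => bool => nat => nat => ('w, bool) M" where
  "play_adv A ench dech x s m w kw j b B k =
     interp (subs A) B (\<lambda>d g. answer ench dech x s m w kw j b d g) B
       ([A], list_data [num_data k, num_data (s * s), num_data w] # replicate (cvars A) Leaf, Some (0, [], False)) \<then>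
     (\<lambda>st. ret (fst st = [] \<and> \<not> snd (snd st) = None \<and> data_bit (nthd Leaf (fst (snd st)) 0) = b))"

lemma plan_Some:
  assumes "plan s m w \<rho>1 \<rho>2 A = Some pl" "valid_array (s * s) w A" "\<rho>1 permutes {1..s * s}" "\<rho>2 permutes {1..s * s}"
  shows "length pl = 2 * (s * s * m + s * s)" "\<And>e. e \<in> set pl ==> length (snd e) = w"
proof -
  let ?A1 = "seg \<rho>1 A 0 (s * s)"
  have nov: "\<not> overflow s m \<rho>1 A" "\<not> overflow s m \<rho>2 ?A1" and
    pl: "pl = (tmp_plan s m w \<rho>1 A @ ?A1) @ tmp_plan s m w \<rho>2 ?A1 @ seg \<rho>2 ?A1 0 (s * s)"
    using assms(1) by (auto simp: plan_def split: if_splits)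
  have v1: "valid_array (s * s) w ?A1" by (rule valid_seg[OF assms(2,3)])
  show "length pl = 2 * (s * s * m + s * s)"
    unfolding pl using length_tmp_plan[OF nov(1)] length_tmp_plan[OF nov(2)] length_seg[OF assms(2,3), of "s * s" 0]
      length_seg[OF v1 assms(4), of "s * s" 0] by simp
  have tp: "length (snd e) = w" if et: "e \<in> set (tmp_plan s m w \<rho> es)" and "valid_array (s * s) w es" for e \<rho> es
  proof -
    obtain i j where "e \<in> set (padded s m w \<rho> es i j)" using et by (auto simp: tmp_plan_def row_def)
    then consider "e \<in> set (chunk s es i)" | "snd e = replicate w False" by (auto simp: padded_def batch_def)
    then show ?thesis
    proof cases
      case 1
      then have "e \<in> set es" unfolding chunk_def by (meson in_set_dropD in_set_takeD)
      then show ?thesis using \<open>valid_array (s * s) w es\<close> by (auto simp: valid_array_def)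
    qed simp
  qed
  have sg: "length (snd e) = w" if "e \<in> set (seg \<rho> es a b)" "valid_array (s * s) w es" for e \<rho> es a b
    using that by (auto simp: seg_def valid_array_def)
  show "length (snd e) = w" if "e \<in> set pl" for e
  proof -
    have "e \<in> set (tmp_plan s m w \<rho>1 A) \<or> e \<in> set ?A1 \<or> e \<in> set (tmp_plan s m w \<rho>2 ?A1) \<or> e \<in> set (seg \<rho>2 ?A1 0 (s * s))"
      using that unfolding pl by auto
    then show ?thesis using tp[of e _ A, OF _ assms(2)] tp[of e _ ?A1, OF _ v1] sg[of e _ A, OF _ assms(2)] sg[of e _ ?A1, OF _ v1]
      by blast
  qed
qed

text \<open>This bounds the growth of the table. As number and length of the plaintexts depend on
  the parameters only, it also makes the zeros that replace them the same for both secret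
  bits.\<close>

lemma plaintexts_props:
  assumes "plan s m w \<rho>1 \<rho>2 A = Some pl" "valid_array (s * s) w A" "\<rho>1 permutes {1..s * s}" "\<rho>2 permutes {1..s * s}"
  shows "length (plaintexts kw pre A pl) = (if pre then s * s else 0) + 2 * (s * s * m + s * s)"
    and "\<And>ms. ms \<in> set (plaintexts kw pre A pl) ==> length ms = kw + w"
proof -
  show "length (plaintexts kw pre A pl) = (if pre then s * s else 0) + 2 * (s * s * m + s * s)"
    using plan_Some(1)[OF assms] assms(2) by (simp add: plaintexts_def valid_array_def)
  fix ms assume "ms \<in> set (plaintexts kw pre A pl)"
  then obtain e where "e \<in> set A \<union> set pl" "ms = msg kw e" by (auto simp: plaintexts_def split: if_splits)
  then show "length ms = kw + w" using plan_Some(2)[OF assms, of e] assms(2)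
    by (auto simp: msg_def ebits_def valid_array_def)
qed

lemma sz_bools: "sz (bs :: bool list) \<le> 2 * length bs"
proof (induction bs)
  case (Cons b bs)
  then show ?case by (cases b) auto
qed simp

section \<open>Growth of the simulated game and polynomial time of the interpreted adversary\<close>

context machine begin

lemma mapM_result:
  assumes inv: "\<And>x w y w'. w \<in> Inv ==> Some (y, w') \<in> set_pmf (f x w) ==> w' \<in> Inv \<and> kp w' = kp w"
    and w: "w \<in> Inv" and r: "Some (ys, w') \<in> set_pmf (mapM f xs w)"
  shows "length ys = length xs \<and> w' \<in> Inv \<and> kp w' = kp w \<and>
    (\<forall>y \<in> set ys. \<exists>x \<in> set xs. \<exists>w1 w2. w1 \<in> Inv \<and> kp w1 = kp w \<and> Some (y, w2) \<in> set_pmf (f x w1))"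
proof -
  have "length ys = length acc + length xs \<and> w' \<in> Inv \<and> kp w' = kp w \<and>
    (\<forall>y \<in> set ys. y \<in> set acc \<or> (\<exists>x \<in> set xs. \<exists>w1 w2. w1 \<in> Inv \<and> kp w1 = kp w \<and> Some (y, w2) \<in> set_pmf (f x w1)))"
    if "w \<in> Inv" "Some (ys, w') \<in> set_pmf (foldM (\<lambda>x acc. f x \<then> (\<lambda>y. ret (acc @ [y]))) xs acc w)" for w acc
    using that
  proof (induction xs arbitrary: w acc)
    case (Cons x xs)
    then obtain y w1 where 1: "Some (y, w1) \<in> set_pmf (f x w)"
      "Some (ys, w') \<in> set_pmf (foldM (\<lambda>x acc. f x \<then> (\<lambda>y. ret (acc @ [y]))) xs (acc @ [y]) w1)"
      by (auto simp: set_bnd)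
    have i: "w1 \<in> Inv" "kp w1 = kp w" using inv[OF Cons.prems(1) 1(1)] by auto
    from Cons.IH[OF i(1) 1(2)] i 1(1) Cons.prems(1) show ?case by fastforce
  qed auto
  from this[OF w r[unfolded mapM_def]] show ?thesis by simp
qed

lemma ptm_ench:
  assumes "pt x" "pt lo" "pt eq" "pt ms" and ench: "ptm (\<lambda>p. ench (fst p) (fst (snd p)) (fst (snd (snd p))) (snd (snd (snd p))))"
  shows "ptm (\<lambda>a. ench (x a) (lo a) (eq a) (ms a))"
  using ptm_comp[OF ench pt_Pair[OF assms(1) pt_Pair[OF assms(2) pt_Pair[OF assms(3) assms(4)]]]] by simp

lemma ptm_enc_seq:
  assumes "pt x" "pt j" "pt i" "pt ms" and ench: "ptm (\<lambda>p. ench (fst p) (fst (snd p)) (fst (snd (snd p))) (snd (snd (snd p))))"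
  shows "ptm (\<lambda>a. enc_seq ench (x a) (j a) (i a) (ms a))"
proof -
  have "ptm (\<lambda>p. enc_seq ench (fst p) (fst (snd p)) (fst (snd (snd p))) (snd (snd (snd p))))"
    unfolding enc_seq_def
    by (intro ptm_mapM' ptm_ench[OF _ _ _ _ ench] pt_upt pt_length pt_nthd pt_add pt_less pt_eq pt_fst pt_snd pt_id pt_const)
  from ptm_comp[OF this pt_Pair[OF assms(1) pt_Pair[OF assms(2) pt_Pair[OF assms(3) assms(4)]]]] show ?thesis by simp
qed

lemma ptm_dec_one:
  assumes "pt x" "pt tab" "pt c" and dech: "ptm (\<lambda>p. dech (fst p) (snd p))"
  shows "ptm (\<lambda>a. dec_one dech (x a) (tab a) (c a))"
proof -
  have d: "ptm (\<lambda>a. dech (X a) (Y a))" if "pt X" "pt Y" for X Y using ptm_comp[OF dech pt_Pair[OF that]] by simp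
  have "ptm (\<lambda>p. dec_one dech (fst p) (fst (snd p)) (snd (snd p)))"
    unfolding dec_one_def by (intro ptm_case_list d pt_filter pt_Some pt_eq pt_fst pt_snd pt_id)
  from ptm_comp[OF this pt_Pair[OF assms(1) pt_Pair[OF assms(2) assms(3)]]] show ?thesis by simp
qed

lemma pt_zipd: assumes "pt cs" "pt ms" shows "pt (\<lambda>a. zipd (cs a) (ms a))"
proof -
  have "pt (\<lambda>p. zipd (fst p) (snd p))" unfolding zipd_def
    by (intro pt_map pt_upt pt_length pt_Pair pt_nthd pt_fst pt_snd pt_id pt_const)
  from ptm_comp[OF this pt_Pair[OF assms]] show ?thesis by simp
qed

lemma pt_plaintexts: assumes "pt kw" "pt pre" "pt A" "pt pl" shows "pt (\<lambda>a. plaintexts (kw a) (pre a) (A a) (pl a))"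
proof -
  have "pt (\<lambda>p. plaintexts (fst p) (fst (snd p)) (fst (snd (snd p))) (snd (snd (snd p))))" unfolding plaintexts_def
    by (intro pt_map pt_append pt_if pt_msg pt_fst pt_snd pt_id pt_const)
  from ptm_comp[OF this pt_Pair[OF assms(1) pt_Pair[OF assms(2) pt_Pair[OF assms(3) assms(4)]]]] show ?thesis by simp
qed

lemma pt_reply: assumes "pt s" "pt m" "pt pre" "pt C" "pt i" "pt tab" "pt ch" "pt ms" "pt cs"
  shows "pt (\<lambda>a. reply (s a) (m a) (pre a) (C a) (i a) (tab a) (ch a) (ms a) (cs a))"
  unfolding reply_def
  by (intro pt_Pair pt_outcome_view pt_if pt_take pt_drop pt_mult pt_add pt_length pt_append pt_zipd assms)

lemma ptm_run_shuffle:
  assumes "pt x" "pt s" "pt m" "pt w" "pt kw" "pt j" "pt i" "pt tab" "pt pre" "pt C" "pt A" "pt ps" "pt ch" and ench: "ptm (\<lambda>p. ench (fst p) (fst (snd p)) (fst (snd (snd p))) (snd (snd (snd p))))"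
  shows "ptm (\<lambda>a. run_shuffle ench (x a) (s a) (m a) (w a) (kw a) (j a) (i a) (tab a) (pre a) (C a) (A a) (ps a) (ch a))"
proof -
  have "ptm (\<lambda>p. run_shuffle ench (fst p) (fst (snd p)) (fst (snd (snd p))) (fst (snd (snd (snd p)))) (fst (snd (snd (snd (snd p))))) (fst (snd (snd (snd (snd (snd p)))))) (fst (snd (snd (snd (snd (snd (snd p))))))) (fst (snd (snd (snd (snd (snd (snd (snd p)))))))) (fst (snd (snd (snd (snd (snd (snd (snd (snd p))))))))) (fst (snd (snd (snd (snd (snd (snd (snd (snd (snd p)))))))))) (fst (snd (snd (snd (snd (snd (snd (snd (snd (snd (snd p))))))))))) (fst (snd (snd (snd (snd (snd (snd (snd (snd (snd (snd (snd p)))))))))))) (snd (snd (snd (snd (snd (snd (snd (snd (snd (snd (snd (snd p)))))))))))))"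
    unfolding run_shuffle_def
    by (intro ptm_pair ptm_rand_perm ptm_case_option pt_plan ptm_enc_seq[OF _ _ _ _ ench] pt_plaintexts pt_Some pt_reply
      pt_mult pt_fst pt_snd pt_id pt_const)
  from ptm_comp[OF this pt_Pair[OF assms(1) pt_Pair[OF assms(2) pt_Pair[OF assms(3) pt_Pair[OF assms(4) pt_Pair[OF assms(5) pt_Pair[OF assms(6) pt_Pair[OF assms(7) pt_Pair[OF assms(8) pt_Pair[OF assms(9) pt_Pair[OF assms(10) pt_Pair[OF assms(11) pt_Pair[OF assms(12) assms(13)]]]]]]]]]]]]] show ?thesis by simp
qed

lemma pt_ok: assumes "pt n" "pt w" "pt A" "pt ps" shows "pt (\<lambda>a. ok (n a) (w a) (A a) (ps a))"
  unfolding ok_def by (intro pt_conj pt_array_check pt_perm_check assms)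

lemma pt_num_list: "pt d ==> pt (\<lambda>a. num_list (d a))"
  unfolding num_list_def by (intro pt_map pt_data_list pt_data_num pt_snd0)

lemma pt_found: assumes "pt n" "pt kw" "pt rs" shows "pt (\<lambda>a. found (n a) (kw a) (rs a))"
proof -
  have "pt (\<lambda>p. found (fst p) (fst (snd p)) (snd (snd p)))" unfolding found_def
    by (intro pt_concat pt_map pt_case_option pt_find_elem pt_Cons pt_fst pt_snd pt_id pt_const)
  from ptm_comp[OF this pt_Pair[OF assms(1) pt_Pair[OF assms(2) assms(3)]]] show ?thesis by simp
qed

lemma ptm_respond:
  assumes "pt x" "pt s" "pt m" "pt w" "pt kw" "pt j" "pt b" "pt d" "pt g" and ench: "ptm (\<lambda>p. ench (fst p) (fst (snd p)) (fst (snd (snd p))) (snd (snd (snd p))))" and dech: "ptm (\<lambda>p. dech (fst p) (snd p))"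
  shows "ptm (\<lambda>a. answer ench dech (x a) (s a) (m a) (w a) (kw a) (j a) (b a) (d a) (g a))"
proof -
  have "ptm (\<lambda>p. answer ench dech (fst p) (fst (snd p)) (fst (snd (snd p))) (fst (snd (snd (snd p)))) (fst (snd (snd (snd (snd p))))) (fst (snd (snd (snd (snd (snd p)))))) (fst (snd (snd (snd (snd (snd (snd p))))))) (fst (snd (snd (snd (snd (snd (snd (snd p)))))))) (snd (snd (snd (snd (snd (snd (snd (snd p)))))))))"
    unfolding answer_def
    by (intro ptm_if ptm_pair ptm_mapM' ptm_dec_one[OF _ _ _ dech] ptm_run_shuffle[OF _ _ _ _ _ _ _ _ _ _ _ _ _ ench]
      pt_conj pt_not pt_ball pt_ok pt_found pt_find_elem pt_num_list pt_data_elems pt_data_num pt_data_list pt_left pt_right pt_eq pt_if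
      pt_mult pt_fst pt_snd pt_id pt_const)
  from ptm_comp[OF this pt_Pair[OF assms(1) pt_Pair[OF assms(2) pt_Pair[OF assms(3) pt_Pair[OF assms(4) pt_Pair[OF assms(5) pt_Pair[OF assms(6) pt_Pair[OF assms(7) pt_Pair[OF assms(8) assms(9)]]]]]]]]] show ?thesis by simp
qed

text \<open>\<open>y\<close> bounds all parameters, so at most
  \<open>y * y + 2 * (y * y * y + y * y)\<close> encryptions are made. A plaintext has at most
  \<open>2 * y\<close> bits, each of size at most 2 in its list, hence \<open>4 * y\<close>. A table
  entry takes two more nodes and the counter one unit, hence the \<open>3\<close>. The
  \<open>5\<close> covers the two flags and the three pairs in the argument of the handler.\<close>

lemma run_shuffle_growth:
  fixes x :: "'x :: code"
  assumes ge: "pmono ge" "\<And>x lo eq ms w c w'. w \<in> Inv ==> Some (c, w') \<in> set_pmf (ench x lo eq ms w) ==>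
      w' \<in> Inv \<and> kp w' = kp w \<and> size c \<le> ge (kp w + sz x + 5 + sz ms)"
    and wI: "wo \<in> Inv" and A: "valid_array (s * s) w A" and ps: "perm_fun ps permutes {1..s * s}"
    and r: "Some (Some (d, g'), w') \<in> set_pmf (run_shuffle ench x s m w kw j i tab pre C A ps ch wo)"
    and y: "sz x \<le> y" "s \<le> y" "m \<le> y" "w \<le> y" "kw \<le> y"
  shows "sz g' \<le> sz (i, tab, ch) + (y * y + 2 * (y * y * y + y * y)) * (ge (kp wo + y + 5 + 4 * y) + 4 * y + 3) + 1"
proof -
  let ?L = "y * y + 2 * (y * y * y + y * y)"
  from r obtain ps1 w1 where 1: "Some (ps1, w1) \<in> set_pmf (rand_perm (s * s) wo)"
    "Some (Some (d, g'), w') \<in> set_pmf ((case plan s m w (perm_fun ps1) (perm_fun ps) A of None => ret None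
       | Some pl => enc_seq ench x j i (plaintexts kw pre A pl) \<then>
           (\<lambda>cs. ret (Some (reply s m pre C i tab ch (plaintexts kw pre A pl) cs)))) w1)"
    unfolding run_shuffle_def set_bnd by blast
  have w1: "w1 = wo" using 1(1) by (simp add: rand_perm_lift)
  have p1: "perm_fun ps1 permutes {1..s * s}" using rand_perm_permutes[OF 1(1)] by simp
  obtain pl where pl: "plan s m w (perm_fun ps1) (perm_fun ps) A = Some pl" using 1(2) by (auto split: option.splits)
  let ?ms = "plaintexts kw pre A pl"
  obtain cs where cs: "Some (cs, w') \<in> set_pmf (enc_seq ench x j i ?ms wo)" "g' = (i + length ?ms, tab @ zipd cs ?ms, ch)"
    using 1(2) pl w1 by (auto simp: set_bnd reply_def)
  note pp = plaintexts_props[OF pl A p1 ps, where kw = kw and pre = pre]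
  have res: "length cs = length [0..<length ?ms] \<and> w' \<in> Inv \<and> kp w' = kp wo \<and> (\<forall>c \<in> set cs. \<exists>q \<in> set [0..<length ?ms]. \<exists>w1 w2. w1 \<in> Inv \<and> kp w1 = kp wo \<and>
      Some (c, w2) \<in> set_pmf (ench x (i + q < j) (i + q = j) (nthd [] ?ms q) w1))"
    by (rule mapM_result[OF _ wI cs(1)[unfolded enc_seq_def]]) (use ge(2) in blast)
  have szm: "sz mm \<le> 4 * y" if "mm \<in> set ?ms" for mm using sz_bools[of mm] pp(2)[OF that] y by simp
  have szc: "size c \<le> ge (kp wo + y + 5 + 4 * y)" if c: "c \<in> set cs" for c
  proof -
    obtain q w1 w2 where q: "q < length ?ms" "w1 \<in> Inv" "kp w1 = kp wo" "Some (c, w2) \<in> set_pmf (ench x (i + q < j) (i + q = j) (nthd [] ?ms q) w1)"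
      using res c by auto
    have "size c \<le> ge (kp wo + sz x + 5 + sz (nthd [] ?ms q))" using ge(2)[OF q(2,4)] q(3) by simp
    also have "\<dots> \<le> ge (kp wo + y + 5 + 4 * y)"
      using szm[of "?ms ! q"] q(1) y by (intro pmono_monoD[OF ge(1)]) (simp add: nthd_eq)
    finally show ?thesis .
  qed
  have len: "length ?ms \<le> ?L"
  proof -
    have "s * s \<le> y * y" using y by (intro mult_le_mono) auto
    moreover have "s * s * m \<le> y * y * y" using y by (intro mult_le_mono) auto
    ultimately show ?thesis unfolding pp(1) by (auto simp: )
  qed
  have "sz (zipd cs ?ms) \<le> length cs * (ge (kp wo + y + 5 + 4 * y) + 4 * y + 2)"
  proof -
    have "sz (zipd cs ?ms) \<le> length [0..<length cs] * (ge (kp wo + y + 5 + 4 * y) + 4 * y + 1 + 1)"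
      unfolding zipd_def
    proof (rule sz_map_le)
      fix q assume "q \<in> set [0..<length cs]"
      then have q: "q < length cs" "q < length ?ms" using res by auto
      then show "sz (nthd Leaf cs q, nthd [] ?ms q) \<le> ge (kp wo + y + 5 + 4 * y) + 4 * y + 1"
        using szc[of "cs ! q"] szm[of "?ms ! q"] by (simp add: nthd_eq)
    qed
    then show ?thesis by simp
  qed
  also have "\<dots> \<le> ?L * (ge (kp wo + y + 5 + 4 * y) + 4 * y + 2)" using res len by (intro mult_le_mono) auto
  finally have "sz (zipd cs ?ms) + length ?ms \<le> ?L * (ge (kp wo + y + 5 + 4 * y) + 4 * y + 3)"
    using len by (simp add: algebra_simps)
  then show ?thesis unfolding cs(2) by simp
qed

lemma respond_growth:
  fixes x :: "'x :: code"
  assumes ge: "pmono ge" "\<And>x lo eq ms w c w'. w \<in> Inv ==> Some (c, w') \<in> set_pmf (ench x lo eq ms w) ==>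
      w' \<in> Inv \<and> kp w' = kp w \<and> size c \<le> ge (kp w + sz x + 5 + sz ms)"
    and dech: "\<And>x c w r w'. w \<in> Inv ==> Some (r, w') \<in> set_pmf (dech x c w) ==> w' \<in> Inv \<and> kp w' = kp w"
    and wI: "wo \<in> Inv" and r: "Some (Some (d', g'), w') \<in> set_pmf (answer ench dech x s m w kw j b d g wo)"
    and y: "sz x \<le> y" "s \<le> y" "m \<le> y" "w \<le> y" "kw \<le> y"
  shows "sz g' \<le> sz g + ((y * y + 2 * (y * y * y + y * y)) * (ge (kp wo + y + 5 + 4 * y) + 4 * y + 3) + 2)"
proof -
  have main: "sz g' \<le> sz g + ((y * y + 2 * (y * y * y + y * y)) * (ge (kp w1 + y + 5 + 4 * y) + 4 * y + 3) + 2)"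
    if "w1 \<in> Inv" "ok (s * s) w A ps" "Some (Some (d', g'), w') \<in> set_pmf (run_shuffle ench x s m w kw j (fst g) (fst (snd g)) pre C A ps ch w1)"
    for w1 A ps pre C ch
  proof -
    have "sz ch \<le> 1" by (cases ch) auto
    then have "sz (fst g, fst (snd g), ch) \<le> sz g + 1" by (cases g) simp
    moreover have "sz g' \<le> sz (fst g, fst (snd g), ch) + (y * y + 2 * (y * y * y + y * y)) * (ge (kp w1 + y + 5 + 4 * y) + 4 * y + 3) + 1"
      by (rule run_shuffle_growth[OF ge that(1) _ _ that(3) y]) (use that(2) in \<open>auto simp: ok_def array_check perm_check\<close>)
    ultimately show ?thesis by linarith
  qed
  show ?thesis
  proof (cases "data_num (left d) = 0 \<or> data_num (left d) = 1")
    case True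
    then show ?thesis using r main[OF wI] by (auto simp: answer_def split: if_splits)
  next
    case False
    then obtain rs w1 where rs: "Some (rs, w1) \<in> set_pmf (mapM (dec_one dech x (fst (snd g))) (data_list (left (right d))) wo)"
      "Some (Some (d', g'), w') \<in> set_pmf ((if (\<forall>r \<in> set rs. find_elem (s * s) kw r \<noteq> None) \<and> ok (s * s) w (found (s * s) kw rs) (num_list (right (right d)))
          then run_shuffle ench x s m w kw j (fst g) (fst (snd g)) False (data_list (left (right d))) (found (s * s) kw rs) (num_list (right (right d))) True
          else ret None) w1)"
      using r by (auto simp: answer_def set_bnd split: if_splits)
    have "w1 \<in> Inv \<and> kp w1 = kp wo"
    proof -
      have "length rs = length (data_list (left (right d))) \<and> w1 \<in> Inv \<and> kp w1 = kp wo \<and> (\<forall>y\<in>set rs. \<exists>c\<in>set (data_list (left (right d))). \<exists>w1 w2. w1 \<in> Inv \<and> kp w1 = kp wo \<and> Some (y, w2) \<in> set_pmf (dec_one dech x (fst (snd g)) c w1))"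
        by (rule mapM_result[OF _ wI rs(1)]) (use dech in \<open>auto simp: dec_one_def split: list.splits\<close>)
      then show ?thesis by blast
    qed
    then show ?thesis using rs(2) main[of w1] by (auto split: if_splits)
  qed
qed

lemma ptm_play_adv:
  fixes x :: "'a :: code => 'x :: code"
  assumes "pt x" "pt s" "pt m" "pt w" "pt kw" "pt j" "pt b" "pt B" "pt k" and ench: "ptm (\<lambda>p. ench (fst p) (fst (snd p)) (fst (snd (snd p))) (snd (snd (snd p))))" and dech: "ptm (\<lambda>p. dech (fst p) (snd p))"
  shows "ptm (\<lambda>a. play_adv A ench dech (x a) (s a) (m a) (w a) (kw a) (j a) (b a) (B a) (k a))"
proof -
  obtain ge where ge: "pmono ge" "\<And>wo p c w'. wo \<in> Inv ==> Some (c, w') \<in> set_pmf (ench (fst p) (fst (snd p)) (fst (snd (snd p))) (snd (snd (snd p))) wo) ==>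
      w' \<in> Inv \<and> kp w' = kp wo \<and> sz c \<le> ge (kp wo + sz p)" by (rule ptm_result[OF ench]) blast
  obtain gd where gd: "\<And>wo p c w'. wo \<in> Inv ==> Some (c, w') \<in> set_pmf (dech (fst p) (snd p) wo) ==>
      w' \<in> Inv \<and> kp w' = kp wo \<and> sz c \<le> gd (kp wo + sz p)" by (rule ptm_result[OF dech]) blast
  have ge': "w' \<in> Inv \<and> kp w' = kp wo \<and> size c \<le> ge (kp wo + sz x + 5 + sz ms)"
    if "wo \<in> Inv" "Some (c, w') \<in> set_pmf (ench x lo eq ms wo)" for x lo eq ms c and wo w' :: 'w
  proof -
    have "sz (x, lo, eq, ms) \<le> sz x + 5 + sz ms" by (cases lo; cases eq) auto
    then have "ge (kp wo + sz (x, lo, eq, ms)) \<le> ge (kp wo + sz x + 5 + sz ms)" by (intro pmono_monoD[OF ge(1)]) simp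
    then show ?thesis using ge(2)[OF that(1), of c w' "(x, lo, eq, ms)"] that(2) by simp
  qed
  \<comment> \<open>The environment's parameter and all arguments are bounded by the same
    \<open>y\<close>, so \<open>kp wo + y\<close> becomes \<open>y + y\<close>.\<close>
  let ?G = "\<lambda>y. (y * y + 2 * (y * y * y + y * y)) * (ge (y + y + 5 + 4 * y) + 4 * y + 3) + 2"
  have "ptm (\<lambda>p :: 'x \<times> nat \<times> nat \<times> nat \<times> nat \<times> nat \<times> bool \<times> nat \<times> nat. interp (subs A) (fst (snd (snd (snd (snd (snd (snd (snd p)))))))) (\<lambda>d g. answer ench dech (fst p) (fst (snd p)) (fst (snd (snd p))) (fst (snd (snd (snd p)))) (fst (snd (snd (snd (snd p))))) (fst (snd (snd (snd (snd (snd p)))))) (fst (snd (snd (snd (snd (snd (snd p))))))) d g) (fst (snd (snd (snd (snd (snd (snd (snd p))))))))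
       ([A], list_data [num_data (snd (snd (snd (snd (snd (snd (snd (snd p)))))))), num_data ((fst (snd p)) * (fst (snd p))), num_data (fst (snd (snd (snd p))))] # replicate (cvars A) Leaf, Some (0, [], False)))"
  proof (rule ptm_interp[where G = ?G])
    show "ptm (\<lambda>q. (\<lambda>p d g. answer ench dech (fst p) (fst (snd p)) (fst (snd (snd p))) (fst (snd (snd (snd p)))) (fst (snd (snd (snd (snd p))))) (fst (snd (snd (snd (snd (snd p)))))) (fst (snd (snd (snd (snd (snd (snd p))))))) d g) (fst (fst q)) (snd (fst q)) (snd q))"
      by (intro ptm_respond[OF _ _ _ _ _ _ _ _ _ ench dech] pt_fst pt_snd pt_id)
    show "pmono ?G" by (intro pmono_intros pmono_comp[OF ge(1)])
    fix p :: "'x \<times> nat \<times> nat \<times> nat \<times> nat \<times> nat \<times> bool \<times> nat \<times> nat" and d d' :: data and g g' :: gst and wo w' :: 'w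
    assume wo: "wo \<in> Inv" and r: "Some (Some (d', g'), w') \<in> set_pmf (answer ench dech (fst p) (fst (snd p)) (fst (snd (snd p))) (fst (snd (snd (snd p)))) (fst (snd (snd (snd (snd p))))) (fst (snd (snd (snd (snd (snd p)))))) (fst (snd (snd (snd (snd (snd (snd p))))))) d g wo)"
    let ?y = "kp wo + sz p"
    have "sz g' \<le> sz g + ((?y * ?y + 2 * (?y * ?y * ?y + ?y * ?y)) * (ge (kp wo + ?y + 5 + 4 * ?y) + 4 * ?y + 3) + 2)"
      by (rule respond_growth[OF ge(1) ge' _ wo r]) (use gd[of _ _ _ "(_, _)"] in \<open>force, (cases p; simp)+\<close>)
    also have "\<dots> \<le> sz g + ?G ?y"
      using pmono_monoD[OF ge(1), of "kp wo + ?y + 5 + 4 * ?y" "?y + ?y + 5 + 4 * ?y"] by (intro add_mono mult_le_mono) auto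
    finally show "sz g' \<le> sz g + ?G (kp wo + sz p)" .
  qed (intro pt_Pair pt_Cons pt_list_data pt_num_data pt_mult pt_fst pt_snd pt_id pt_const)+
  then have "ptm (\<lambda>p :: 'x \<times> nat \<times> nat \<times> nat \<times> nat \<times> nat \<times> bool \<times> nat \<times> nat. play_adv A ench dech (fst p) (fst (snd p)) (fst (snd (snd p))) (fst (snd (snd (snd p)))) (fst (snd (snd (snd (snd p))))) (fst (snd (snd (snd (snd (snd p)))))) (fst (snd (snd (snd (snd (snd (snd p))))))) (fst (snd (snd (snd (snd (snd (snd (snd p)))))))) (snd (snd (snd (snd (snd (snd (snd (snd p)))))))))"
    unfolding play_adv_def
    by (rule ptm_pair) (intro pt_conj pt_not pt_eq pt_data_bit pt_nthd pt_fst pt_snd pt_id pt_const)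
  from ptm_comp[OF this pt_Pair[OF assms(1) pt_Pair[OF assms(2) pt_Pair[OF assms(3) pt_Pair[OF assms(4) pt_Pair[OF assms(5) pt_Pair[OF assms(6) pt_Pair[OF assms(7) pt_Pair[OF assms(8) assms(9)]]]]]]]]] show ?thesis by simp
qed

end

section \<open>Real and simulated encryption\<close>

type_synonym world = "nat \<times> data \<times> bool \<times> data list option"

definition world_env :: "scheme => world env" where
  "world_env E w d = map_pmf (map_option (map_prod id (Pair (fst w)))) (enc_respond E (fst w) (snd w) d)"

text \<open>Keys in the support of key generation have size polynomial in the security parameter;
  this is what bounds the answers of the oracle.\<close>

definition worlds :: "scheme => world set" where
  "worlds E = {w. fst (snd w) \<in> set_pmf (gen E (fst w))}"

lemma code_nat_num: "(code :: nat => data) = num_data" by (simp add: fun_eq_iff code_nat_def)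
lemma code_bits: "code (m :: bool list) = bits_data m"
  by (simp add: code_list_def bits_data_def code_bool_def[abs_def])
lemma code_bits_option: "code (r :: bool list option) = option_data (map_option bits_data r)"
  by (cases r) (simp_all add: code_option_def code_bits)
lemma code_enc_input: "(\<lambda>(k, key, m). Node (num_data k) (Node key (bits_data m))) = (code :: nat \<times> data \<times> bool list => data)"
  by (auto simp: fun_eq_iff code_nat_num code_bits)
lemma code_dec_input: "(\<lambda>(k, key, c). Node (num_data k) (Node key c)) = (code :: nat \<times> data \<times> data => data)"
  by (auto simp: fun_eq_iff code_nat_num)

lemma data_bits_code [simp]: "data_bits (code (m :: bool list)) = m"
  by (simp add: code_bits data_bits_def bits_data_def map_idI o_def data_bit_def bit_data_def)

lemma machine_trivial: "machine (\<lambda>_ _. return_pmf None) (\<lambda>_ :: unit. 0) UNIV (\<lambda>_. 0)"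
  by standard (auto intro: pmono_const)

text \<open>No output larger than the time bound can be written; this is read off from the
  interpreted machine over a trivial environment.\<close>

lemma poly_time_size:
  assumes "poly_time code (f :: 'a :: code => data pmf)"
  shows "\<exists>g. pmono g \<and> (\<forall>a. \<forall>d \<in> set_pmf (f a). size d \<le> g (sz a))"
proof -
  interpret machine "\<lambda>_ _. return_pmf None" "\<lambda>_ :: unit. 0" UNIV "\<lambda>_. 0" by (rule machine_trivial)
  show ?thesis
  proof (rule ptm_result[OF poly_time_ptm[OF assms]])
    fix g assume g: "pmono g" "\<And>w a b w'. w \<in> UNIV ==> Some (b, w') \<in> set_pmf (lift (f a) w) ==>
      w' \<in> UNIV \<and> (0 :: nat) = 0 \<and> sz b \<le> g (0 + sz a)"
    show ?thesis using g(1) g(2)[OF UNIV_I] by (intro exI[of _ g]) auto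
  qed
qed

lemma sz_data_bits: "sz (data_bits d) \<le> 2 * size d"
proof -
  have "length (data_list d) \<le> size d" using length_le_sz[of "data_list d"] by (simp add: sz_def code_data_list)
  then show ?thesis using sz_bools[of "data_bits d"] by (simp add: data_bits_def)
qed

lemma size_data_list: "x \<in> set (data_list d) ==> size x \<le> size d" "length (data_list d) \<le> size d"
  using sz_mem[of x "data_list d"] length_le_sz[of "data_list d"] by (simp_all add: sz_def code_data_list)

lemma size_list_data_le: "(\<And>c. c \<in> set cs ==> size c \<le> B) ==> size (list_data cs) \<le> length cs * (B + 1)"
  by (induction cs) (auto intro: order_trans add_mono)

definition zeros :: "bool list => bool list" where "zeros m = replicate (length m) False"

lemma length_zeros [simp]: "length (zeros m) = length m" by (simp add: zeros_def)

text \<open>\<open>lo\<close> and \<open>eq\<close> say whether an encryption lies before or at the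
  position of the hybrid. At this position the bit \<open>\<beta>\<close> of the encryption game
  decides as in a challenge with the zeros as first and the message as second sequence.\<close>

definition masked :: "bool => bool => bool => bool list => bool list" where
  "masked \<beta> lo eq m = (if lo \<or> eq \<and> \<not> \<beta> then zeros m else m)"

locale encryption =
  fixes E :: scheme
  assumes sym: "symmetric_encryption E"
begin

lemma poly_time_gen: "poly_time code (gen E)"
  using sym by (simp add: symmetric_encryption_def code_nat_num)
lemma poly_time_enc: "poly_time code (\<lambda>(k, key, m). enc E k key m)"
  using sym unfolding symmetric_encryption_def code_enc_input by blast
lemma poly_time_dec: "poly_time code (\<lambda>(k, key, c). return_pmf (code (dec E k key c)))"
  using sym unfolding symmetric_encryption_def code_dec_input by (simp add: code_bits_option)

lemma enc_all_size:
  assumes ge: "pmono ge" "\<And>a d. d \<in> set_pmf (case a of (k, key, m) => enc E k key m) ==> size d \<le> ge (sz a)"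
    and ms: "ms = map data_bits (data_list d)" and cs: "cs \<in> set_pmf (enc_all E k key ms)"
  shows "size (list_data cs) \<le> size d * (ge (k + size key + 2 * size d + 2) + 1)"
proof -
  have la: "list_all2 (\<lambda>c m. c \<in> set_pmf (enc E k key m)) cs ms"
    using cs by (simp add: enc_all_def set_seq_pmf list_all2_map2)
  have "size c \<le> ge (k + size key + 2 * size d + 2)" if ci: "c \<in> set cs" for c
  proof -
    obtain q where q: "q < length cs" "c = cs ! q" using ci by (auto simp: in_set_conv_nth)
    then have 1: "c \<in> set_pmf (enc E k key (ms ! q))" and "ms ! q \<in> set ms"
      using la by (auto simp: list_all2_conv_all_nth)
    then obtain x where "x \<in> set (data_list d)" "ms ! q = data_bits x" using ms by auto
    then have "sz (ms ! q) \<le> 2 * size d" using sz_data_bits[of x] size_data_list(1)[of x d] by simp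
    then have "ge (sz (k, key, ms ! q)) \<le> ge (k + size key + 2 * size d + 2)" by (intro pmono_monoD[OF ge(1)]) simp
    then show ?thesis using ge(2)[of c "(k, key, ms ! q)"] 1 by simp
  qed
  then have "size (list_data cs) \<le> length cs * (ge (k + size key + 2 * size d + 2) + 1)" by (rule size_list_data_le)
  also have "\<dots> \<le> size d * (ge (k + size key + 2 * size d + 2) + 1)"
    using size_data_list(2)[of d] list_all2_lengthD[OF la] ms by (intro mult_le_mono1) simp
  finally show ?thesis .
qed

lemma machine_world: "\<exists>rb. machine (world_env E) fst (worlds E) rb"
proof -
  obtain gk where gk: "pmono gk" "\<And>k d. d \<in> set_pmf (gen E k) ==> size d \<le> gk (sz k)"
    using poly_time_size[OF poly_time_gen] by blast
  obtain ge where ge: "pmono ge" "\<And>a d. d \<in> set_pmf (case a of (k, key, m) => enc E k key m) ==> size d \<le> ge (sz a)"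
    using poly_time_size[OF poly_time_enc] by blast
  obtain gd where gd: "pmono gd" "\<And>a d. d \<in> set_pmf (case a of (k, key, c) => return_pmf (code (dec E k key c))) ==> size d \<le> gd (sz a)"
    using poly_time_size[OF poly_time_dec] by blast
  \<comment> \<open>One summand for encryption and challenge queries, one for decryption queries;
    \<open>gk\<close> bounds the key.\<close>
  let ?rb = "\<lambda>x. x * (ge (x + gk x + 2 * x + 2) + 1) + x * (gd (x + gk x + x + 2) + 1)"
  have "machine (world_env E) fst (worlds E) ?rb"
  proof
    show "pmono ?rb" by (intro pmono_intros pmono_comp[OF ge(1)] pmono_comp[OF gd(1)] gk(1))
    fix w a w' d assume w: "w \<in> worlds E" and r: "Some (a, w') \<in> set_pmf (world_env E w d)"
    obtain k key b C where we: "w = (k, key, b, C)" by (cases w) auto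
    have key: "key \<in> set_pmf (gen E k)" using w by (simp add: worlds_def we)
    let ?x = "k + size d"
    have kx: "size key \<le> gk ?x" using gk(2)[OF key] pmono_monoD[OF gk(1), of k ?x] by simp
    have ge1: "ge (k + size key + 2 * size d' + 2) \<le> ge (?x + gk ?x + 2 * ?x + 2)" if "size d' \<le> size d" for d' :: data
      using kx that by (intro pmono_monoD[OF ge(1)]) simp
    have encb: "size (list_data cs) \<le> ?rb ?x"
      if cs: "cs \<in> set_pmf (enc_all E k key (map data_bits (data_list d')))" and le: "size d' \<le> size d" for cs d'
    proof -
      have "size (list_data cs) \<le> size d' * (ge (k + size key + 2 * size d' + 2) + 1)" by (rule enc_all_size[OF ge refl cs])
      also have "\<dots> \<le> ?x * (ge (?x + gk ?x + 2 * ?x + 2) + 1)" using ge1[OF le] le by (intro mult_le_mono) auto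
      finally show ?thesis by simp
    qed
    have sub: "size (right d) \<le> size d" "size (left (right d)) \<le> size d" "size (right (right d)) \<le> size d"
      using size_left_right(2)[of d] size_left_right[of "right d"] by auto
    obtain s' where s': "Some (a, s') \<in> set_pmf (enc_respond E k (key, b, C) d)" "w' = (k, s')"
      using r by (auto simp: world_env_def we map_option_case split: option.splits)
    have "(\<exists>b' C'. s' = (key, b', C')) \<and> size a \<le> ?rb ?x"
    proof (cases "parse_enc_query d")
      case (EncQ ms)
      then have "ms = map data_bits (data_list (right d))" by (auto simp: parse_enc_query_def Let_def split: if_splits)
      then show ?thesis using s' EncQ encb[OF _ sub(1)] by auto
    next
      case (DecQ cs)
      then have cs: "cs = data_list (right d)" by (auto simp: parse_enc_query_def Let_def split: if_splits)
      have a: "a = list_data (map (\<lambda>c. code (dec E k key c)) cs)" "s' = (key, b, C)"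
        using s' DecQ by (auto simp: code_bits_option split: if_splits)
      have "size a \<le> length (map (\<lambda>c. code (dec E k key c)) cs) * (gd (?x + gk ?x + ?x + 2) + 1)"
        unfolding a
      proof (rule size_list_data_le)
        fix r assume "r \<in> set (map (\<lambda>c. code (dec E k key c)) cs)"
        then obtain c where c: "c \<in> set cs" "r = code (dec E k key c)" by auto
        have "size c \<le> size d" using c cs size_data_list(1)[of c "right d"] sub(1) by auto
        then have "gd (sz (k, key, c)) \<le> gd (?x + gk ?x + ?x + 2)" using kx by (intro pmono_monoD[OF gd(1)]) simp
        then show "size r \<le> gd (?x + gk ?x + ?x + 2)" using gd(2)[of r "(k, key, c)"] c by simp
      qed
      also have "\<dots> \<le> ?x * (gd (?x + gk ?x + ?x + 2) + 1)"
        using size_data_list(2)[of "right d"] sub(1) cs by (intro mult_le_mono1) simp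
      finally show ?thesis using a by simp
    next
      case (EncChallenge M0 M1)
      then have "M0 = map data_bits (data_list (left (right d)))" "M1 = map data_bits (data_list (right (right d)))"
        by (auto simp: parse_enc_query_def Let_def split: if_splits)
      then show ?thesis using s' EncChallenge encb[OF _ sub(2)] encb[OF _ sub(3)] by (auto split: if_splits)
    qed
    then show "w' \<in> worlds E \<and> fst w' = fst w \<and> size a \<le> ?rb (fst w + size d)" using s'(2) key by (auto simp: worlds_def we)
  qed
  then show ?thesis by blast
qed

abbreviation wptm :: "('a :: code => (world, 'b :: code) M) => bool" where
  "wptm \<equiv> machine.ptm (world_env E) fst (worlds E)"

text \<open>The oracle answers with a list of ciphertexts; each query selects one message, so
  \<open>left\<close> takes out the only ciphertext. The zeros have the length of the message, as a
  legal challenge demands.\<close>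

definition real_enc :: "unit => bool => bool => bool list => (world, data) M" where
  "real_enc x lo eq m =
     (\<lambda>w. world_env E w
       (if lo then Node (num_data 0) (code [zeros m])
        else if eq then Node (num_data 2) (Node (code [zeros m]) (code [m]))
        else Node (num_data 0) (code [m]))) \<then> (\<lambda>a. ret (left a))"

definition real_dec :: "unit => data => (world, bool list option) M" where
  "real_dec x c = (\<lambda>w. world_env E w (Node (num_data 1) (list_data [c]))) \<then>
     (\<lambda>a. ret (if left a = Leaf then None else Some (data_bits (right (left a)))))"

text \<open>The security parameter, a key drawn by the reduction, and a bit in place of that of the
  encryption game.\<close>

type_synonym sim = "nat \<times> data \<times> bool"

definition sim_enc :: "sim => bool => bool => bool list => ('w, data) M" where
  "sim_enc x lo eq m = lift (enc E (fst x) (fst (snd x)) (masked (snd (snd x)) lo eq m))"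

definition sim_dec :: "sim => data => ('w, bool list option) M" where
  "sim_dec x c = ret (dec E (fst x) (fst (snd x)) c)"

lemma num_data_simps: "data_num (num_data n) = n" by (simp add: data_num_def num_data_def)

lemma msgs_code: "map data_bits (data_list (code (ms :: bool list list))) = ms"
  by (simp add: code_list_def[of ms] o_def)

lemma real_enc_eq:
  assumes "\<not> lo ==> eq ==> C = None"
  shows "real_enc x lo eq m (k, key, \<beta>, C) = map_pmf (\<lambda>c. Some (c, (k, key, \<beta>, if \<not> lo \<and> eq then Some [c] else C)))
    (enc E k key (masked \<beta> lo eq m))"
proof -
  have one: "enc_all E k key [m] = map_pmf (\<lambda>c. [c]) (enc E k key m)" for m
    by (simp add: enc_all_def map_pmf_def bind_assoc_pmf bind_return_pmf)
  have q0: "parse_enc_query (Node (num_data 0) (code ms)) = EncQ ms" for ms :: "bool list list"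
    using msgs_code[of ms] by (simp add: parse_enc_query_def Let_def num_data_simps)
  have q2: "parse_enc_query (Node (num_data 2) (Node (code M0) (code M1))) = EncChallenge M0 M1" for M0 M1 :: "bool list list"
    using msgs_code[of M0] msgs_code[of M1] by (simp add: parse_enc_query_def Let_def num_data_simps)
  have e0: "world_env E (k, key, \<beta>, C) (Node (num_data 0) (code [m])) = map_pmf (\<lambda>c. Some (list_data [c], (k, key, \<beta>, C))) (enc E k key m)" for m
    by (simp add: world_env_def q0[of "[m]"] one pmf.map_comp o_def del: code_Cons)
  have e2: "world_env E (k, key, \<beta>, None) (Node (num_data 2) (Node (code [zeros m]) (code [m]))) =
     map_pmf (\<lambda>c. Some (list_data [c], (k, key, \<beta>, Some [c]))) (enc E k key (if \<beta> then m else zeros m))"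
    by (simp add: world_env_def q2[of "[zeros m]" "[m]"] one pmf.map_comp o_def del: code_Cons)
  have fin: "obind (map_pmf (\<lambda>c. Some (list_data [c], F c)) p) (\<lambda>(a, w'). ret (left a) w') = map_pmf (\<lambda>c. Some (c, F c)) p"
    for F :: "data => world" and p
    by (simp add: obind_def ret_def map_pmf_def bind_assoc_pmf bind_return_pmf)
  show ?thesis
    using assms unfolding real_enc_def bnd_def masked_def
    by (cases lo; cases eq) (auto simp only: if_True if_False e0 e2 fin simp_thms split: if_splits cong: if_cong)
qed

lemma real_dec_eq:
  assumes "C = None \<or> c \<notin> set (the C)"
  shows "real_dec x c (k, key, \<beta>, C) = return_pmf (Some (dec E k key c, (k, key, \<beta>, C)))"
proof -
  have q1: "parse_enc_query (Node (num_data 1) (list_data [c])) = DecQ [c]"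
    by (simp add: parse_enc_query_def Let_def num_data_simps)
  have "world_env E (k, key, \<beta>, C) (Node (num_data 1) (list_data [c])) = return_pmf (Some (list_data [code (dec E k key c)], (k, key, \<beta>, C)))"
    using assms by (auto simp: world_env_def q1[simplified] code_bits_option)
  then show ?thesis by (cases "dec E k key c") (simp_all add: real_dec_def bnd_def ret_def)
qed

lemma ptm_sim:
  "wptm (\<lambda>p. sim_enc (fst p) (fst (snd p)) (fst (snd (snd p))) (snd (snd (snd p))))"
  "wptm (\<lambda>p. sim_dec (fst p) (snd p))"
  "wptm (\<lambda>k. lift (gen E k))"
proof -
  obtain rb where "machine (world_env E) fst (worlds E) rb" using machine_world by blast
  then interpret machine "world_env E" fst "worlds E" rb .
  have m: "pt (\<lambda>p. masked (snd (snd (fst p))) (fst (snd p)) (fst (snd (snd p))) (snd (snd (snd p))))"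
    unfolding masked_def zeros_def
    by (intro pt_if pt_disj pt_conj pt_not pt_replicate pt_length pt_fst pt_snd pt_id pt_const)
  have "ptm (\<lambda>p. lift ((\<lambda>(k, key, m). enc E k key m) (fst (fst p), fst (snd (fst p)), masked (snd (snd (fst p))) (fst (snd p)) (fst (snd (snd p))) (snd (snd (snd p))))))"
    by (rule ptm_comp[OF poly_time_ptm[OF poly_time_enc]]) (intro pt_Pair m pt_fst pt_snd pt_id)
  then show "ptm (\<lambda>p. sim_enc (fst p) (fst (snd p)) (fst (snd (snd p))) (snd (snd (snd p))))" by (simp add: sim_enc_def)
  have "ptm (\<lambda>a. lift (case a of (k, key, c) => return_pmf (code (dec E k key c))))" by (rule poly_time_ptm[OF poly_time_dec])
  then have "pt (\<lambda>a. case a of (k, key, c) => dec E k key c)"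
    by (rule ptm_transfer[where r = "\<lambda>a. a"]) (auto simp: ret_def)
  from ptm_comp[OF this, of "\<lambda>p. (fst (fst p), fst (snd (fst p)), snd p)"]
  show "ptm (\<lambda>p. sim_dec (fst p) (snd p))" by (simp add: sim_dec_def pt_Pair pt_fst pt_snd pt_id)
  show "ptm (\<lambda>k. lift (gen E k))" by (rule poly_time_ptm[OF poly_time_gen])
qed

lemma ptm_real:
  "wptm (\<lambda>p. real_enc (fst p) (fst (snd p)) (fst (snd (snd p))) (snd (snd (snd p))))"
  "wptm (\<lambda>p. real_dec (fst p) (snd p))"
proof -
  obtain rb where "machine (world_env E) fst (worlds E) rb" using machine_world by blast
  then interpret machine "world_env E" fst "worlds E" rb .
  show "ptm (\<lambda>p. real_enc (fst p) (fst (snd p)) (fst (snd (snd p))) (snd (snd (snd p))))"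
    unfolding real_enc_def zeros_def
    by (intro ptm_pair ptm_query pt_left pt_if pt_Node pt_code pt_Cons pt_replicate pt_length pt_fst pt_snd pt_id pt_const)
  show "ptm (\<lambda>p. real_dec (fst p) (snd p))" unfolding real_dec_def
    by (intro ptm_pair ptm_query pt_left pt_right pt_if pt_eq pt_Some pt_data_bits pt_Node pt_list_data pt_Cons pt_fst pt_snd pt_id pt_const)
qed

end

section \<open>Comparison of the oracle with its simulation\<close>

lemma foldM_append: "foldM f (xs @ ys) s = foldM f xs s \<then> foldM f ys"
proof (induction xs arbitrary: s)
  case (Cons x xs)
  then have "foldM f (xs @ ys) = (\<lambda>s. foldM f xs s \<then> foldM f ys)" by blast
  then show ?case by (simp add: bnd_assoc)
qed simp

lemma mapM_lift: "(mapM (\<lambda>x. lift (P x)) xs :: ('w, 'y list) M) = lift (seq_pmf (map P xs))"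
proof -
  have "(foldM (\<lambda>x acc. lift (P x) \<then> (\<lambda>y. ret (acc @ [y]))) xs acc :: ('w, 'y list) M) = lift (map_pmf (\<lambda>ys. acc @ ys) (seq_pmf (map P xs)))" for acc
  proof (induction xs arbitrary: acc)
    case (Cons x xs)
    show ?case by (simp only: foldM.simps bnd_assoc ret_bnd Cons.IH list.map seq_pmf.simps)
        (simp add: lift_bnd_lift map_bind_pmf pmf.map_comp o_def)
  qed simp
  then show ?thesis by (simp add: mapM_def pmf.map_ident)
qed

lemma seq_pmf_return: "seq_pmf (map (\<lambda>x. return_pmf (f x)) xs) = return_pmf (map f xs)"
  by (induction xs) (simp_all add: bind_return_pmf)

lemma mapM_ret: "mapM (\<lambda>x. ret (f x)) xs = ret (map f xs)"
  using mapM_lift[of "\<lambda>x. return_pmf (f x)" xs] by (simp add: seq_pmf_return)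

definition lookup :: "(data \<times> bool list) list => (data => bool list option) => data => bool list option" where
  "lookup tab D c = (case filter (\<lambda>t. fst t = c) tab of [] => D c | t # _ => Some (snd t))"

text \<open>What a legal query asks for: whether the input array is to be encrypted first, its
  ciphertexts if not, the elements, the permutation, and whether the challenge counts as issued
  afterwards.\<close>

definition job :: "(data => bool list option) => nat => nat => nat => bool => data => gst =>
    (bool \<times> data list \<times> elem list \<times> nat list \<times> bool) option" where
  "job D n w kw b d g =
     (if data_num (left d) = 0 then
        (if \<not> snd (snd g) \<and> ok n w (data_elems (left (right d))) (num_list (right (right d)))
         then Some (True, [], data_elems (left (right d)), num_list (right (right d)), False)
         else None)
      else if data_num (left d) = 1 then
        (if \<not> snd (snd g) \<and> ok n w (data_elems (left (left (right d)))) (num_list (right (left (right d)))) \<and>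
            ok n w (data_elems (left (right (right d)))) (num_list (right (right (right d))))
         then Some (True, [],
           if b then data_elems (left (right (right d))) else data_elems (left (left (right d))),
           if b then num_list (right (right (right d))) else num_list (right (left (right d))), True)
         else None)
      else
        (let rs = map (lookup (fst (snd g)) D) (data_list (left (right d))) in
         if snd (snd g) \<and> (\<forall>r \<in> set rs. find_elem n kw r \<noteq> None) \<and> ok n w (found n kw rs) (num_list (right (right d)))
         then Some (False, data_list (left (right d)), found n kw rs, num_list (right (right d)), True)
         else None))"

definition hyb_enc :: "(bool list => data pmf) => nat => nat => bool list list => data list pmf" where
  "hyb_enc e h i ms =
     seq_pmf (map (\<lambda>q. e (if i + q < h then zeros (nthd [] ms q) else nthd [] ms q)) [0..<length ms])"

definition hyb_shuffle :: "(bool list => data pmf) => nat => nat => nat => nat => nat =>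
    nat => (data \<times> bool list) list => bool \<times> data list \<times> elem list \<times> nat list \<times> bool => (data \<times> gst) option pmf" where
  "hyb_shuffle e h s m w kw i tab = (\<lambda>(pre, C, A, ps, ch).
     bind_pmf (pmf_of_set {\<sigma>. \<sigma> permutes {1..s * s}}) (\<lambda>\<rho>. case plan s m w \<rho> (perm_fun ps) A of
         None => return_pmf None
       | Some pl => map_pmf (\<lambda>cs. Some (reply s m pre C i tab ch (plaintexts kw pre A pl) cs))
           (hyb_enc e h i (plaintexts kw pre A pl))))"

definition hyb_respond :: "(bool list => data pmf) => (data => bool list option) => nat => nat => nat => nat => nat =>
    bool => data => gst => (data \<times> gst) option pmf" where
  "hyb_respond e D h s m w kw b d g = (case job D (s * s) w kw b d g of None => return_pmf None
     | Some J => hyb_shuffle e h s m w kw (fst g) (fst (snd g)) J)"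

text \<open>Both runs are coupled with equal results. The left one may change its world, subject to
  \<open>P\<close>; the right one ends in the world \<open>v\<close> in which it started. Neither
  aborts: illegal moves of the interpreted adversary are ordinary results at this level.\<close>

definition msim :: "'u => 'v => ('u, 'a) M => ('v, 'a) M => ('a => 'u => bool) => bool" where
  "msim u v m m' P \<longleftrightarrow> rel_pmf (\<lambda>r r'. \<exists>y u'. r = Some (y, u') \<and> r' = Some (y, v) \<and> P y u') (m u) (m' v)"

lemma msim_ret: "P x u ==> msim u v (ret x) (ret x) P"
  by (simp add: msim_def ret_def)

lemma msim_mono: "msim u v m m' P ==> (\<And>y u'. P y u' ==> Q y u') ==> msim u v m m' Q"
  unfolding msim_def by (erule pmf.rel_mono_strong) blast

lemma msim_bnd:
  assumes "msim u v m m' P" "\<And>y u'. P y u' ==> msim u' v (f y) (f' y) Q"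
  shows "msim u v (m \<then> f) (m' \<then> f') Q"
  unfolding msim_def bnd_def obind_def
  by (rule rel_pmf_bindI[OF assms(1)[unfolded msim_def]]) (use assms(2)[unfolded msim_def] in auto)

lemma msim_if: "msim u v m1 m1' P ==> msim u v m2 m2' P ==>
    msim u v (if c then m1 else m2) (if c then m1' else m2') P"
  by simp

lemma msim_lift: "(\<And>y. y \<in> set_pmf p ==> P y u) ==> msim u v (lift p) (lift p) P"
  unfolding msim_def lift_def by (simp add: pmf.rel_map) (rule rel_pmf_reflI, blast)

lemma msim_eq: "msim u v m m' P ==> map_pmf (map_option fst) (m u) = map_pmf (map_option fst) (m' v)"
  unfolding msim_def by (rule pmf.rel_eq[THEN fun_cong, THEN fun_cong, THEN iffD1]) (auto simp: pmf.rel_map elim!: pmf.rel_mono_strong)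

lemma msim_mapM_upt:
  assumes "\<And>q ys u. q < L ==> length ys = q ==> I ys u ==> msim u v (f q) (f' q) (\<lambda>y u'. I (ys @ [y]) u')" and "I [] u"
  shows "msim u v (mapM f [0..<L]) (mapM f' [0..<L]) (\<lambda>ys u'. length ys = L \<and> I ys u')"
  using assms(1) unfolding mapM_def
proof (induction L)
  case 0
  then show ?case by (simp add: msim_ret assms(2))
next
  case (Suc L)
  show ?case unfolding upt_Suc_append[OF le0] foldM_append
  proof (rule msim_bnd[OF Suc.IH])
    fix ys u assume "length ys = L \<and> I ys u"
    then show "msim u v (foldM (\<lambda>x acc. f x \<then> (\<lambda>y. ret (acc @ [y]))) [L] ys) (foldM (\<lambda>x acc. f' x \<then> (\<lambda>y. ret (acc @ [y]))) [L] ys)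
        (\<lambda>ys u'. length ys = Suc L \<and> I ys u')"
      by (simp add: bnd_assoc) (rule msim_bnd[OF Suc.prems[OF lessI, of ys]], auto intro!: msim_ret)
  qed (use Suc.prems in simp)
qed

lemma msim_mapM:
  assumes "\<And>x. x \<in> set xs ==> msim u v (f x) (f' x) (\<lambda>_ u'. u' = u)"
  shows "msim u v (mapM f xs) (mapM f' xs) (\<lambda>_ u'. u' = u)"
proof -
  have "msim u v (foldM (\<lambda>x acc. f x \<then> (\<lambda>y. ret (acc @ [y]))) xs acc) (foldM (\<lambda>x acc. f' x \<then> (\<lambda>y. ret (acc @ [y]))) xs acc) (\<lambda>_ u'. u' = u)" for acc
    using assms
  proof (induction xs arbitrary: acc)
    case (Cons x xs)
    show ?case unfolding foldM.simps bnd_assoc ret_bnd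
      by (rule msim_bnd[OF Cons.prems[of x]]) (use Cons in auto)
  qed (simp add: msim_ret)
  then show ?thesis unfolding mapM_def .
qed

text \<open>
  Before call number \<open>j\<close> no challenge has been issued; afterwards its ciphertext is in the table,
  so that it is never submitted for decryption.
\<close>
definition in_step :: "nat => data => bool => nat => nat => data set => world => bool" where
  "in_step k key \<beta> j i S u \<longleftrightarrow>
     (\<exists>C. u = (k, key, \<beta>, C) \<and> (if i \<le> j then C = None else \<exists>cs. C = Some cs \<and> set cs \<subseteq> S))"

lemma subset_zipd: "length cs \<le> length ms ==> set cs \<subseteq> fst ` set (zipd cs ms)"
  by (force simp: zipd_def in_set_conv_nth nthd_eq image_iff)

definition post :: "nat => data => bool => nat => gst option => world => bool" where
  "post k key \<beta> j og u = (case og of None => True | Some g => in_step k key \<beta> j (fst g) (fst ` set (fst (snd g))) u)"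

context encryption begin

text \<open>Encryption number \<open>j\<close> is masked exactly if \<open>\<beta>\<close> is false,
  so the two values of the bit give the hybrids with \<open>j\<close> and with \<open>Suc j\<close>
  encryptions of zeros.\<close>

lemma run_shuffle_sim:
  "(run_shuffle sim_enc (k, key, \<beta>) s m w kw j i tab pre C A ps ch :: ('w, _) M) =
     lift (hyb_shuffle (enc E k key) (if \<beta> then j else Suc j) s m w kw i tab (pre, C, A, ps, ch))"
proof -
  have e: "(enc_seq sim_enc (k, key, \<beta>) j i ms :: ('w, _) M) = lift (hyb_enc (enc E k key) (if \<beta> then j else Suc j) i ms)" for ms
    unfolding enc_seq_def sim_enc_def mapM_lift hyb_enc_def
    by (rule arg_cong[where f = lift], rule arg_cong[where f = seq_pmf], rule map_cong) (auto simp: masked_def)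
  let ?G = "\<lambda>\<rho>. case plan s m w \<rho> (perm_fun ps) A of
         None => return_pmf None
       | Some pl => map_pmf (\<lambda>cs. Some (reply s m pre C i tab ch (plaintexts kw pre A pl) cs))
           (hyb_enc (enc E k key) (if \<beta> then j else Suc j) i (plaintexts kw pre A pl))"
  have "(run_shuffle sim_enc (k, key, \<beta>) s m w kw j i tab pre C A ps ch :: ('w, _) M) =
     lift (pmf_of_set (permutations_of_set {1..s * s})) \<then> (\<lambda>ps1. lift (?G (perm_fun ps1)))"
    unfolding run_shuffle_def rand_perm_lift e
    by (rule arg_cong[where f = "bnd _"]) (auto simp: fun_eq_iff lift_bnd_ret split: option.splits)
  also have "\<dots> = lift (bind_pmf (map_pmf perm_fun (pmf_of_set (permutations_of_set {1..s * s}))) ?G)"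
    unfolding lift_bnd_lift bind_map_pmf ..
  finally show ?thesis unfolding map_perm_fun by (simp add: hyb_shuffle_def)
qed

lemma respond_sim:
  "(answer sim_enc sim_dec (k, key, \<beta>) s m w kw j b d g :: ('w, _) M) =
     lift (hyb_respond (enc E k key) (dec E k key) (if \<beta> then j else Suc j) s m w kw b d g)"
proof -
  have d1: "(\<lambda>c. dec_one sim_dec (k, key, \<beta>) tab c :: ('w, _) M) = (\<lambda>c. ret (lookup tab (dec E k key) c))" for tab
    by (auto simp: fun_eq_iff dec_one_def sim_dec_def lookup_def split: list.splits)
  show ?thesis
    unfolding answer_def run_shuffle_sim hyb_respond_def job_def d1 mapM_ret ret_bnd Let_def
    by (cases "data_num (left d) = 0"; cases "data_num (left d) = 1"; cases "snd (snd g)"; simp only: if_True if_False simp_thms option.case)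
      (auto simp: split: if_split)
qed

lemma real_enc_sim:
  assumes "in_step k key \<beta> j t S u"
  shows "msim u v (real_enc () (t < j) (t = j) m) (sim_enc (k, key, \<beta>) (t < j) (t = j) m) (\<lambda>c u'. in_step k key \<beta> j (Suc t) (insert c S) u')"
proof -
  obtain C where C: "u = (k, key, \<beta>, C)" "if t \<le> j then C = None else \<exists>cs. C = Some cs \<and> set cs \<subseteq> S"
    using assms by (auto simp: in_step_def)
  have "real_enc () (t < j) (t = j) m u = map_pmf (\<lambda>c. Some (c, (k, key, \<beta>, if t = j then Some [c] else C))) (enc E k key (masked \<beta> (t < j) (t = j) m))"
  proof -
    have "(\<not> t < j \<and> t = j) = (t = j)" by auto
    then show ?thesis unfolding C(1) by (subst real_enc_eq) (use C(2) in \<open>auto simp del: not_less\<close>)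
  qed
  then show ?thesis unfolding msim_def sim_enc_def lift_def
    by (simp add: pmf.rel_map) (rule rel_pmf_reflI, use C(2) in \<open>auto simp: in_step_def subset_iff\<close>)
qed

lemma enc_seq_sim:
  assumes "in_step k key \<beta> j i S u"
  shows "msim u v (enc_seq real_enc () j i ms) (enc_seq sim_enc (k, key, \<beta>) j i ms)
    (\<lambda>cs u'. length cs = length ms \<and> in_step k key \<beta> j (i + length ms) (S \<union> set cs) u')"
proof -
  have "msim u v (enc_seq real_enc () j i ms) (enc_seq sim_enc (k, key, \<beta>) j i ms)
    (\<lambda>cs u'. length cs = length ms \<and> in_step k key \<beta> j (i + length cs) (S \<union> set cs) u')"
    unfolding enc_seq_def
  proof (rule msim_mapM_upt)
    fix q and ys :: "data list" and u assume "length ys = q" "in_step k key \<beta> j (i + length ys) (S \<union> set ys) u"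
    then have "in_step k key \<beta> j (i + q) (S \<union> set ys) u" by simp
    from real_enc_sim[OF this] show "msim u v (real_enc () (i + q < j) (i + q = j) (nthd [] ms q)) (sim_enc (k, key, \<beta>) (i + q < j) (i + q = j) (nthd [] ms q))
        (\<lambda>y u'. in_step k key \<beta> j (i + length (ys @ [y])) (S \<union> set (ys @ [y])) u')"
      by (rule msim_mono) (use \<open>length ys = q\<close> in simp)
  qed (use assms in simp)
  then show ?thesis by (rule msim_mono) auto
qed

lemma run_shuffle_real:
  assumes "in_step k key \<beta> j i (fst ` set tab) u"
  shows "msim u v (run_shuffle real_enc () s m w kw j i tab pre C A ps ch) (run_shuffle sim_enc (k, key, \<beta>) s m w kw j i tab pre C A ps ch)
    (\<lambda>r. post k key \<beta> j (map_option snd r))"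
  unfolding run_shuffle_def rand_perm_lift
proof (rule msim_bnd[where P = "\<lambda>_ u'. u' = u"])
  fix ps1 :: "nat list" and u' assume u': "u' = u"
  show "msim u' v (case plan s m w (perm_fun ps1) (perm_fun ps) A of None => ret None
       | Some pl => enc_seq real_enc () j i (plaintexts kw pre A pl) \<then> (\<lambda>cs. ret (Some (reply s m pre C i tab ch (plaintexts kw pre A pl) cs))))
     (case plan s m w (perm_fun ps1) (perm_fun ps) A of None => ret None
       | Some pl => enc_seq sim_enc (k, key, \<beta>) j i (plaintexts kw pre A pl) \<then> (\<lambda>cs. ret (Some (reply s m pre C i tab ch (plaintexts kw pre A pl) cs))))
     (\<lambda>r. post k key \<beta> j (map_option snd r))"
  proof (cases "plan s m w (perm_fun ps1) (perm_fun ps) A")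
    case None
    then show ?thesis by (simp add: msim_ret post_def)
  next
    case (Some pl)
    let ?ms = "plaintexts kw pre A pl"
    show ?thesis unfolding Some option.case u'
    proof (rule msim_bnd[OF enc_seq_sim[OF assms]])
      fix cs u1 assume *: "length cs = length ?ms \<and> in_step k key \<beta> j (i + length ?ms) (fst ` set tab \<union> set cs) u1"
      then have "set cs \<subseteq> fst ` set (zipd cs ?ms)" by (intro subset_zipd) simp
      then show "msim u1 v (ret (Some (reply s m pre C i tab ch ?ms cs))) (ret (Some (reply s m pre C i tab ch ?ms cs)))
          (\<lambda>r. post k key \<beta> j (map_option snd r))"
        using * by (intro msim_ret) (fastforce simp: post_def reply_def in_step_def split: if_splits)
    qed
  qed
qed (rule msim_lift, rule refl)

text \<open>A ciphertext that is missing from the table is not the challenge ciphertext, so the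
  oracle decrypts it.\<close>

lemma respond_real:
  assumes "in_step k key \<beta> j (fst g) (fst ` set (fst (snd g))) u"
  shows "msim u v (answer real_enc real_dec () s m w kw j b d g) (answer sim_enc sim_dec (k, key, \<beta>) s m w kw j b d g)
    (\<lambda>r. post k key \<beta> j (map_option snd r))"
proof -
  have none: "msim u v (ret None) (ret None) (\<lambda>r. post k key \<beta> j (map_option snd r))" for u and v
    by (rule msim_ret) (simp add: post_def)
  have d1: "msim u v (dec_one real_dec () (fst (snd g)) c) (dec_one sim_dec (k, key, \<beta>) (fst (snd g)) c) (\<lambda>_ u'. u' = u)" for c
  proof (cases "filter (\<lambda>t. fst t = c) (fst (snd g))")
    case Nil
    then have "c \<notin> fst ` set (fst (snd g))" by (auto simp: filter_empty_conv)
    moreover obtain C where C: "u = (k, key, \<beta>, C)" "if fst g \<le> j then C = None else \<exists>cs. C = Some cs \<and> set cs \<subseteq> fst ` set (fst (snd g))"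
      using assms by (auto simp: in_step_def)
    ultimately have C2: "C = None \<or> c \<notin> set (the C)" by (auto split: if_splits)
    show ?thesis unfolding dec_one_def Nil list.case
      using real_dec_eq[OF C2, of "()" k key \<beta>] by (simp add: C(1) msim_def sim_dec_def ret_def)
  qed (simp add: dec_one_def msim_ret)
  show ?thesis
    unfolding answer_def
    by (intro msim_if run_shuffle_real[OF assms] none msim_bnd[OF msim_mapM[OF d1]]) (auto intro!: msim_if run_shuffle_real none assms)
qed

lemma interp_real:
  assumes "post k key \<beta> j (snd (snd st)) u"
  shows "msim u v (interp S B (\<lambda>d g. answer real_enc real_dec () s m w kw j b d g) n st)
    (interp S B (\<lambda>d g. answer sim_enc sim_dec (k, key, \<beta>) s m w kw j b d g) n st) (\<lambda>st. post k key \<beta> j (snd (snd st)))"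
  using assms
proof (induction n arbitrary: st u)
  case 0
  then show ?case by (simp add: msim_ret)
next
  case (Suc n)
  let ?h1 = "\<lambda>d g. answer real_enc real_dec () s m w kw j b d g" and ?h2 = "\<lambda>d g. answer sim_enc sim_dec (k, key, \<beta>) s m w kw j b d g"
  let ?P = "\<lambda>st :: gst ist. post k key \<beta> j (snd (snd st))"
  have put: "msim u v (put B cs st x d g) (put B cs st x d g) ?P" if "post k key \<beta> j g u" for cs st x d g u and v :: 'a
    unfolding put_def by (rule msim_ret) (use that in \<open>simp add: post_def\<close>)
  have istep: "msim u v (istep B ?h1 c cs st g) (istep B ?h2 c cs st g) ?P" if p: "post k key \<beta> j g u" for c cs st g u
  proof (cases c)
    case (Query y e)
    show ?thesis
    proof (cases g)
      case None
      then show ?thesis using Query by (simp add: msim_ret post_def)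
    next
      case (Some g')
      have st: "in_step k key \<beta> j (fst g') (fst ` set (fst (snd g'))) u" using p Some by (simp add: post_def)
      show ?thesis unfolding Query Some istep.simps option.case
      proof (rule msim_bnd[OF respond_real[OF st]])
        fix r :: "(data \<times> gst) option" and u' assume "post k key \<beta> j (map_option snd r) u'"
        then show "msim u' v (case r of None => ret ([], st, None) | Some q => put B cs st y (fst q) (Some (snd q)))
          (case r of None => ret ([], st, None) | Some q => put B cs st y (fst q) (Some (snd q))) ?P"
          by (cases r) (auto intro!: put msim_ret simp: post_def)
      qed
    qed
  next
    case (Sample y e)
    show ?thesis unfolding Sample istep.simps
      by (rule msim_bnd[OF msim_lift[where P = "\<lambda>_ u'. u' = u"]]) (use p put in auto)
  qed (use p in \<open>auto intro!: put msim_ret\<close>)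
  show ?case unfolding interp_Suc
  proof (rule msim_bnd[where P = ?P])
    show "msim u v (rstep S B ?h1 st) (rstep S B ?h2 st) ?P"
      unfolding rstep_def using Suc.prems by (auto intro!: istep msim_ret split: list.splits)
  qed (rule Suc.IH)
qed

lemma play_adv_real:
  "map_pmf (map_option fst) (play_adv A real_enc real_dec () s m w kw j b B k0 (k, key, \<beta>, None)) =
   map_pmf (map_option fst) (play_adv A sim_enc sim_dec (k, key, \<beta>) s m w kw j b B k0 v)"
  unfolding play_adv_def
  by (rule msim_eq[where P = "\<lambda>_ _. True"], rule msim_bnd[OF interp_real[where k = k and key = key and \<beta> = \<beta>]])
    (auto simp: post_def in_step_def intro!: msim_ret)

end

section \<open>Encryptions of zeros\<close>

lemma lift_inject: "lift p = (lift q :: ('w, 'a) M) ==> p = q"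
proof -
  assume "lift p = (lift q :: ('w, 'a) M)"
  then have "map_pmf (\<lambda>x. Some (x, undefined :: 'w)) p = map_pmf (\<lambda>x. Some (x, undefined)) q" by (auto simp: lift_def fun_eq_iff)
  then show "p = q" by (rule pmf.inj_map[OF injI, THEN injD, rotated]) simp
qed

text \<open>Computations that neither use the environment nor abort; they are plain distributions,
  which can be coupled.\<close>

definition pure :: "('w, 'a) M => bool" where "pure m \<longleftrightarrow> (\<exists>p. m = lift p)"

definition unlift :: "('w, 'a) M => 'a pmf" where "unlift m = (SOME p. m = lift p)"

lemma lift_unlift: "pure m ==> lift (unlift m) = m"
  unfolding pure_def unlift_def by (metis (mono_tags, lifting) someI_ex)

lemma unlift_lift [simp]: "unlift (lift p) = p"
  by (rule lift_inject, rule lift_unlift) (auto simp: pure_def)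

lemma pure_lift: "pure (lift p)" by (auto simp: pure_def)
lemma pure_ret: "pure (ret x)" unfolding lift_return[symmetric] by (rule pure_lift)
lemma pure_bnd: assumes "pure m" "\<And>x. pure (f x)" shows "pure (m \<then> f)"
proof -
  have "m \<then> f = lift (unlift m) \<then> (\<lambda>x. lift (unlift (f x)))" by (simp add: lift_unlift assms)
  then show ?thesis by (simp add: lift_bnd_lift pure_lift)
qed

definition coupled :: "('a => 'b => bool) => ('w, 'a) M => ('w, 'b) M => bool" where
  "coupled Q m0 m1 \<longleftrightarrow> pure m0 \<and> pure m1 \<and> rel_pmf Q (unlift m0) (unlift m1)"

lemma unlift_ret: "unlift (ret x) = return_pmf x" using unlift_lift[of "return_pmf x"] by (simp del: unlift_lift)

lemma unlift_bnd: assumes "pure m" "\<And>x. pure (f x)" shows "unlift (m \<then> f) = bind_pmf (unlift m) (\<lambda>x. unlift (f x))"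
proof -
  have "m \<then> f = lift (unlift m) \<then> (\<lambda>x. lift (unlift (f x)))" by (simp add: lift_unlift assms)
  then show ?thesis by (simp add: lift_bnd_lift)
qed

lemma coupled_ret: "Q x y ==> coupled Q (ret x) (ret y)"
  by (simp add: coupled_def unlift_ret pure_ret)

lemma coupled_bnd:
  assumes "coupled Q m0 m1" "\<And>x. pure (f x)" "\<And>x. pure (g x)" "\<And>x y. Q x y ==> coupled P (f x) (g y)"
  shows "coupled P (m0 \<then> f) (m1 \<then> g)"
  using assms unfolding coupled_def
  by (auto simp: unlift_bnd intro!: pure_bnd rel_pmf_bindI)

text \<open>Every coupling will do, so the independent one is taken. This serves pairs of runs of
  which one is already dead, where nothing remains to be compared.\<close>

lemma coupled_any:
  assumes "pure m0" "pure m1" "\<And>x y. x \<in> set_pmf (unlift m0) ==> y \<in> set_pmf (unlift m1) ==> Q x y"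
  shows "coupled Q m0 m1"
  unfolding coupled_def
  by (intro conjI assms rel_pmf.intros[of "pair_pmf (unlift m0) (unlift m1)"])
    (auto simp: assms map_fst_pair_pmf map_snd_pair_pmf)

text \<open>Under the coupling the partners of \<open>X\<close> lie outside \<open>Y\<close>, so
  \<open>X\<close> is at most as likely as the complement of \<open>Y\<close>.\<close>

lemma rel_pmf_exclusive:
  assumes "rel_pmf Q p q" "\<And>x y. Q x y ==> x \<in> X ==> y \<in> Y ==> False"
  shows "measure_pmf.prob p X + measure_pmf.prob q Y \<le> 1"
proof -
  have "measure_pmf.prob p X \<le> measure_pmf.prob q {y. \<exists>x \<in> X. Q x y}" by (rule rel_pmf_measureD[OF assms(1)])
  also have "\<dots> \<le> measure_pmf.prob q (- Y)" by (rule measure_pmf.finite_measure_mono) (use assms(2) in auto)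
  also have "\<dots> = 1 - measure_pmf.prob q Y" using measure_pmf.prob_compl[of Y q] by (simp add: Compl_eq_Diff_UNIV)
  finally show ?thesis by simp
qed

lemma pure_interp:
  assumes "\<And>d g. pure (h d g)"
  shows "pure (interp S B h n st)"
proof (induction n arbitrary: st)
  case (Suc n)
  have "pure (istep B h c cs st g)" for c cs st g
    by (cases c; cases g) (auto simp: put_def split: option.splits intro!: pure_ret pure_bnd pure_lift assms)
  then show ?case unfolding interp_Suc by (intro pure_bnd Suc) (auto simp: rstep_def pure_ret split: list.splits)
qed (simp add: pure_ret)

lemma interp_dead:
  assumes "\<And>d g. pure (h d g)" "snd (snd st) = None" "st' \<in> set_pmf (unlift (interp S B h n st))"
  shows "snd (snd st') = None"
proof -
  have dead: "snd (snd st1) = None" if "Some (st1, w1) \<in> set_pmf (istep B h c cs st None w)" for c cs st st1 w w1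
    using that by (cases c) (auto simp: put_def set_bnd)
  have "snd (snd st') = None" if "Some (st', w') \<in> set_pmf (interp S B h n st w)" "snd (snd st) = None" for w w' n st
    using that
  proof (induction n arbitrary: st w)
    case (Suc n)
    then obtain st1 w1 where 1: "Some (st1, w1) \<in> set_pmf (rstep S B h st w)" "Some (st', w') \<in> set_pmf (interp S B h n st1 w1)"
      by (auto simp: interp_Suc set_bnd)
    have "snd (snd st1) = None" using 1(1) Suc.prems(2)
      by (auto simp: rstep_def dest: dead split: list.splits if_splits)
    then show ?case using Suc.IH 1(2) by blast
  qed simp
  moreover have "lift (unlift (interp S B h n st)) = interp S B h n st" by (rule lift_unlift[OF pure_interp[OF assms(1)]])
  then have "Some (st', undefined) \<in> set_pmf (interp S B h n st undefined)" using assms(3) set_lift by metis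
  ultimately show ?thesis using assms(2) by blast
qed

text \<open>Two runs are compared as long as both are alive, since a dead run is not won.\<close>
definition agree :: "('g => 'g => bool) => 'g ist => 'g ist => bool" where
  "agree G st0 st1 \<longleftrightarrow> (\<forall>g0 g1. snd (snd st0) = Some g0 \<longrightarrow> snd (snd st1) = Some g1 \<longrightarrow>
     fst st0 = fst st1 \<and> fst (snd st0) = fst (snd st1) \<and> G g0 g1)"

definition agree_reply :: "('g => 'g => bool) => (data \<times> 'g) option => (data \<times> 'g) option => bool" where
  "agree_reply G r0 r1 \<longleftrightarrow> (\<forall>q0 q1. r0 = Some q0 \<longrightarrow> r1 = Some q1 \<longrightarrow> fst q0 = fst q1 \<and> G (snd q0) (snd q1))"

text \<open>The relation \<open>G n\<close> is indexed by the number of steps still to come. Each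
  step makes at most one query, so the index can hold a reserve of encryptions that is used up query
  by query.\<close>

lemma coupled_interp:
  assumes p: "\<And>d g. pure (h0 d g)" "\<And>d g. pure (h1 d g)"
    and h: "\<And>n d g0 g1. G (Suc n) g0 g1 ==> coupled (agree_reply (G n)) (h0 d g0) (h1 d g1)"
    and mono: "\<And>n g0 g1. G (Suc n) g0 g1 ==> G n g0 g1"
  shows "agree (G n) st0 st1 ==> coupled (agree (G 0)) (interp S B h0 n st0) (interp S B h1 n st1)"
proof (induction n arbitrary: st0 st1)
  case 0
  then show ?case unfolding interp_0 by (rule coupled_ret)
next
  case (Suc n)
  note pu = pure_interp[OF p(1)] pure_interp[OF p(2)]
  show ?case
  proof (cases "snd (snd st0) = None \<or> snd (snd st1) = None")
    case True
    show ?thesis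
    proof (rule coupled_any[OF pu])
      fix x y assume xy: "x \<in> set_pmf (unlift (interp S B h0 (Suc n) st0))" "y \<in> set_pmf (unlift (interp S B h1 (Suc n) st1))"
      have "snd (snd x) = None \<or> snd (snd y) = None"
        using True
      proof
        assume "snd (snd st0) = None"
        from interp_dead[OF p(1) this xy(1)] show ?thesis ..
      next
        assume "snd (snd st1) = None"
        from interp_dead[OF p(2) this xy(2)] show ?thesis ..
      qed
      then show "agree (G 0) x y" by (auto simp: agree_def)
    qed
  next
    case False
    then obtain g0 g1 where g: "snd (snd st0) = Some g0" "snd (snd st1) = Some g1" by auto
    then have "fst st0 = fst st1" "fst (snd st0) = fst (snd st1)" "G (Suc n) g0 g1" using Suc.prems unfolding agree_def by blast+
    then obtain cs0 st where st: "st0 = (cs0, st, Some g0)" "st1 = (cs0, st, Some g1)" "G (Suc n) g0 g1"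
      using g by (metis prod.collapse)
    have put: "coupled (agree (G n)) (put B cs st x d (Some g0)) (put B cs st x d (Some g1))" if "G n g0 g1" for cs st x d g0 g1
      unfolding put_def by (rule coupled_ret) (use that in \<open>simp add: agree_def\<close>)
    have g': "G n g0 g1" by (rule mono[OF st(3)])
    have same: "agree (G n) (cs, st, Some g0) (cs, st, Some g1)" for cs st using g' by (simp add: agree_def)
    have istep: "coupled (agree (G n)) (istep B h0 c cs st (Some g0)) (istep B h1 c cs st (Some g1))" for c cs
    proof (cases c)
      case (Query y e)
      have ag: "agree (G n) (case r0 of None => ([], st, None) | Some q => if size (fst q) \<le> B then (cs, st[y := fst q], Some (snd q)) else ([], st, None))
          (case r1 of None => ([], st, None) | Some q => if size (fst q) \<le> B then (cs, st[y := fst q], Some (snd q)) else ([], st, None))"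
        if "agree_reply (G n) r0 r1" for r0 r1
        using that by (cases r0; cases r1) (simp_all add: agree_def agree_reply_def)
      have eq: "(case r of None => ret ([], st, None) | Some q => put B cs st y (fst q) (Some (snd q))) =
          ret (case r of None => ([], st, None) | Some q => if size (fst q) \<le> B then (cs, st[y := fst q], Some (snd q)) else ([], st, None))" for r
        by (simp add: put_def split: option.split)
      show ?thesis unfolding Query istep.simps option.case eq
        by (rule coupled_bnd[OF h[OF st(3)]])
          (rule pure_ret, rule pure_ret, rule coupled_ret, rule ag)
    next
      case (Sample y e)
      have "coupled (=) (lift (pick (data_list (den st e)))) (lift (pick (data_list (den st e))))"
        by (simp add: coupled_def pure_lift pmf.rel_eq)
      then show ?thesis unfolding Sample istep.simps
        by (rule coupled_bnd) (simp_all add: put_def pure_ret put[OF g', unfolded put_def])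
    qed (simp_all add: put[OF g'] coupled_ret same)
    have "coupled (agree (G n)) (rstep S B h0 st0) (rstep S B h1 st1)"
      unfolding rstep_def st by (simp split: list.split add: istep coupled_ret same)
    then show ?thesis unfolding interp_Suc by (rule coupled_bnd) (rule pu, rule pu, rule Suc.IH)
  qed
qed

text \<open>The encryptions caused by one query at most: the input array and, in each of the two
  passes, the temporary and the output array.\<close>

definition calls :: "nat => nat => nat" where "calls s m = s * s + 2 * (s * s * m + s * s)"

text \<open>The ciphertexts in the two tables agree, while the plaintexts may differ. The last
  condition is the reserve: even if all \<open>n\<close> remaining steps are queries, every
  encryption has a number below \<open>h\<close> and is one of zeros.\<close>

definition same_view :: "nat => nat => nat => gst => gst => bool" where
  "same_view h L n g0 g1 \<longleftrightarrow> fst g0 = fst g1 \<and> map fst (fst (snd g0)) = map fst (fst (snd g1)) \<and>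
     snd (snd g0) = snd (snd g1) \<and> fst g0 + n * L \<le> h"

lemma job_Some:
  assumes "job D n w kw b d g = Some (pre, C, A, ps, ch)"
  shows "valid_array n w A" "perm_fun ps permutes {1..n}"
    "ch \<longleftrightarrow> data_num (left d) \<noteq> 0" "pre \<longleftrightarrow> data_num (left d) = 0 \<or> data_num (left d) = 1"
    "C = (if pre then [] else data_list (left (right d)))"
  using assms by (auto simp: job_def ok_def array_check perm_check Let_def split: if_splits)

text \<open>Both runs use the same permutation \<open>\<rho>\<close>. If one of them overflows, it
  dies and nothing has to be shown; otherwise both encrypt equally many zero strings of equal
  length, which gives the same distribution of ciphertexts.\<close>

lemma hyb_shuffle_agree:
  assumes g: "same_view h (calls s m) (Suc n) g0 g1"
    and A: "valid_array (s * s) w A0" "valid_array (s * s) w A1"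
    and ps: "perm_fun ps0 permutes {1..s * s}" "perm_fun ps1 permutes {1..s * s}"
  shows "rel_pmf (agree_reply (same_view h (calls s m) n))
     (hyb_shuffle e h s m w kw (fst g0) (fst (snd g0)) (pre, C, A0, ps0, ch))
     (hyb_shuffle e h s m w kw (fst g1) (fst (snd g1)) (pre, C, A1, ps1, ch))"
  unfolding hyb_shuffle_def prod.case
proof (rule rel_pmf_bindI[OF rel_pmf_reflI[where P = "\<lambda>\<rho> \<rho>'. \<rho>' = \<rho> \<and> \<rho> \<in> set_pmf (pmf_of_set {\<sigma>. \<sigma> permutes {1..s * s}})"]])
  fix \<rho> \<rho>' assume "\<rho>' = \<rho> \<and> \<rho> \<in> set_pmf (pmf_of_set {\<sigma>. \<sigma> permutes {1..s * s}})"
  then have eq: "\<rho>' = \<rho>" and "\<rho> \<in> set_pmf (pmf_of_set {\<sigma>. \<sigma> permutes {1..s * s}})" by auto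
  from this(2) have \<rho>: "\<rho> permutes {1..s * s}" by (subst (asm) set_pmf_of_set) (auto simp: finite_permutations intro: exI[of _ id] permutes_id)
  let ?F = "\<lambda>\<rho> A ps g. case plan s m w \<rho> (perm_fun ps) A of None => return_pmf None
     | Some pl => map_pmf (\<lambda>cs. Some (reply s m pre C (fst g) (fst (snd g)) ch (plaintexts kw pre A pl) cs)) (hyb_enc e h (fst g) (plaintexts kw pre A pl))"
  have "rel_pmf (agree_reply (same_view h (calls s m) n)) (?F \<rho> A0 ps0 g0) (?F \<rho> A1 ps1 g1)"
  proof (cases "plan s m w \<rho> (perm_fun ps0) A0")
    case None
    then show ?thesis by (simp add: rel_pmf_return_pmf1 agree_reply_def)
  next
    case (Some pl0)
    note p0 = Some plaintexts_props[OF Some A(1) \<rho> ps(1), where pre = pre and kw = kw]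
    show ?thesis
    proof (cases "plan s m w \<rho> (perm_fun ps1) A1")
      case None
      then show ?thesis by (simp add: rel_pmf_return_pmf2 agree_reply_def)
    next
      case (Some pl1)
      note p1 = Some plaintexts_props[OF Some A(2) \<rho> ps(2), where pre = pre and kw = kw]
      let ?m0 = "plaintexts kw pre A0 pl0" and ?m1 = "plaintexts kw pre A1 pl1"
      have L: "length ?m1 = length ?m0" "length ?m0 \<le> calls s m" using p0(2) p1(2) by (simp_all add: calls_def)
      \<comment> \<open>The reserve for \<open>Suc n\<close> steps is split into this query and the
        remaining \<open>n\<close> steps.\<close>
      have i: "fst g1 = fst g0" "fst g0 + (calls s m + n * calls s m) \<le> h" using g by (simp_all add: same_view_def)
      have z: "zeros x = replicate (kw + w) False" if "x \<in> set ?m0 \<union> set ?m1" for x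
        using p0(3)[of x] p1(3)[of x] that by (auto simp: zeros_def)
      have e: "hyb_enc e h (fst g0) ?m0 = hyb_enc e h (fst g0) ?m1"
        unfolding hyb_enc_def L(1)
      proof (rule arg_cong[where f = seq_pmf], rule map_cong[OF refl])
        fix q assume "q \<in> set [0..<length ?m0]"
        then have q: "q < length ?m0" "fst g0 + q < h" using L i by auto
        then have "zeros (?m0 ! q) = zeros (?m1 ! q)" using L(1) by (simp add: z)
        then show "e (if fst g0 + q < h then zeros (nthd [] ?m0 q) else nthd [] ?m0 q) =
            e (if fst g0 + q < h then zeros (nthd [] ?m1 q) else nthd [] ?m1 q)"
          using q L(1) by (simp add: nthd_eq)
      qed
      have r: "agree_reply (same_view h (calls s m) n) (Some (reply s m pre C (fst g0) (fst (snd g0)) ch ?m0 cs))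
          (Some (reply s m pre C (fst g1) (fst (snd g1)) ch ?m1 cs))" for cs
        using g L i by (auto simp: agree_reply_def same_view_def reply_def zipd_def)
      show ?thesis unfolding p0(1) p1(1) option.case i(1) e
        by (simp add: pmf.rel_map) (rule rel_pmf_reflI, use r i in simp)
    qed
  qed
  then show "rel_pmf (agree_reply (same_view h (calls s m) n)) (?F \<rho> A0 ps0 g0) (?F \<rho>' A1 ps1 g1)" by (simp only: eq)
qed simp

text \<open>The arrays may differ, in the challenge by the bit and later because the tables hold
  different plaintexts. Only their validity matters for the comparison; submitted ciphertexts are
  part of the query, which is the same on both sides.\<close>

lemma hyb_respond_agree:
  assumes g: "same_view h (calls s m) (Suc n) g0 g1"
  shows "rel_pmf (agree_reply (same_view h (calls s m) n))
     (hyb_respond e D h s m w kw False d g0) (hyb_respond e D h s m w kw True d g1)"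
proof (cases "job D (s * s) w kw False d g0")
  case None
  then show ?thesis by (simp add: hyb_respond_def rel_pmf_return_pmf1 agree_reply_def)
next
  case (Some J0)
  note J0 = Some
  show ?thesis
  proof (cases "job D (s * s) w kw True d g1")
    case None
    then show ?thesis by (simp add: hyb_respond_def rel_pmf_return_pmf2 agree_reply_def)
  next
    case (Some J1)
    obtain pre C A0 ps0 ch where j0: "J0 = (pre, C, A0, ps0, ch)" by (cases J0)
    obtain pre' C' A1 ps1 ch' where j1: "J1 = (pre', C', A1, ps1, ch')" by (cases J1)
    note k0 = job_Some[OF J0[unfolded j0]] and k1 = job_Some[OF Some[unfolded j1]]
    have "pre' = pre" "C' = C" "ch' = ch" using k0(3-5) k1(3-5) by auto
    then show ?thesis unfolding hyb_respond_def J0 Some j0 j1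
      using hyb_shuffle_agree[OF g k0(1) k1(1) k0(2) k1(2)] by simp
  qed
qed

definition hyb_interp :: "com => (bool list => data pmf) => (data => bool list option) => nat => nat => nat => nat => nat =>
    bool => nat => nat => gst ist pmf" where
  "hyb_interp A e D h s m w kw b B k =
     unlift (interp (subs A) B (\<lambda>d g. lift (hyb_respond e D h s m w kw b d g)) B
       ([A], list_data [num_data k, num_data (s * s), num_data w] # replicate (cvars A) Leaf, Some (0, [], False)) :: (world, gst ist) M)"

definition won_by :: "bool => gst ist => bool" where
  "won_by b st \<longleftrightarrow> fst st = [] \<and> \<not> snd (snd st) = None \<and> data_bit (nthd Leaf (fst (snd st)) 0) = b"

definition hyb_play :: "com => (bool list => data pmf) => (data => bool list option) => nat => nat => nat => nat => nat =>
    bool => nat => nat => bool pmf" where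
  "hyb_play A e D h s m w kw b B k = map_pmf (won_by b) (hyb_interp A e D h s m w kw b B k)"

lemma (in encryption) play_adv_sim:
  "(play_adv A sim_enc sim_dec (k, key, \<beta>) s m w kw j b B k0 :: (world, bool) M) =
     lift (hyb_play A (enc E k key) (dec E k key) (if \<beta> then j else Suc j) s m w kw b B k0)"
  unfolding play_adv_def respond_sim hyb_play_def hyb_interp_def lift_bnd_ret[symmetric]
  by (simp add: lift_unlift pure_interp pure_lift won_by_def)

text \<open>
  Once every plaintext is replaced by zeros, the two values of the secret bit lead to the same
  view as long as both runs are alive, and at most one of them can be won.
\<close>
lemma hyb_play_zeros:
  assumes "B * calls s m \<le> h"
  shows "pmf (hyb_play A e D h s m w kw False B k) True + pmf (hyb_play A e D h s m w kw True B k) True \<le> 1"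
proof -
  have c: "coupled (agree (same_view h (calls s m) 0))
     (interp (subs A) B (\<lambda>d g. lift (hyb_respond e D h s m w kw False d g)) B
       ([A], list_data [num_data k, num_data (s * s), num_data w] # replicate (cvars A) Leaf, Some (0, [], False)) :: (world, gst ist) M)
     (interp (subs A) B (\<lambda>d g. lift (hyb_respond e D h s m w kw True d g)) B
       ([A], list_data [num_data k, num_data (s * s), num_data w] # replicate (cvars A) Leaf, Some (0, [], False)))"
  proof (rule coupled_interp[where G = "same_view h (calls s m)"])
    show "coupled (agree_reply (same_view h (calls s m) n)) (lift (hyb_respond e D h s m w kw False d g0)) (lift (hyb_respond e D h s m w kw True d g1))"
      if "same_view h (calls s m) (Suc n) g0 g1" for n d g0 g1
      using hyb_respond_agree[OF that] by (simp add: coupled_def pure_lift)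
  qed (auto simp: pure_lift agree_def same_view_def assms)
  have "measure_pmf.prob (hyb_interp A e D h s m w kw False B k) {st. won_by False st} +
      measure_pmf.prob (hyb_interp A e D h s m w kw True B k) {st. won_by True st} \<le> 1"
    unfolding hyb_interp_def by (rule rel_pmf_exclusive[OF c[unfolded coupled_def, THEN conjunct2, THEN conjunct2]])
      (auto simp: agree_def won_by_def)
  moreover have "won_by b -` {True} = {st. won_by b st}" for b by auto
  ultimately show ?thesis by (simp add: hyb_play_def pmf_map)
qed

section \<open>The shuffle game and the first hybrid\<close>

lemma find_elem_Some: "find_elem n kw r = Some e ==> r = Some (msg kw e)"
proof -
  assume f: "find_elem n kw r = Some e"
  then obtain bs where r: "r = Some bs" by (auto simp: find_elem_def split: option.splits)
  let ?F = "filter (\<lambda>x. ebits kw x = take kw bs) [1..<n+1]"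
  obtain x xs where x: "?F = x # xs" "e = (x, drop kw bs)" using f r by (auto simp: find_elem_def split: list.splits)
  have "x \<in> set ?F" unfolding x(1) by simp
  then have "ebits kw x = take kw bs" unfolding set_filter by blast
  then show ?thesis using x r by (simp add: msg_def)
qed

text \<open>With the true key width, the bits determine every key up to \<open>n\<close>, so the
  search returns no other one.\<close>

lemma find_elem_msg:
  assumes "fst e \<in> {1..n}"
  shows "find_elem n (key_width n) (Some (msg (key_width n) e)) = Some e"
proof -
  let ?kw = "key_width n"
  have len: "length (ebits ?kw x) = ?kw" for x by (simp add: ebits_def)
  have inj: "x = fst e" if "ebits ?kw x = ebits ?kw (fst e)" "x \<le> n" for x
  proof -
    have "elem_bits n (x, snd e) = elem_bits n e" using that by (simp add: elem_bits_msg msg_def del: elem_bits.simps)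
    then have "bits_elem n (elem_bits n (x, snd e)) = bits_elem n (elem_bits n e)" by simp
    moreover have "bits_elem n (elem_bits n (x, snd e)) = (x, snd e)" by (rule bits_elem_bits) (simp add: that)
    moreover have "bits_elem n (elem_bits n e) = e" by (rule bits_elem_bits) (use assms in simp)
    ultimately show ?thesis by (metis fst_conv)
  qed
  let ?F = "filter (\<lambda>x. ebits ?kw x = ebits ?kw (fst e)) [1..<n+1]"
  have "fst e \<in> {1..<n+1}" using assms by auto
  then have "fst e \<in> set ?F" by (simp only: set_filter set_upt mem_Collect_eq simp_thms)
  then have "?F \<noteq> []" by (metis empty_iff list.set(1))
  then obtain x xs where x: "?F = x # xs" by (meson neq_Nil_conv)
  have "x \<in> set ?F" unfolding x by simp
  then have "x = fst e" unfolding set_filter by (intro inj) auto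
  moreover have "find_elem n ?kw (Some (msg ?kw e)) = Some (x, snd e)"
    unfolding find_elem_def option.case msg_def by (simp only: append_eq_conv_conj[THEN iffD1, OF refl] take_append drop_append len diff_self_eq_0 take0 drop0 append_Nil2 take_all[OF eq_refl[OF len]] drop_all[OF eq_refl[OF len]] append_Nil x list.case)
  ultimately show ?thesis by (cases e) simp
qed

lemma found_map: "(\<And>e. e \<in> set es ==> find_elem n kw (f e) = Some e) ==> found n kw (map f es) = es"
  unfolding found_def by (induction es) auto

text \<open>A submitted list encrypts at most one legal array. Together with
  \<open>found_encrypts\<close> this turns the existential condition on encrypted queries into a
  computation.\<close>

lemma encrypts_array_found:
  assumes "encrypts_array E k key n A C" "valid_array n w A"
  shows "\<forall>r \<in> set (map (dec E k key) C). find_elem n (key_width n) r \<noteq> None" "found n (key_width n) (map (dec E k key) C) = A"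
proof -
  have "map (dec E k key) C = map (\<lambda>e. Some (msg (key_width n) e)) A"
    using assms(1) by (intro nth_equalityI) (auto simp: encrypts_array_def list_all2_conv_all_nth elem_bits_msg simp del: elem_bits.simps)
  moreover have "find_elem n (key_width n) (Some (msg (key_width n) e)) = Some e" if "e \<in> set A" for e
    using assms(2) that by (intro find_elem_msg) (auto simp: valid_array_def)
  ultimately show "\<forall>r \<in> set (map (dec E k key) C). find_elem n (key_width n) r \<noteq> None" "found n (key_width n) (map (dec E k key) C) = A"
    by (auto intro: found_map)
qed

lemma found_encrypts:
  assumes "\<forall>r \<in> set (map (dec E k key) C). find_elem n (key_width n) r \<noteq> None"
  shows "encrypts_array E k key n (found n (key_width n) (map (dec E k key) C)) C"
  using assms
proof (induction C)
  case (Cons c C)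
  then obtain e where "find_elem n (key_width n) (dec E k key c) = Some e" by auto
  then show ?case using Cons find_elem_Some[of n "key_width n" "dec E k key c" e]
    by (simp add: found_def encrypts_array_def elem_bits_msg del: elem_bits.simps)
qed (simp add: found_def encrypts_array_def)

lemma hyb_enc_0: "hyb_enc (enc E k key) 0 i (map (msg (key_width n)) es) = enc_elems E k key n es"
proof -
  have "map (\<lambda>q. enc E k key (nthd [] ms q)) [0..<length ms] = map (enc E k key) ms" for ms
    by (intro nth_equalityI) (auto simp: nthd_eq)
  from this[of "map (msg (key_width n)) es"] show ?thesis
    by (simp add: hyb_enc_def enc_elems_def enc_all_def elem_bits_msg[abs_def] del: elem_bits.simps)
qed

lemma data_perm_num_list: "data_perm d = perm_fun (num_list d)" by (simp add: data_perm_fun num_list_def)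

text \<open>Answer and next state of the actual game after a shuffle without overflow. It is written
  with \<open>reply\<close>, so that it agrees with the hybrid's answer by construction.\<close>

definition cont :: "nat => nat => nat => (data \<times> bool list) list => data \<times> bool => bool \<times> data list \<times> elem list \<times> nat list \<times> bool =>
    elem list => data list => (data \<times> data \<times> bool \<times> bool) option" where
  "cont s m i tab kb = (\<lambda>(pre, C, A, ps, ch) pl cs.
     Some (fst (reply s m pre C i tab ch (plaintexts (key_width (s * s)) pre A pl) cs), (fst kb, snd kb, ch)))"

context encryption begin

text \<open>The input array is encrypted before the shuffle draws its permutation. The two choices
  are independent and can be exchanged, so that the encryptions of the input and of the plan form
  one sequence.\<close>

lemma plain_eq:
  assumes key: "key \<in> set_pmf (gen E k)" and n: "n = s * s" and m: "m = batch_size p n"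
    and A: "valid_array n w A" and ps: "perm_fun ps permutes {1..n}"
  shows "\<exists>\<kappa>. map_pmf (\<lambda>r. Some (outcome_data r, (key, b, ch)))
      (bind_pmf (enc_elems E k key n A) (\<lambda>C. melbourne_shuffle E p n w k key C (perm_fun ps))) =
    bind_pmf (pmf_of_set {\<sigma>. \<sigma> permutes {1..n}}) (\<lambda>\<rho>. case plan s m w \<rho> (perm_fun ps) A of None => \<kappa> \<rho>
      | Some pl => map_pmf (cont s m i tab (key, b) (True, [], A, ps, ch) pl)
          (hyb_enc (enc E k key) 0 i (plaintexts (key_width n) True A pl)))"
proof -
  let ?Q = "pmf_of_set {\<sigma>. \<sigma> permutes {1..n}}"
  have "\<forall>C \<in> set_pmf (enc_elems E k key n A). \<exists>\<kappa>. melbourne_shuffle E p n w k key C (perm_fun ps) =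
    bind_pmf ?Q (\<lambda>\<rho>. case plan s m w \<rho> (perm_fun ps) A of None => \<kappa> \<rho> | Some ms => map_pmf (view s m C) (enc_elems E k key n ms))"
    using melbourne_shuffle_plan[OF sym key n m A _ ps] enc_elems_dec[OF sym key] by blast
  \<comment> \<open>The distribution of failing runs may depend on the ciphertexts of the input, so
    one is chosen for each of them.\<close>
  from bchoice[OF this] obtain \<kappa> where \<kappa>: "\<And>C. C \<in> set_pmf (enc_elems E k key n A) ==> melbourne_shuffle E p n w k key C (perm_fun ps) =
    bind_pmf ?Q (\<lambda>\<rho>. case plan s m w \<rho> (perm_fun ps) A of None => \<kappa> C \<rho> | Some ms => map_pmf (view s m C) (enc_elems E k key n ms))"
    by blast
  let ?G = "\<lambda>r. Some (outcome_data r, (key, b, ch))"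
  let ?\<kappa> = "\<lambda>\<rho>. map_pmf ?G (bind_pmf (enc_elems E k key n A) (\<lambda>C. \<kappa> C \<rho>))"
  have "bind_pmf (enc_elems E k key n A) (\<lambda>C. melbourne_shuffle E p n w k key C (perm_fun ps)) =
     bind_pmf (enc_elems E k key n A) (\<lambda>C. bind_pmf ?Q (\<lambda>\<rho>. case plan s m w \<rho> (perm_fun ps) A of None => \<kappa> C \<rho> | Some ms => map_pmf (view s m C) (enc_elems E k key n ms)))"
    by (rule bind_pmf_cong[OF refl]) (rule \<kappa>)
  also have "\<dots> = bind_pmf ?Q (\<lambda>\<rho>. bind_pmf (enc_elems E k key n A) (\<lambda>C. case plan s m w \<rho> (perm_fun ps) A of None => \<kappa> C \<rho> | Some ms => map_pmf (view s m C) (enc_elems E k key n ms)))"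
    by (rule bind_commute_pmf)
  finally have eq: "map_pmf ?G (bind_pmf (enc_elems E k key n A) (\<lambda>C. melbourne_shuffle E p n w k key C (perm_fun ps))) =
     bind_pmf ?Q (\<lambda>\<rho>. map_pmf ?G (bind_pmf (enc_elems E k key n A) (\<lambda>C. case plan s m w \<rho> (perm_fun ps) A of None => \<kappa> C \<rho> | Some ms => map_pmf (view s m C) (enc_elems E k key n ms))))"
    by (simp only: map_bind_pmf)
  have main: "map_pmf ?G (bind_pmf (enc_elems E k key n A) (\<lambda>C. map_pmf (view s m C) (enc_elems E k key n pl))) =
     map_pmf (cont s m i tab (key, b) (True, [], A, ps, ch) pl) (hyb_enc (enc E k key) 0 i (plaintexts (key_width n) True A pl))" for pl
  proof -
    have lenA: "length A = s * s" using A by (simp add: valid_array_def n)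
    have "map_pmf (cont s m i tab (key, b) (True, [], A, ps, ch) pl) (hyb_enc (enc E k key) 0 i (plaintexts (key_width n) True A pl)) =
      bind_pmf (enc_elems E k key n A) (\<lambda>C. map_pmf (\<lambda>cs. cont s m i tab (key, b) (True, [], A, ps, ch) pl (C @ cs)) (enc_elems E k key n pl))"
      by (simp add: plaintexts_def hyb_enc_0 enc_elems_append map_bind_pmf pmf.map_comp o_def flip: map_append)
    also have "\<dots> = bind_pmf (enc_elems E k key n A) (\<lambda>C. map_pmf (\<lambda>cs. ?G (view s m C cs)) (enc_elems E k key n pl))"
      by (rule bind_pmf_cong[OF refl]) (simp add: cont_def reply_def lenA enc_elems_length)
    finally show ?thesis by (simp add: map_bind_pmf pmf.map_comp o_def)
  qed
  show ?thesis
  proof (rule exI[of _ ?\<kappa>])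
    show "map_pmf ?G (bind_pmf (enc_elems E k key n A) (\<lambda>C. melbourne_shuffle E p n w k key C (perm_fun ps))) =
      bind_pmf ?Q (\<lambda>\<rho>. case plan s m w \<rho> (perm_fun ps) A of None => ?\<kappa> \<rho>
      | Some pl => map_pmf (cont s m i tab (key, b) (True, [], A, ps, ch) pl)
          (hyb_enc (enc E k key) 0 i (plaintexts (key_width n) True A pl)))"
      unfolding eq by (rule bind_pmf_cong[OF refl]) (simp add: main split: option.split)
  qed
qed

lemma crypt_eq:
  assumes key: "key \<in> set_pmf (gen E k)" and n: "n = s * s" and m: "m = batch_size p n"
    and A: "valid_array n w A" and C: "encrypts_array E k key n A C" and ps: "perm_fun ps permutes {1..n}"
  shows "\<exists>\<kappa>. map_pmf (\<lambda>r. Some (outcome_data r, (key, b, ch))) (melbourne_shuffle E p n w k key C (perm_fun ps)) =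
    bind_pmf (pmf_of_set {\<sigma>. \<sigma> permutes {1..n}}) (\<lambda>\<rho>. case plan s m w \<rho> (perm_fun ps) A of None => \<kappa> \<rho>
      | Some pl => map_pmf (cont s m i tab (key, b) (False, C, A, ps, ch) pl)
          (hyb_enc (enc E k key) 0 i (plaintexts (key_width n) False A pl)))"
proof -
  let ?G = "\<lambda>r. Some (outcome_data r, (key, b, ch))"
  obtain \<kappa> where \<kappa>: "melbourne_shuffle E p n w k key C (perm_fun ps) =
    bind_pmf (pmf_of_set {\<sigma>. \<sigma> permutes {1..n}}) (\<lambda>\<rho>. case plan s m w \<rho> (perm_fun ps) A of None => \<kappa> \<rho> | Some ms => map_pmf (view s m C) (enc_elems E k key n ms))"
    using melbourne_shuffle_plan[OF sym key n m A C ps] by blast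
  show ?thesis
  proof (rule exI[of _ "\<lambda>\<rho>. map_pmf ?G (\<kappa> \<rho>)"])
    show "map_pmf ?G (melbourne_shuffle E p n w k key C (perm_fun ps)) =
      bind_pmf (pmf_of_set {\<sigma>. \<sigma> permutes {1..n}}) (\<lambda>\<rho>. case plan s m w \<rho> (perm_fun ps) A of None => map_pmf ?G (\<kappa> \<rho>)
      | Some pl => map_pmf (cont s m i tab (key, b) (False, C, A, ps, ch) pl)
          (hyb_enc (enc E k key) 0 i (plaintexts (key_width n) False A pl)))"
      unfolding \<kappa> map_bind_pmf
      by (rule bind_pmf_cong[OF refl])
        (simp add: plaintexts_def hyb_enc_0 pmf.map_comp o_def cont_def reply_def split: option.split)
  qed
qed

text \<open>As long as nothing is replaced by zeros, the table is truthful: \<open>lookup\<close>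
  agrees with decryption, so the job computed by the hybrid is that of the game. Only the reply to
  an overflow can differ, and it is left to \<open>\<kappa>\<close>.\<close>

lemma shuffle_respond_eq:
  assumes key: "key \<in> set_pmf (gen E k)" and n: "n = s * s" and m: "m = batch_size p n"
    and tab: "\<And>c m. (c, m) \<in> set tab ==> dec E k key c = Some m"
  shows "\<exists>\<kappa>. shuffle_respond E n w k (melbourne_shuffle E p n w k) (key, b, ch) d =
    (case job (dec E k key) n w (key_width n) b d (i, tab, ch) of None => return_pmf None
     | Some J => bind_pmf (pmf_of_set {\<sigma>. \<sigma> permutes {1..n}}) (\<lambda>\<rho>.
         case plan s m w \<rho> (perm_fun (fst (snd (snd (snd J))))) (fst (snd (snd J))) of None => \<kappa> \<rho>
       | Some pl => map_pmf (cont s m i tab (key, b) J pl)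
           (hyb_enc (enc E k key) 0 i (plaintexts (key_width n) (fst J) (fst (snd (snd J))) pl))))"
proof -
  have ok: "ok n w A ps \<longleftrightarrow> valid_array n w A \<and> perm_fun ps permutes {1..n}" for A ps
    by (simp add: ok_def array_check perm_check)
  have look: "lookup tab (dec E k key) = dec E k key"
  proof
    fix c show "lookup tab (dec E k key) c = dec E k key c"
    proof (cases "filter (\<lambda>t. fst t = c) tab")
      case (Cons t ts)
      then have "t \<in> set (filter (\<lambda>t. fst t = c) tab)" by simp
      then have "t \<in> set tab" "fst t = c" unfolding set_filter by blast+
      then have "(c, snd t) \<in> set tab" by auto
      from tab[OF this] show ?thesis using Cons by (simp add: lookup_def)
    qed (simp add: lookup_def)
  qed
  consider "data_num (left d) = 0" | "data_num (left d) = 1" | "data_num (left d) \<noteq> 0" "data_num (left d) \<noteq> 1" by blast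
  then show ?thesis
  proof cases
    case 1
    let ?A = "data_elems (left (right d))" and ?ps = "num_list (right (right d))"
    show ?thesis
    proof (cases "\<not> ch \<and> ok n w ?A ?ps")
      case True
      then have j: "job (dec E k key) n w (key_width n) b d (i, tab, ch) = Some (True, [], ?A, ?ps, False)"
        using 1 by (simp add: job_def)
      have resp: "shuffle_respond E n w k (melbourne_shuffle E p n w k) (key, b, ch) d =
          map_pmf (\<lambda>r. Some (outcome_data r, (key, b, False)))
            (bind_pmf (enc_elems E k key n ?A) (\<lambda>C. melbourne_shuffle E p n w k key C (perm_fun ?ps)))"
        using True 1 by (simp add: parse_shuffle_query_def Let_def data_perm_num_list ok)
      show ?thesis unfolding resp j option.case fst_conv snd_conv
        by (rule plain_eq[OF key n m]) (use True ok in blast)+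
    next
      case False
      then have j: "job (dec E k key) n w (key_width n) b d (i, tab, ch) = None"
        using 1 by (auto simp: job_def)
      have "shuffle_respond E n w k (melbourne_shuffle E p n w k) (key, b, ch) d = return_pmf None"
      proof -
        have c: "\<not> (\<not> ch \<and> valid_array n w ?A \<and> perm_fun ?ps permutes {1..n})" using False ok by blast
        show ?thesis
          by (simp only: shuffle_respond.simps parse_shuffle_query_def Let_def data_perm_num_list 1 shuffle_query.case simp_thms if_True if_not_P[OF c])
      qed
      then show ?thesis by (simp add: j)
    qed
  next
    case 2
    let ?A0 = "data_elems (left (left (right d)))" and ?ps0 = "num_list (right (left (right d)))"
    let ?A1 = "data_elems (left (right (right d)))" and ?ps1 = "num_list (right (right (right d)))"
    show ?thesis
    proof (cases "\<not> ch \<and> ok n w ?A0 ?ps0 \<and> ok n w ?A1 ?ps1")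
      case True
      then have j: "job (dec E k key) n w (key_width n) b d (i, tab, ch) =
          Some (True, [], if b then ?A1 else ?A0, if b then ?ps1 else ?ps0, True)"
        using 2 by (simp add: job_def)
      have resp: "shuffle_respond E n w k (melbourne_shuffle E p n w k) (key, b, ch) d =
          map_pmf (\<lambda>r. Some (outcome_data r, (key, b, True)))
            (bind_pmf (enc_elems E k key n (if b then ?A1 else ?A0)) (\<lambda>C. melbourne_shuffle E p n w k key C (perm_fun (if b then ?ps1 else ?ps0))))"
        using True 2 by (simp add: parse_shuffle_query_def Let_def data_perm_num_list ok)
      show ?thesis unfolding resp j option.case fst_conv snd_conv
        by (rule plain_eq[OF key n m]) (use True ok in \<open>auto simp: if_split\<close>)
    next
      case False
      then have j: "job (dec E k key) n w (key_width n) b d (i, tab, ch) = None"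
        using 2 by (auto simp: job_def)
      have "shuffle_respond E n w k (melbourne_shuffle E p n w k) (key, b, ch) d = return_pmf None"
      proof -
        have c: "\<not> (\<not> ch \<and> (valid_array n w ?A0 \<and> perm_fun ?ps0 permutes {1..n}) \<and> valid_array n w ?A1 \<and> perm_fun ?ps1 permutes {1..n})"
          using False ok by blast
        show ?thesis
          by (simp only: shuffle_respond.simps parse_shuffle_query_def Let_def data_perm_num_list 2 one_neq_zero shuffle_query.case simp_thms if_True if_False if_not_P[OF c])
      qed
      then show ?thesis by (simp add: j)
    qed
  next
    case 3
    let ?C = "data_list (left (right d))" and ?ps = "num_list (right (right d))"
    let ?rs = "map (dec E k key) ?C"
    let ?A = "found n (key_width n) ?rs"
    show ?thesis
    proof (cases "ch \<and> (\<forall>r \<in> set ?rs. find_elem n (key_width n) r \<noteq> None) \<and> ok n w ?A ?ps")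
      case True
      then have e: "encrypts_array E k key n ?A ?C" by (intro found_encrypts) blast
      have j: "job (dec E k key) n w (key_width n) b d (i, tab, ch) = Some (False, ?C, ?A, ?ps, True)"
        using True 3 by (simp add: job_def Let_def look)
      have resp: "shuffle_respond E n w k (melbourne_shuffle E p n w k) (key, b, ch) d =
          map_pmf (\<lambda>r. Some (outcome_data r, (key, b, True))) (melbourne_shuffle E p n w k key ?C (perm_fun ?ps))"
        using True 3 e by (auto simp: parse_shuffle_query_def Let_def data_perm_num_list ok)
      show ?thesis unfolding resp j option.case fst_conv snd_conv
        by (rule crypt_eq[OF key n m]) (use True ok e in blast)+
    next
      case False
      have j: "job (dec E k key) n w (key_width n) b d (i, tab, ch) = None"
        using False 3 by (auto simp: job_def Let_def look)
      have no: "\<not> (ch \<and> (\<exists>A. (valid_array n w A \<and> perm_fun ?ps permutes {1..n}) \<and> encrypts_array E k key n A ?C))"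
      proof
        assume "ch \<and> (\<exists>A. (valid_array n w A \<and> perm_fun ?ps permutes {1..n}) \<and> encrypts_array E k key n A ?C)"
        then obtain A where A: "ch" "valid_array n w A" "perm_fun ?ps permutes {1..n}" "encrypts_array E k key n A ?C" by blast
        note f = encrypts_array_found[OF A(4,2)]
        have "ok n w ?A ?ps" unfolding f(2) using A ok by blast
        then show False using False f(1) A(1) by blast
      qed
      have "shuffle_respond E n w k (melbourne_shuffle E p n w k) (key, b, ch) d = return_pmf None"
        by (simp only: shuffle_respond.simps parse_shuffle_query_def Let_def data_perm_num_list 3 shuffle_query.case simp_thms if_False if_not_P[OF no])
      then show ?thesis by (simp add: j)
    qed
  qed
qed

end

section \<open>Winning probabilities, and the coupling of the game with the first hybrid\<close>

lemma run_add: "run R (t + t') c = bind_pmf (run R t c) (run R t')"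
proof (induction t arbitrary: c)
  case (Suc t)
  then have "run R (t + t') = (\<lambda>c. bind_pmf (run R t c) (run R t'))" by blast
  then show ?case by (simp add: bind_assoc_pmf)
qed (simp add: bind_return_pmf)

lemma prob_bind_mono:
  assumes "\<And>x. x \<in> set_pmf p ==> f x \<le> measure_pmf.prob (q x) X" "\<And>x. 0 \<le> f x" "\<And>x. f x \<le> 1"
  shows "measure_pmf.expectation p f \<le> measure_pmf.prob (bind_pmf p q) X"
  unfolding measure_bind_pmf
  by (rule integral_mono_AE) (use assms in \<open>auto intro!: measure_pmf.integrable_const_bound[where B = 1] AE_pmfI simp: abs_le_iff\<close>)

text \<open>A won configuration has halted and stays as it is.\<close>

lemma prob_run_mono: "t \<le> t' ==> measure_pmf.prob (run R t c) {c. won G c} \<le> measure_pmf.prob (run R t' c) {c. won G c}"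
proof -
  assume "t \<le> t'"
  then have e: "run R t' c = bind_pmf (run R t c) (run R (t' - t))" using run_add[of R t "t' - t" c] by simp
  have "measure_pmf.expectation (run R t c) (indicator {c. won G c}) \<le> measure_pmf.prob (bind_pmf (run R t c) (run R (t' - t))) {c. won G c}"
    by (rule prob_bind_mono) (auto simp: indicator_def won_def run_halted)
  then show ?thesis unfolding e by simp
qed

lemma play_halted:
  assumes "\<And>c. c \<in> set_pmf (play G A t) ==> halted_by t c" "t \<le> t'"
  shows "play G A t' = play G A t"
proof -
  have "run (game.respond G) t' (init_config A (input G) s) = run (game.respond G) t (init_config A (input G) s)"
    if "s \<in> set_pmf (start G)" for s
  proof -
    let ?c = "init_config A (input G) s"
    have "run (game.respond G) t' ?c = bind_pmf (run (game.respond G) t ?c) (run (game.respond G) (t' - t))"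
      using run_add[of "game.respond G" t "t' - t" ?c] assms(2) by simp
    also have "\<dots> = bind_pmf (run (game.respond G) t ?c) return_pmf"
      by (rule bind_pmf_cong[OF refl], rule run_halted)
        (use assms(1) that in \<open>force simp: play_def halted_by_def\<close>)
    finally show ?thesis by (simp add: bind_return_pmf')
  qed
  then show ?thesis unfolding play_def by (intro bind_pmf_cong refl)
qed

text \<open>Once all runs have halted, the supremum over the number of steps is attained.\<close>

lemma win_prob_le:
  assumes "\<And>c. c \<in> set_pmf (play G A t) ==> halted_by t c"
  shows "win_prob G A \<le> measure_pmf.prob (play G A t) {c. won G c}"
  unfolding win_prob_def
proof (rule cSUP_least)
  fix t'
  show "measure_pmf.prob (play G A t') {c. won G c} \<le> measure_pmf.prob (play G A t) {c. won G c}"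
  proof (cases "t \<le> t'")
    case True
    then show ?thesis using play_halted[OF assms True] by simp
  next
    case False
    have "measure_pmf.expectation (start G) (\<lambda>s. measure_pmf.prob (run (game.respond G) t' (init_config A (input G) s)) {c. won G c})
      \<le> measure_pmf.prob (play G A t) {c. won G c}"
      unfolding play_def by (rule prob_bind_mono) (use False in \<open>auto intro: prob_run_mono\<close>)
    then show ?thesis by (simp add: play_def measure_bind_pmf)
  qed
qed simp

lemma win_prob_ge: "measure_pmf.prob (play G A t) {c. won G c} \<le> win_prob G A"
  unfolding win_prob_def by (rule cSUP_upper) (auto intro!: bdd_aboveI[of _ 1])

lemma hyb_enc_0_dec:
  assumes "symmetric_encryption E" "key \<in> set_pmf (gen E k)" "cs \<in> set_pmf (hyb_enc (enc E k key) 0 i ms)" "(c, x) \<in> set (zipd cs ms)"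
  shows "dec E k key c = Some x"
proof -
  have "list_all2 (\<lambda>c p. c \<in> set_pmf p) cs (map (\<lambda>q. enc E k key (nthd [] ms q)) [0..<length ms])"
    using assms(3) by (simp add: hyb_enc_def set_seq_pmf)
  then have "c \<in> set_pmf (enc E k key x)"
    using assms(4) by (auto simp: list_all2_conv_all_nth zipd_def nthd_eq)
  then show ?thesis using assms(1,2) by (auto simp: symmetric_encryption_def)
qed

text \<open>Equal times are recorded because the adversary's time bound in the game has to be
  carried over to the hybrid. The correctness of the table is what \<open>shuffle_respond_eq\<close>
  asks for.\<close>

definition match :: "scheme => nat => data => bool => (data \<times> bool \<times> bool) config => gst config => bool" where
  "match E k key b c c' \<longleftrightarrow> fst c = fst c' \<and> fst (snd c) = fst (snd c') \<and> cfg_time c = cfg_time c' \<and>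
     (case fst (snd (snd c')) of None => fst (snd (snd c)) = None \<and> fst c = []
      | Some g => fst (snd (snd c)) = Some (key, b, snd (snd g)) \<and> (\<forall>(x, y) \<in> set (fst (snd g)). dec E k key x = Some y))"

definition dead :: "gst config => bool" where "dead c \<longleftrightarrow> fst c = [] \<and> fst (snd (snd c)) = None"

locale shuffle_game = encryption +
  fixes k :: nat and key :: data and b :: bool and s m w n :: nat and p :: real
  assumes key: "key \<in> set_pmf (gen E k)" and n: "n = s * s" and m: "m = batch_size p n"
begin

abbreviation "R \<equiv> shuffle_respond E n w k (melbourne_shuffle E p n w k)"
abbreviation "H \<equiv> (\<lambda>g d. hyb_respond (enc E k key) (dec E k key) 0 s m w (key_width n) b d g)"
abbreviation "ma \<equiv> match E k key b"

text \<open>Both answers are drawn from the same permutation and the same ciphertexts. They part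
  only if the plan overflows, which has probability at most \<open>fail_bound p n\<close>; the
  hybrid then dies, while the game continues after a failure.\<close>

lemma couple_query:
  assumes tab: "\<forall>(x, y) \<in> set tab. dec E k key x = Some y"
    and c: "c = (Query x e # cs, \<sigma>, Some (key, b, ch), u)" and c': "c' = (Query x e # cs, \<sigma>, Some (i, tab, ch), u)"
  shows "\<exists>J. map_pmf fst J = step R c \<and> map_pmf snd J = step H c' \<and>
    (\<forall>y \<in> set_pmf J. ma (fst y) (snd y) \<or> dead (snd y) \<and> cfg_time (snd y) \<le> cfg_time (fst y)) \<and>
    measure_pmf.prob J {y. \<not> ma (fst y) (snd y)} \<le> fail_bound p n"
proof -
  let ?d = "denote \<sigma> e"
  let ?t = "u + 1 + size ?d"
  define K :: "(data \<times> data \<times> bool \<times> bool) option => (data \<times> bool \<times> bool) config" where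
    "K r = (case r of None => ([], \<sigma>, None, ?t) | Some (a, s') => (cs, \<sigma>(x := a), Some s', ?t + size a))" for r
  define K' :: "(data \<times> gst) option => gst config" where
    "K' r = (case r of None => ([], \<sigma>, None, ?t) | Some (a, s') => (cs, \<sigma>(x := a), Some s', ?t + size a))" for r
  let ?job = "job (dec E k key) n w (key_width n) b ?d (i, tab, ch)"
  have st: "step R c = map_pmf K (R (key, b, ch) ?d)" "step H c' = map_pmf K' (H (i, tab, ch) ?d)"
    unfolding c c' step.simps Let_def K_def[abs_def] K'_def[abs_def] by (rule refl)+
  obtain \<kappa> where R: "R (key, b, ch) ?d = (case ?job of None => return_pmf None
     | Some J => bind_pmf (pmf_of_set {\<sigma>. \<sigma> permutes {1..n}}) (\<lambda>\<rho>.
         case plan s m w \<rho> (perm_fun (fst (snd (snd (snd J))))) (fst (snd (snd J))) of None => \<kappa> \<rho>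
       | Some pl => map_pmf (cont s m i tab (key, b) J pl)
           (hyb_enc (enc E k key) 0 i (plaintexts (key_width n) (fst J) (fst (snd (snd J))) pl))))"
    using shuffle_respond_eq[OF key n m, of tab w b ch ?d i] tab by blast
  have f0: "0 \<le> fail_bound p n" by (rule fail_bound_nonneg)
  show ?thesis
  proof (cases ?job)
    case None
    then have "hyb_respond (enc E k key) (dec E k key) 0 s m w (key_width n) b ?d (i, tab, ch) = return_pmf None"
      by (simp add: hyb_respond_def n)
    then show ?thesis unfolding st R None using f0
      by (intro exI[of _ "return_pmf (K None, K' None)"]) (simp add: K_def K'_def match_def)
  next
    case (Some J)
    obtain pre C A ps ch' where J: "J = (pre, C, A, ps, ch')" by (cases J)
    note js = job_Some[OF Some[unfolded J]]
    let ?Q = "pmf_of_set {\<sigma>. \<sigma> permutes {1..n}}"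
    let ?pl = "\<lambda>\<rho>. plan s m w \<rho> (perm_fun ps) A"
    let ?ms = "plaintexts (key_width n) pre A"
    let ?e = "\<lambda>pl. hyb_enc (enc E k key) 0 i (?ms pl)"
    let ?a = "\<lambda>pl cs. cont s m i tab (key, b) J pl cs" and ?a' = "\<lambda>pl cs. Some (reply s m pre C i tab ch' (?ms pl) cs)"
    have R': "R (key, b, ch) ?d = bind_pmf ?Q (\<lambda>\<rho>. case ?pl \<rho> of None => \<kappa> \<rho> | Some pl => map_pmf (?a pl) (?e pl))"
      by (simp only: R Some J option.case fst_conv snd_conv)
    have H': "H (i, tab, ch) ?d = bind_pmf ?Q (\<lambda>\<rho>. case ?pl \<rho> of None => return_pmf None | Some pl => map_pmf (?a' pl) (?e pl))"
      using Some by (simp only: hyb_respond_def hyb_shuffle_def J n[symmetric] option.case prod.case fst_conv snd_conv)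
    \<comment> \<open>The coupling, given the permutation: equal ciphertexts if there is a plan,
      otherwise an arbitrary failing answer of the game next to a dead hybrid.\<close>
    let ?F = "\<lambda>\<rho>. case ?pl \<rho> of None => map_pmf (\<lambda>r. (K r, K' None)) (\<kappa> \<rho>) | Some pl => map_pmf (\<lambda>cs. (K (?a pl cs), K' (?a' pl cs))) (?e pl)"
    have good: "ma (K (?a pl cs)) (K' (?a' pl cs))" if "cs \<in> set_pmf (?e pl)" for pl cs
      using tab hyb_enc_0_dec[OF sym key that]
      by (auto simp: match_def K_def K'_def cont_def J reply_def n)
    have bad: "dead (K' None) \<and> cfg_time (K' None) \<le> cfg_time (K r)" for r
      by (auto simp: dead_def K_def K'_def split: option.splits prod.splits)
    have pr: "measure_pmf.prob (bind_pmf ?Q ?F) {y. \<not> ma (fst y) (snd y)} \<le> fail_bound p n"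
    proof -
      have "measure_pmf.prob (bind_pmf ?Q ?F) {y. \<not> ma (fst y) (snd y)} = (\<integral>\<rho>. measure_pmf.prob (?F \<rho>) {y. \<not> ma (fst y) (snd y)} \<partial>?Q)"
        by (rule measure_bind_pmf)
      also have "\<dots> \<le> (\<integral>\<rho>. indicator {\<sigma>. ?pl \<sigma> = None} \<rho> \<partial>?Q)"
      proof (rule integral_mono)
        show "measure_pmf.prob (?F \<rho>) {y. \<not> ma (fst y) (snd y)} \<le> indicator {\<sigma>. ?pl \<sigma> = None} \<rho>" for \<rho>
        proof (cases "?pl \<rho>")
          case (Some pl)
          have "measure_pmf.prob (?F \<rho>) {y. \<not> ma (fst y) (snd y)} = 0"
            unfolding Some option.case by (subst measure_pmf_zero_iff) (use good in auto)
          then show ?thesis by simp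
        qed simp
      qed (auto intro!: measure_pmf.integrable_const_bound[where B = 1] AE_pmfI)
      also have "\<dots> = measure_pmf.prob ?Q {\<sigma>. ?pl \<sigma> = None}" by simp
      also have "\<dots> \<le> fail_bound p n" unfolding fail_bound_def m by (rule prob_plan_None[OF n js(1,2)])
      finally show ?thesis .
    qed
    show ?thesis
    proof (intro exI[of _ "bind_pmf ?Q ?F"] conjI ballI pr)
      show "map_pmf fst (bind_pmf ?Q ?F) = step R c" unfolding st R' map_bind_pmf
      proof (rule bind_pmf_cong[OF refl])
        fix \<rho> show "map_pmf fst (?F \<rho>) = map_pmf K (case ?pl \<rho> of None => \<kappa> \<rho> | Some pl => map_pmf (?a pl) (?e pl))"
          by (cases "?pl \<rho>") (simp_all only: option.case pmf.map_comp o_def fst_conv)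
      qed
      show "map_pmf snd (bind_pmf ?Q ?F) = step H c'" unfolding st H' map_bind_pmf
      proof (rule bind_pmf_cong[OF refl])
        fix \<rho> show "map_pmf snd (?F \<rho>) = map_pmf K' (case ?pl \<rho> of None => return_pmf None | Some pl => map_pmf (?a' pl) (?e pl))"
          by (cases "?pl \<rho>") (simp_all add: pmf.map_comp o_def)
      qed
      fix y assume "y \<in> set_pmf (bind_pmf ?Q ?F)"
      then obtain \<rho> where "y \<in> set_pmf (?F \<rho>)" by auto
      then show "ma (fst y) (snd y) \<or> dead (snd y) \<and> cfg_time (snd y) \<le> cfg_time (fst y)"
        using good bad by (cases "?pl \<rho>") auto
    qed
  qed
qed

lemma couple_step:
  assumes "ma c c'"
  shows "\<exists>J. map_pmf fst J = step R c \<and> map_pmf snd J = step H c' \<and>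
    (\<forall>y \<in> set_pmf J. ma (fst y) (snd y) \<or> dead (snd y) \<and> cfg_time (snd y) \<le> cfg_time (fst y)) \<and>
    measure_pmf.prob J {y. \<not> ma (fst y) (snd y)} \<le> fail_bound p n"
proof -
  have one: ?thesis if "step R c = map_pmf f q" "step H c' = map_pmf f' q" "\<And>x. x \<in> set_pmf q ==> ma (f x) (f' x)" for f f' and q :: "data pmf"
  proof (rule exI[of _ "map_pmf (\<lambda>x. (f x, f' x)) q"], intro conjI ballI)
    have "measure_pmf.prob (map_pmf (\<lambda>x. (f x, f' x)) q) {y. \<not> ma (fst y) (snd y)} = 0"
      by (subst measure_pmf_zero_iff) (use that(3) in auto)
    then show "measure_pmf.prob (map_pmf (\<lambda>x. (f x, f' x)) q) {y. \<not> ma (fst y) (snd y)} \<le> fail_bound p n"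
      by (simp add: fail_bound_nonneg)
  qed (use that in \<open>auto simp: pmf.map_comp o_def\<close>)
  have ret: ?thesis if "step R c = return_pmf d" "step H c' = return_pmf d'" "ma d d'" for d d'
    by (rule one[of "\<lambda>_. d" "return_pmf Leaf" "\<lambda>_. d'"]) (use that in simp_all)
  obtain cs \<sigma> st u where c: "c = (cs, \<sigma>, st, u)" by (cases c)
  obtain st' where c': "c' = (cs, \<sigma>, st', u)" using assms by (cases c') (auto simp: c match_def)
  show ?thesis
  proof (cases cs)
    case Nil
    then show ?thesis using ret[of c c'] assms by (simp add: c c')
  next
    case (Cons c1 cs1)
    then obtain i tab ch where s': "st' = Some (i, tab, ch)" "st = Some (key, b, ch)" "\<forall>(x, y) \<in> set tab. dec E k key x = Some y"
      using assms by (cases st') (auto simp: c c' match_def)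
    show ?thesis
    proof (cases c1)
      case (Query x e)
      show ?thesis by (rule couple_query[OF s'(3)]) (simp_all add: c c' Cons s' Query)
    next
      case (Sample x e)
      show ?thesis
        by (rule one[of "\<lambda>d. (cs1, \<sigma>(x := d), st, u + 1 + size d)" "pick (data_list (denote \<sigma> e))"
            "\<lambda>d. (cs1, \<sigma>(x := d), st', u + 1 + size d)"]) (use s' in \<open>auto simp: c c' Cons Sample match_def\<close>)
    qed (rule ret, simp add: c Cons Let_def, simp add: c' Cons Let_def, use s' in \<open>simp add: match_def\<close>)+
  qed
qed

definition won' :: "gst config => bool" where
  "won' = (\<lambda>(cs, \<sigma>, g, u). cs = [] \<and> g \<noteq> None \<and> data_bit (\<sigma> 0) = b)"

abbreviation "G \<equiv> shuffle_ind_game E n w k (melbourne_shuffle E p n w k)"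

lemma won_match: "ma c c' ==> won G c ==> won' c'"
  by (auto simp: match_def won_def won'_def shuffle_ind_game_def split: option.splits)

text \<open>Each step loses at most one failure probability. The second claim transfers the time
  bound: a hybrid run keeps pace with some run of the game or dies earlier, so the size limit does
  not cut off the interpreted adversary.\<close>

lemma run_compare:
  assumes "ma c c'"
  shows "measure_pmf.prob (run R t c) {c. won G c} \<le> measure_pmf.prob (run H t c') {c. won' c} + real t * fail_bound p n \<and>
    (\<forall>x' \<in> set_pmf (run H t c'). \<exists>x \<in> set_pmf (run R t c). cfg_time x' \<le> cfg_time x)"
  using assms
proof (induction t arbitrary: c c')
  case 0
  then show ?case using won_match[OF 0] by (auto simp: match_def indicator_def)
next
  case (Suc t)
  let ?f = "fail_bound p n"
  obtain J where J: "map_pmf fst J = step R c" "map_pmf snd J = step H c'"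
    "\<And>y. y \<in> set_pmf J ==> ma (fst y) (snd y) \<or> dead (snd y) \<and> cfg_time (snd y) \<le> cfg_time (fst y)"
    "measure_pmf.prob J {y. \<not> ma (fst y) (snd y)} \<le> ?f"
    using couple_step[OF Suc.prems] by blast
  have rR: "run R (Suc t) c = bind_pmf J (\<lambda>y. run R t (fst y))" by (simp add: bind_map_pmf flip: J(1))
  have rH: "run H (Suc t) c' = bind_pmf J (\<lambda>y. run H t (snd y))" by (simp add: bind_map_pmf flip: J(2))
  note int = measure_pmf.integrable_const_bound[where B = 1]
  have "measure_pmf.prob (run R (Suc t) c) {c. won G c} = (\<integral>y. measure_pmf.prob (run R t (fst y)) {c. won G c} \<partial>J)"
    unfolding rR by (rule measure_bind_pmf)
  \<comment> \<open>Where the coupling breaks, the winning probability of the game is bounded by 1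
    and charged to the indicator.\<close>
  also have "\<dots> \<le> (\<integral>y. (measure_pmf.prob (run H t (snd y)) {c. won' c} + real t * ?f) + indicator {y. \<not> ma (fst y) (snd y)} y \<partial>J)"
  proof (rule integral_mono)
    fix y show "measure_pmf.prob (run R t (fst y)) {c. won G c} \<le>
      (measure_pmf.prob (run H t (snd y)) {c. won' c} + real t * ?f) + indicator {y. \<not> ma (fst y) (snd y)} y"
    proof (cases "ma (fst y) (snd y)")
      case True
      then show ?thesis using Suc.IH[OF True] by simp
    next
      case False
      have "measure_pmf.prob (run R t (fst y)) {c. won G c} \<le> 1" by simp
      also have "\<dots> \<le> (measure_pmf.prob (run H t (snd y)) {c. won' c} + real t * ?f) + indicator {y. \<not> ma (fst y) (snd y)} y"
        using False fail_bound_nonneg[of p n] by simp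
      finally show ?thesis .
    qed
  qed (auto intro!: int AE_pmfI Bochner_Integration.integrable_add)
  also have "\<dots> = (\<integral>y. measure_pmf.prob (run H t (snd y)) {c. won' c} \<partial>J) + real t * ?f + measure_pmf.prob J {y. \<not> ma (fst y) (snd y)}"
    by (subst Bochner_Integration.integral_add, (auto intro!: int AE_pmfI Bochner_Integration.integrable_add)[2])
      (subst Bochner_Integration.integral_add, auto intro!: int AE_pmfI)
  also have "(\<integral>y. measure_pmf.prob (run H t (snd y)) {c. won' c} \<partial>J) = measure_pmf.prob (run H (Suc t) c') {c. won' c}"
    unfolding rH by (rule measure_bind_pmf[symmetric])
  finally have 1: "measure_pmf.prob (run R (Suc t) c) {c. won G c} \<le> measure_pmf.prob (run H (Suc t) c') {c. won' c} + real (Suc t) * ?f"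
    using J(4) by (simp add: algebra_simps)
  have 2: "\<exists>x \<in> set_pmf (run R (Suc t) c). cfg_time x' \<le> cfg_time x" if x': "x' \<in> set_pmf (run H (Suc t) c')" for x'
  proof -
    obtain y where y: "y \<in> set_pmf J" "x' \<in> set_pmf (run H t (snd y))" using x' unfolding rH by auto
    have "\<exists>x \<in> set_pmf (run R t (fst y)). cfg_time x' \<le> cfg_time x"
    proof (cases "ma (fst y) (snd y)")
      case True
      then show ?thesis using Suc.IH y(2) by blast
    next
      case False
      then have d: "fst (snd y) = []" "cfg_time (snd y) \<le> cfg_time (fst y)" using J(3)[OF y(1)] by (auto simp: dead_def)
      obtain x where x: "x \<in> set_pmf (run R t (fst y))" using set_pmf_not_empty by fast
      have "x' = snd y" using y(2) run_halted[OF d(1)] by simp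
      then show ?thesis using x d(2) run_time[OF x] by (intro bexI[OF _ x]) simp
    qed
    then show ?thesis using y(1) unfolding rR by auto
  qed
  show ?case using 1 2 by blast
qed

lemma real_run_le_hyb_play:
  assumes halt: "\<And>c. c \<in> set_pmf (run R B (init_config A (list_data [num_data k, num_data n, num_data w]) (key, b, False))) ==> halted_by B c"
  shows "measure_pmf.prob (run R B (init_config A (list_data [num_data k, num_data n, num_data w]) (key, b, False))) {c. won G c} \<le>
    pmf (hyb_play A (enc E k key) (dec E k key) 0 s m w (key_width n) b B k) True + real B * fail_bound p n"
proof -
  let ?\<sigma> = "(\<lambda>_. Leaf)(0 := list_data [num_data k, num_data n, num_data w])"
  let ?c = "init_config A (list_data [num_data k, num_data n, num_data w]) (key, b, False)"
  let ?c' = "([A], ?\<sigma>, Some (0, [], False), 0) :: gst config"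
  have ma: "ma ?c ?c'" by (simp add: match_def init_config_def)
  note rc = run_compare[OF ma, of B]
  let ?V = "Suc (cvars A)"
  \<comment> \<open>The interpreter's list of variables is the initial store of the machine, cut off
    above the variables of \<open>A\<close>.\<close>
  have init: "list_data [num_data k, num_data n, num_data w] # replicate (cvars A) Leaf = map ?\<sigma> [0..<?V]"
    by (rule nth_equalityI) (auto simp: nth_Cons simp del: upt_Suc list_data.simps split: nat.splits)
  have "interp (subs A) B (\<lambda>d g. lift (hyb_respond (enc E k key) (dec E k key) 0 s m w (key_width n) b d g)) B ([A], map ?\<sigma> [0..<?V], Some (0, [], False)) =
     (lift (map_pmf (proj ?V) (run H B ?c')) :: (world, _) M)"
  proof (rule interp_run)
    fix x' assume "x' \<in> set_pmf (run H B ?c')"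
    then obtain x where "x \<in> set_pmf (run R B ?c)" "cfg_time x' \<le> cfg_time x" using rc by blast
    then show "cfg_time x' \<le> B" using halt[of x] by (cases x) (auto simp: halted_by_def)
  qed (auto simp: subs_self)
  then have e: "hyb_interp A (enc E k key) (dec E k key) 0 s m w (key_width n) b B k = map_pmf (proj ?V) (run H B ?c')"
    unfolding hyb_interp_def n[symmetric] init by simp
  have "pmf (hyb_play A (enc E k key) (dec E k key) 0 s m w (key_width n) b B k) True = measure_pmf.prob (run H B ?c') {c. won' c}"
  proof -
    have "won_by b (proj ?V c) = won' c" for c
      by (cases c) (simp add: won_by_def proj_def won'_def nthd_map del: upt_Suc)
    then have "(won_by b \<circ> proj ?V) -` {True} = {c. won' c}" by auto
    then show ?thesis unfolding hyb_play_def e pmf.map_comp pmf_map by (simp only:)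
  qed
  then show ?thesis using rc by simp
qed

end

section \<open>The reduction\<close>

lemma negligible_mono:
  assumes "negligible \<nu>" "\<And>k. \<bar>\<mu> k\<bar> \<le> \<bar>\<nu> k\<bar>"
  shows "negligible \<mu>"
  unfolding negligible_def
proof
  fix c show "\<forall>\<^sub>F k in sequentially. \<bar>\<mu> k\<bar> < 1 / real k ^ c"
    using assms(1)[unfolded negligible_def, rule_format, of c] by eventually_elim (use assms(2) le_less_trans in blast)
qed

lemma poly_le_power: "\<exists>d. \<forall>\<^sub>F k in sequentially. poly (q :: nat poly) k \<le> k ^ d"
proof (induction q)
  case (pCons a q)
  then obtain d where d: "\<forall>\<^sub>F k in sequentially. poly q k \<le> k ^ d" by blast
  have "\<forall>\<^sub>F k in sequentially. poly (pCons a q) k \<le> k ^ (d + 2)"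
    using d eventually_ge_at_top[of "a + 2"]
  proof eventually_elim
    case (elim k)
    have k1: "k * 1 \<le> k * k ^ d" using elim(2) by (intro mult_le_mono) auto
    have "a \<le> k * k ^ d" using elim(2) k1 by linarith
    from add_mono[OF this mult_le_mono2[OF elim(1), of k]]
    have "poly (pCons a q) k \<le> k * k ^ d + k * k ^ d" by (simp only: poly_pCons of_nat_id)
    also have "\<dots> = 2 * (k * k ^ d)" by simp
    also have "\<dots> \<le> k * (k * k ^ d)" using elim(2) by (intro mult_le_mono1) simp
    finally show ?case by (simp add: power_add power2_eq_square algebra_simps)
  qed
  then show ?case by blast
qed (auto intro: exI[of _ 0])

lemma negligible_poly_mult:
  assumes "negligible \<nu>"
  shows "negligible (\<lambda>k. real (poly q k) * \<nu> k)"
  unfolding negligible_def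
proof
  fix c
  obtain d where d: "\<forall>\<^sub>F k in sequentially. poly q k \<le> k ^ d" using poly_le_power by blast
  show "\<forall>\<^sub>F k in sequentially. \<bar>real (poly q k) * \<nu> k\<bar> < 1 / real k ^ c"
    using d assms[unfolded negligible_def, rule_format, of "c + d"] eventually_gt_at_top[of 0]
  proof eventually_elim
    case (elim k)
    have "real (poly q k) \<le> real k ^ d" using elim(1) by (metis of_nat_le_iff of_nat_power)
    then have "\<bar>real (poly q k) * \<nu> k\<bar> \<le> real k ^ d * \<bar>\<nu> k\<bar>" by (simp add: abs_mult mult_right_mono)
    also have "\<dots> < real k ^ d * (1 / real k ^ (c + d))" using elim by (intro mult_strict_left_mono) auto
    also have "\<dots> = 1 / real k ^ c" using elim(3) by (simp add: power_add)
    finally show ?case .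
  qed
qed

lemma negligible_add:
  assumes "negligible \<mu>" "negligible \<nu>"
  shows "negligible (\<lambda>k. \<mu> k + \<nu> k)"
  unfolding negligible_def
proof
  fix c
  show "\<forall>\<^sub>F k in sequentially. \<bar>\<mu> k + \<nu> k\<bar> < 1 / real k ^ c"
    using assms(1)[unfolded negligible_def, rule_format, of "Suc c"] assms(2)[unfolded negligible_def, rule_format, of "Suc c"]
      eventually_ge_at_top[of 2]
  proof eventually_elim
    case (elim k)
    have "2 * (1 / real k ^ Suc c) \<le> real k * (1 / real k ^ Suc c)" using elim(3) by (intro mult_right_mono) auto
    also have "\<dots> = 1 / real k ^ c" using elim(3) by simp
    finally show ?case using elim(1,2) abs_triangle_ineq[of "\<mu> k" "\<nu> k"] by linarith
  qed
qed

lemma negligible_sqrt: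
  assumes "negligible \<nu>"
  shows "negligible (\<lambda>k. sqrt \<bar>\<nu> k\<bar>)"
  unfolding negligible_def
proof
  fix c
  show "\<forall>\<^sub>F k in sequentially. \<bar>sqrt \<bar>\<nu> k\<bar>\<bar> < 1 / real k ^ c"
    using assms[unfolded negligible_def, rule_format, of "2 * c"]
  proof eventually_elim
    case (elim k)
    have "sqrt \<bar>\<nu> k\<bar> < sqrt (1 / real k ^ (2 * c))" using elim by simp
    also have "1 / real k ^ (2 * c) = (1 / real k ^ c)\<^sup>2" by (simp add: power_mult[symmetric] power_divide mult.commute)
    also have "sqrt \<dots> = 1 / real k ^ c" by simp
    finally show ?case by simp
  qed
qed

text \<open>As \<open>k \<le> poly q (N k)\<close> and \<open>poly q\<close> is monotone,
  \<open>N k\<close> eventually exceeds every bound, and then \<open>k\<close> is at most a fixed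
  power of \<open>N k\<close>; so every power of \<open>k\<close> is dominated by a power of
  \<open>N k\<close>.\<close>

lemma negligible_comp:
  assumes "negligible \<mu>" "poly_related N"
  shows "negligible (\<lambda>k. \<mu> (N k))"
  unfolding negligible_def
proof
  fix c
  obtain q :: "nat poly" where q: "\<And>k. k \<le> poly q (N k)" using assms(2) by (auto simp: poly_related_def)
  obtain d where d: "\<forall>\<^sub>F x in sequentially. poly q x \<le> x ^ d" using poly_le_power by blast
  have "\<forall>\<^sub>F x in sequentially. poly q x \<le> x ^ d \<and> \<bar>\<mu> x\<bar> < 1 / real x ^ (d * c)"
    using d assms(1)[unfolded negligible_def, rule_format, of "d * c"] by eventually_elim blast
  then obtain X where X: "\<And>x. x \<ge> X ==> poly q x \<le> x ^ d \<and> \<bar>\<mu> x\<bar> < 1 / real x ^ (d * c)"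
    by (auto simp: eventually_sequentially)
  show "\<forall>\<^sub>F k in sequentially. \<bar>\<mu> (N k)\<bar> < 1 / real k ^ c"
    using eventually_gt_at_top[of "poly q X"]
  proof eventually_elim
    case (elim k)
    have "X \<le> N k"
    proof (rule ccontr)
      assume "\<not> X \<le> N k"
      then have "poly q (N k) \<le> poly q X" by (intro poly_nat_mono) simp
      then show False using q[of k] elim by simp
    qed
    from X[OF this] have x: "poly q (N k) \<le> N k ^ d" "\<bar>\<mu> (N k)\<bar> < 1 / real (N k) ^ (d * c)" by auto
    have "k ^ c \<le> (N k ^ d) ^ c" using q[of k] x(1) by (intro power_mono) auto
    then have "k ^ c \<le> N k ^ (d * c)" by (simp only: power_mult)
    then have "real k ^ c \<le> real (N k) ^ (d * c)" by (simp only: of_nat_power[symmetric] of_nat_le_iff)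
    moreover have "0 < real k ^ c" using elim by simp
    ultimately have "1 / real (N k) ^ (d * c) \<le> 1 / real k ^ c" by (intro frac_le) auto
    then show ?case using x(2) by linarith
  qed
qed

section \<open>From polynomial-time functions to adversaries\<close>

definition emb :: "nat => (data \<times> bool \<times> data list option) config => world config" where
  "emb k c = (fst c, fst (snd c), map_option (Pair k) (fst (snd (snd c))), cfg_time c)"

lemma step_world: "step (world_env E) (emb k c) = map_pmf (emb k) (step (enc_respond E k) c)"
proof -
  obtain cs \<sigma> s u where c: "c = (cs, \<sigma>, s, u)" by (cases c)
  show ?thesis
  proof (cases cs)
    case (Cons c1 cs1)
    show ?thesis
    proof (cases c1)
      case (Query x e)
      show ?thesis
        by (cases s) (simp_all add: c Cons Query emb_def world_env_def Let_def pmf.map_comp o_def del: enc_respond.simps,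
          intro map_pmf_cong refl, auto split: option.splits)
    qed (simp_all add: c Cons emb_def Let_def pmf.map_comp o_def)
  qed (simp add: c emb_def)
qed

lemma run_world: "run (world_env E) t (emb k c) = map_pmf (emb k) (run (enc_respond E k) t c)"
proof (induction t arbitrary: c)
  case (Suc t)
  show ?case unfolding run.simps step_world bind_map_pmf map_bind_pmf by (intro bind_pmf_cong refl Suc)
qed simp

text \<open>The oracle never changes its bit, so the bit judged at the end is the one drawn at the
  start.\<close>

lemma step_bit:
  assumes "c' \<in> set_pmf (step (enc_respond E k) c)" "\<And>s. fst (snd (snd c)) = Some s ==> fst (snd s) = b"
    and "fst (snd (snd c')) = Some s'"
  shows "fst (snd s') = b"
proof -
  obtain cs \<sigma> s u where c: "c = (cs, \<sigma>, s, u)" by (cases c)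
  have q: "fst (snd s1) = fst (snd s0)" if "Some (a, s1) \<in> set_pmf (enc_respond E k s0 d)" for a s0 s1 d
    using that by (cases s0) (auto split: enc_query.splits if_splits)
  show ?thesis
  proof (cases cs)
    case (Cons c1 cs1)
    show ?thesis
    proof (cases c1)
      case (Query x e)
      show ?thesis
      proof (cases s)
        case None
        then show ?thesis using assms c Cons Query by simp
      next
        case (Some s0)
        then obtain r where r: "r \<in> set_pmf (enc_respond E k s0 (denote \<sigma> e))"
          "c' = (case r of None => ([], \<sigma>, None, u + 1 + size (denote \<sigma> e))
            | Some (a, s') => (cs1, \<sigma>(x := a), Some s', u + 1 + size (denote \<sigma> e) + size a))"
          using assms(1) unfolding c Cons Query Some step.simps Let_def set_map_pmf by blast
        obtain a s1 where "r = Some (a, s1)" using r(2) assms(3) by (cases r) auto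
        then show ?thesis using r assms(2,3) q[of a s1 s0 "denote \<sigma> e"] Some c by simp
      qed
    qed (use assms(1,3) assms(2)[of s'] c Cons in \<open>auto simp: Let_def\<close>)
  qed (use assms(1,3) assms(2)[of s'] c in auto)
qed

lemma run_bit:
  assumes "c' \<in> set_pmf (run (enc_respond E k) t c)" "\<And>s. fst (snd (snd c)) = Some s ==> fst (snd s) = b"
    and "fst (snd (snd c')) = Some s'"
  shows "fst (snd s') = b"
  using assms
proof (induction t arbitrary: c)
  case (Suc t)
  then obtain c1 where c1: "c1 \<in> set_pmf (step (enc_respond E k) c)" "c' \<in> set_pmf (run (enc_respond E k) t c1)" by auto
  show ?case by (rule Suc.IH[OF c1(2) step_bit[OF c1(1) Suc.prems(2)] Suc.prems(3)])
qed simp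

context encryption begin

text \<open>Turns a function that is known to have some program into an adversary. \<open>F\<close>
  is the distribution of its answer under the given key and bit; that it is free of aborts means
  that the adversary makes no illegal move.\<close>

lemma ptm_adversary:
  fixes f :: "nat => (world, bool) M"
  assumes f: "wptm f"
    and F: "\<And>k key \<beta>. key \<in> set_pmf (gen E k) ==> map_pmf (map_option fst) (f k (k, key, \<beta>, None)) = map_pmf Some (F k key \<beta>)"
  shows "\<exists>c. ppt (enc_ind_game E) c \<and> (\<forall>k. pmf (bind_pmf (gen E k) (\<lambda>key. bind_pmf (pmf_of_set UNIV)
      (\<lambda>\<beta>. map_pmf (\<lambda>x. x = \<beta>) (F k key \<beta>)))) True \<le> win_prob (enc_ind_game E k) c)"
proof -
  obtain rb where "machine (world_env E) fst (worlds E) rb" using machine_world by blast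
  then interpret machine "world_env E" fst "worlds E" rb .
  obtain c g where g: "pmono g" "\<And>w \<sigma> a. w \<in> worlds E ==> \<sigma> 0 = code a ==> spec 0 c \<sigma> w (g (fst w + sz a)) (f a w)"
    by (rule ptmE[OF f, where v = 0]) blast
  \<comment> \<open>The input is \<open>k\<close> in unary and the parameter of the environment is
    \<open>k\<close> as well, so each contributes \<open>k\<close>.\<close>
  have "pmono (\<lambda>k. g (k + k))" by (intro pmono_comp[OF g(1)] pmono_intros)
  then obtain q :: "nat poly" where q: "\<And>k. g (k + k) \<le> poly q k" using pmono_poly_bound by blast
  let ?G = "enc_ind_game E"
  let ?c = "\<lambda>k key \<beta>. init_config c (num_data k) (key, \<beta>, None) :: (data \<times> bool \<times> data list option) config"
  have main: "(\<forall>x \<in> set_pmf (run (enc_respond E k) (poly q k) (?c k key \<beta>)). halted_by (poly q k) x) \<and>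
     map_pmf (won (?G k)) (run (enc_respond E k) (poly q k) (?c k key \<beta>)) = map_pmf (\<lambda>x. x = \<beta>) (F k key \<beta>)"
    if key: "key \<in> set_pmf (gen E k)" for k key \<beta>
  proof -
    let ?\<sigma> = "(\<lambda>_. Leaf)(0 := num_data k)" and ?w = "(k, key, \<beta>, None) :: world" and ?run = "run (enc_respond E k) (poly q k) (?c k key \<beta>)"
    have "spec 0 c ?\<sigma> ?w (g (k + k)) (f k ?w)"
      using g(2)[of ?w ?\<sigma> k] key by (simp add: worlds_def code_nat_num)
    then obtain \<nu> where \<nu>: "exl (world_env E) [c] ?\<sigma> ?w (g (k + k)) \<nu>"
      "map_pmf (map_option (\<lambda>(\<sigma>', w'). (\<sigma>' 0, w'))) \<nu> = map_pmf (map_option (map_prod code id)) (f k ?w)"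
      unfolding spec_def by blast
    obtain \<mu> where \<mu>: "reach (world_env E) ([c] @ [], ?\<sigma>, Some ?w, 0) \<mu>" "\<And>x. x \<in> set_pmf \<mu> ==> fin [] (0 + g (k + k)) x" "map_pmf outc \<mu> = \<nu>"
      using \<nu>(1) unfolding exl_def by blast
    have fin: "fst x = [] \<and> cfg_time x \<le> poly q k" if "x \<in> set_pmf \<mu>" for x
      using \<mu>(2)[OF that] q[of k] by (auto simp: fin_def split: if_splits)
    have "run (world_env E) (poly q k) ([c] @ [], ?\<sigma>, Some ?w, 0) = \<mu>"
      by (rule run_reach[OF \<mu>(1)]) (use fin in auto)
    moreover have "([c] @ [], ?\<sigma>, Some ?w, 0) = emb k (?c k key \<beta>)" by (simp add: emb_def init_config_def)
    ultimately have e: "map_pmf (emb k) ?run = \<mu>" by (simp add: run_world)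
    have h: "fst x = [] \<and> cfg_time x \<le> poly q k" if "x \<in> set_pmf ?run" for x
    proof -
      have "emb k x \<in> set_pmf \<mu>" unfolding e[symmetric] using that by simp
      from fin[OF this] show ?thesis by (simp add: emb_def)
    qed
    let ?h = "\<lambda>r. case r of None => False | Some (d, w' :: world) => data_bit d = \<beta>"
    have "map_pmf (won (?G k)) ?run = map_pmf (\<lambda>x. ?h (map_option (\<lambda>(\<sigma>', w'). (\<sigma>' 0, w')) (outc (emb k x)))) ?run"
    proof (rule map_pmf_cong[OF refl])
      fix x assume x: "x \<in> set_pmf ?run"
      have "fst (snd s') = \<beta>" if "fst (snd (snd x)) = Some s'" for s'
        by (rule run_bit[OF x _ that]) (simp add: init_config_def)
      then show "won (?G k) x = ?h (map_option (\<lambda>(\<sigma>', w'). (\<sigma>' 0, w')) (outc (emb k x)))"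
        using h[OF x] by (cases x) (auto simp: won_def enc_ind_game_def outc_def emb_def split: option.splits)
    qed
    also have "\<dots> = map_pmf ?h (map_pmf (map_option (\<lambda>(\<sigma>', w'). (\<sigma>' 0, w'))) \<nu>)"
      unfolding \<mu>(3)[symmetric] e[symmetric] by (simp add: pmf.map_comp o_def)
    also have "\<dots> = map_pmf (\<lambda>r. case r of None => False | Some x => x = \<beta>) (map_pmf (map_option fst) (f k ?w))"
      unfolding \<nu>(2) pmf.map_comp
      by (rule map_pmf_cong[OF refl]) (auto simp: code_bool_def bit_data_def data_bit_def split: option.splits)
    also have "\<dots> = map_pmf (\<lambda>x. x = \<beta>) (F k key \<beta>)" unfolding F[OF key] by (simp add: pmf.map_comp o_def)
    finally show ?thesis using h by (auto simp: halted_by_def)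
  qed
  have pl: "play (?G k) c t = bind_pmf (gen E k) (\<lambda>key. bind_pmf (pmf_of_set UNIV) (\<lambda>\<beta>. run (enc_respond E k) t (?c k key \<beta>)))" for k t
    by (simp add: play_def enc_ind_game_def pair_pmf_def map_bind_pmf bind_map_pmf bind_assoc_pmf bind_return_pmf map_pmf_def)
  have "ppt ?G c" unfolding ppt_def
  proof (rule exI[of _ q], intro allI ballI)
    fix k x assume "x \<in> set_pmf (play (?G k) c (poly q k))"
    then obtain key \<beta> where "key \<in> set_pmf (gen E k)" "x \<in> set_pmf (run (enc_respond E k) (poly q k) (?c k key \<beta>))"
      unfolding pl set_bind_pmf by blast
    then show "halted_by (poly q k) x" using main by blast
  qed
  moreover have "pmf (bind_pmf (gen E k) (\<lambda>key. bind_pmf (pmf_of_set UNIV) (\<lambda>\<beta>. map_pmf (\<lambda>x. x = \<beta>) (F k key \<beta>)))) True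
      \<le> win_prob (?G k) c" for k
  proof -
    have "bind_pmf (gen E k) (\<lambda>key. bind_pmf (pmf_of_set UNIV) (\<lambda>\<beta>. map_pmf (\<lambda>x. x = \<beta>) (F k key \<beta>))) =
        map_pmf (won (?G k)) (play (?G k) c (poly q k))"
      unfolding pl map_bind_pmf
    proof (intro bind_pmf_cong refl)
      fix key \<beta> assume "key \<in> set_pmf (gen E k)"
      then show "map_pmf (\<lambda>x. x = \<beta>) (F k key \<beta>) = map_pmf (won (?G k)) (run (enc_respond E k) (poly q k) (?c k key \<beta>))"
        using main by simp
    qed
    then have "pmf (bind_pmf (gen E k) (\<lambda>key. bind_pmf (pmf_of_set UNIV) (\<lambda>\<beta>. map_pmf (\<lambda>x. x = \<beta>) (F k key \<beta>)))) True =
        measure_pmf.prob (play (?G k) c (poly q k)) {x. won (?G k) x}"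
      by (simp add: pmf_map vimage_def)
    then show ?thesis by (simp only: win_prob_ge)
  qed
  ultimately show ?thesis by blast
qed

end

section \<open>Guesses, trials and the reduction\<close>

lemma prob_bind_le:
  assumes "\<And>x. x \<in> set_pmf p ==> measure_pmf.prob (f x) X \<le> measure_pmf.prob (g x) Y + c"
  shows "measure_pmf.prob (bind_pmf p f) X \<le> measure_pmf.prob (bind_pmf p g) Y + c"
proof -
  note int = measure_pmf.integrable_const_bound[where B = 1]
  have "(\<integral>x. measure_pmf.prob (f x) X \<partial>p) \<le> (\<integral>x. measure_pmf.prob (g x) Y + c \<partial>p)"
    by (rule integral_mono_AE) (use assms in \<open>auto intro!: int AE_pmfI Bochner_Integration.integrable_add\<close>)
  also have "\<dots> = (\<integral>x. measure_pmf.prob (g x) Y \<partial>p) + c"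
    by (subst Bochner_Integration.integral_add) (auto intro!: int AE_pmfI)
  finally show ?thesis by (simp add: measure_bind_pmf)
qed

lemma pmf_bind_coin: "pmf (bind_pmf (pmf_of_set (UNIV :: bool set)) f) x = (pmf (f True) x + pmf (f False) x) / 2"
  by (simp add: pmf_bind integral_pmf_of_set UNIV_bool)

lemma pmf_map_eq: "pmf (map_pmf (\<lambda>y. y = x) X) True = pmf X x"
proof -
  have "(\<lambda>y. y = x) -` {True} = {x}" by auto
  then show ?thesis by (simp add: pmf_map measure_pmf_single)
qed

lemma pmf_map_Not: "pmf (map_pmf Not X) True = 1 - pmf X True"
  using pmf_map_eq[of False X] by (simp add: pmf_False_conv_True)

text \<open>Two independent copies agree with probability \<open>x * x + (1 - x) * (1 - x)\<close>,
  where \<open>x\<close> is the probability of \<open>True\<close>; completing the square gives the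
  claim.\<close>

lemma pmf_square:
  fixes X :: "bool pmf"
  shows "pmf (bind_pmf X (\<lambda>x. map_pmf (\<lambda>y. y = x) X)) True = 1 / 2 + 2 * (pmf X True - 1 / 2)\<^sup>2"
proof -
  have "pmf (bind_pmf X (\<lambda>x. map_pmf (\<lambda>y. y = x) X)) True = (\<Sum>x\<in>UNIV. pmf X x * pmf X x)"
    unfolding pmf_bind pmf_map_eq by (subst integral_measure_pmf_real[of UNIV]) auto
  also have "\<dots> = (pmf X True)\<^sup>2 + (1 - pmf X True)\<^sup>2" by (simp add: UNIV_bool pmf_False_conv_True power2_eq_square)
  finally show ?thesis by (simp add: power2_eq_square field_simps)
qed

lemma bind_pair_split: "bind_pmf (pair_pmf p q) (\<lambda>x. f (fst x) (snd x)) = bind_pmf p (\<lambda>a. bind_pmf q (f a))"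
  by (simp add: pair_pmf_def bind_assoc_pmf bind_return_pmf)

lemma bnd_ret_fst: "map_pmf (map_option fst) ((m' \<then> (\<lambda>y. ret (\<phi> y))) w) = map_pmf (map_option \<phi>) (map_pmf (map_option fst) (m' w))"
  unfolding bnd_def obind_def ret_def map_bind_pmf pmf.map_comp
  by (simp add: map_pmf_def) (rule bind_pmf_cong[OF refl], auto simp: bind_return_pmf split: option.splits)

definition coin :: "('w, bool) M" where
  "coin = lift (nat_pick [0, 1]) \<then> (\<lambda>x. ret (x = 1))"

lemma coin_lift: "coin = lift (pmf_of_set UNIV)"
proof -
  have "map_pmf (\<lambda>x. x = (1 :: nat)) (pmf_of_set {0, 1}) = pmf_of_set UNIV"
    by (rule map_pmf_of_set_bij_betw) (auto simp: bij_betw_def inj_on_def UNIV_bool)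
  then show ?thesis unfolding coin_def lift_bnd_ret by (simp add: nat_pick_set)
qed

definition pairM :: "('w, 'a) M => ('w, 'b) M => ('w, 'a \<times> 'b) M" where
  "pairM x y = x \<then> (\<lambda>a. y \<then> (\<lambda>b. ret (a, b)))"

lemma pairM_lift: "pairM (lift p) (lift q) = lift (pair_pmf p q)"
  unfolding pairM_def lift_bnd_ret lift_bnd_lift pair_pmf_def
  by (simp add: map_pmf_def)

text \<open>Guesses for the square root of the number of elements, the width of the values, the batch size, the width of the keys and the hybrid.\<close>
type_synonym advice = "nat \<times> nat \<times> nat \<times> nat \<times> nat"

definition trial :: "com => ('x => bool => bool => bool list => ('w, data) M) => ('x => data => ('w, bool list option) M) =>
    'x => nat => nat => advice => ('w, bool) M" where
  "trial A ench dech x B k g = coin \<then> (\<lambda>b. play_adv A ench dech x (fst g) (fst (snd (snd g))) (fst (snd g))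
      (fst (snd (snd (snd g)))) (snd (snd (snd (snd g)))) b B k)"

definition guess :: "nat => ('w, advice) M" where
  "guess Q = pairM (lift (nat_pick [0..<Suc Q])) (pairM (lift (nat_pick [0..<Suc Q])) (pairM (lift (nat_pick [0..<Suc Q]))
     (pairM (lift (nat_pick [0..<Suc Q])) (lift (nat_pick [0..<Suc Q])))))"

definition guess_pmf :: "nat => advice pmf" where
  "guess_pmf Q = (let U = pmf_of_set {..Q} in pair_pmf U (pair_pmf U (pair_pmf U (pair_pmf U U))))"

lemma guess_lift: "guess Q = lift (guess_pmf Q)"
proof -
  have "set [0..<Suc Q] = {..Q}" by auto
  then have "nat_pick [0..<Suc Q] = pmf_of_set {..Q}" by (simp add: nat_pick_set del: upt_Suc)
  then show ?thesis by (simp add: guess_def pairM_lift guess_pmf_def Let_def del: upt_Suc)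
qed

lemma pmf_guess:
  assumes "s \<le> Q" "w \<le> Q" "m \<le> Q" "kw \<le> Q" "j \<le> Q"
  shows "pmf (guess_pmf Q) (s, w, m, kw, j) = 1 / (real Q + 1) ^ 5"
  using assms by (simp add: guess_pmf_def Let_def pmf_pair numeral_eq_Suc field_simps)

context encryption begin

text \<open>\<open>x\<close> tells whether the shuffle adversary won in the simulated game with bit
  \<open>\<beta>\<close>. Winning is taken as evidence for the bit \<open>True\<close>, under which
  the message at the guessed position is encrypted itself. If this rule was right in the simulation,
  \<open>y\<close> is returned, otherwise its negation.\<close>

definition reduction :: "com => nat poly => nat poly => nat => (world, bool) M" where
  "reduction A q Q k = guess (poly Q k) \<then> (\<lambda>g. lift (gen E k) \<then> (\<lambda>key. coin \<then> (\<lambda>\<beta>.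
     trial A sim_enc sim_dec (k, key, \<beta>) (poly q k) k g \<then> (\<lambda>x.
     trial A real_enc real_dec () (poly q k) k g \<then> (\<lambda>y. ret (y = (x = \<beta>)))))))"

lemma ptm_reduction: "wptm (reduction A q Q)"
proof -
  obtain rb where "machine (world_env E) fst (worlds E) rb" using machine_world by blast
  then interpret machine "world_env E" fst "worlds E" rb .
  have coin: "ptm (\<lambda>_ :: 'c :: code. coin)" unfolding coin_def
    by (intro ptm_pair ptm_nat_pick pt_eq pt_snd pt_id pt_const)
  show ?thesis
    unfolding reduction_def guess_def pairM_def trial_def
    by (intro ptm_pair coin ptm_nat_pick ptm_comp[OF ptm_sim(3)] ptm_play_adv[OF _ _ _ _ _ _ _ _ _ ptm_sim(1,2)]
      ptm_play_adv[OF _ _ _ _ _ _ _ _ _ ptm_real(1,2)] pt_Pair pt_upt pt_Suc pt_poly pt_eq pt_fst pt_snd pt_id pt_const)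
qed

definition hyb_game :: "com => nat => nat => advice => nat => data => bool pmf" where
  "hyb_game A B k = (\<lambda>(s, w, m, kw, _) h key. bind_pmf (pmf_of_set UNIV) (\<lambda>b.
     hyb_play A (enc E k key) (dec E k key) h s m w kw b B k))"

definition hyb_index :: "bool => advice => nat" where
  "hyb_index \<beta> g = (if \<beta> then snd (snd (snd (snd g))) else Suc (snd (snd (snd (snd g)))))"

lemma trial_sim: "(trial A sim_enc sim_dec (k, key, \<beta>) B k g :: (world, bool) M) = lift (hyb_game A B k g (hyb_index \<beta> g) key)"
  unfolding trial_def coin_lift play_adv_sim lift_bnd_lift hyb_game_def hyb_index_def by (cases g) simp

lemma trial_real:
  "map_pmf (map_option fst) (trial A real_enc real_dec () B k g (k, key, \<beta>, None)) = map_pmf Some (hyb_game A B k g (hyb_index \<beta> g) key)"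
proof -
  have "map_pmf (map_option fst) (trial A real_enc real_dec () B k g (k, key, \<beta>, None)) =
    map_pmf (map_option fst) (trial A sim_enc sim_dec (k, key, \<beta>) B k g (k, key, \<beta>, None :: data list option))"
    unfolding trial_def coin_lift lift_bnd map_bind_pmf
    by (intro bind_pmf_cong refl play_adv_real)
  then show ?thesis unfolding trial_sim lift_fst .
qed

definition success :: "com => nat => nat => advice => bool pmf" where
  "success A B k g = bind_pmf (pair_pmf (gen E k) (pmf_of_set UNIV)) (\<lambda>x. map_pmf (\<lambda>y. y = snd x) (hyb_game A B k g (hyb_index (snd x) g) (fst x)))"

lemma reduction_output:
  "map_pmf (map_option fst) (reduction A q Q k (k, key, \<beta>, None)) =
   map_pmf Some (bind_pmf (guess_pmf (poly Q k)) (\<lambda>g. bind_pmf (success A (poly q k) k g)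
     (\<lambda>c. map_pmf (\<lambda>y. y = c) (hyb_game A (poly q k) k g (hyb_index \<beta> g) key))))"
proof -
  have "map_pmf (map_option fst) (reduction A q Q k (k, key, \<beta>, None)) =
    bind_pmf (guess_pmf (poly Q k)) (\<lambda>g. bind_pmf (gen E k) (\<lambda>key'. bind_pmf (pmf_of_set UNIV) (\<lambda>\<beta>'.
      bind_pmf (hyb_game A (poly q k) k g (hyb_index \<beta>' g) key') (\<lambda>x.
        map_pmf (map_option (\<lambda>y. y = (x = \<beta>'))) (map_pmf Some (hyb_game A (poly q k) k g (hyb_index \<beta> g) key))))))"
    unfolding reduction_def guess_lift coin_lift trial_sim lift_bnd map_bind_pmf bnd_ret_fst trial_real ..
  also have "\<dots> = bind_pmf (guess_pmf (poly Q k)) (\<lambda>g. bind_pmf (success A (poly q k) k g)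
     (\<lambda>c. map_pmf Some (map_pmf (\<lambda>y. y = c) (hyb_game A (poly q k) k g (hyb_index \<beta> g) key))))"
    unfolding success_def bind_assoc_pmf bind_map_pmf by (simp add: bind_pair_split[where f = "\<lambda>a b. bind_pmf (hyb_game A (poly q k) k _ (hyb_index b _) a) (_ b)"] pair_pmf_def bind_assoc_pmf bind_return_pmf pmf.map_comp o_def)
  finally show ?thesis by (simp add: map_bind_pmf)
qed

text \<open>Given the guess, the simulated and the actual trial are independent and identically
  distributed, since key and bit are drawn in the same way in both. The answer is right iff the two
  trials agree in their success: for truth values, \<open>(y = c) = b\<close> and
  \<open>(y = b) = c\<close> are the same.\<close>

lemma win_reduction:
  "bind_pmf (gen E k) (\<lambda>key. bind_pmf (pmf_of_set UNIV) (\<lambda>\<beta>. map_pmf (\<lambda>x. x = \<beta>)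
     (bind_pmf G (\<lambda>g. bind_pmf (success A B k g) (\<lambda>c. map_pmf (\<lambda>y. y = c) (hyb_game A B k g (hyb_index \<beta> g) key)))))) =
   bind_pmf G (\<lambda>g. bind_pmf (success A B k g) (\<lambda>c. map_pmf (\<lambda>y. y = c) (success A B k g)))"
proof -
  let ?S = "pair_pmf (gen E k) (pmf_of_set (UNIV :: bool set))"
  let ?T = "\<lambda>g x. hyb_game A B k g (hyb_index (snd x) g) (fst x)"
  have "bind_pmf (gen E k) (\<lambda>key. bind_pmf (pmf_of_set UNIV) (\<lambda>\<beta>. map_pmf (\<lambda>x. x = \<beta>)
     (bind_pmf G (\<lambda>g. bind_pmf (success A B k g) (\<lambda>c. map_pmf (\<lambda>y. y = c) (hyb_game A B k g (hyb_index \<beta> g) key)))))) =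
    bind_pmf ?S (\<lambda>x. bind_pmf G (\<lambda>g. bind_pmf (success A B k g) (\<lambda>c. map_pmf (\<lambda>y. (y = c) = snd x) (?T g x))))"
    by (simp add: pair_pmf_def bind_assoc_pmf bind_return_pmf map_bind_pmf pmf.map_comp o_def)
  also have "\<dots> = bind_pmf G (\<lambda>g. bind_pmf ?S (\<lambda>x. bind_pmf (success A B k g) (\<lambda>c. map_pmf (\<lambda>y. (y = c) = snd x) (?T g x))))"
    by (rule bind_commute_pmf)
  also have "\<dots> = bind_pmf G (\<lambda>g. bind_pmf (success A B k g) (\<lambda>c. bind_pmf ?S (\<lambda>x. map_pmf (\<lambda>y. (y = c) = snd x) (?T g x))))"
    by (rule bind_pmf_cong[OF refl], rule bind_commute_pmf)
  also have "(\<lambda>g c. bind_pmf ?S (\<lambda>x. map_pmf (\<lambda>y. (y = c) = snd x) (?T g x))) = (\<lambda>g c. map_pmf (\<lambda>y. y = c) (success A B k g))"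
  proof -
    have "((y = c) = b) = ((y = b) = c)" for y c b :: bool by auto
    then show ?thesis by (simp add: success_def map_bind_pmf pmf.map_comp o_def)
  qed
  finally show ?thesis .
qed

text \<open>Under every guess the reduction is right with probability at least 1/2, so the surplus
  of all guesses but one may be dropped. The remaining one has probability
  \<open>1 / (poly Q k + 1) ^ 5\<close>, which bounds its squared advantage by this power times a
  negligible function. One reduction covers all parameters, so the bound is uniform in them.\<close>

lemma advantage_bound:
  assumes sec: "enc_ind_cpa_secure E"
  shows "\<exists>\<nu>. negligible \<nu> \<and> (\<forall>k s w m kw j. s \<le> poly Q k \<longrightarrow> w \<le> poly Q k \<longrightarrow> m \<le> poly Q k \<longrightarrow> kw \<le> poly Q k \<longrightarrow> j \<le> poly Q k \<longrightarrow>
    \<bar>pmf (success A (poly q k) k (s, w, m, kw, j)) True - 1 / 2\<bar> \<le> \<nu> k)"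
proof -
  obtain c where c: "ppt (enc_ind_game E) c" "\<And>k. pmf (bind_pmf (guess_pmf (poly Q k)) (\<lambda>g. bind_pmf (success A (poly q k) k g) (\<lambda>c. map_pmf (\<lambda>y. y = c) (success A (poly q k) k g)))) True
      \<le> win_prob (enc_ind_game E k) c"
    using ptm_adversary[OF ptm_reduction[of A q Q] reduction_output[of A q Q]] unfolding win_reduction by blast
  obtain \<nu> where \<nu>: "negligible \<nu>" "\<And>k. win_prob (enc_ind_game E k) c \<le> 1 / 2 + \<nu> k"
    using sec c(1) unfolding enc_ind_cpa_secure_def secure_def by blast
  let ?R = "\<lambda>k. real (poly ((Q + 1) ^ 5) k) * \<nu> k"
  have "negligible (\<lambda>k. sqrt \<bar>?R k\<bar>)" by (intro negligible_sqrt negligible_poly_mult \<nu>(1))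
  moreover have "\<bar>pmf (success A (poly q k) k (s, w, m, kw, j)) True - 1 / 2\<bar> \<le> sqrt \<bar>?R k\<bar>"
    if le: "s \<le> poly Q k" "w \<le> poly Q k" "m \<le> poly Q k" "kw \<le> poly Q k" "j \<le> poly Q k" for k s w m kw j
  proof -
    let ?g = "(s, w, m, kw, j)"
    let ?x = "\<lambda>g. pmf (success A (poly q k) k g) True" and ?G = "guess_pmf (poly Q k)"
    let ?y = "2 * (?x ?g - 1 / 2)\<^sup>2"
    have lo: "1 / 2 + ?y * indicator {?g} g \<le> 1 / 2 + 2 * (?x g - 1 / 2)\<^sup>2" for g by (auto simp: indicator_def)
    have "1 / 2 + ?y * pmf ?G ?g = (\<integral>g. 1 / 2 + ?y * indicator {?g} g \<partial>?G)"
    proof -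
      have "(\<integral>g. 1 / 2 + ?y * indicator {?g} g \<partial>?G) = (\<integral>g. 1 / 2 \<partial>?G) + (\<integral>g. ?y * indicator {?g} g \<partial>?G)"
        by (rule Bochner_Integration.integral_add) (auto intro!: integrable_mult_right measure_pmf.integrable_const_bound[where B = 1] AE_pmfI)
      then show ?thesis by (simp add: measure_pmf_single)
    qed
    also have "\<dots> \<le> (\<integral>g. pmf (bind_pmf (success A (poly q k) k g) (\<lambda>c. map_pmf (\<lambda>y. y = c) (success A (poly q k) k g))) True \<partial>?G)"
    proof (rule integral_mono)
      show "integrable ?G (\<lambda>g. 1 / 2 + ?y * indicator {?g} g)"
        by (intro Bochner_Integration.integrable_add integrable_mult_right measure_pmf.integrable_const)
          (auto intro!: measure_pmf.integrable_const_bound[where B = 1] AE_pmfI)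
      show "integrable ?G (\<lambda>g. pmf (bind_pmf (success A (poly q k) k g) (\<lambda>c. map_pmf (\<lambda>y. y = c) (success A (poly q k) k g))) True)"
        by (auto intro!: measure_pmf.integrable_const_bound[where B = 1] AE_pmfI simp: pmf_le_1)
      show "1 / 2 + ?y * indicator {?g} g \<le> pmf (bind_pmf (success A (poly q k) k g) (\<lambda>c. map_pmf (\<lambda>y. y = c) (success A (poly q k) k g))) True" for g
        using lo[of g] by (simp only: pmf_square)
    qed
    also have "\<dots> = pmf (bind_pmf ?G (\<lambda>g. bind_pmf (success A (poly q k) k g) (\<lambda>c. map_pmf (\<lambda>y. y = c) (success A (poly q k) k g)))) True"
      by (simp only: pmf_bind)
    also have "\<dots> \<le> 1 / 2 + \<nu> k" using c(2)[of k] \<nu>(2)[of k] by linarith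
    finally have "?y * pmf ?G ?g \<le> \<nu> k" by simp
    moreover have "pmf ?G ?g = 1 / (real (poly Q k) + 1) ^ 5" by (rule pmf_guess[OF le])
    ultimately have "?y \<le> (real (poly Q k) + 1) ^ 5 * \<nu> k" by (simp add: divide_le_eq mult.commute)
    also have "(real (poly Q k) + 1) ^ 5 = real (poly ((Q + 1) ^ 5) k)" by (simp add: poly_power add.commute)
    finally have "(?x ?g - 1 / 2)\<^sup>2 \<le> \<bar>?R k\<bar>" using zero_le_power2[of "?x ?g - 1 / 2"] by linarith
    then have "sqrt ((?x ?g - 1 / 2)\<^sup>2) \<le> sqrt \<bar>?R k\<bar>" by (rule real_sqrt_le_mono)
    then show ?thesis by simp
  qed
  ultimately show ?thesis by blast
qed

section \<open>Summing up over the hybrids\<close>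

definition hyb_win :: "com => nat => nat => nat => nat => nat => nat => nat => real" where
  "hyb_win A B k s w m kw h = pmf (bind_pmf (gen E k) (hyb_game A B k (s, w, m, kw, 0) h)) True"

text \<open>With the bit \<open>True\<close> the trial plays hybrid \<open>j\<close> and a win is a
  success; with \<open>False\<close> it plays hybrid \<open>Suc j\<close> and a loss is one. The
  position in the advice enters a trial only through this index, and is set to 0 in
  \<open>hyb_win\<close>.\<close>

lemma success_hyb_win:
  "pmf (success A B k (s, w, m, kw, j)) True = 1 / 2 + (hyb_win A B k s w m kw j - hyb_win A B k s w m kw (Suc j)) / 2"
proof -
  have g: "hyb_game A B k (s, w, m, kw, j) = hyb_game A B k (s, w, m, kw, 0)" by (simp add: hyb_game_def fun_eq_iff)
  let ?T = "\<lambda>\<beta>. bind_pmf (gen E k) (hyb_game A B k (s, w, m, kw, 0) (hyb_index \<beta> (s, w, m, kw, j)))"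
  have "success A B k (s, w, m, kw, j) = bind_pmf (gen E k) (\<lambda>key. bind_pmf (pmf_of_set UNIV) (\<lambda>\<beta>. map_pmf (\<lambda>y. y = \<beta>)
      (hyb_game A B k (s, w, m, kw, 0) (hyb_index \<beta> (s, w, m, kw, j)) key)))"
    by (simp add: success_def g pair_pmf_def bind_assoc_pmf bind_return_pmf)
  also have "\<dots> = bind_pmf (pmf_of_set UNIV) (\<lambda>\<beta>. map_pmf (\<lambda>y. y = \<beta>) (?T \<beta>))"
    by (subst bind_commute_pmf) (simp add: map_bind_pmf)
  finally show ?thesis
    by (simp add: pmf_bind_coin pmf_map_Not hyb_win_def hyb_index_def pmf.map_ident field_simps)
qed

text \<open>For every key, the winning probabilities for the two values of the secret bit add up to
  at most 1, and the bit is a fair coin.\<close>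

lemma hyb_win_zeros: "B * calls s m \<le> h ==> hyb_win A B k s w m kw h \<le> 1 / 2"
proof -
  assume h: "B * calls s m \<le> h"
  have "pmf (hyb_game A B k (s, w, m, kw, 0) h key) True \<le> 1 / 2" for key
    using hyb_play_zeros[OF h, of A "enc E k key" "dec E k key" w kw k] by (simp add: hyb_game_def pmf_bind_coin)
  then have "(\<integral>key. pmf (hyb_game A B k (s, w, m, kw, 0) h key) True \<partial>gen E k) \<le> (\<integral>key. 1 / 2 \<partial>gen E k)"
    by (intro integral_mono) (auto intro!: measure_pmf.integrable_const_bound[where B = 1] AE_pmfI simp: pmf_le_1)
  then show ?thesis by (simp add: hyb_win_def pmf_bind)
qed

text \<open>Neighbouring hybrids differ by at most twice the advantage, because of the factor 1/2 in
  \<open>success_hyb_win\<close>.\<close>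

lemma hyb_win_telescope:
  assumes "\<And>j. j < L ==> \<bar>pmf (success A B k (s, w, m, kw, j)) True - 1 / 2\<bar> \<le> \<delta>"
  shows "hyb_win A B k s w m kw 0 \<le> hyb_win A B k s w m kw L + 2 * real L * \<delta>"
  using assms
proof (induction L)
  case (Suc L)
  have "hyb_win A B k s w m kw L - hyb_win A B k s w m kw (Suc L) \<le> 2 * \<delta>"
    using Suc.prems[of L] unfolding success_hyb_win by (simp add: abs_le_iff)
  then show ?case using Suc.IH Suc.prems by (simp add: algebra_simps)
qed simp

text \<open>The logarithm is crudely replaced by \<open>n\<close>; a polynomial range for the guess
  of the batch size is all that is wanted.\<close>

lemma batch_size_le: "batch_size p n \<le> nat \<lceil>p\<rceil> * n"
proof (cases "n = 0 \<or> p \<le> 0")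
  case True
  have "p * log 2 (real n) \<le> 0"
  proof (cases "n = 0")
    case False
    then have "0 \<le> log 2 (real n)" by (simp add: zero_le_log_cancel_iff)
    then show ?thesis using True False by (simp add: mult_nonpos_nonneg)
  qed (simp add: log_def)
  then show ?thesis by (simp add: batch_size_def)
next
  case False
  then have n: "1 \<le> n" and p: "0 < p" by auto
  have "real n \<le> 2 powr real n" using less_exp[of n] by (simp add: powr_realpow)
  then have "log 2 (real n) \<le> real n" using n by (simp add: log_le_iff)
  then have "p * log 2 (real n) \<le> real_of_int \<lceil>p\<rceil> * real n" using n p by (intro mult_mono) (auto simp: zero_le_log_cancel_iff)
  then have "\<lceil>p * log 2 (real n)\<rceil> \<le> \<lceil>p\<rceil> * int n" by (simp add: ceiling_le_iff)
  then have "nat \<lceil>p * log 2 (real n)\<rceil> \<le> nat (\<lceil>p\<rceil> * int n)" by (rule nat_mono)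
  then show ?thesis using p by (simp add: batch_size_def nat_mult_distrib)
qed

lemma key_width_le: "key_width n \<le> Suc n"
proof (cases "n = 0")
  case False
  have "floor_log n < 2 ^ floor_log n" by (rule less_exp)
  also have "\<dots> \<le> n" using False by (simp add: floor_log_exp2_le)
  finally show ?thesis by (simp add: key_width_def)
qed (simp add: key_width_def)

lemma win_prob_le_hyb_win:
  assumes n: "n = s * s" and m: "m = batch_size p n"
    and halt: "\<And>c. c \<in> set_pmf (play (shuffle_ind_game E n w k (melbourne_shuffle E p n w k)) A B) ==> halted_by B c"
  shows "win_prob (shuffle_ind_game E n w k (melbourne_shuffle E p n w k)) A \<le>
    hyb_win A B k s w m (key_width n) 0 + real B * fail_bound p n"
proof -
  let ?G = "shuffle_ind_game E n w k (melbourne_shuffle E p n w k)"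
  let ?run = "\<lambda>key b. run (shuffle_respond E n w k (melbourne_shuffle E p n w k)) B
    (init_config A (list_data [num_data k, num_data n, num_data w]) (key, b, False))"
  have pl: "play ?G A B = bind_pmf (gen E k) (\<lambda>key. bind_pmf (pmf_of_set UNIV) (?run key))"
    by (simp add: play_def shuffle_ind_game_def pair_pmf_def map_bind_pmf bind_map_pmf bind_assoc_pmf bind_return_pmf map_pmf_def)
  have "win_prob ?G A \<le> measure_pmf.prob (play ?G A B) {c. won ?G c}" by (rule win_prob_le) (rule halt)
  also have "\<dots> \<le> measure_pmf.prob (bind_pmf (gen E k) (\<lambda>key. bind_pmf (pmf_of_set UNIV) (\<lambda>b.
      hyb_play A (enc E k key) (dec E k key) 0 s m w (key_width n) b B k))) {True} + real B * fail_bound p n"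
    unfolding pl
  proof (intro prob_bind_le)
    fix key b assume key: "key \<in> set_pmf (gen E k)"
    interpret sg: shuffle_game E k key b s m w n p by unfold_locales (use key n m in auto)
    show "measure_pmf.prob (?run key b) {c. won ?G c} \<le>
        measure_pmf.prob (hyb_play A (enc E k key) (dec E k key) 0 s m w (key_width n) b B k) {True} + real B * fail_bound p n"
      unfolding measure_pmf_single
    proof (rule sg.real_run_le_hyb_play)
      fix c assume "c \<in> set_pmf (?run key b)"
      then have "c \<in> set_pmf (play ?G A B)" unfolding pl using key by auto
      then show "halted_by B c" by (rule halt)
    qed
  qed
  finally show ?thesis by (simp add: hyb_win_def hyb_game_def[abs_def] measure_pmf_single)
qed

lemma melbourne_oblivious:
  assumes p: "p \<ge> exp 1" and sec: "enc_ind_cpa_secure E"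
    and N: "\<And>k. \<exists>s. N k = s\<^sup>2" "poly_related N" and W: "poly_bounded W"
  shows "oblivious_shuffle E N W (melbourne_shuffle E p)"
  unfolding oblivious_shuffle_def secure_def
proof (intro allI impI)
  let ?G = "\<lambda>k. shuffle_ind_game E (N k) (W k) k (melbourne_shuffle E p (N k) (W k) k)"
  fix A assume "ppt ?G A"
  then obtain q :: "nat poly" where q: "\<And>k c. c \<in> set_pmf (play (?G k) A (poly q k)) ==> halted_by (poly q k) c"
    unfolding ppt_def by blast
  obtain S where S: "\<And>k. N k = S k * S k" using N(1) by (metis power2_eq_square)
  obtain gN where gN: "pmono gN" "\<And>k. N k \<le> gN k" using poly_bounded_pmono N(2) unfolding poly_related_def by blast
  obtain gW where gW: "pmono gW" "\<And>k. W k \<le> gW k" using poly_bounded_pmono W by blast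
  let ?P = "nat \<lceil>p\<rceil>" and ?m = "\<lambda>k. batch_size p (N k)"
  \<comment> \<open>The last hybrid: \<open>poly q k\<close> interpreted steps cause at most
    \<open>calls\<close> encryptions each, so from this position on all encryptions are of
    zeros.\<close>
  let ?L = "\<lambda>k. poly q k * calls (S k) (?m k)"
  \<comment> \<open>One bound for all five guesses. The summands stand for the square root of
    \<open>N k\<close> (bounded by \<open>N k\<close> itself), the width of the values, the batch
    size, the key width and the last hybrid.\<close>
  let ?b = "\<lambda>k. gN k + gW k + ?P * gN k + Suc (gN k) + poly q k * (gN k + 2 * (gN k * (?P * gN k) + gN k))"
  have "pmono ?b" by (intro pmono_intros gN(1) gW(1) pmono_poly)
  then obtain Q :: "nat poly" where Q: "\<And>k. ?b k \<le> poly Q k" using pmono_poly_bound by blast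
  have m_le: "?m k \<le> ?P * gN k" for k using batch_size_le[of p "N k"] mult_le_mono2[OF gN(2)[of k], of ?P] by linarith
  have "calls (S k) (?m k) \<le> gN k + 2 * (gN k * (?P * gN k) + gN k)" for k
    unfolding calls_def S[symmetric] by (intro add_mono mult_le_mono gN(2) m_le order_refl)
  then have L_le: "?L k \<le> poly q k * (gN k + 2 * (gN k * (?P * gN k) + gN k))" for k by (rule mult_le_mono2)
  have le: "S k \<le> poly Q k" "W k \<le> poly Q k" "?m k \<le> poly Q k" "key_width (N k) \<le> poly Q k" "?L k \<le> poly Q k" for k
  proof -
    have "S k \<le> N k" unfolding S by simp
    then show "S k \<le> poly Q k" using gN(2)[of k] Q[of k] by linarith
    show "W k \<le> poly Q k" using gW(2)[of k] Q[of k] by linarith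
    show "?m k \<le> poly Q k" using m_le[of k] Q[of k] by linarith
    show "key_width (N k) \<le> poly Q k" using key_width_le[of "N k"] gN(2)[of k] Q[of k] by linarith
    show "?L k \<le> poly Q k" using L_le[of k] Q[of k] by linarith
  qed
  obtain \<nu> where neg: "negligible \<nu>" and adv: "\<forall>k s w m kw j. s \<le> poly Q k \<longrightarrow> w \<le> poly Q k \<longrightarrow> m \<le> poly Q k \<longrightarrow> kw \<le> poly Q k \<longrightarrow> j \<le> poly Q k \<longrightarrow>
    \<bar>pmf (success A (poly q k) k (s, w, m, kw, j)) True - 1 / 2\<bar> \<le> \<nu> k"
    using advantage_bound[OF sec, of Q A q] by blast
  have \<nu>: "\<bar>pmf (success A (poly q k) k (S k, W k, ?m k, key_width (N k), j)) True - 1 / 2\<bar> \<le> \<nu> k" if "j \<le> poly Q k" for k j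
    by (rule adv[rule_format, OF le(1-4) that])
  let ?\<mu> = "\<lambda>k. real (poly (2 * Q) k) * \<bar>\<nu> k\<bar> + real (poly q k) * fail_bound p (N k)"
  show "\<exists>\<nu>. negligible \<nu> \<and> (\<forall>k. win_prob (?G k) A \<le> 1 / 2 + \<nu> k)"
  proof (intro exI[of _ ?\<mu>] conjI allI)
    have "negligible (\<lambda>k. \<bar>\<nu> k\<bar>)" by (rule negligible_mono[OF neg]) simp
    then show "negligible ?\<mu>"
      by (intro negligible_add negligible_poly_mult negligible_comp[OF negligible_fail_bound[OF p] N(2)])
    fix k
    let ?kw = "key_width (N k)" and ?B = "poly q k"
    have "win_prob (?G k) A \<le> hyb_win A ?B k (S k) (W k) (?m k) ?kw 0 + real ?B * fail_bound p (N k)"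
      by (rule win_prob_le_hyb_win[OF S refl]) (rule q)
    moreover have "hyb_win A ?B k (S k) (W k) (?m k) ?kw 0 \<le> hyb_win A ?B k (S k) (W k) (?m k) ?kw (?L k) + 2 * real (?L k) * \<bar>\<nu> k\<bar>"
    proof (rule hyb_win_telescope)
      fix j assume "j < ?L k"
      then have "j \<le> poly Q k" using le(5)[of k] by simp
      from \<nu>[OF this] show "\<bar>pmf (success A ?B k (S k, W k, ?m k, ?kw, j)) True - 1 / 2\<bar> \<le> \<bar>\<nu> k\<bar>" by linarith
    qed
    moreover have "hyb_win A ?B k (S k) (W k) (?m k) ?kw (?L k) \<le> 1 / 2" by (rule hyb_win_zeros) simp
    moreover have "2 * real (?L k) * \<bar>\<nu> k\<bar> \<le> real (poly (2 * Q) k) * \<bar>\<nu> k\<bar>"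
    proof (rule mult_right_mono)
      have "2 * ?L k \<le> poly (2 * Q) k" using le(5)[of k] by simp
      then show "2 * real (?L k) \<le> real (poly (2 * Q) k)" by (metis of_nat_le_iff of_nat_mult of_nat_numeral)
    qed simp
    ultimately show "win_prob (?G k) A \<le> 1 / 2 + ?\<mu> k" by linarith
  qed
qed

end

theorem theorem4p8:
  fixes p :: real and E :: scheme and N W :: "nat \<Rightarrow> nat"
  assumes "p \<ge> exp 1"
    and "symmetric_encryption E" and "enc_ind_cpa_secure E"
    and "\<And>k. \<exists>s. N k = s\<^sup>2" and "poly_related N"
    and "poly_bounded W"
  shows "succeeds_whp E (melbourne_shuffle E p) \<and> oblivious_shuffle E N W (melbourne_shuffle E p)"
  using melbourne_succeeds_whp[OF assms(1,2)] encryption.melbourne_oblivious[OF encryption.intro[OF assms(2)] assms(1,3-6)]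
  by blast

end
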